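(* Let $\alpha>0$ and let $G$ be the damped wave operator with damping $2\alpha/x$ on $\mathcal I=(0,1)$ defined in the context. Then the following hold. (i) For $\lambda\in\mathbb C$, $$\lambda\in\sigma(G)\iff M(1-\alpha,2,-2\lambda)=0,$$ and for such $\lambda$ a corresponding eigenvector of $G$ can be selected as $(f_\lambda,\lambda f_\lambda)^t$ with $$f_\lambda(x)=x e^{\lambda x}M(1-\alpha,2,-2\lambda x).$$ (ii) If $\alpha\notin\mathbb N$, then $\sigma(G)$ contains exactly $\lceil\alpha-1\rceil$ negative eigenvalues and infinitely many complex conjugated (non-real) eigenvalues $\{\lambda_k^{(\alpha)}\}$, which for large $|\lambda_k^{(\alpha)}|$ satisfy the asymptotic relation $$\lambda_k^{(\alpha)}=\mp\frac{2k+1-\alpha}{2}\pi \mathrm i-\frac12\log\left(-\frac{\Gamma(1-\alpha)}{\Gamma(1+\alpha)}(\pm 2k\pi \mathrm i)^{2\alpha}\right)+\mathcal O(k^{-1}\log k),\qquad k\to\infty,$$ where the upper signs are taken together and the lower signs are taken together (the two choices giving the two members of each complex conjugate pair). (iii) If $\alpha=n+1$ with $n\in\mathbb N_0$, then $$\sigma(G)=\{\mu_k^{(n)}\}_{k=1}^n\subset(-\infty,0),$$ i.e. the spectrum of $G$ consists of exactly $n$ negative eigenvalues (it is empty for $n=0$). These are determined by the equation $L_n^{(1)}(-2\mu)=0$, and the corresponding eigenvectors can be selected as $(f_k^{(n)},\mu_k^{(n)}f_k^{(n)})^t$ with $$f_k^{(n)}(x)=x\exp(\mu_k^{(n)}x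)\,L_n^{(1)}(-2\mu_k^{(n)}x).$$
   Context: Let $\mathcal I=(0,1)$, $\mathbb N=\{1,2,\dots\}$, $\mathbb N_0=\mathbb N\cup\{0\}$. Let $\mathcal H=W_0^{1,2}(\mathcal I)\times L^2(\mathcal I)$ be the (complex) Hilbert space with inner product $$\langle(\phi_1,\phi_2),(\psi_1,\psi_2)\rangle_{\mathcal H}=\langle\phi_1',\psi_1'\rangle_{L^2}+\langle\phi_2,\psi_2\rangle_{L^2}.$$ For $\alpha>0$ let $G_0$ be the operator in $\mathcal H$ with domain $\operatorname{Dom}(G_0)=(W_0^{1,2}(\mathcal I)\cap W^{2,2}(\mathcal I))^2$ acting as $$G_0\begin{pmatrix} u \\ v \end{pmatrix}=\begin{pmatrix} v \\ u''-\frac{2\alpha}{x}v \end{pmatrix},$$ and let $G=\overline{G_0}$ be its closure in $\mathcal H$. (It is the operator associated with the equation $u_{tt}+\frac{2\alpha}{x}u_t=u_{xx}$ on $(0,1)$ with Dirichlet boundary conditions.) $\sigma(G)$ is the spectrum of $G$. $M(a,b,z)=\sum_{j\ge0}\frac{(a)_j}{(b)_j\,j!}z^j$ is the Kummer (confluent hypergeometric) function, with $(a)_j$ the rising factorial. $L_n^{(1)}$ is the associated Laguerre polynomial $L_n^{(1)}(z)=\sum_{j=0}^n\binom{n+1}{n-j}\frac{(-z)^j}{j!}$. $\Gamma$ is the Gamma function; the power and logarithm in (ii) are taken with their principal values. *)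

theory Defs
  imports "HOL-Analysis.Analysis" "HOL-Library.Landau_Symbols"
begin

text \<open>
  Elements of $L^2(0,1)$ and of the Sobolev spaces are represented by functions
  \<open>real \<Rightarrow> complex\<close>; two functions represent the same element iff they agree almost everywhere
  on $(0,1)$, and values outside $(0,1)$ are irrelevant. Accordingly, operators are represented by
  their graphs, and vanishing of a vector means vanishing almost everywhere.
\<close>

type_synonym state = "(real \<Rightarrow> complex) \<times> (real \<Rightarrow> complex)"

abbreviation I01 :: "real measure" where
  "I01 \<equiv> lebesgue_on {0<..<1}"

definition L2 :: "(real \<Rightarrow> complex) set" where
  "L2 = {f. f \<in> borel_measurable I01 \<and> integrable I01 (\<lambda>x. (cmod (f x))\<^sup>2)}"

definition L2_inner :: "(real \<Rightarrow> complex) \<Rightarrow> (real \<Rightarrow> complex) \<Rightarrow> complex" where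
  "L2_inner f g = (LINT x|I01. f x * cnj (g x))"

definition L2_norm :: "(real \<Rightarrow> complex) \<Rightarrow> real" where
  "L2_norm f = sqrt (LINT x|I01. (cmod (f x))\<^sup>2)"

definition smooth :: "(real \<Rightarrow> complex) \<Rightarrow> bool" where
  "smooth \<phi> \<longleftrightarrow> (\<exists>D :: nat \<Rightarrow> real \<Rightarrow> complex. D 0 = \<phi> \<and>
      (\<forall>n x. (D n has_vector_derivative D (Suc n) x) (at x)))"

definition test_functions :: "(real \<Rightarrow> complex) set" where
  "test_functions = {\<phi>. smooth \<phi> \<and>
      (\<exists>K. compact K \<and> K \<subseteq> {0<..<1} \<and> (\<forall>x. x \<notin> K \<longrightarrow> \<phi> x = 0))}"

text \<open>The weak derivative is required to be in $L^2$, since only the spaces $W^{k,2}$ are used.\<close>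

definition has_weak_derivative :: "(real \<Rightarrow> complex) \<Rightarrow> (real \<Rightarrow> complex) \<Rightarrow> bool" where
  "has_weak_derivative f g \<longleftrightarrow> f \<in> L2 \<and> g \<in> L2 \<and>
      (\<forall>\<phi>\<in>test_functions.
         (LINT x|I01. f x * vector_derivative \<phi> (at x)) = - (LINT x|I01. g x * \<phi> x))"

definition W12 :: "(real \<Rightarrow> complex) set" where
  "W12 = {f. \<exists>g. has_weak_derivative f g}"

definition W22 :: "(real \<Rightarrow> complex) set" where
  "W22 = {f. \<exists>g h. has_weak_derivative f g \<and> has_weak_derivative g h}"

text \<open>A choice of representative; the weak derivative is unique up to null sets.\<close>

definition weak_deriv :: "(real \<Rightarrow> complex) \<Rightarrow> real \<Rightarrow> complex" where
  "weak_deriv f = (SOME g. has_weak_derivative f g)"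

definition W12_norm :: "(real \<Rightarrow> complex) \<Rightarrow> real" where
  "W12_norm f = sqrt ((L2_norm f)\<^sup>2 + (L2_norm (weak_deriv f))\<^sup>2)"

definition W012 :: "(real \<Rightarrow> complex) set" where
  "W012 = {f \<in> W12. \<forall>\<epsilon>>0. \<exists>\<phi>\<in>test_functions. W12_norm (f - \<phi>) < \<epsilon>}"

definition Hspace :: "state set" where
  "Hspace = W012 \<times> L2"

definition H_inner :: "state \<Rightarrow> state \<Rightarrow> complex" where
  "H_inner \<Phi> \<Psi> =
     L2_inner (weak_deriv (fst \<Phi>)) (weak_deriv (fst \<Psi>)) + L2_inner (snd \<Phi>) (snd \<Psi>)"

definition H_norm :: "state \<Rightarrow> real" where
  "H_norm \<Phi> = sqrt (Re (H_inner \<Phi> \<Phi>))"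

definition H_scale :: "complex \<Rightarrow> state \<Rightarrow> state" where
  "H_scale c \<Phi> = ((\<lambda>x. c * fst \<Phi> x), (\<lambda>x. c * snd \<Phi> x))"

definition H_null :: "state \<Rightarrow> bool" where
  "H_null \<Phi> \<longleftrightarrow> (AE x in I01. fst \<Phi> x = 0 \<and> snd \<Phi> x = 0)"

text \<open>
  An operator $T$ in $\mathcal H$ is given by its graph $\{(U, TU)\}$. The graph closure below is
  the graph of the closure of $T$ whenever $T$ is closable; it is automatically saturated under
  changing representatives on null sets.
\<close>

definition op_closure :: "(state \<times> state) set \<Rightarrow> (state \<times> state) set" where
  "op_closure T = {(U, F). U \<in> Hspace \<and> F \<in> Hspace \<and>
      (\<forall>\<epsilon>>0. \<exists>(U', F')\<in>T. H_norm (U - U') < \<epsilon> \<and> H_norm (F - F') < \<epsilon>)}"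

definition op_shift :: "(state \<times> state) set \<Rightarrow> complex \<Rightarrow> (state \<times> state) set" where
  "op_shift T z = {(U, F - H_scale z U) | U F. (U, F) \<in> T}"

text \<open>The three conjuncts: $T - z$ is surjective, injective, and has a bounded inverse.\<close>

definition op_resolvent_set :: "(state \<times> state) set \<Rightarrow> complex set" where
  "op_resolvent_set T = {z.
      (\<forall>F\<in>Hspace. \<exists>U. (U, F) \<in> op_shift T z) \<and>
      (\<forall>(U, F)\<in>op_shift T z. H_null F \<longrightarrow> H_null U) \<and>
      (\<exists>C. \<forall>(U, F)\<in>op_shift T z. H_norm U \<le> C * H_norm F)}"

definition op_spectrum :: "(state \<times> state) set \<Rightarrow> complex set" where
  "op_spectrum T = - op_resolvent_set T"

definition is_eigenvector :: "(state \<times> state) set \<Rightarrow> complex \<Rightarrow> state \<Rightarrow> bool" where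
  "is_eigenvector T z U \<longleftrightarrow> (U, H_scale z U) \<in> T \<and> \<not> H_null U"

definition is_eigenvalue :: "(state \<times> state) set \<Rightarrow> complex \<Rightarrow> bool" where
  "is_eigenvalue T z \<longleftrightarrow> (\<exists>U. is_eigenvector T z U)"

definition G0_dom :: "state set" where
  "G0_dom = (W012 \<inter> W22) \<times> (W012 \<inter> W22)"

definition G0_app :: "real \<Rightarrow> state \<Rightarrow> state" where
  "G0_app \<alpha> = (\<lambda>(u, v).
     (v, \<lambda>x. weak_deriv (weak_deriv u) x - complex_of_real (2 * \<alpha> / x) * v x))"

definition G0 :: "real \<Rightarrow> (state \<times> state) set" where
  "G0 \<alpha> = {(U, G0_app \<alpha> U) | U. U \<in> G0_dom}"

definition G :: "real \<Rightarrow> (state \<times> state) set" where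
  "G \<alpha> = op_closure (G0 \<alpha>)"

definition kummer_M :: "complex \<Rightarrow> complex \<Rightarrow> complex \<Rightarrow> complex" where
  "kummer_M a b z = (\<Sum>j. pochhammer a j / (pochhammer b j * fact j) * z ^ j)"

text \<open>The associated Laguerre polynomial $L_n^{(1)}$.\<close>

definition laguerre1 :: "nat \<Rightarrow> complex \<Rightarrow> complex" where
  "laguerre1 n z = (\<Sum>j\<le>n. of_nat ((n + 1) choose (n - j)) * ((- z) ^ j / fact j))"

text \<open>
  The main terms of the asymptotic expansion: \<open>s = 1\<close> gives the upper signs and \<open>s = -1\<close> the
  lower signs. On the complex numbers, \<^const>\<open>Ln\<close> and \<open>powr\<close> are the principal branches.
\<close>

definition asymp_eigenvalue :: "real \<Rightarrow> real \<Rightarrow> int \<Rightarrow> complex" where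
  "asymp_eigenvalue \<alpha> s k =
     - of_real s * of_real ((2 * of_int k + 1 - \<alpha>) / 2 * pi) * \<i>
     - 1 / 2 * Ln (- of_real (Gamma (1 - \<alpha>) / Gamma (1 + \<alpha>)) *
                    (of_real (s * 2 * of_int k * pi) * \<i>) powr of_real (2 * \<alpha>))"

end

theory Submission
  imports Defs "HOL-Complex_Analysis.Complex_Analysis" "HOL-Real_Asymp.Real_Asymp"
begin

text \<open>
  The function \<open>u(x) = x e\<^sup>z\<^sup>x M(1-\<alpha>,2,-2zx)\<close> spans the solutions of \<open>u'' = (z\<^sup>2 + 2\<alpha>z/x) u\<close> with \<open>u(0) = 0\<close>.
  It is an eigenvector iff \<open>u(1) = 0\<close>; otherwise the Dirichlet problem with a source is solvable with a bound, because
  for the derivative it is a Volterra equation with square integrable data. The positive zeros of \<open>M(1-\<alpha>,2,\<cdot>)\<close> are counted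
  inductively in \<open>\<alpha>\<close>, from above by Rolle's theorem and from below by sign alternation. For the non-real zeros, deforming the contour in
  Euler's integral splits \<open>M\<close> into an exponentially growing and an algebraic part; this is done for \<open>\<bar>\<alpha>\<bar> < 1\<close> and
  carried to all \<open>\<alpha>\<close> by the three-term recursion. Taking logarithms, \<open>M = 0\<close> becomes
  \<open>z = c + 2\<alpha> Ln z + O(1/z) + 2\<pi>ik\<close>, which the contraction principle solves near \<open>2\<pi>ik\<close>.
\<close>

section \<open>The Sobolev spaces on the unit interval\<close>

text \<open>The coefficient 2 \<alpha> z / x is in general not integrable at 0, but the primitive of
  a bounded function is O(x); taking p = u' as the unknown makes the equation regular and moves the
  analysis from Sobolev classes to continuous functions. The closure of G0 is genuinely used for the
  resolvent: if the first component f of the right-hand side is only in \<open>W012\<close>, then f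
  + z u need not lie in \<open>W22\<close>. Preimages are limits of exact solutions with f replaced
  by test functions, controlled by the Dirichlet bound. Euler's integral converges only for
  \<bar>\<alpha>\<bar> < 1, so for larger \<alpha> the algebraic part is what is left after
  subtracting the growing part. The recursion applies to it because Kummer functions and growing
  parts satisfy it separately. It has two terms, so two starting values one apart are needed; this
  is why negative \<alpha> occurs although the theorem has \<alpha> > 0. The upper half-plane
  suffices, since zeros come in conjugate pairs; the argument -2 z sends its zeros to eigenvalues
  below the real axis.\<close>

lemma smooth_coinduct:
  assumes "f \<in> S" and step: "\<And>g. g \<in> S \<Longrightarrow> \<exists>g'\<in>S. \<forall>x. (g has_vector_derivative g' x) (at x)"
  shows "smooth f"
proof -
  \<comment> \<open>The definition of \<open>smooth\<close> asks for the whole sequence of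
    derivatives at once; iterating one chosen derivative inside S supplies it.\<close>
  define d where "d g = (SOME g'. g' \<in> S \<and> (\<forall>x. (g has_vector_derivative g' x) (at x)))" for g
  have d: "d g \<in> S \<and> (\<forall>x. (g has_vector_derivative d g x) (at x))" if "g \<in> S" for g
    using someI_ex[of "\<lambda>g'. g' \<in> S \<and> (\<forall>x. (g has_vector_derivative g' x) (at x))"] step[OF that]
    unfolding d_def by blast
  have *: "(d ^^ n) f \<in> S" for n by (induct n) (use assms d in auto)
  show ?thesis unfolding smooth_def
    by (rule exI[of _ "\<lambda>n. (d ^^ n) f"]) (use d[OF *] in auto)
qed

lemma smooth_has_derivative:
  assumes "smooth f"
  obtains f' where "smooth f'" "\<And>x. (f has_vector_derivative f' x) (at x)"
proof -
  from assms obtain D where D: "D 0 = f" "\<And>n x. (D n has_vector_derivative D (Suc n) x) (at x)"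
    by (auto simp: smooth_def)
  show ?thesis
    by (rule that[of "D (Suc 0)"], unfold smooth_def, rule exI[of _ "\<lambda>n. D (Suc n)"])
      (use D in \<open>auto simp flip: D(1)\<close>)
qed

lemma smooth_intro_deriv:
  assumes "smooth f'" "\<And>x. (f has_vector_derivative f' x) (at x)"
  shows "smooth f"
proof -
  from assms obtain D where D: "D 0 = f'" "\<And>n x. (D n has_vector_derivative D (Suc n) x) (at x)"
    by (auto simp: smooth_def)
  show ?thesis unfolding smooth_def
    by (rule exI[of _ "\<lambda>n. case n of 0 \<Rightarrow> f | Suc m \<Rightarrow> D m"]) (use D assms in \<open>auto split: nat.split\<close>)
qed

lemma smooth_continuous: "smooth f \<Longrightarrow> continuous_on A f"
  by (metis smooth_has_derivative continuous_at_imp_continuous_on has_vector_derivative_continuous)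

text \<open>All derivatives of a product are sums of products of derivatives. Closure under
  differentiation is all that \<open>smooth_coinduct\<close> asks for, so the binomial coefficients
  of Leibniz' rule never appear.\<close>

inductive_set leibniz_span :: "(nat \<Rightarrow> real \<Rightarrow> complex) \<Rightarrow> (nat \<Rightarrow> real \<Rightarrow> complex) \<Rightarrow> (real \<Rightarrow> complex) set"
  for D E where
  "(\<lambda>x. D i x * E j x) \<in> leibniz_span D E"
| "f \<in> leibniz_span D E \<Longrightarrow> g \<in> leibniz_span D E \<Longrightarrow> (\<lambda>x. f x + g x) \<in> leibniz_span D E"

lemma smooth_mult:
  assumes "smooth f" "smooth g"
  shows "smooth (\<lambda>x. f x * g x)"
proof -
  from assms obtain D where D: "D 0 = f" "\<And>n x. (D n has_vector_derivative D (Suc n) x) (at x)"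
    by (auto simp: smooth_def)
  from assms obtain E where E: "E 0 = g" "\<And>n x. (E n has_vector_derivative E (Suc n) x) (at x)"
    by (auto simp: smooth_def)
  have "\<exists>h'\<in>leibniz_span D E. \<forall>x. (h has_vector_derivative h' x) (at x)" if "h \<in> leibniz_span D E" for h
    using that
  proof induction
    case (1 i j)
    have "(\<lambda>x. D i x * E (Suc j) x + D (Suc i) x * E j x) \<in> leibniz_span D E"
      by (intro leibniz_span.intros)
    moreover have "((\<lambda>x. D i x * E j x) has_vector_derivative D i x * E (Suc j) x + D (Suc i) x * E j x) (at x)" for x
      by (rule has_vector_derivative_mult[OF D(2) E(2)])
    ultimately show ?case by (metis (no_types, lifting))
  next
    case (2 f g)
    then obtain f' g' where "f' \<in> leibniz_span D E" "g' \<in> leibniz_span D E" 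
      "\<And>x. (f has_vector_derivative f' x) (at x)" "\<And>x. (g has_vector_derivative g' x) (at x)" by blast
    then show ?case
      by (intro bexI[of _ "\<lambda>x. f' x + g' x"]) (auto intro: has_vector_derivative_add leibniz_span.intros)
  qed
  moreover have "(\<lambda>x. f x * g x) \<in> leibniz_span D E" using leibniz_span.intros(1)[of D 0 E 0] D(1) E(1) by simp
  ultimately show ?thesis by (rule smooth_coinduct[rotated])
qed

lemma smooth_add:
  assumes "smooth f" "smooth g"
  shows "smooth (\<lambda>x. f x + g x)"
proof -
  from assms obtain D where D: "D 0 = f" "\<And>n x. (D n has_vector_derivative D (Suc n) x) (at x)"
    by (auto simp: smooth_def)
  from assms obtain E where E: "E 0 = g" "\<And>n x. (E n has_vector_derivative E (Suc n) x) (at x)"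
    by (auto simp: smooth_def)
  show ?thesis unfolding smooth_def
    by (rule exI[of _ "\<lambda>n x. D n x + E n x"]) (auto intro!: has_vector_derivative_add D E simp: D(1) E(1))
qed

lemma smooth_polynomial_function:
  fixes p :: "real \<Rightarrow> complex"
  assumes "polynomial_function p"
  shows "smooth p"
  by (rule smooth_coinduct[of _ "Collect polynomial_function"])
    (use assms has_vector_derivative_polynomial_function in \<open>blast+\<close>)

lemma smooth_affine:
  fixes a b :: real
  assumes "smooth f"
  shows "smooth (\<lambda>x. f (a * x + b))"
proof -
  from assms obtain D where D: "D 0 = f" "\<And>n x. (D n has_vector_derivative D (Suc n) x) (at x)"
    by (auto simp: smooth_def)
  have "((\<lambda>x. (a ^ n) *\<^sub>R D n (a * x + b)) has_vector_derivative (a ^ Suc n) *\<^sub>R D (Suc n) (a * x + b)) (at x)" for n x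
  proof -
    have "((\<lambda>x. a * x + b) has_vector_derivative a) (at x)"
      by (auto intro!: derivative_eq_intros)
    from vector_diff_chain_at[OF this D(2)]
    have "((\<lambda>x. D n (a * x + b)) has_vector_derivative a *\<^sub>R D (Suc n) (a * x + b)) (at x)"
      by (simp add: o_def)
    then show ?thesis
      by (auto intro!: derivative_eq_intros)
  qed
  then show ?thesis unfolding smooth_def
    by (intro exI[of _ "\<lambda>n x. (a ^ n) *\<^sub>R D n (a * x + b)"]) (simp add: D(1))
qed

section \<open>Bump functions\<close>

definition flat_exp :: "real \<Rightarrow> complex" where
  "flat_exp x = (if x \<le> 0 then 0 else of_real (exp (- 1 / x)))"

lemma poly_div_exp_tendsto_0: "((\<lambda>t. poly p t / exp t) \<longlongrightarrow> (0::real)) at_top"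
proof -
  have "((\<lambda>t. \<Sum>i\<le>degree p. coeff p i * (t ^ i / exp t)) \<longlongrightarrow> (\<Sum>i\<le>degree p. coeff p i * 0)) at_top"
    by (intro tendsto_sum tendsto_mult tendsto_const tendsto_power_div_exp_0)
  then show ?thesis by (simp add: poly_altdef sum_divide_distrib)
qed

lemma smooth_flat_exp: "smooth flat_exp"
proof -
  \<comment> \<open>The class closed under differentiation: for x > 0, differentiating p(1/x)
    exp(-1/x) replaces the polynomial p by X^2 (p - p').\<close>
  define e where "e p x = (if x \<le> 0 then 0 else of_real (poly p (1 / x) * exp (- 1 / x)) :: complex)" for p :: "real poly" and x :: real
  have der: "(e p has_vector_derivative e ([:0,0,1:] * (p - pderiv p)) x) (at x)" for p x
  proof -
    define eR where "eR p x = (if x \<le> 0 then 0 else poly p (1 / x) * exp (- 1 / x))" for p :: "real poly" and x :: real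
    have "(eR p has_real_derivative eR ([:0,0,1:] * (p - pderiv p)) x) (at x)"
    proof -
      consider "x < 0" | "x = 0" | "x > 0" by linarith
      then show ?thesis
      proof cases
        case 1
        have "((\<lambda>x. 0) has_real_derivative 0) (at x)" by simp
        then have "(eR p has_real_derivative 0) (at x)"
          by (rule has_field_derivative_transform_within_open[of _ _ _ "{..<0}"]) (use 1 in \<open>auto simp: eR_def\<close>)
        then show ?thesis using 1 by (simp add: eR_def)
      next
        case 3
        have "((\<lambda>x. poly p (1 / x) * exp (- 1 / x)) has_real_derivative 
            poly ([:0,0,1:] * (p - pderiv p)) (1 / x) * exp (- 1 / x)) (at x)"
          using 3 by (auto intro!: derivative_eq_intros poly_DERIV[THEN DERIV_chain2] simp: field_simps power2_eq_square)
        then have "(eR p has_real_derivative poly ([:0,0,1:] * (p - pderiv p)) (1 / x) * exp (- 1 / x)) (at x)"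
          by (rule has_field_derivative_transform_within_open[of _ _ _ "{0<..}"]) (use 3 in \<open>auto simp: eR_def\<close>)
        then show ?thesis using 3 by (simp add: eR_def)
      next
        case 2
        have "((\<lambda>h. eR p h / h) \<longlongrightarrow> 0) (at_left 0)"
          by (rule Lim_transform_eventually[OF tendsto_const])
            (auto simp: eR_def eventually_at_filter)
        \<comment> \<open>The only delicate point is 0 approached from the right, where the
          difference quotient is a polynomial in 1/h divided by exp(1/h).\<close>
        moreover have "((\<lambda>h. eR p h / h) \<longlongrightarrow> 0) (at_right 0)"
        proof -
          have "((\<lambda>h. poly ([:0,1:] * p) (inverse h) / exp (inverse h)) \<longlongrightarrow> 0) (at_right 0)"
            by (rule filterlim_compose[OF poly_div_exp_tendsto_0 filterlim_inverse_at_top_right])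
          then show ?thesis
            by (rule Lim_transform_eventually) (auto simp: eR_def eventually_at_filter field_simps exp_minus)
        qed
        ultimately have "((\<lambda>h. eR p h / h) \<longlongrightarrow> 0) (at 0)"
          by (simp add: filterlim_split_at)
        then show ?thesis using 2 by (simp add: has_field_derivative_iff eR_def)
      qed
    qed
    moreover have "e p = (\<lambda>x. of_real (eR p x))" for p by (auto simp: e_def eR_def)
    ultimately show ?thesis by (simp add: has_vector_derivative_of_real has_real_derivative_iff_has_vector_derivative)
  qed
  show ?thesis
  proof (rule smooth_coinduct[of _ "range e"])
    show "flat_exp \<in> range e" by (rule image_eqI[of _ _ "[:1:]"]) (auto simp: flat_exp_def e_def)
  qed (use der in blast)
qed

definition bump :: "real \<Rightarrow> real \<Rightarrow> real \<Rightarrow> complex" where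
  "bump a b x = flat_exp (x - a) * flat_exp (b - x)"

lemma smooth_bump: "smooth (bump a b)"
  using smooth_mult[OF smooth_affine[OF smooth_flat_exp, of 1 "-a"] smooth_affine[OF smooth_flat_exp, of "-1" b]]
  by (simp add: bump_def[abs_def])

lemma bump_eq_0: "x \<notin> {a<..<b} \<Longrightarrow> bump a b x = 0"
  by (auto simp: bump_def flat_exp_def)

lemma bump_pos: "a < x \<Longrightarrow> x < b \<Longrightarrow> bump a b x = of_real (exp (- 1 / (x - a)) * exp (- 1 / (b - x)))"
  by (auto simp: bump_def flat_exp_def)

lemma bump_le_1: "cmod (bump a b x) \<le> 1"
proof (cases "a < x \<and> x < b")
  case True
  then show ?thesis unfolding bump_pos[OF conjunct1[OF True] conjunct2[OF True]]
    by (simp add: norm_mult mult_le_one)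
qed (auto simp: bump_eq_0)

lemma test_function_mult_bump:
  assumes "smooth f" "0 < a" "b < 1"
  shows "(\<lambda>x. f x * bump a b x) \<in> test_functions"
  unfolding test_functions_def
  by (auto intro!: smooth_mult assms smooth_bump exI[of _ "{a..b}"] simp: bump_eq_0) (use assms in auto)

section \<open>Square integrable functions on the unit interval\<close>

lemma finite_measure_I01: "finite_measure I01"
  by (rule finite_measure_lebesgue_on) auto

lemma measure_I01 [simp]: "measure I01 {0<..<1} = 1"
  by (simp add: measure_restrict_space)

lemma integrable_const_I01 [simp, intro]: "integrable I01 (\<lambda>x. c)" for c :: "'a::{banach,second_countable_topology}"
  using finite_measure_I01 by (simp add: finite_measure.integrable_const)

lemma LINT_const_I01 [simp]: "(LINT x|I01. c) = c" for c :: real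
  using finite_measure.finite_emeasure_space finite_measure_I01 by (simp add: lebesgue_integral_const measure_I01)

lemma AE_I01I: "(\<And>x. 0 < x \<Longrightarrow> x < 1 \<Longrightarrow> P x) \<Longrightarrow> AE x in I01. P x"
  by (rule AE_I2) auto

lemma continuous_borel_measurable_I01 [intro]:
  fixes f :: "real \<Rightarrow> 'a::euclidean_space"
  shows "continuous_on {0<..<1} f \<Longrightarrow> f \<in> borel_measurable I01"
  by (rule continuous_imp_measurable_on_sets_lebesgue) auto

lemma L2_measurable [measurable_dest]: "f \<in> L2 \<Longrightarrow> f \<in> borel_measurable I01"
  by (simp add: L2_def)

lemma L2_square_integrable: "f \<in> L2 \<Longrightarrow> integrable I01 (\<lambda>x. (cmod (f x))\<^sup>2)"
  by (simp add: L2_def)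

lemma two_mult_le_squares: "2 * (a * b) \<le> a\<^sup>2 + (b::real)\<^sup>2"
  using sum_squares_bound[of a b] by simp

lemma L2_norm_mult_integrable: "f \<in> L2 \<Longrightarrow> g \<in> L2 \<Longrightarrow> integrable I01 (\<lambda>x. cmod (f x) * cmod (g x))"
proof (rule Bochner_Integration.integrable_bound)
  assume fg: "f \<in> L2" "g \<in> L2"
  show "integrable I01 (\<lambda>x. (cmod (f x))\<^sup>2 + (cmod (g x))\<^sup>2)"
    by (intro Bochner_Integration.integrable_add L2_square_integrable fg)
  show "(\<lambda>x. cmod (f x) * cmod (g x)) \<in> borel_measurable I01"
    using fg by measurable
  show "AE x in I01. norm (cmod (f x) * cmod (g x)) \<le> norm ((cmod (f x))\<^sup>2 + (cmod (g x))\<^sup>2)"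
    using two_mult_le_squares by (intro AE_I2) (smt (verit) real_norm_def mult_nonneg_nonneg norm_ge_zero)
qed

lemma L2_mult_integrable: "f \<in> L2 \<Longrightarrow> g \<in> L2 \<Longrightarrow> integrable I01 (\<lambda>x. f x * g x)"
  by (rule Bochner_Integration.integrable_bound[OF L2_norm_mult_integrable[of f g]])
    (measurable, auto simp: norm_mult)

lemma L2_of_bound:
  assumes [measurable]: "f \<in> borel_measurable I01" and "g \<in> L2" "\<And>x. 0 < x \<Longrightarrow> x < 1 \<Longrightarrow> cmod (f x) \<le> C * cmod (g x)"
  shows "f \<in> L2"
  unfolding L2_def
proof (safe, fact, rule Bochner_Integration.integrable_bound)
  show "integrable I01 (\<lambda>x. C\<^sup>2 * (cmod (g x))\<^sup>2)"
    using assms(2) by (intro integrable_mult_right L2_square_integrable)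
  show "AE x in I01. norm ((cmod (f x))\<^sup>2) \<le> norm (C\<^sup>2 * (cmod (g x))\<^sup>2)"
    using assms(3) by (intro AE_I01I) (simp add: power_mono flip: power_mult_distrib)
qed measurable

lemma L2_const [simp, intro]: "(\<lambda>x. c) \<in> L2"
  by (auto simp: L2_def)

lemma L2_bounded:
  assumes "f \<in> borel_measurable I01" "\<And>x. 0 < x \<Longrightarrow> x < 1 \<Longrightarrow> cmod (f x) \<le> C"
  shows "f \<in> L2"
  by (rule L2_of_bound[OF assms(1) L2_const[of 1], of C]) (use assms(2) in auto)

lemma L2_continuous:
  assumes "continuous_on {0..1} f"
  shows "f \<in> L2"
proof -
  have "bounded (f ` {0..1})"
    by (intro compact_imp_bounded compact_continuous_image assms) auto
  then obtain B where "\<And>x. 0 \<le> x \<Longrightarrow> x \<le> 1 \<Longrightarrow> cmod (f x) \<le> B"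
    unfolding bounded_iff by (metis atLeastAtMost_iff image_eqI)
  moreover have "f \<in> borel_measurable I01"
    by (rule continuous_borel_measurable_I01) (rule continuous_on_subset[OF assms], auto)
  ultimately show ?thesis by (intro L2_bounded[of f B]) auto
qed

lemma L2_add: 
  assumes [measurable_dest]: "f \<in> L2" "g \<in> L2" 
  shows "(\<lambda>x. f x + g x) \<in> L2"
  unfolding L2_def
proof (safe)
  show "(\<lambda>x. f x + g x) \<in> borel_measurable I01" using assms by measurable
  show "integrable I01 (\<lambda>x. (cmod (f x + g x))\<^sup>2)"
  proof (rule Bochner_Integration.integrable_bound)
    show "integrable I01 (\<lambda>x. 2 * (cmod (f x))\<^sup>2 + 2 * (cmod (g x))\<^sup>2)"
      by (intro Bochner_Integration.integrable_add integrable_mult_right L2_square_integrable assms)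
    show "(\<lambda>x. (cmod (f x + g x))\<^sup>2) \<in> borel_measurable I01" using assms by measurable
    have "(cmod (f x + g x))\<^sup>2 \<le> 2 * (cmod (f x))\<^sup>2 + 2 * (cmod (g x))\<^sup>2" for x
    proof -
      have "(cmod (f x + g x))\<^sup>2 \<le> (cmod (f x) + cmod (g x))\<^sup>2"
        by (intro power_mono norm_triangle_ineq) auto
      then show ?thesis using two_mult_le_squares[of "cmod (f x)" "cmod (g x)"] by (simp add: power2_sum)
    qed
    then show "AE x in I01. norm ((cmod (f x + g x))\<^sup>2) \<le> norm (2 * (cmod (f x))\<^sup>2 + 2 * (cmod (g x))\<^sup>2)"
      by (intro AE_I2) (metis abs_of_nonneg order_trans real_norm_def abs_ge_self zero_le_power2)
  qed
qed

lemma L2_mult_const: "f \<in> L2 \<Longrightarrow> (\<lambda>x. c * f x) \<in> L2"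
  by (rule L2_of_bound[of _ f "cmod c"]) (measurable, auto simp: norm_mult)

lemma L2_diff: "f \<in> L2 \<Longrightarrow> g \<in> L2 \<Longrightarrow> (\<lambda>x. f x - g x) \<in> L2"
  using L2_add[OF _ L2_mult_const[of g "-1"], of f] by simp

lemma L2_diff': "f \<in> L2 \<Longrightarrow> g \<in> L2 \<Longrightarrow> f - g \<in> L2"
  using L2_diff by (simp add: fun_diff_def)

lemma L2_norm_nonneg [simp]: "L2_norm f \<ge> 0"
  by (simp add: L2_norm_def)

lemma L2_norm_square: "(L2_norm f)\<^sup>2 = (LINT x|I01. (cmod (f x))\<^sup>2)"
  by (simp add: L2_norm_def)

lemma L2_norm_cong_AE:
  assumes "AE x in I01. f x = g x" "f \<in> L2" "g \<in> L2"
  shows "L2_norm f = L2_norm g"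
  unfolding L2_norm_def
  by (intro arg_cong[where f = sqrt] integral_cong_AE) (use assms in \<open>measurable, auto\<close>)

lemma L2_Cauchy_Schwarz:
  assumes "f \<in> L2" "g \<in> L2"
  shows "(LINT x|I01. cmod (f x) * cmod (g x)) \<le> L2_norm f * L2_norm g"
proof -
  have [measurable]: "f \<in> borel_measurable I01" "g \<in> borel_measurable I01" using assms by measurable
  have eq: "(\<integral>\<^sup>+x. (ennreal (cmod (h x)))\<^sup>2 \<partial>I01) = ennreal ((L2_norm h)\<^sup>2)" if "h \<in> L2" for h
    unfolding L2_norm_square using L2_square_integrable[OF that]
    by (subst nn_integral_eq_integral[symmetric]) (auto simp: ennreal_power)
  have "(\<integral>\<^sup>+x. ennreal (cmod (f x)) * ennreal (cmod (g x)) \<partial>I01) = ennreal (LINT x|I01. cmod (f x) * cmod (g x))"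
    using L2_norm_mult_integrable[OF assms]
    by (subst nn_integral_eq_integral[symmetric]) (auto simp: ennreal_mult)
  moreover have "(\<integral>\<^sup>+x. ennreal (cmod (f x)) * ennreal (cmod (g x)) \<partial>I01)\<^sup>2 \<le> 
     (\<integral>\<^sup>+x. (ennreal (cmod (f x)))\<^sup>2 \<partial>I01) * (\<integral>\<^sup>+x. (ennreal (cmod (g x)))\<^sup>2 \<partial>I01)"
    by (rule Cauchy_Schwarz_nn_integral) measurable
  ultimately have "ennreal ((LINT x|I01. cmod (f x) * cmod (g x))\<^sup>2) \<le> ennreal ((L2_norm f * L2_norm g)\<^sup>2)"
    unfolding eq[OF assms(1)] eq[OF assms(2)]
    by (simp add: ennreal_power integral_nonneg_AE power_mult_distrib flip: ennreal_mult)
  then have "(LINT x|I01. cmod (f x) * cmod (g x))\<^sup>2 \<le> (L2_norm f * L2_norm g)\<^sup>2"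
    by simp
  then show ?thesis by (rule power2_le_imp_le) simp
qed

lemma L2_norm_triangle:
  assumes "f \<in> L2" "g \<in> L2"
  shows "L2_norm (\<lambda>x. f x + g x) \<le> L2_norm f + L2_norm g"
proof (rule power2_le_imp_le)
  have "(L2_norm (\<lambda>x. f x + g x))\<^sup>2 \<le> (LINT x|I01. (cmod (f x))\<^sup>2 + (cmod (g x))\<^sup>2 + 2 * (cmod (f x) * cmod (g x)))"
    unfolding L2_norm_square
  proof (rule integral_mono)
    show "integrable I01 (\<lambda>x. (cmod (f x))\<^sup>2 + (cmod (g x))\<^sup>2 + 2 * (cmod (f x) * cmod (g x)))"
      by (intro Bochner_Integration.integrable_add integrable_mult_right L2_square_integrable L2_norm_mult_integrable assms)
    show "(cmod (f x + g x))\<^sup>2 \<le> (cmod (f x))\<^sup>2 + (cmod (g x))\<^sup>2 + 2 * (cmod (f x) * cmod (g x))" for x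
    proof -
      have "(cmod (f x + g x))\<^sup>2 \<le> (cmod (f x) + cmod (g x))\<^sup>2"
        by (intro power_mono norm_triangle_ineq) auto
      then show ?thesis by (simp add: power2_sum)
    qed
  qed (intro L2_square_integrable L2_add assms)
  also have "\<dots> = (L2_norm f)\<^sup>2 + (L2_norm g)\<^sup>2 + 2 * (LINT x|I01. cmod (f x) * cmod (g x))"
    unfolding L2_norm_square
    using L2_square_integrable[OF assms(1)] L2_square_integrable[OF assms(2)] L2_norm_mult_integrable[OF assms]
    by simp
  also have "\<dots> \<le> (L2_norm f + L2_norm g)\<^sup>2"
    using L2_Cauchy_Schwarz[OF assms] by (simp add: power2_sum)
  finally show "(L2_norm (\<lambda>x. f x + g x))\<^sup>2 \<le> (L2_norm f + L2_norm g)\<^sup>2" .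
qed simp

lemma L2_norm_scale: "L2_norm (\<lambda>x. c * f x) = cmod c * L2_norm f"
  by (simp add: L2_norm_def norm_mult power_mult_distrib real_sqrt_mult)

lemma L2_norm_diff_triangle:
  assumes "f \<in> L2" "g \<in> L2"
  shows "L2_norm (\<lambda>x. f x - g x) \<le> L2_norm f + L2_norm g"
  using L2_norm_triangle[OF assms(1) L2_mult_const[OF assms(2), of "-1"]] L2_norm_scale[of "-1" g] by simp

lemma L2_integrable: "f \<in> L2 \<Longrightarrow> integrable I01 f"
  using L2_mult_integrable[of f "\<lambda>_. 1"] by simp

lemma L1_le_L2_norm:
  assumes "f \<in> L2"
  shows "(LINT x|I01. cmod (f x)) \<le> L2_norm f"
  using L2_Cauchy_Schwarz[OF assms L2_const[of 1]] by (simp add: L2_norm_def)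

lemma L2_norm_mono:
  assumes "g \<in> L2" "f \<in> L2" "\<And>x. 0 < x \<Longrightarrow> x < 1 \<Longrightarrow> cmod (f x) \<le> cmod (g x)"
  shows "L2_norm f \<le> L2_norm g"
  unfolding L2_norm_def
  by (intro real_sqrt_le_mono integral_mono_AE L2_square_integrable assms AE_I01I power_mono) auto

lemma L2_norm_le_const:
  assumes "f \<in> L2" "\<And>x. 0 < x \<Longrightarrow> x < 1 \<Longrightarrow> cmod (f x) \<le> C"
  shows "L2_norm f \<le> C"
proof -
  have "0 \<le> C" using assms(2)[of "1/2"] norm_ge_zero[of "f (1/2)"] by linarith
  have "L2_norm f \<le> L2_norm (\<lambda>x. of_real C)"
    by (rule L2_norm_mono) (use assms \<open>0 \<le> C\<close> in auto)
  then show ?thesis using \<open>0 \<le> C\<close> by (simp add: L2_norm_def)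
qed

text \<open>Dominated convergence, with the dominating function placed on the squared difference so
  that truncations of an unbounded f are covered too.\<close>

lemma L2_norm_tendsto_0:
  fixes s :: "nat \<Rightarrow> real \<Rightarrow> complex"
  assumes "f \<in> borel_measurable I01" "\<And>n. s n \<in> borel_measurable I01"
    and "AE x in I01. (\<lambda>n. s n x) \<longlonglongrightarrow> f x" and "integrable I01 w"
    and "\<And>n. AE x in I01. (cmod (f x - s n x))\<^sup>2 \<le> w x"
  shows "(\<lambda>n. L2_norm (\<lambda>x. f x - s n x)) \<longlonglongrightarrow> 0"
proof -
  have "(\<lambda>n. LINT x|I01. (cmod (f x - s n x))\<^sup>2) \<longlonglongrightarrow> (LINT x|I01. 0)"
  proof (rule integral_dominated_convergence[where w = w])
    show "AE x in I01. (\<lambda>n. (cmod (f x - s n x))\<^sup>2) \<longlonglongrightarrow> 0"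
      using assms(3)
    proof eventually_elim
      case (elim x)
      have "(\<lambda>n. (cmod (f x - s n x))\<^sup>2) \<longlonglongrightarrow> (cmod (f x - f x))\<^sup>2"
        by (intro tendsto_intros elim)
      then show ?case by simp
    qed
  qed (use assms in \<open>auto\<close>)
  from tendsto_real_sqrt[OF this] show ?thesis by (simp add: L2_norm_def)
qed

text \<open>Polynomials are the approximants because they are smooth: multiplied by a bump they
  become test functions.\<close>

lemma polynomial_approx_bounded:
  assumes f [measurable]: "f \<in> borel_measurable I01" and B: "\<And>x. cmod (f x) \<le> B" and "e > 0"
  obtains p :: "real \<Rightarrow> complex" where "polynomial_function p" "L2_norm (\<lambda>x. f x - p x) < e"
proof -
  define C where "C = max B 1"
  have C: "C > 0" "\<And>x. cmod (f x) \<le> C" using B by (auto simp: C_def intro: max.coboundedI1)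
  define f0 where "f0 x = (if x \<in> {0<..<1} then f x else 0)" for x
  have "f0 \<in> borel_measurable lebesgue"
    using borel_measurable_if[of "{0<..<1}" f] f by (simp add: f0_def[abs_def])
  then have "f0 measurable_on UNIV"
    by (simp add: measurable_on_iff_borel_measurable lebesgue_on_UNIV_eq)
  then obtain N g where N: "negligible N" and g: "\<And>n. continuous_on UNIV (g n)" 
    and lim: "\<And>x. x \<notin> N \<Longrightarrow> (\<lambda>n. g n x) \<longlonglongrightarrow> f0 x"
    by (auto simp: measurable_on_def)
  \<comment> \<open>Radial retraction onto the disc of radius C. Composed with it, the approximants
    stay continuous and become uniformly bounded, as dominated convergence requires, and their limit
    is left fixed.\<close>
  define c where "c w = (C / max C (cmod w)) *\<^sub>R w" for w :: complex
  have c: "continuous_on UNIV c" unfolding c_def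
    using \<open>C > 0\<close> by (intro continuous_intros) (auto simp: max_def)
  have c_le: "cmod (c w) \<le> C" for w
    using \<open>C > 0\<close> by (simp add: c_def max_def field_simps)
  have c_id: "c w = w" if "cmod w \<le> C" for w
    using \<open>C > 0\<close> that by (simp add: c_def max_def)
  have cg: "continuous_on UNIV (\<lambda>x. c (g n x))" for n
    using continuous_on_compose2[OF c g] by simp
  have m: "(\<lambda>x. c (g n x)) \<in> borel_measurable I01" for n
    by (rule continuous_borel_measurable_I01) (rule continuous_on_subset[OF cg], auto)
  have "(\<lambda>n. L2_norm (\<lambda>x. f x - c (g n x))) \<longlonglongrightarrow> 0"
  proof (rule L2_norm_tendsto_0[where w = "\<lambda>x. (2 * C)\<^sup>2"])
    have "AE x in lebesgue. x \<notin> N"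
      using N by (simp add: AE_not_in negligible_iff_null_sets)
    then have "AE x in I01. x \<notin> N"
      by (subst AE_restrict_space_iff) (auto elim: AE_mp)
    then show "AE x in I01. (\<lambda>n. c (g n x)) \<longlonglongrightarrow> f x"
    proof (rule AE_mp, intro AE_I01I impI)
      fix x :: real assume x: "0 < x" "x < 1" "x \<notin> N"
      have "isCont c (f0 x)" using c by (simp add: continuous_on_eq_continuous_at)
      from isCont_tendsto_compose[OF this lim[OF x(3)]]
      show "(\<lambda>n. c (g n x)) \<longlonglongrightarrow> f x" using x C(2)[of x] by (simp add: f0_def c_id)
    qed
    have "cmod (f x - c (g n x)) \<le> 2 * C" for x n
      using norm_triangle_ineq4[of "f x" "c (g n x)"] C(2)[of x] c_le[of "g n x"] by simp
    then show "AE x in I01. (cmod (f x - c (g n x)))\<^sup>2 \<le> (2 * C)\<^sup>2" for n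
      by (intro AE_I2 power_mono) auto
  qed (use m f in auto)
  then obtain n where n: "L2_norm (\<lambda>x. f x - c (g n x)) < e / 2"
    using order_tendstoD(2)[of _ 0 sequentially "e/2"] \<open>e > 0\<close> by (auto simp: eventually_sequentially)
  obtain p where p: "polynomial_function p" "\<And>x. x \<in> {0..1} \<Longrightarrow> norm (c (g n x) - p x) < e / 2"
    using Stone_Weierstrass_polynomial_function[of "{0..1::real}" "\<lambda>x. c (g n x)" "e/2"] \<open>e > 0\<close>
      continuous_on_subset[OF cg] by (metis compact_Icc half_gt_zero subset_UNIV)
  have L1: "(\<lambda>x. c (g n x)) \<in> L2" "p \<in> L2"
    by (auto intro: L2_continuous continuous_on_subset[OF cg] continuous_on_polymonial_function p)
  have "L2_norm (\<lambda>x. (f x - c (g n x)) + (c (g n x) - p x)) \<le> L2_norm (\<lambda>x. f x - c (g n x)) + L2_norm (\<lambda>x. c (g n x) - p x)"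
    by (intro L2_norm_triangle L2_diff L1 L2_bounded[of f C] f C)
  also have "L2_norm (\<lambda>x. c (g n x) - p x) \<le> e / 2"
    by (rule L2_norm_le_const) (use p(2) L1 in \<open>auto intro: L2_diff less_imp_le\<close>)
  finally have "L2_norm (\<lambda>x. f x - p x) < e" using n by simp
  then show ?thesis using p(1) that by blast
qed

text \<open>The bump is divided out before approximating: f is cut off in size and near the
  endpoints, the result is divided by a bump that is bounded below there, the quotient is
  approximated by a polynomial, and the bump is multiplied back. Since the bump is at most 1 in
  modulus, the last step does not enlarge the error.\<close>

lemma test_functions_dense:
  assumes f: "f \<in> L2" and "e > 0"
  obtains \<phi> where "\<phi> \<in> test_functions" "L2_norm (\<lambda>x. f x - \<phi> x) < e"
proof -
  have [measurable]: "f \<in> borel_measurable I01" using f by measurable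
  have id [measurable]: "(\<lambda>x. x) \<in> borel_measurable I01" 
    by (rule continuous_borel_measurable_I01) (intro continuous_intros)
  define T where "T n x \<longleftrightarrow> 1 / real (Suc n) < x \<and> x < 1 - 1 / real (Suc n) \<and> cmod (f x) \<le> real n" for n x
  define s where "s n x = (if T n x then f x else 0)" for n x
  have s [measurable]: "s n \<in> borel_measurable I01" for n
    unfolding s_def T_def by measurable
  have "(\<lambda>n. L2_norm (\<lambda>x. f x - s n x)) \<longlonglongrightarrow> 0"
  proof (rule L2_norm_tendsto_0[where w = "\<lambda>x. (cmod (f x))\<^sup>2"])
    show "AE x in I01. (\<lambda>n. s n x) \<longlonglongrightarrow> f x"
    proof (rule AE_I01I)
      fix x :: real assume x: "0 < x" "x < 1"
      have "(\<lambda>n. 1 / real (Suc n)) \<longlonglongrightarrow> 0" using LIMSEQ_inverse_real_of_nat by (simp add: inverse_eq_divide)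
      then have "\<forall>\<^sub>F n in sequentially. 1 / real (Suc n) < min x (1 - x)"
        by (rule order_tendstoD) (use x in auto)
      moreover have "\<forall>\<^sub>F n in sequentially. cmod (f x) \<le> real n"
        using filterlim_real_sequentially by (simp add: filterlim_at_top)
      ultimately have "\<forall>\<^sub>F n in sequentially. s n x = f x"
        by eventually_elim (auto simp: s_def T_def)
      then show "(\<lambda>n. s n x) \<longlonglongrightarrow> f x" by (simp add: tendsto_eventually)
    qed
    show "AE x in I01. (cmod (f x - s n x))\<^sup>2 \<le> (cmod (f x))\<^sup>2" for n
      by (rule AE_I2) (simp add: s_def)
  qed (use s L2_square_integrable[OF f] in \<open>auto\<close>)
  then obtain n where n: "L2_norm (\<lambda>x. f x - s n x) < e / 2"
    using order_tendstoD(2)[of _ 0 sequentially "e/2"] \<open>e > 0\<close> by (auto simp: eventually_sequentially)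
  \<comment> \<open>Half the cut-off distance: where \<open>T n\<close> holds, the distances to the
    zeros a and 1 - a of the bump both exceed a, which gives the lower bound exp(-1/a)^2.\<close>
  define a where "a = 1 / (2 * real (Suc n))"
  have a: "0 < a" "1 - a < 1" "2 * a = 1 / real (Suc n)" by (auto simp: a_def divide_simps)
  define b where "b = bump a (1 - a)"
  define g where "g x = (if T n x then f x / b x else 0)" for x
  have b_lower: "cmod (b x) \<ge> exp (- 1 / a) * exp (- 1 / a)" if "T n x" for x
  proof -
    have x: "2 * a < x" "x < 1 - 2 * a" using that by (auto simp: T_def a(3))
    then have "b x = of_real (exp (- 1 / (x - a)) * exp (- 1 / (1 - a - x)))"
      unfolding b_def using a(1) by (intro bump_pos) auto
    then have "cmod (b x) = exp (- 1 / (x - a)) * exp (- 1 / (1 - a - x))"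
      by (simp add: norm_mult del: of_real_mult)
    also have "\<dots> \<ge> exp (- 1 / a) * exp (- 1 / a)"
      by (intro mult_mono) (use x a(1) in \<open>auto simp: field_simps\<close>)
    finally show ?thesis .
  qed
  have bc: "continuous_on A b" for A unfolding b_def by (rule smooth_continuous[OF smooth_bump])
  have [measurable]: "b \<in> borel_measurable I01" by (rule continuous_borel_measurable_I01[OF bc])
  have [measurable]: "g \<in> borel_measurable I01" unfolding g_def T_def by measurable
  have "cmod (g x) \<le> real n / (exp (- 1 / a) * exp (- 1 / a))" for x
  proof (cases "T n x")
    case True
    then have "cmod (g x) = cmod (f x) / cmod (b x)" by (simp add: g_def norm_divide)
    also have "\<dots> \<le> real n / (exp (- 1 / a) * exp (- 1 / a))"
      by (rule frac_le) (use True b_lower[OF True] in \<open>auto simp: T_def\<close>)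
    finally show ?thesis .
  qed (auto simp: g_def)
  note gB = this
  obtain p where p: "polynomial_function p" "L2_norm (\<lambda>x. g x - p x) < e / 2"
    by (rule polynomial_approx_bounded[of g _ "e/2"]) (use gB \<open>e > 0\<close> in auto)
  have pL: "p \<in> L2" "g \<in> L2"
    by (rule L2_continuous, rule continuous_on_polymonial_function, rule p) (rule L2_bounded[OF _ gB], measurable)
  have sL: "s n \<in> L2" by (rule L2_of_bound[OF s f, of _ 1]) (auto simp: s_def)
  have pbL: "(\<lambda>x. p x * b x) \<in> L2"
    by (intro L2_continuous continuous_on_mult bc continuous_on_polymonial_function p)
  have "L2_norm (\<lambda>x. (f x - s n x) + (s n x - p x * b x)) \<le> L2_norm (\<lambda>x. f x - s n x) + L2_norm (\<lambda>x. s n x - p x * b x)"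
    by (intro L2_norm_triangle L2_diff f sL pbL)
  also have "L2_norm (\<lambda>x. s n x - p x * b x) \<le> L2_norm (\<lambda>x. g x - p x)"
  proof (rule L2_norm_mono)
    fix x :: real
    have "b x \<noteq> 0" if "T n x" using b_lower[OF that] by (auto simp flip: exp_add simp: not_le)
    then have "s n x - p x * b x = (g x - p x) * b x" by (auto simp: s_def g_def field_simps)
    then show "cmod (s n x - p x * b x) \<le> cmod (g x - p x)"
      using bump_le_1[of a "1 - a" x] by (simp add: norm_mult b_def mult_left_le)
  qed (intro L2_diff pL sL pbL)+
  finally have "L2_norm (\<lambda>x. f x - p x * b x) < e" using n p(2) by simp
  moreover have "(\<lambda>x. p x * b x) \<in> test_functions"
    unfolding b_def by (rule test_function_mult_bump[OF smooth_polynomial_function]) (use a p in auto)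
  ultimately show ?thesis using that by blast
qed

section \<open>Primitives vanishing at 0\<close>

definition prim :: "(real \<Rightarrow> complex) \<Rightarrow> real \<Rightarrow> complex" where
  "prim g x = integral {0..x} g"

lemma integrable_I01_imp_HK:
  fixes g :: "real \<Rightarrow> 'a::euclidean_space"
  assumes "integrable I01 g"
  shows "g integrable_on {0..1}"
  using integrable_on_lebesgue_on[OF assms] by (simp add: integrable_on_Icc_iff_Ioo)

lemma integrable_I01_imp_HK_sub:
  fixes g :: "real \<Rightarrow> 'a::euclidean_space"
  assumes "integrable I01 g" "0 \<le> x" "x \<le> 1"
  shows "g integrable_on {0..x}"
  by (rule integrable_on_subinterval[OF integrable_I01_imp_HK[OF assms(1)]]) (use assms in auto)

lemma LINT_I01_eq_integral:
  fixes g :: "real \<Rightarrow> 'a::euclidean_space"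
  assumes "integrable I01 g"
  shows "(LINT x|I01. g x) = integral {0..1} g"
proof -
  have "(g has_integral (LINT x|I01. g x)) {0<..<1}"
    by (rule has_integral_integral_lebesgue_on[OF assms]) auto
  then show ?thesis by (simp add: has_integral_Icc_iff_Ioo integral_unique)
qed

lemma integrable_I01_cut:
  fixes g :: "real \<Rightarrow> complex"
  assumes "integrable I01 g"
  shows "integrable I01 (\<lambda>t. if t \<le> x then g t else 0)"
proof (rule Bochner_Integration.integrable_bound[OF assms])
  have [measurable]: "(\<lambda>x. x) \<in> borel_measurable I01" 
    by (rule continuous_borel_measurable_I01) (intro continuous_intros)
  have [measurable]: "g \<in> borel_measurable I01" using assms by auto
  show "(\<lambda>t. if t \<le> x then g t else 0) \<in> borel_measurable I01" by measurable
qed auto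

text \<open>Bridge between two integrals: \<open>prim\<close> is a gauge integral, for which the
  fundamental theorem of calculus is at hand; as an integral over the fixed measure
  \<open>I01\<close> it is open to almost everywhere arguments and to Cauchy-Schwarz.\<close>

lemma prim_eq_LINT:
  assumes "integrable I01 g" "0 \<le> x" "x \<le> 1"
  shows "prim g x = (LINT t|I01. (if t \<le> x then g t else 0))"
proof -
  have "(LINT t|I01. (if t \<le> x then g t else 0)) = integral {0..1} (\<lambda>t. if t \<in> {0..x} then g t else 0)"
    unfolding LINT_I01_eq_integral[OF integrable_I01_cut[OF assms(1)]]
    by (intro integral_cong) auto
  also have "\<dots> = integral {0..x} g"
    unfolding integral_restrict_Int by (rule arg_cong[where f = "\<lambda>S. integral S g"]) (use assms in auto)
  finally show ?thesis by (simp add: prim_def)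
qed

lemma prim_0 [simp]: "prim g 0 = 0"
  by (simp add: prim_def)

lemma prim_1: "integrable I01 g \<Longrightarrow> prim g 1 = (LINT x|I01. g x)"
  by (simp add: prim_def LINT_I01_eq_integral)

lemma prim_continuous: "integrable I01 g \<Longrightarrow> continuous_on {0..1} (prim g)"
  unfolding prim_def[abs_def] by (intro indefinite_integral_continuous_1 integrable_I01_imp_HK)

lemma prim_cong_AE:
  assumes "AE x in I01. f x = g x" "integrable I01 f" "integrable I01 g" "0 \<le> x" "x \<le> 1"
  shows "prim f x = prim g x"
proof -
  have "AE t in I01. (if t \<le> x then f t else 0) = (if t \<le> x then g t else 0)"
    using assms(1) by (auto elim: eventually_mono)
  with integrable_I01_cut[OF assms(2), of x] integrable_I01_cut[OF assms(3), of x] 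
  show ?thesis using assms(4,5) by (auto simp: prim_eq_LINT assms intro!: integral_cong_AE)
qed

lemma prim_cong: "(\<And>t. 0 < t \<Longrightarrow> t < x \<Longrightarrow> f t = g t) \<Longrightarrow> prim f x = prim g x"
  unfolding prim_def integral_open_interval_real by (rule integral_cong) auto

lemma prim_add:
  assumes "integrable I01 f" "integrable I01 g" "0 \<le> x" "x \<le> 1"
  shows "prim (\<lambda>t. f t + g t) x = prim f x + prim g x"
  unfolding prim_def using assms
  by (intro integral_add integrable_I01_imp_HK_sub) auto

lemma prim_diff:
  assumes "integrable I01 f" "integrable I01 g" "0 \<le> x" "x \<le> 1"
  shows "prim (\<lambda>t. f t - g t) x = prim f x - prim g x"
  unfolding prim_def using assms
  by (intro integral_diff integrable_I01_imp_HK_sub) auto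

lemma prim_mult: "prim (\<lambda>t. c * f t) x = c * prim f x"
  unfolding prim_def by (rule integral_mult_right)

lemma norm_prim_le:
  assumes "integrable I01 f" "integrable I01 w" "\<And>t. 0 < t \<Longrightarrow> t < x \<Longrightarrow> cmod (f t) \<le> w t" "0 \<le> x" "x \<le> 1"
  shows "cmod (prim f x) \<le> integral {0..x} w"
  unfolding prim_def integral_open_interval_real
proof (rule integral_norm_bound_integral)
  show "f integrable_on {0<..<x}" "w integrable_on {0<..<x}"
    using integrable_I01_imp_HK_sub[OF assms(1,4,5)] integrable_I01_imp_HK_sub[OF assms(2,4,5)]
    by (simp_all add: integrable_on_Icc_iff_Ioo)
qed (use assms in auto)

lemma norm_prim_le_L1:
  assumes "integrable I01 f" "0 \<le> x" "x \<le> 1"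
  shows "cmod (prim f x) \<le> (LINT t|I01. cmod (f t))"
proof -
  have "cmod (prim f x) \<le> (LINT t|I01. cmod (if t \<le> x then f t else 0))"
    unfolding prim_eq_LINT[OF assms] by (rule integral_norm_bound)
  also have "\<dots> \<le> (LINT t|I01. cmod (f t))"
    using integrable_I01_cut[OF assms(1), of x] assms(1) by (intro integral_mono) auto
  finally show ?thesis .
qed

lemma norm_prim_le_L2: "f \<in> L2 \<Longrightarrow> 0 \<le> x \<Longrightarrow> x \<le> 1 \<Longrightarrow> cmod (prim f x) \<le> L2_norm f"
  using norm_prim_le_L1[OF L2_integrable, of f x] L1_le_L2_norm[of f] by linarith

lemma integrable_I01_continuous: "continuous_on {0..1} f \<Longrightarrow> integrable I01 f" for f :: "real \<Rightarrow> complex"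
  by (intro L2_integrable L2_continuous)

lemma prim_L2: "g \<in> L2 \<Longrightarrow> prim g \<in> L2"
  by (rule L2_continuous[OF prim_continuous[OF L2_integrable]])

lemma prim_has_derivative:
  assumes "continuous_on {0..1} g" "0 < x" "x < 1"
  shows "(prim g has_vector_derivative g x) (at x)"
proof -
  have "(prim g has_vector_derivative g x) (at x within {0..1})"
    unfolding prim_def[abs_def] using assms by (intro integral_has_vector_derivative) auto
  then show ?thesis using assms by (simp add: at_within_Icc_at)
qed

lemma prim_FTC:
  assumes "continuous_on {0..1} F" "\<And>x. 0 < x \<Longrightarrow> x < 1 \<Longrightarrow> (F has_vector_derivative f x) (at x)" 
    and "0 \<le> x" "x \<le> 1"
  shows "prim f x = F x - F 0"
proof -
  have "(f has_integral F x - F 0) {0..x}"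
    by (rule fundamental_theorem_of_calculus_interior) (use assms in \<open>auto intro: continuous_on_subset\<close>)
  then show ?thesis by (simp add: prim_def integral_unique)
qed

section \<open>Test functions and weak derivatives\<close>

lemma test_function_support:
  assumes "\<phi> \<in> test_functions"
  obtains a b where "0 < a" "a < b" "b < 1" "\<And>x. x \<notin> {a..b} \<Longrightarrow> \<phi> x = 0"
proof -
  from assms obtain K where K: "compact K" "K \<subseteq> {0<..<1}" "\<And>x. x \<notin> K \<Longrightarrow> \<phi> x = 0"
    by (auto simp: test_functions_def)
  show ?thesis
  proof (cases "K = {}")
    case True
    then show ?thesis by (intro that[of "1/4" "3/4"]) (use K in auto)
  next
    case False
    obtain a where a: "a \<in> K" "\<And>x. x \<in> K \<Longrightarrow> a \<le> x"
      using compact_attains_inf[OF K(1) False] by blast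
    obtain b where b: "b \<in> K" "\<And>x. x \<in> K \<Longrightarrow> x \<le> b"
      using compact_attains_sup[OF K(1) False] by blast
    \<comment> \<open>K may be a single point, so b itself could equal a; the midpoint of b and 1
      gives a strict inequality and stays below 1.\<close>
    show ?thesis
    proof (rule that[of a "(b + 1) / 2"])
      fix x assume "x \<notin> {a..(b + 1) / 2}"
      moreover have "b < 1" using b K(2) by auto
      ultimately have "x \<notin> K" using a(2)[of x] b(2)[of x] by auto
      then show "\<phi> x = 0" by (rule K)
    qed (use a b K(2) in force)+
  qed
qed

lemma test_functionI:
  assumes "smooth \<phi>" "0 < a" "b < 1" "\<And>x. x \<notin> {a..b} \<Longrightarrow> \<phi> x = 0"
  shows "\<phi> \<in> test_functions"
  unfolding test_functions_def using assms by (auto intro!: exI[of _ "{a..b}"])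

lemma test_function_smooth: "\<phi> \<in> test_functions \<Longrightarrow> smooth \<phi>"
  by (simp add: test_functions_def)

lemma test_function_boundary: "\<phi> \<in> test_functions \<Longrightarrow> \<phi> 0 = 0 \<and> \<phi> 1 = 0"
  by (erule test_function_support) auto

lemma test_function_continuous: "\<phi> \<in> test_functions \<Longrightarrow> continuous_on A \<phi>"
  by (intro smooth_continuous test_function_smooth)

lemma test_function_L2: "\<phi> \<in> test_functions \<Longrightarrow> \<phi> \<in> L2"
  by (intro L2_continuous test_function_continuous)

lemma test_function_deriv:
  assumes "\<phi> \<in> test_functions"
  obtains \<phi>' where "\<phi>' \<in> test_functions" "\<And>x. (\<phi> has_vector_derivative \<phi>' x) (at x)"
proof -
  obtain \<phi>' where \<phi>': "smooth \<phi>'" "\<And>x. (\<phi> has_vector_derivative \<phi>' x) (at x)"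
    by (rule smooth_has_derivative[OF test_function_smooth[OF assms]]) auto
  obtain a b where ab: "0 < a" "a < b" "b < 1" "\<And>x. x \<notin> {a..b} \<Longrightarrow> \<phi> x = 0"
    by (rule test_function_support[OF assms]) blast
  have "\<phi>' x = 0" if "x \<notin> {a..b}" for x
  proof -
    have "((\<lambda>x. 0) has_vector_derivative 0) (at x)" by simp
    then have "(\<phi> has_vector_derivative 0) (at x)"
      by (rule has_vector_derivative_transform_within_open[of _ _ _ "- {a..b}"]) (use that ab in auto)
    then show ?thesis using \<phi>'(2) vector_derivative_unique_at by blast
  qed
  then show ?thesis using test_functionI[OF \<phi>'(1) ab(1,3)] \<phi>'(2) that by blast
qed

lemma test_function_mult_const: 
  assumes "\<phi> \<in> test_functions" shows "(\<lambda>x. c * \<phi> x) \<in> test_functions"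
proof -
  obtain a b where ab: "0 < a" "a < b" "b < 1" "\<And>x. x \<notin> {a..b} \<Longrightarrow> \<phi> x = 0"
    by (rule test_function_support[OF assms]) blast
  show ?thesis
    by (rule test_functionI[OF smooth_mult[OF smooth_polynomial_function[of "\<lambda>_. c"] test_function_smooth[OF assms]] ab(1,3)])
      (use ab in auto)
qed

lemma test_function_add: 
  assumes "\<phi> \<in> test_functions" "\<psi> \<in> test_functions" shows "(\<lambda>x. \<phi> x + \<psi> x) \<in> test_functions"
proof -
  obtain a b where 1: "0 < a" "a < b" "b < 1" "\<And>x. x \<notin> {a..b} \<Longrightarrow> \<phi> x = 0" by (rule test_function_support[OF assms(1)]) blast
  obtain c d where 2: "0 < c" "c < d" "d < 1" "\<And>x. x \<notin> {c..d} \<Longrightarrow> \<psi> x = 0" by (rule test_function_support[OF assms(2)]) blast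
  show ?thesis
    by (rule test_functionI[OF smooth_add[OF assms[THEN test_function_smooth]], of "min a c" "max b d"]) 
      (use 1 2 in \<open>auto simp: min_def max_def split: if_splits\<close>)
qed

text \<open>The support stays compact because the mean is zero: to the right of the support the
  primitive equals the full integral.\<close>

lemma test_function_prim:
  assumes "\<psi> \<in> test_functions" "(LINT x|I01. \<psi> x) = 0"
  shows "prim \<psi> \<in> test_functions" "(prim \<psi> has_vector_derivative \<psi> x) (at x)"
proof -
  obtain a b where ab: "0 < a" "a < b" "b < 1" "\<And>x. x \<notin> {a..b} \<Longrightarrow> \<psi> x = 0"
    by (rule test_function_support[OF assms(1)]) blast
  have cont: "continuous_on A \<psi>" for A by (rule test_function_continuous[OF assms(1)])
  have left: "prim \<psi> x = 0" if "x < a" for x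
    unfolding prim_def by (subst integral_cong[of _ _ "\<lambda>_. 0"]) (use that ab in auto)
  have right: "prim \<psi> x = 0" if "x > b" for x
  proof -
    have z: "integral {b..y} \<psi> = 0" for y
      unfolding integral_open_interval_real by (subst integral_cong[of _ _ "\<lambda>_. 0"]) (use ab in auto)
    have int: "\<psi> integrable_on {0..y}" for y by (intro integrable_continuous_interval cont)
    have "prim \<psi> y = integral {0..b} \<psi>" if "b \<le> y" for y
      unfolding prim_def using Henstock_Kurzweil_Integration.integral_combine[of 0 b y \<psi>] ab that int z[of y] by simp
    from this[of x] this[of 1] show ?thesis using that ab assms(2) prim_1[OF L2_integrable[OF test_function_L2[OF assms(1)]]] by simp
  qed
  have der: "(prim \<psi> has_vector_derivative \<psi> x) (at x)" for x
  proof (cases "x < a")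
    case True
    have "((\<lambda>x. 0) has_vector_derivative 0) (at x)" by simp
    then have "(prim \<psi> has_vector_derivative 0) (at x)"
      by (rule has_vector_derivative_transform_within_open[of _ _ _ "{..<a}"]) (use True left in auto)
    then show ?thesis using True ab by simp
  next
    case False
    have "(prim \<psi> has_vector_derivative \<psi> x) (at x within {0..x+1})"
      unfolding prim_def[abs_def] using False ab by (intro integral_has_vector_derivative cont) auto
    then show ?thesis using False ab by (simp add: at_within_Icc_at)
  qed
  then show "(prim \<psi> has_vector_derivative \<psi> x) (at x)" .
  have "smooth (prim \<psi>)" by (rule smooth_intro_deriv[OF test_function_smooth[OF assms(1)] der])
  then show "prim \<psi> \<in> test_functions"
    by (rule test_functionI[OF _ ab(1,3)]) (use left right ab in force)
qed

lemma L2_bounded_LINT_prod: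
  assumes "f \<in> L2" "g \<in> L2"
  shows "cmod (LINT x|I01. f x * g x) \<le> L2_norm f * L2_norm g"
proof -
  have "cmod (LINT x|I01. f x * g x) \<le> (LINT x|I01. cmod (f x * g x))" by (rule integral_norm_bound)
  then show ?thesis using L2_Cauchy_Schwarz[OF assms] by (simp add: norm_mult)
qed

text \<open>Fundamental lemma of the calculus of variations, by density: testing against an
  e-approximation of the conjugate of f gives |f|^2 <= |f| e in the \<open>L2\<close> norm, for
  every e > 0.\<close>

lemma L2_orthogonal_test_functions:
  assumes f: "f \<in> L2" and orth: "\<And>\<phi>. \<phi> \<in> test_functions \<Longrightarrow> (LINT x|I01. f x * \<phi> x) = 0"
  shows "AE x in I01. f x = 0"
proof -
  have "(\<lambda>x. cnj (f x)) \<in> borel_measurable I01" 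
    by (rule borel_measurable_continuous_on[OF _ L2_measurable[OF f]]) (intro continuous_intros)
  then have cf: "(\<lambda>x. cnj (f x)) \<in> L2" by (rule L2_of_bound[OF _ f, of _ 1]) auto
  have "(L2_norm f)\<^sup>2 \<le> L2_norm f * e" if "e > 0" for e
  proof -
    obtain \<phi> where \<phi>: "\<phi> \<in> test_functions" "L2_norm (\<lambda>x. cnj (f x) - \<phi> x) < e"
      by (rule test_functions_dense[OF cf \<open>e > 0\<close>])
    note [simp] = L2_mult_integrable[OF f cf] L2_mult_integrable[OF f test_function_L2[OF \<phi>(1)]]
    have "(L2_norm f)\<^sup>2 = Re (LINT x|I01. f x * cnj (f x))"
      unfolding L2_norm_square complex_norm_square[symmetric] of_real_power[symmetric] integral_complex_of_real by simp
    also have "(LINT x|I01. f x * cnj (f x)) = (LINT x|I01. f x * (cnj (f x) - \<phi> x))"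
      using orth[OF \<phi>(1)] by (simp add: ring_distribs)
    also have "Re \<dots> \<le> cmod \<dots>" by (rule complex_Re_le_cmod)
    also have "\<dots> \<le> L2_norm f * L2_norm (\<lambda>x. cnj (f x) - \<phi> x)"
      by (intro L2_bounded_LINT_prod f L2_diff cf test_function_L2 \<phi>)
    also have "\<dots> \<le> L2_norm f * e" using \<phi>(2) by (intro mult_left_mono) auto
    finally show ?thesis .
  qed
  from this[of "L2_norm f / 2"] have "L2_norm f = 0"
    using L2_norm_nonneg[of f] by (cases "L2_norm f = 0") (auto simp: power2_eq_square)
  then have "(LINT x|I01. (cmod (f x))\<^sup>2) = 0" by (simp add: L2_norm_def)
  then have "AE x in I01. (cmod (f x))\<^sup>2 = 0"
    by (subst (asm) integral_nonneg_eq_0_iff_AE) (use L2_square_integrable[OF f] in auto)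
  then show ?thesis by simp
qed

text \<open>For continuous g this is integration by parts, but g is only square integrable. The
  defect \<open>J\<close> of the formula vanishes when g is a test function and changes by at most a
  multiple of the \<open>L2\<close> distance between g and a test function; density then gives zero.
  The additive constant c cancels in the difference.\<close>

lemma prim_weak_derivative:
  assumes g: "g \<in> L2"
  shows "has_weak_derivative (\<lambda>x. c + prim g x) g"
  unfolding has_weak_derivative_def
proof (intro conjI ballI)
  show "(\<lambda>x. c + prim g x) \<in> L2" by (intro L2_add L2_const prim_L2 g)
  fix \<phi> assume \<phi>: "\<phi> \<in> test_functions"
  then obtain \<phi>' where \<phi>': "\<phi>' \<in> test_functions" "\<And>x. (\<phi> has_vector_derivative \<phi>' x) (at x)"
    by (rule test_function_deriv) blast
  have \<phi>L: "\<phi> \<in> L2" "\<phi>' \<in> L2" using \<phi> \<phi>' by (auto intro: test_function_L2)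
  define J where "J h = (LINT x|I01. (c + prim h x) * \<phi>' x) + (LINT x|I01. h x * \<phi> x)" for h
  have "J \<psi> = 0" if \<psi>: "\<psi> \<in> test_functions" for \<psi>
  proof -
    have pc: "continuous_on {0..1} (prim \<psi>)" by (intro prim_continuous L2_integrable test_function_L2 \<psi>)
    have "prim (\<lambda>x. (c + prim \<psi> x) * \<phi>' x + \<psi> x * \<phi> x) 1 = (c + prim \<psi> 1) * \<phi> 1 - (c + prim \<psi> 0) * \<phi> 0"
    proof (rule prim_FTC)
      show "continuous_on {0..1} (\<lambda>x. (c + prim \<psi> x) * \<phi> x)"
        by (intro continuous_intros pc test_function_continuous \<phi>)
      fix x :: real assume "0 < x" "x < 1"
      have "(prim \<psi> has_vector_derivative \<psi> x) (at x)"
        by (rule prim_has_derivative) (use \<open>0 < x\<close> \<open>x < 1\<close> \<psi> test_function_continuous in auto)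
      then show "((\<lambda>x. (c + prim \<psi> x) * \<phi> x) has_vector_derivative (c + prim \<psi> x) * \<phi>' x + \<psi> x * \<phi> x) (at x)"
        by (auto intro!: derivative_eq_intros \<phi>')
    qed auto
    moreover have "integrable I01 (\<lambda>x. (c + prim \<psi> x) * \<phi>' x)" "integrable I01 (\<lambda>x. \<psi> x * \<phi> x)"
      by (intro L2_mult_integrable L2_add L2_const prim_L2 test_function_L2 \<psi> \<phi> \<phi>')+
    ultimately show ?thesis using test_function_boundary[OF \<phi>]
      unfolding J_def by (subst Bochner_Integration.integral_add[symmetric], simp, simp, subst prim_1[symmetric]) auto
  qed
  moreover have "cmod (J g - J \<psi>) \<le> L2_norm (\<lambda>x. g x - \<psi> x) * (L2_norm \<phi>' + L2_norm \<phi>)" if \<psi>: "\<psi> \<in> test_functions" for \<psi>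
  proof -
    have \<psi>L: "\<psi> \<in> L2" using \<psi> by (rule test_function_L2)
    note i = L2_mult_integrable L2_add L2_const L2_diff prim_L2 \<phi>L \<psi>L g
    have "J g - J \<psi> = (LINT x|I01. (prim g x - prim \<psi> x) * \<phi>' x) + (LINT x|I01. (g x - \<psi> x) * \<phi> x)"
      unfolding J_def
      by (simp add: i ring_distribs)
    also have "(LINT x|I01. (prim g x - prim \<psi> x) * \<phi>' x) = (LINT x|I01. prim (\<lambda>t. g t - \<psi> t) x * \<phi>' x)"
      by (rule Bochner_Integration.integral_cong) (auto simp: prim_diff L2_integrable g \<psi>L)
    finally have "cmod (J g - J \<psi>) \<le> cmod (LINT x|I01. prim (\<lambda>t. g t - \<psi> t) x * \<phi>' x) + cmod (LINT x|I01. (g x - \<psi> x) * \<phi> x)"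
      by (simp add: norm_triangle_ineq)
    also have "\<dots> \<le> L2_norm (prim (\<lambda>t. g t - \<psi> t)) * L2_norm \<phi>' + L2_norm (\<lambda>x. g x - \<psi> x) * L2_norm \<phi>"
      by (intro add_mono L2_bounded_LINT_prod i)
    also have "L2_norm (prim (\<lambda>t. g t - \<psi> t)) \<le> L2_norm (\<lambda>t. g t - \<psi> t)"
      by (intro L2_norm_le_const norm_prim_le_L2 i) auto
    finally show ?thesis by (simp add: ring_distribs mult_right_mono)
  qed
  ultimately have *: "cmod (J g) \<le> L2_norm (\<lambda>x. g x - \<psi> x) * (L2_norm \<phi>' + L2_norm \<phi>)" if "\<psi> \<in> test_functions" for \<psi>
    using that by fastforce
  have "cmod (J g) \<le> e" if "e > 0" for e
  proof -
    define B where "B = L2_norm \<phi>' + L2_norm \<phi> + 1"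
    have "B > 0" "L2_norm \<phi>' + L2_norm \<phi> \<le> B" unfolding B_def using L2_norm_nonneg[of \<phi>] L2_norm_nonneg[of \<phi>'] by linarith+
    obtain \<psi> where \<psi>: "\<psi> \<in> test_functions" "L2_norm (\<lambda>x. g x - \<psi> x) < e / B"
      by (rule test_functions_dense[OF g, of "e / B"]) (use \<open>e > 0\<close> \<open>B > 0\<close> in auto)
    have "cmod (J g) \<le> e / B * B"
      by (rule order_trans[OF *[OF \<psi>(1)]]) 
        (intro mult_mono less_imp_le[OF \<psi>(2)], use \<open>B > 0\<close> \<open>_ \<le> B\<close> \<open>e > 0\<close> in auto)
    then show ?thesis using \<open>B > 0\<close> by simp
  qed
  then have "J g = 0" by (metis field_le_epsilon add_0 norm_le_zero_iff)
  moreover have "vector_derivative \<phi> (at x) = \<phi>' x" for x by (rule vector_derivative_at[OF \<phi>'(2)])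
  ultimately show "(LINT x|I01. (c + prim g x) * vector_derivative \<phi> (at x)) = - (LINT x|I01. g x * \<phi> x)"
    by (simp add: J_def add_eq_0_iff2)
qed (fact g)

lemma weak_derivative_unique:
  assumes "has_weak_derivative f g" "has_weak_derivative f h"
  shows "AE x in I01. g x = h x"
proof -
  have gh: "g \<in> L2" "h \<in> L2" using assms by (auto simp: has_weak_derivative_def)
  have "AE x in I01. g x - h x = 0"
  proof (rule L2_orthogonal_test_functions)
    fix \<phi> assume "\<phi> \<in> test_functions"
    then have "(LINT x|I01. g x * \<phi> x) = (LINT x|I01. h x * \<phi> x)"
      using assms by (auto simp: has_weak_derivative_def)
    then show "(LINT x|I01. (g x - h x) * \<phi> x) = 0"
      by (simp add: ring_distribs L2_mult_integrable gh test_function_L2 \<open>\<phi> \<in> test_functions\<close>)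
  qed (intro L2_diff gh)
  then show ?thesis by simp
qed

lemma unit_mass_test_function:
  obtains b where "b \<in> test_functions" "(LINT x|I01. b x) = 1"
proof -
  define b where "b = bump (1/4) (3/4)"
  have b: "b \<in> test_functions" using test_function_mult_bump[OF smooth_polynomial_function[of "\<lambda>_. 1"], of "1/4" "3/4"]
    by (simp add: b_def)
  define r where "r x = Re (b x)" for x
  have br: "b x = of_real (r x)" "r x \<ge> 0" for x
    by (cases "x \<in> {1/4<..<3/4}"; auto simp: r_def b_def bump_eq_0 bump_pos)+
  have cont: "continuous_on {0..1} r" unfolding r_def by (intro continuous_intros test_function_continuous b)
  have "(LINT x|I01. r x) \<noteq> 0"
  proof
    assume *: "(LINT x|I01. r x) = 0"
    have "integrable I01 b" by (intro L2_integrable test_function_L2 b)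
    then have "integrable I01 r" unfolding r_def by simp
    then have "integral {0..1} r = 0" using * by (simp add: LINT_I01_eq_integral)
    then have "r (1/2) = 0"
      using integral_eq_0_iff[OF cont, of ] br(2) by simp
    then show False by (auto simp: r_def b_def bump_pos)
  qed
  moreover have "(LINT x|I01. b x) = of_real (LINT x|I01. r x)"
    by (simp add: br(1))
  ultimately show ?thesis
    using that[OF test_function_mult_const[OF b, of "1 / (LINT x|I01. b x)"]] by simp
qed

text \<open>Du Bois-Reymond: a test function minus its mean times a fixed \<open>b\<close> of mass 1
  has mean zero, so it is the derivative of a test function. Hence f minus the integral of f times
  \<open>b\<close> is orthogonal to all test functions.\<close>

lemma weak_derivative_zero_const:
  assumes f: "f \<in> L2" and orth: "\<And>\<phi>. \<phi> \<in> test_functions \<Longrightarrow> (LINT x|I01. f x * vector_derivative \<phi> (at x)) = 0"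
  obtains c where "AE x in I01. f x = c"
proof -
  obtain b where b: "b \<in> test_functions" "(LINT x|I01. b x) = 1" by (rule unit_mass_test_function)
  define c where "c = (LINT x|I01. f x * b x)"
  have "AE x in I01. f x - c = 0"
  proof (rule L2_orthogonal_test_functions)
    fix \<phi> assume \<phi>: "\<phi> \<in> test_functions"
    define m where "m = (LINT x|I01. \<phi> x)"
    define \<psi> where "\<psi> x = \<phi> x + (- m) * b x" for x
    note i = L2_mult_integrable L2_integrable test_function_L2 \<phi> b(1) f L2_const
    have \<psi>: "\<psi> \<in> test_functions" unfolding \<psi>_def by (intro test_function_add test_function_mult_const \<phi> b)
    have \<psi>0: "(LINT x|I01. \<psi> x) = 0" unfolding \<psi>_def by (simp add: i b(2) m_def)
    from orth[OF test_function_prim(1)[OF \<psi> \<psi>0]] have "(LINT x|I01. f x * \<psi> x) = 0"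
      by (simp add: vector_derivative_at[OF test_function_prim(2)[OF \<psi> \<psi>0]])
    then have "(LINT x|I01. f x * \<phi> x - m * (f x * b x)) = 0"
      by (simp add: \<psi>_def ring_distribs mult_ac)
    then have "(LINT x|I01. f x * \<phi> x) - m * c = 0"
      by (simp add: i c_def)
    then show "(LINT x|I01. (f x - c) * \<phi> x) = 0"
      by (simp add: ring_distribs i m_def mult.commute)
  qed (intro L2_diff f L2_const)
  then show ?thesis using that by simp
qed

lemma weak_derivative_primitive:
  assumes "has_weak_derivative f g"
  obtains c where "AE x in I01. f x = c + prim g x"
proof -
  have fg: "f \<in> L2" "g \<in> L2" using assms by (auto simp: has_weak_derivative_def)
  have w: "has_weak_derivative (prim g) g" using prim_weak_derivative[OF fg(2), of 0] by simp
  obtain c where "AE x in I01. f x - prim g x = c"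
  proof (rule weak_derivative_zero_const)
    fix \<phi> assume \<phi>: "\<phi> \<in> test_functions"
    then obtain \<phi>' where \<phi>': "\<phi>' \<in> test_functions" "\<And>x. (\<phi> has_vector_derivative \<phi>' x) (at x)"
      by (rule test_function_deriv) blast
    have v: "vector_derivative \<phi> (at x) = \<phi>' x" for x by (rule vector_derivative_at[OF \<phi>'(2)])
    have "(LINT x|I01. f x * \<phi>' x) = (LINT x|I01. prim g x * \<phi>' x)"
      using assms w \<phi> unfolding has_weak_derivative_def v[symmetric] by simp
    then show "(LINT x|I01. (f x - prim g x) * vector_derivative \<phi> (at x)) = 0"
      by (simp add: v ring_distribs L2_mult_integrable fg prim_L2 test_function_L2 \<phi>')
  qed (intro L2_diff fg prim_L2)
  then have "AE x in I01. f x = c + prim g x" by (auto elim: eventually_mono)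
  then show ?thesis by (rule that)
qed

lemma has_weak_derivative_cong_AE:
  assumes "has_weak_derivative f g" "AE x in I01. f x = f' x" "AE x in I01. g x = g' x" "f' \<in> L2" "g' \<in> L2"
  shows "has_weak_derivative f' g'"
  unfolding has_weak_derivative_def
proof (intro conjI ballI assms)
  have fg: "f \<in> L2" "g \<in> L2" using assms by (auto simp: has_weak_derivative_def)
  fix \<phi> assume \<phi>: "\<phi> \<in> test_functions"
  then obtain \<phi>' where \<phi>': "\<phi>' \<in> test_functions" "\<And>x. (\<phi> has_vector_derivative \<phi>' x) (at x)"
    by (rule test_function_deriv) blast
  have v: "vector_derivative \<phi> (at x) = \<phi>' x" for x by (rule vector_derivative_at[OF \<phi>'(2)])
  note i = L2_mult_integrable fg assms(4,5) test_function_L2 \<phi> \<phi>'(1)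
  have "(LINT x|I01. f' x * \<phi>' x) = (LINT x|I01. f x * \<phi>' x)"
    by (rule integral_cong_AE) (use assms(2) in \<open>auto intro!: borel_measurable_integrable i\<close>)
  moreover have "(LINT x|I01. g' x * \<phi> x) = (LINT x|I01. g x * \<phi> x)"
    by (rule integral_cong_AE) (use assms(3) in \<open>auto intro!: borel_measurable_integrable i\<close>)
  ultimately show "(LINT x|I01. f' x * vector_derivative \<phi> (at x)) = - (LINT x|I01. g' x * \<phi> x)"
    using assms(1) \<phi> unfolding has_weak_derivative_def v by (simp add: v[symmetric])
qed

lemma has_weak_derivative_L2: 
  assumes "has_weak_derivative f g" shows "f \<in> L2" "g \<in> L2"
  using assms by (auto simp: has_weak_derivative_def)

lemma weak_deriv_works: "has_weak_derivative f g \<Longrightarrow> has_weak_derivative f (weak_deriv f)"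
  unfolding weak_deriv_def by (rule someI[of "has_weak_derivative f"])

lemma weak_deriv_AE_eq: "has_weak_derivative f g \<Longrightarrow> AE x in I01. weak_deriv f x = g x"
  by (rule weak_derivative_unique[OF weak_deriv_works])

lemma L2_norm_weak_deriv: "has_weak_derivative f g \<Longrightarrow> L2_norm (weak_deriv f) = L2_norm g"
  by (rule L2_norm_cong_AE) (auto intro: weak_deriv_AE_eq has_weak_derivative_L2 dest: weak_deriv_works)

lemma has_weak_derivative_lincomb:
  assumes "has_weak_derivative f g" "has_weak_derivative f' g'"
  shows "has_weak_derivative (\<lambda>x. f x + c * f' x) (\<lambda>x. g x + c * g' x)"
  unfolding has_weak_derivative_def
proof (intro conjI ballI)
  note L = has_weak_derivative_L2[OF assms(1)] has_weak_derivative_L2[OF assms(2)]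
  show "(\<lambda>x. f x + c * f' x) \<in> L2" "(\<lambda>x. g x + c * g' x) \<in> L2"
    by (intro L2_add L2_mult_const L)+
  fix \<phi> assume \<phi>: "\<phi> \<in> test_functions"
  then obtain \<phi>' where \<phi>': "\<phi>' \<in> test_functions" "\<And>x. (\<phi> has_vector_derivative \<phi>' x) (at x)"
    by (rule test_function_deriv) blast
  have v: "vector_derivative \<phi> (at x) = \<phi>' x" for x by (rule vector_derivative_at[OF \<phi>'(2)])
  note i = L2_mult_integrable L test_function_L2 \<phi> \<phi>'(1)
  have 1: "(LINT x|I01. f x * \<phi>' x) = - (LINT x|I01. g x * \<phi> x)" "(LINT x|I01. f' x * \<phi>' x) = - (LINT x|I01. g' x * \<phi> x)"
    using assms \<phi> unfolding has_weak_derivative_def v[symmetric] by auto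
  have "(LINT x|I01. (f x + c * f' x) * \<phi>' x) = (LINT x|I01. f x * \<phi>' x) + c * (LINT x|I01. f' x * \<phi>' x)"
    by (simp add: ring_distribs mult.assoc i)
  moreover have "(LINT x|I01. (g x + c * g' x) * \<phi> x) = (LINT x|I01. g x * \<phi> x) + c * (LINT x|I01. g' x * \<phi> x)"
    by (simp add: ring_distribs mult.assoc i)
  ultimately show "(LINT x|I01. (f x + c * f' x) * vector_derivative \<phi> (at x)) = - (LINT x|I01. (g x + c * g' x) * \<phi> x)"
    unfolding v by (simp add: 1)
qed

lemma has_weak_derivative_diff:
  assumes "has_weak_derivative f g" "has_weak_derivative f' g'"
  shows "has_weak_derivative (f - f') (g - g')"
  using has_weak_derivative_lincomb[OF assms, of "-1"] by (simp add: fun_diff_def)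

lemma W12_norm_eq: "has_weak_derivative f g \<Longrightarrow> W12_norm f = sqrt ((L2_norm f)\<^sup>2 + (L2_norm g)\<^sup>2)"
  by (simp add: W12_norm_def L2_norm_weak_deriv)

lemma test_function_weak_derivative:
  assumes "\<phi> \<in> test_functions" "\<phi>' \<in> test_functions" "\<And>x. (\<phi> has_vector_derivative \<phi>' x) (at x)"
  shows "has_weak_derivative \<phi> \<phi>'" "\<And>x. 0 \<le> x \<Longrightarrow> x \<le> 1 \<Longrightarrow> prim \<phi>' x = \<phi> x"
proof -
  show *: "prim \<phi>' x = \<phi> x" if "0 \<le> x" "x \<le> 1" for x
    using prim_FTC[of \<phi> \<phi>' x] that assms test_function_continuous test_function_boundary[OF assms(1)] by auto
  have "has_weak_derivative (\<lambda>x. 0 + prim \<phi>' x) \<phi>'"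
    by (rule prim_weak_derivative) (intro test_function_L2 assms)
  then show "has_weak_derivative \<phi> \<phi>'"
    by (rule has_weak_derivative_cong_AE) (use * in \<open>auto intro!: AE_I01I test_function_L2 assms\<close>)
qed

section \<open>Zero boundary values\<close>

lemma L2_norm_const [simp]: "L2_norm (\<lambda>x. c) = cmod c"
  by (simp add: L2_norm_def)

lemma complex_eq_0_of_small: "(\<And>e. e > 0 \<Longrightarrow> cmod c \<le> e) \<Longrightarrow> c = 0"
  by (metis field_le_epsilon add_0 norm_le_zero_iff)

text \<open>Boundary values survive the closure. Test functions close to f in the \<open>W12\<close>
  norm have derivatives of integral 0 close to g, so g has integral 0; comparing f with their
  primitives shows that the additive constant is arbitrarily small.\<close>

lemma W012_imp_primitive:
  assumes "f \<in> W012"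
  obtains g where "g \<in> L2" "prim g 1 = 0" "AE x in I01. f x = prim g x" "has_weak_derivative f g"
proof -
  from assms obtain g where g: "has_weak_derivative f g" by (auto simp: W012_def W12_def)
  note L = has_weak_derivative_L2[OF g]
  obtain c where c: "AE x in I01. f x = c + prim g x" by (rule weak_derivative_primitive[OF g]) 
  have appr: "\<exists>\<phi> \<phi>'. \<phi> \<in> test_functions \<and> \<phi>' \<in> test_functions \<and> has_weak_derivative \<phi> \<phi>' \<and> (\<forall>x\<in>{0..1}. prim \<phi>' x = \<phi> x) \<and>
     L2_norm (\<lambda>x. f x - \<phi> x) < e \<and> L2_norm (\<lambda>x. g x - \<phi>' x) < e" if e: "e > 0" for e
  proof -
    from assms e obtain \<phi> where \<phi>: "\<phi> \<in> test_functions" "W12_norm (f - \<phi>) < e" by (auto simp: W012_def)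
    obtain \<phi>' where \<phi>': "\<phi>' \<in> test_functions" "\<And>x. (\<phi> has_vector_derivative \<phi>' x) (at x)"
      by (rule test_function_deriv[OF \<phi>(1)]) blast
    note w = test_function_weak_derivative[OF \<phi>(1) \<phi>']
    have "sqrt ((L2_norm (f - \<phi>))\<^sup>2 + (L2_norm (g - \<phi>'))\<^sup>2) < e"
      using \<phi>(2) W12_norm_eq[OF has_weak_derivative_diff[OF g w(1)]] by simp
    then have "L2_norm (f - \<phi>) < e" "L2_norm (g - \<phi>') < e"
      using real_sqrt_sum_squares_ge1[of "L2_norm (f - \<phi>)" "L2_norm (g - \<phi>')"] real_sqrt_sum_squares_ge2[of "L2_norm (g - \<phi>')" "L2_norm (f - \<phi>)"]
      by linarith+
    then have "L2_norm (\<lambda>x. f x - \<phi> x) < e" "L2_norm (\<lambda>x. g x - \<phi>' x) < e" by (simp_all add: fun_diff_def)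
    moreover have "\<forall>x\<in>{0..1}. prim \<phi>' x = \<phi> x" using w(2) by auto
    ultimately show ?thesis using \<phi>(1) \<phi>'(1) w(1) by blast
  qed
  have m0: "prim g 1 = 0"
  proof (rule complex_eq_0_of_small)
    fix e :: real assume "e > 0"
    from appr[OF this] obtain \<phi> \<phi>' where \<phi>: "\<phi> \<in> test_functions" "\<phi>' \<in> test_functions" "\<And>x. x \<in> {0..1} \<Longrightarrow> prim \<phi>' x = \<phi> x"
      "L2_norm (\<lambda>x. g x - \<phi>' x) < e" by blast
    have "prim g 1 = prim (\<lambda>x. g x - \<phi>' x) 1"
      using \<phi>(3)[of 1] test_function_boundary[OF \<phi>(1)]
      by (simp add: prim_diff L2_integrable L test_function_L2 \<phi>)
    also have "cmod \<dots> \<le> L2_norm (\<lambda>x. g x - \<phi>' x)"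
      by (intro norm_prim_le_L2 L2_diff L test_function_L2 \<phi>) auto
    finally show "cmod (prim g 1) \<le> e" using \<phi>(4) by simp
  qed
  have "c = 0"
  proof (rule complex_eq_0_of_small)
    fix e :: real assume "e > 0"
    then have "e / 2 > 0" by simp
    from appr[OF this] obtain \<phi> \<phi>' where \<phi>: "\<phi> \<in> test_functions" "\<phi>' \<in> test_functions" "\<And>x. x \<in> {0..1} \<Longrightarrow> prim \<phi>' x = \<phi> x"
      "L2_norm (\<lambda>x. g x - \<phi>' x) < e / 2" "L2_norm (\<lambda>x. f x - \<phi> x) < e / 2" by blast
    note i = L2_diff L test_function_L2 \<phi>(1,2) prim_L2 L2_const
    have "L2_norm (\<lambda>x. c) = L2_norm (\<lambda>x. (f x - \<phi> x) - prim (\<lambda>x. g x - \<phi>' x) x)"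
    proof (rule L2_norm_cong_AE)
      show "AE x in I01. c = f x - \<phi> x - prim (\<lambda>x. g x - \<phi>' x) x"
        using c by (rule AE_mp, intro AE_I01I impI) 
          (simp add: prim_diff L2_integrable i \<phi>(3))
    qed (intro i)+
    also have "\<dots> \<le> L2_norm (\<lambda>x. f x - \<phi> x) + L2_norm (prim (\<lambda>x. g x - \<phi>' x))"
      by (intro L2_norm_diff_triangle i)
    also have "L2_norm (prim (\<lambda>x. g x - \<phi>' x)) \<le> L2_norm (\<lambda>x. g x - \<phi>' x)"
      by (intro L2_norm_le_const norm_prim_le_L2 i) auto
    finally show "cmod c \<le> e" using \<phi>(4,5) by simp
  qed
  with c m0 g L that show ?thesis by simp
qed

text \<open>To be the derivative of a test function, an approximation of g must be corrected to mean
  zero. The correction is a multiple m of a fixed function of mass 1, and because g has mean zero,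
  |m| is at most the error already made; hence the factor \<open>B\<close>.\<close>

lemma mean_zero_test_functions_dense:
  assumes g: "g \<in> L2" "prim g 1 = 0" and "e > 0"
  obtains \<phi> \<phi>' where "\<phi> \<in> test_functions" "\<phi>' \<in> test_functions" "\<And>x. (\<phi> has_vector_derivative \<phi>' x) (at x)"
    "L2_norm (\<lambda>x. g x - \<phi>' x) < e"
proof -
  obtain b where b: "b \<in> test_functions" "(LINT x|I01. b x) = 1" by (rule unit_mass_test_function)
  define B where "B = 1 + L2_norm b"
  have B: "B > 0" unfolding B_def using L2_norm_nonneg[of b] by linarith
  obtain \<psi> where \<psi>: "\<psi> \<in> test_functions" "L2_norm (\<lambda>x. g x - \<psi> x) < e / B"
    by (rule test_functions_dense[OF g(1), of "e / B"]) (use B \<open>e > 0\<close> in auto)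
  define m where "m = (LINT x|I01. \<psi> x)"
  define \<xi> where "\<xi> x = \<psi> x + (- m) * b x" for x
  note i = L2_mult_integrable L2_integrable test_function_L2 \<psi>(1) b(1) g L2_const L2_diff L2_mult_const
  have \<xi>: "\<xi> \<in> test_functions" unfolding \<xi>_def by (intro test_function_add test_function_mult_const \<psi> b)
  have \<xi>0: "(LINT x|I01. \<xi> x) = 0" unfolding \<xi>_def by (simp add: i b(2) m_def)
  have "m = - prim (\<lambda>x. g x - \<psi> x) 1"
    by (simp add: prim_diff i) (simp add: prim_1 i m_def)
  then have m: "cmod m \<le> L2_norm (\<lambda>x. g x - \<psi> x)"
    using norm_prim_le_L2[of "\<lambda>x. g x - \<psi> x" 1] by (simp add: i)
  have "L2_norm (\<lambda>x. g x - \<xi> x) = L2_norm (\<lambda>x. (g x - \<psi> x) + m * b x)"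
    unfolding \<xi>_def by (rule arg_cong[where f = L2_norm]) (auto simp: algebra_simps)
  also have "\<dots> \<le> L2_norm (\<lambda>x. g x - \<psi> x) + L2_norm (\<lambda>x. m * b x)"
    by (intro L2_norm_triangle i)
  also have "\<dots> \<le> L2_norm (\<lambda>x. g x - \<psi> x) * B"
    using mult_right_mono[OF m L2_norm_nonneg[of b]] by (simp add: B_def ring_distribs L2_norm_scale)
  also have "\<dots> < e" using \<psi>(2) B by (simp add: field_simps)
  finally show ?thesis using that test_function_prim[OF \<xi> \<xi>0] \<xi> by blast
qed

text \<open>Converse of \<open>W012_imp_primitive\<close>. Together they replace the closure in the
  definition of \<open>W012\<close> by a mean zero condition on the derivative.\<close>

lemma primitive_in_W012:
  assumes g: "g \<in> L2" "prim g 1 = 0" and f: "f \<in> L2" "AE x in I01. f x = prim g x"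
  shows "f \<in> W012" "has_weak_derivative f g"
proof -
  have "has_weak_derivative (\<lambda>x. 0 + prim g x) g" by (rule prim_weak_derivative[OF g(1)])
  then show w: "has_weak_derivative f g"
    by (rule has_weak_derivative_cong_AE) (use f g in \<open>auto elim: eventually_mono\<close>)
  have "\<exists>\<phi>\<in>test_functions. W12_norm (f - \<phi>) < e" if "e > 0" for e
  proof -
    obtain \<phi> \<phi>' where \<phi>: "\<phi> \<in> test_functions" "\<phi>' \<in> test_functions" "\<And>x. (\<phi> has_vector_derivative \<phi>' x) (at x)"
      "L2_norm (\<lambda>x. g x - \<phi>' x) < e / 2"
      by (rule mean_zero_test_functions_dense[OF g, of "e/2"]) (use \<open>e > 0\<close> in auto)
    note w' = test_function_weak_derivative[OF \<phi>(1-3)]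
    note i = L2_diff test_function_L2 \<phi>(1,2) prim_L2 g f
    have "L2_norm (f - \<phi>) = L2_norm (prim (\<lambda>x. g x - \<phi>' x))"
    proof (rule L2_norm_cong_AE)
      show "AE x in I01. (f - \<phi>) x = prim (\<lambda>x. g x - \<phi>' x) x"
        using f(2) by (rule AE_mp, intro AE_I01I impI) (simp add: prim_diff L2_integrable i w')
    next
      show "f - \<phi> \<in> L2" unfolding fun_diff_def by (intro i)
      show "prim (\<lambda>x. g x - \<phi>' x) \<in> L2" by (intro i)
    qed
    also have "\<dots> \<le> L2_norm (\<lambda>x. g x - \<phi>' x)"
      by (intro L2_norm_le_const norm_prim_le_L2 i) auto
    finally have "W12_norm (f - \<phi>) \<le> L2_norm (\<lambda>x. g x - \<phi>' x) + L2_norm (\<lambda>x. g x - \<phi>' x)"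
      unfolding W12_norm_eq[OF has_weak_derivative_diff[OF w w'(1)]] unfolding fun_diff_def
      by (intro order_trans[OF sqrt_sum_squares_le_sum]) auto
    also have "\<dots> < e" using \<phi>(4) by simp
    finally show ?thesis using \<phi>(1) by blast
  qed
  with w show "f \<in> W012" by (auto simp: W012_def W12_def)
qed

lemma test_function_W012: "\<phi> \<in> test_functions \<Longrightarrow> \<phi> \<in> W012"
proof -
  assume \<phi>: "\<phi> \<in> test_functions"
  obtain \<phi>' where \<phi>': "\<phi>' \<in> test_functions" "\<And>x. (\<phi> has_vector_derivative \<phi>' x) (at x)"
      by (rule test_function_deriv[OF \<phi>]) blast
  note w = test_function_weak_derivative[OF \<phi> \<phi>']
  show ?thesis
    by (rule primitive_in_W012[of \<phi>']) (use \<phi> \<phi>' w(2) test_function_boundary[OF \<phi>] in \<open>auto intro!: test_function_L2 AE_I01I\<close>)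
qed

lemma W012_lincomb:
  assumes "f \<in> W012" "g \<in> W012"
  shows "(\<lambda>x. f x + c * g x) \<in> W012"
proof -
  obtain f' where f: "f' \<in> L2" "prim f' 1 = 0" "AE x in I01. f x = prim f' x" "has_weak_derivative f f'"
    by (rule W012_imp_primitive[OF assms(1)])
  obtain g' where g: "g' \<in> L2" "prim g' 1 = 0" "AE x in I01. g x = prim g' x" "has_weak_derivative g g'"
    by (rule W012_imp_primitive[OF assms(2)])
  note i = L2_add L2_mult_const f(1) g(1) has_weak_derivative_L2[OF f(4)] has_weak_derivative_L2[OF g(4)]
  show ?thesis
  proof (rule primitive_in_W012)
    show "AE x in I01. f x + c * g x = prim (\<lambda>x. f' x + c * g' x) x"
      using eventually_conj[OF f(3) g(3)]
      by (rule AE_mp, intro AE_I01I impI) (simp add: prim_add prim_mult L2_integrable i)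
  qed (simp_all add: i prim_add prim_mult L2_integrable f g)
qed

section \<open>The energy norm\<close>

lemma H_norm_eq:
  assumes "has_weak_derivative u p" "v \<in> L2"
  shows "H_norm (u, v) = sqrt ((L2_norm p)\<^sup>2 + (L2_norm v)\<^sup>2)"
proof -
  have *: "L2_inner f f = of_real ((L2_norm f)\<^sup>2)" for f
    unfolding L2_inner_def L2_norm_square complex_norm_square[symmetric] of_real_power[symmetric] integral_complex_of_real ..
  show ?thesis
    unfolding H_norm_def H_inner_def * by (simp add: L2_norm_weak_deriv[OF assms(1)])
qed

lemma H_norm_le:
  assumes "has_weak_derivative u p" "v \<in> L2"
  shows "H_norm (u, v) \<le> L2_norm p + L2_norm v"
  unfolding H_norm_eq[OF assms] by (rule sqrt_sum_squares_le_sum) auto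

lemma H_norm_ge:
  assumes "has_weak_derivative u p" "v \<in> L2"
  shows "L2_norm p \<le> H_norm (u, v)" "L2_norm v \<le> H_norm (u, v)"
  unfolding H_norm_eq[OF assms] by auto

section \<open>The eigenvalue equation as a Volterra equation for the derivative\<close>

definition wave_potential :: "real \<Rightarrow> complex \<Rightarrow> real \<Rightarrow> complex" where
  "wave_potential \<alpha> z t = z\<^sup>2 + 2 * of_real \<alpha> * z / of_real t"

text \<open>Eliminating the second component from G U = z U leaves u'' = q u with q =
  \<open>wave_potential \<alpha> z\<close>. For p = u' and u(0) = 0, integration turns this into p =
  p(0) + \<open>volterra \<alpha> z p\<close>.\<close>

definition volterra :: "real \<Rightarrow> complex \<Rightarrow> (real \<Rightarrow> complex) \<Rightarrow> real \<Rightarrow> complex" where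
  "volterra \<alpha> z p x = prim (\<lambda>t. wave_potential \<alpha> z t * prim p t) x"

text \<open>A bound for t |q(t)| on (0, 1], with q the potential; the summand 1 makes it strictly
  positive also for z = 0.\<close>

definition potential_bound :: "real \<Rightarrow> complex \<Rightarrow> real" where
  "potential_bound \<alpha> z = (cmod z)\<^sup>2 + 2 * \<bar>\<alpha>\<bar> * cmod z + 1"

lemma potential_bound_pos: "potential_bound \<alpha> z > 0"
  by (simp add: potential_bound_def add_nonneg_pos)

lemma wave_potential_bound:
  assumes "0 < t" "t \<le> 1"
  shows "cmod (wave_potential \<alpha> z t) \<le> potential_bound \<alpha> z / t"
proof -
  have "cmod (wave_potential \<alpha> z t) \<le> (cmod z)\<^sup>2 + 2 * \<bar>\<alpha>\<bar> * cmod z / t"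
    unfolding wave_potential_def using assms
    by (intro order_trans[OF norm_triangle_ineq]) (simp add: norm_mult norm_divide norm_power)
  also have "(cmod z)\<^sup>2 \<le> (cmod z)\<^sup>2 / t"
    using assms by (simp add: field_simps mult_left_le_one_le)
  also have "(cmod z)\<^sup>2 / t + 2 * \<bar>\<alpha>\<bar> * cmod z / t \<le> potential_bound \<alpha> z / t"
    unfolding potential_bound_def add_divide_distrib[symmetric] using assms by (intro divide_right_mono) auto
  finally show ?thesis by simp
qed

lemma wave_potential_continuous: "0 \<notin> A \<Longrightarrow> continuous_on A (wave_potential \<alpha> z)"
  unfolding wave_potential_def by (intro continuous_intros) auto

lemma norm_prim_le_const:
  assumes "continuous_on {0..1} p" "\<And>t. 0 \<le> t \<Longrightarrow> t \<le> x \<Longrightarrow> cmod (p t) \<le> B" "0 \<le> x" "x \<le> 1"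
  shows "cmod (prim p x) \<le> B * x"
proof -
  have "continuous_on {0..x} p" by (rule continuous_on_subset[OF assms(1)]) (use assms in auto)
  then show ?thesis unfolding prim_def using integral_bound[of 0 x p B] assms(2,3) by simp
qed

text \<open>The singularity cancels: if p is bounded by B, then \<open>prim p t\<close> is at most B
  t, against a potential of size 1/t.\<close>

lemma potential_times_prim_L2:
  assumes "continuous_on {0..1} p"
  shows "(\<lambda>t. wave_potential \<alpha> z t * prim p t) \<in> L2"
proof -
  have "bounded (p ` {0..1})"
    by (intro compact_imp_bounded compact_continuous_image assms) auto
  then obtain B where B: "\<And>x. 0 \<le> x \<Longrightarrow> x \<le> 1 \<Longrightarrow> cmod (p x) \<le> B"
    unfolding bounded_iff by (metis atLeastAtMost_iff image_eqI)
  show ?thesis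
  proof (rule L2_bounded)
    show "(\<lambda>t. wave_potential \<alpha> z t * prim p t) \<in> borel_measurable I01"
      by (intro continuous_borel_measurable_I01 continuous_on_mult wave_potential_continuous 
          continuous_on_subset[OF prim_continuous[OF integrable_I01_continuous[OF assms]]]) auto
    fix t :: real assume t: "0 < t" "t < 1"
    have "cmod (wave_potential \<alpha> z t * prim p t) \<le> (potential_bound \<alpha> z / t) * (B * t)"
      unfolding norm_mult using t potential_bound_pos[of \<alpha> z]
      by (intro mult_mono wave_potential_bound norm_prim_le_const assms B) auto
    then show "cmod (wave_potential \<alpha> z t * prim p t) \<le> potential_bound \<alpha> z * B" using t by simp
  qed
qed

lemma volterra_continuous: "continuous_on {0..1} p \<Longrightarrow> continuous_on {0..1} (volterra \<alpha> z p)"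
  unfolding volterra_def[abs_def] by (rule prim_continuous[OF L2_integrable[OF potential_times_prim_L2]])

text \<open>The weight makes the contraction factor \<open>1/2\<close> however large \<open>\<alpha>\<close> and \<open>z\<close> are.\<close>

lemma volterra_contraction:
  assumes p: "continuous_on {0..1} p" and x: "0 \<le> x" "x \<le> 1"
    and B: "\<And>t. 0 \<le> t \<Longrightarrow> t \<le> 1 \<Longrightarrow> cmod (p t) \<le> B * exp (2 * potential_bound \<alpha> z * t)"
  shows "cmod (volterra \<alpha> z p x) \<le> B / 2 * exp (2 * potential_bound \<alpha> z * x)"
proof -
  define C where "C = potential_bound \<alpha> z"
  have C: "C > 0" unfolding C_def by (rule potential_bound_pos)
  have "0 \<le> B" using order_trans[OF norm_ge_zero B[of 0]] by simp
  define w where "w t = C * B * exp (2 * C * t)" for t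
  have w: "(w has_integral (B / 2 * exp (2 * C * x) - B / 2 * exp (2 * C * 0))) {0..x}"
    unfolding w_def using C x
    by (intro fundamental_theorem_of_calculus)
      (auto intro!: derivative_eq_intros simp flip: has_real_derivative_iff_has_vector_derivative)
  have "cmod (volterra \<alpha> z p x) \<le> integral {0..x} w"
    unfolding volterra_def
  proof (rule norm_prim_le[OF L2_integrable[OF potential_times_prim_L2[OF p]] _ _ x])
    have "continuous_on {0..1} (\<lambda>t. complex_of_real (w t))" unfolding w_def by (intro continuous_intros)
    from integrable_Re[OF integrable_I01_continuous[OF this]] show "integrable I01 w" by simp
    fix t assume t: "0 < t" "t < x"
    have "cmod (p s) \<le> B * exp (2 * C * t)" if "0 \<le> s" "s \<le> t" for s
    proof -
      have "cmod (p s) \<le> B * exp (2 * C * s)" using B[of s] that t x by (simp add: C_def)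
      also have "\<dots> \<le> B * exp (2 * C * t)" using that C \<open>0 \<le> B\<close> by (intro mult_left_mono) auto
      finally show ?thesis .
    qed
    then have "cmod (wave_potential \<alpha> z t * prim p t) \<le> (C / t) * (B * exp (2 * C * t) * t)"
      unfolding norm_mult C_def[symmetric] using t x C
      by (intro mult_mono norm_prim_le_const p wave_potential_bound[of _ \<alpha> z, folded C_def]) auto
    then show "cmod (wave_potential \<alpha> z t * prim p t) \<le> w t" using t by (simp add: w_def)
  qed
  also have "\<dots> = B / 2 * exp (2 * C * x) - B / 2" using w by (simp add: integral_unique)
  also have "\<dots> \<le> B / 2 * exp (2 * C * x)" using \<open>0 \<le> B\<close> by simp
  finally show ?thesis by (simp add: C_def)
qed

lemma volterra_lincomb:
  assumes "continuous_on {0..1} p" "continuous_on {0..1} r" "0 \<le> x" "x \<le> 1"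
  shows "volterra \<alpha> z (\<lambda>t. p t + c * r t) x = volterra \<alpha> z p x + c * volterra \<alpha> z r x"
proof -
  note i = L2_integrable[OF potential_times_prim_L2] integrable_I01_continuous
  have rc: "continuous_on {0..1} (\<lambda>t. c * r t)" by (intro continuous_intros assms)
  have "volterra \<alpha> z (\<lambda>t. p t + c * r t) x = prim (\<lambda>t. wave_potential \<alpha> z t * prim p t + c * (wave_potential \<alpha> z t * prim r t)) x"
    unfolding volterra_def
    by (rule prim_cong) (use assms in \<open>simp add: prim_add[OF i(2)[OF assms(1)] i(2)[OF rc]] prim_mult algebra_simps\<close>)
  also have "\<dots> = volterra \<alpha> z p x + c * volterra \<alpha> z r x"
    using assms i(1) by (simp add: volterra_def prim_add prim_mult)
  finally show ?thesis .
qed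

lemma volterra_cong:
  assumes "\<And>t. 0 < t \<Longrightarrow> t < x \<Longrightarrow> p t = r t"
  shows "volterra \<alpha> z p x = volterra \<alpha> z r x"
  unfolding volterra_def by (rule prim_cong) (metis assms less_trans prim_cong)

text \<open>At a maximum x0 of the exponentially weighted |p| the Volterra term takes up at most
  half of the maximal value B, so it can be absorbed, and B is at most 2 A.\<close>

lemma volterra_gronwall:
  assumes p: "continuous_on {0..1} p" and eq: "\<And>x. 0 \<le> x \<Longrightarrow> x \<le> 1 \<Longrightarrow> p x = h x + volterra \<alpha> z p x"
    and h: "\<And>x. 0 \<le> x \<Longrightarrow> x \<le> 1 \<Longrightarrow> cmod (h x) \<le> A" and x: "0 \<le> x" "x \<le> 1"
  shows "cmod (p x) \<le> 2 * A * exp (2 * potential_bound \<alpha> z)"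
proof -
  define C where "C = potential_bound \<alpha> z"
  have C: "C > 0" unfolding C_def by (rule potential_bound_pos)
  have "A \<ge> 0" using order_trans[OF norm_ge_zero h[of 0]] by simp
  obtain x0 where x0: "x0 \<in> {0..1}" "\<And>x. x \<in> {0..1} \<Longrightarrow> cmod (p x) * exp (- (2 * C * x)) \<le> cmod (p x0) * exp (- (2 * C * x0))"
  proof -
    have "continuous_on {0..1} (\<lambda>x. cmod (p x) * exp (- (2 * C * x)))" by (intro continuous_intros p)
    from continuous_attains_sup[OF compact_Icc _ this] show ?thesis using that by auto
  qed
  define B where "B = cmod (p x0) * exp (- (2 * C * x0))"
  have "B \<ge> 0" by (simp add: B_def)
  have B: "cmod (p t) \<le> B * exp (2 * C * t)" if "0 \<le> t" "t \<le> 1" for t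
    using x0(2)[of t] that by (simp add: B_def exp_minus field_simps)
  have "cmod (volterra \<alpha> z p x0) \<le> B / 2 * exp (2 * C * x0)"
    unfolding C_def by (rule volterra_contraction[OF p]) (use x0 B in \<open>auto simp: C_def\<close>)
  moreover have "cmod (p x0) \<le> cmod (h x0) + cmod (volterra \<alpha> z p x0)"
    using eq[of x0] x0 norm_triangle_ineq by simp
  moreover have "cmod (p x0) = B * exp (2 * C * x0)"
    by (simp add: B_def exp_minus)
  ultimately have "B * exp (2 * C * x0) \<le> 2 * A" using h[of x0] x0 by simp
  moreover have "B * 1 \<le> B * exp (2 * C * x0)" using C x0 \<open>B \<ge> 0\<close> by (intro mult_left_mono) auto
  ultimately have "B \<le> 2 * A" by simp
  have "cmod (p x) \<le> B * exp (2 * C * x)" by (rule B[OF x])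
  also have "\<dots> \<le> (2 * A) * exp (2 * C)" using \<open>B \<le> 2 * A\<close> \<open>A \<ge> 0\<close> C x by (intro mult_mono) auto
  finally show ?thesis by (simp add: C_def)
qed

text \<open>Neumann series: in the weighted norm the iterates of h decay like (1/2)^n. The partial
  sums converge uniformly, and the contraction estimate carries the equation to the limit.\<close>

lemma volterra_solution_exists:
  assumes h: "continuous_on {0..1} h"
  obtains p where "continuous_on {0..1} p" "\<And>x. 0 \<le> x \<Longrightarrow> x \<le> 1 \<Longrightarrow> p x = h x + volterra \<alpha> z p x"
proof -
  define C where "C = potential_bound \<alpha> z"
  have C: "C > 0" unfolding C_def by (rule potential_bound_pos)
  define P where "P n = ((volterra \<alpha> z) ^^ n) h" for n
  have P0: "P 0 = h" and PS: "P (Suc n) = volterra \<alpha> z (P n)" for n by (auto simp: P_def)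
  have Pc: "continuous_on {0..1} (P n)" for n
    by (induct n) (auto simp: P0 PS h volterra_continuous)
  have "bounded (h ` {0..1})"
    by (intro compact_imp_bounded compact_continuous_image h) auto
  then obtain A where A: "\<And>x. 0 \<le> x \<Longrightarrow> x \<le> 1 \<Longrightarrow> cmod (h x) \<le> A"
    unfolding bounded_iff by (metis atLeastAtMost_iff image_eqI)
  have "A \<ge> 0" using order_trans[OF norm_ge_zero A[of 0]] by simp
  have PB: "cmod (P n x) \<le> A * (1/2) ^ n * exp (2 * C * x)" if "0 \<le> x" "x \<le> 1" for n x
    using that
  proof (induct n arbitrary: x)
    case 0
    have "cmod (h x) \<le> A * 1" using A[OF 0] by simp
    also have "\<dots> \<le> A * exp (2 * C * x)" using 0 C \<open>A \<ge> 0\<close> by (intro mult_left_mono) auto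
    finally show ?case by (simp add: P0)
  next
    case (Suc n)
    show ?case using volterra_contraction[OF Pc[of n] Suc(2,3), of "A * (1/2) ^ n" \<alpha> z] Suc(1) 
      by (simp add: PS C_def)
  qed
  define S where "S N x = (\<Sum>n<N. P n x)" for N x
  define p where "p x = (\<Sum>n. P n x)" for x
  have ul: "uniform_limit {0..1} S p sequentially"
    unfolding S_def p_def
  proof (rule Weierstrass_m_test[where M = "\<lambda>n. A * (1/2) ^ n * exp (2 * C)"])
    fix n and x :: real assume "x \<in> {0..1}"
    then have x: "0 \<le> x" "x \<le> 1" by auto
    have "A * (1/2) ^ n * exp (2 * C * x) \<le> A * (1/2) ^ n * exp (2 * C)"
      using x C \<open>A \<ge> 0\<close> by (intro mult_left_mono) auto
    then show "norm (P n x) \<le> A * (1/2) ^ n * exp (2 * C)" using PB[OF x, of n] by linarith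
  qed (intro summable_mult summable_mult2 summable_geometric, simp)
  have Sc: "continuous_on {0..1} (S N)" for N
    unfolding S_def by (intro continuous_on_sum Pc)
  have pc: "continuous_on {0..1} p"
    by (rule uniform_limit_theorem[OF always_eventually ul]) (auto simp: Sc)
  have VS: "volterra \<alpha> z (S N) x = S (Suc N) x - h x" if x: "0 \<le> x" "x \<le> 1" for N x
  proof (induct N)
    case 0
    have "S 0 = (\<lambda>_. 0)" by (rule ext) (simp add: S_def)
    then have "volterra \<alpha> z (S 0) x = 0" by (simp add: volterra_def prim_def)
    moreover have "S (Suc 0) x = h x" by (simp add: S_def P0)
    ultimately show ?case by simp
  next
    case (Suc N)
    have S_step: "S (Suc (Suc N)) x = S (Suc N) x + P (Suc N) x" by (simp add: S_def)
    have "volterra \<alpha> z (S (Suc N)) x = volterra \<alpha> z (\<lambda>t. S N t + 1 * P N t) x"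
      by (rule volterra_cong) (simp add: S_def)
    also have "\<dots> = volterra \<alpha> z (S N) x + P (Suc N) x"
      by (subst volterra_lincomb[OF Sc Pc x]) (simp add: PS)
    finally show ?case using Suc S_step by simp
  qed
  have "p x = h x + volterra \<alpha> z p x" if x: "0 \<le> x" "x \<le> 1" for x
  proof -
    have "(\<lambda>N. S N x) \<longlonglongrightarrow> p x" using tendsto_uniform_limitI[OF ul, of x] x by simp
    then have 1: "(\<lambda>N. S (Suc N) x - h x) \<longlonglongrightarrow> p x - h x" 
      by (intro tendsto_intros LIMSEQ_Suc)
    have 2: "(\<lambda>N. volterra \<alpha> z (S N) x) \<longlonglongrightarrow> volterra \<alpha> z p x"
    proof (rule LIMSEQ_I)
      fix r :: real assume "r > 0"
      define e where "e = r / exp (2 * C)"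
      have "e > 0" using \<open>r > 0\<close> by (simp add: e_def)
      then obtain N0 where N0: "\<And>N x. N \<ge> N0 \<Longrightarrow> x \<in> {0..1} \<Longrightarrow> dist (S N x) (p x) < e"
        using ul unfolding uniform_limit_sequentially_iff by blast
      show "\<exists>no. \<forall>n\<ge>no. norm (volterra \<alpha> z (S n) x - volterra \<alpha> z p x) < r"
      proof (intro exI[of _ N0] allI impI)
        fix N assume "N \<ge> N0"
        have "volterra \<alpha> z (S N) x - volterra \<alpha> z p x = volterra \<alpha> z (\<lambda>t. S N t + (-1) * p t) x"
          by (subst volterra_lincomb[OF Sc pc x]) simp
        also have "cmod \<dots> \<le> e / 2 * exp (2 * C * x)"
          unfolding C_def
        proof (rule volterra_contraction[OF _ x])
          show "continuous_on {0..1} (\<lambda>t. S N t + - 1 * p t)" by (intro continuous_intros Sc pc)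
          fix t :: real assume t: "0 \<le> t" "t \<le> 1"
          have "cmod (S N t + - 1 * p t) \<le> e * 1" using N0[OF \<open>N \<ge> N0\<close>, of t] t by (simp add: dist_norm)
          also have "\<dots> \<le> e * exp (2 * C * t)" using C t \<open>e > 0\<close> by (intro mult_left_mono) auto
          finally show "cmod (S N t + - 1 * p t) \<le> e * exp (2 * potential_bound \<alpha> z * t)" by (simp add: C_def)
        qed
        also have "\<dots> \<le> e / 2 * exp (2 * C)" using C x \<open>e > 0\<close> by (intro mult_left_mono) auto
        also have "\<dots> < r" using \<open>r > 0\<close> by (simp add: e_def)
        finally show "norm (volterra \<alpha> z (S N) x - volterra \<alpha> z p x) < r" .
      qed
    qed
    have "volterra \<alpha> z p x = p x - h x"
      using LIMSEQ_unique[OF 2] 1 by (simp add: VS x)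
    then show ?thesis by simp
  qed
  with pc show ?thesis by (rule that)
qed

text \<open>In integrated form, w is the derivative of the solution u with u(0) = 0 and u'(0) = 1.
  Then \<open>prim w 1\<close> is u(1), whose vanishing decides whether z is an eigenvalue.\<close>

definition fundamental_derivative :: "real \<Rightarrow> complex \<Rightarrow> (real \<Rightarrow> complex) \<Rightarrow> bool" where
  "fundamental_derivative \<alpha> z w \<longleftrightarrow> continuous_on {0..1} w \<and> (\<forall>x\<in>{0..1}. w x = 1 + volterra \<alpha> z w x)"

text \<open>Shooting: a solution r for c = 0 is corrected by a multiple of w. The multiple is the
  free constant c, and the condition at 1 determines it because \<open>prim w 1\<close> is
  nonzero.\<close>

lemma dirichlet_solution_exists:
  assumes w: "fundamental_derivative \<alpha> z w" "prim w 1 \<noteq> 0" and h: "continuous_on {0..1} h"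
  obtains p c where "continuous_on {0..1} p" "prim p 1 = 0"
    "\<And>x. 0 \<le> x \<Longrightarrow> x \<le> 1 \<Longrightarrow> p x = c + h x + volterra \<alpha> z p x"
proof -
  obtain r where r: "continuous_on {0..1} r" "\<And>x. 0 \<le> x \<Longrightarrow> x \<le> 1 \<Longrightarrow> r x = h x + volterra \<alpha> z r x"
    by (rule volterra_solution_exists[OF h]) blast
  have wc: "continuous_on {0..1} w" and wv: "\<And>x. 0 \<le> x \<Longrightarrow> x \<le> 1 \<Longrightarrow> w x = 1 + volterra \<alpha> z w x"
    using w by (auto simp: fundamental_derivative_def)
  define c where "c = - prim r 1 / prim w 1"
  show ?thesis
  proof (rule that)
    show "continuous_on {0..1} (\<lambda>x. r x + c * w x)" by (intro continuous_intros r wc)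
    have "continuous_on {0..1} (\<lambda>x. c * w x)" by (intro continuous_intros wc)
    from prim_add[OF integrable_I01_continuous[OF r(1)] integrable_I01_continuous[OF this], of 1]
    show "prim (\<lambda>x. r x + c * w x) 1 = 0"
      using w(2) unfolding prim_mult by (simp add: c_def)
    show "r x + c * w x = c + h x + volterra \<alpha> z (\<lambda>x. r x + c * w x) x" if "0 \<le> x" "x \<le> 1" for x
      unfolding volterra_lincomb[OF r(1) wc that] using r(2)[OF that] wv[OF that]
      by (simp add: algebra_simps)
  qed
qed

text \<open>Subtracting c w removes the unknown constant: r solves the equation with h alone and is
  bounded by E A. The condition at 1 then reads \<open>prim r 1 = - c * prim w 1\<close> and bounds
  c. The constant D is chosen before p, c and h, as the later limits require.\<close>

lemma dirichlet_solution_bound: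
  assumes w: "fundamental_derivative \<alpha> z w" "prim w 1 \<noteq> 0"
  obtains D where "D > 0" and "\<And>p c h A x. continuous_on {0..1} p \<Longrightarrow> prim p 1 = 0 \<Longrightarrow>
    (\<And>x. 0 \<le> x \<Longrightarrow> x \<le> 1 \<Longrightarrow> p x = c + h x + volterra \<alpha> z p x) \<Longrightarrow>
    (\<And>x. 0 \<le> x \<Longrightarrow> x \<le> 1 \<Longrightarrow> cmod (h x) \<le> A) \<Longrightarrow> 0 \<le> x \<Longrightarrow> x \<le> 1 \<Longrightarrow> cmod (p x) \<le> D * A"
proof -
  define E where "E = 2 * exp (2 * potential_bound \<alpha> z)"
  define m where "m = cmod (prim w 1)"
  have m: "m > 0" using w(2) by (simp add: m_def)
  have E: "E > 0" by (simp add: E_def)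
  have wc: "continuous_on {0..1} w" and wv: "\<And>x. 0 \<le> x \<Longrightarrow> x \<le> 1 \<Longrightarrow> w x = 1 + volterra \<alpha> z w x"
    using w by (auto simp: fundamental_derivative_def)
  have wb: "cmod (w x) \<le> E" if "0 \<le> x" "x \<le> 1" for x
    using volterra_gronwall[OF wc, of "\<lambda>_. 1" \<alpha> z 1, OF wv _ that] by (simp add: E_def)
  show ?thesis
  proof (rule that[of "E + E / m * E"])
    show "E + E / m * E > 0" using E m by (simp add: add_pos_pos)
    fix p c h A and x :: real
    assume p: "continuous_on {0..1} p" "prim p 1 = 0" "\<And>x. 0 \<le> x \<Longrightarrow> x \<le> 1 \<Longrightarrow> p x = c + h x + volterra \<alpha> z p x"
      and h: "\<And>x. 0 \<le> x \<Longrightarrow> x \<le> 1 \<Longrightarrow> cmod (h x) \<le> A" and x: "0 \<le> x" "x \<le> 1"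
    define r where "r t = p t + (- c) * w t" for t
    have rc: "continuous_on {0..1} r" unfolding r_def by (intro continuous_intros p wc)
    have rb: "cmod (r t) \<le> E * A" if "0 \<le> t" "t \<le> 1" for t
    proof -
      have "r s = h s + volterra \<alpha> z r s" if "0 \<le> s" "s \<le> 1" for s
        unfolding r_def volterra_lincomb[OF p(1) wc that] using p(3)[OF that] wv[OF that] by (simp add: algebra_simps)
      from volterra_gronwall[OF rc this h that] show ?thesis by (simp add: E_def mult_ac)
    qed
    have "continuous_on {0..1} (\<lambda>x. - c * w x)" by (intro continuous_intros wc)
    then have "prim r 1 = - c * prim w 1"
      unfolding r_def using p wc by (subst prim_add) (simp_all add: prim_mult[of "- c" w, simplified] prim_mult[of "- c" w] integrable_I01_continuous)
    moreover have "cmod (prim r 1) \<le> E * A * 1" by (rule norm_prim_le_const[OF rc rb]) auto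
    ultimately have "cmod c * m \<le> E * A" by (simp add: m_def norm_mult)
    then have c: "cmod c \<le> E / m * A" using m by (simp add: field_simps)
    have "p x = r x + c * w x" by (simp add: r_def)
    then have "cmod (p x) \<le> cmod (r x) + cmod c * cmod (w x)" by (metis norm_mult norm_triangle_ineq)
    also have "\<dots> \<le> E * A + (E / m * A) * E"
      using x c wb[OF x] rb[OF x] order_trans[OF norm_ge_zero c] by (intro add_mono mult_mono) auto
    finally show "cmod (p x) \<le> (E + E / m * E) * A" by (simp add: algebra_simps)
  qed
qed

section \<open>The source term of the resolvent equation\<close>

lemma L2_cong_AE:
  assumes "f \<in> L2" "AE x in I01. f x = g x" "g \<in> borel_measurable I01"
  shows "g \<in> L2"
proof -
  have "integrable I01 (\<lambda>x. (cmod (f x))\<^sup>2) \<longleftrightarrow> integrable I01 (\<lambda>x. (cmod (g x))\<^sup>2)"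
    by (rule integrable_cong_AE) (use assms in \<open>auto elim!: eventually_mono\<close>)
  then show ?thesis using assms by (simp add: L2_def)
qed

lemma L2_norm_eq_0_imp_AE:
  assumes "f \<in> L2" "L2_norm f = 0"
  shows "AE x in I01. f x = 0"
proof -
  have "(LINT x|I01. (cmod (f x))\<^sup>2) = 0" using assms(2) by (simp add: L2_norm_def)
  then have "AE x in I01. (cmod (f x))\<^sup>2 = 0"
    by (subst (asm) integral_nonneg_eq_0_iff_AE) (use L2_square_integrable[OF assms(1)] in auto)
  then show ?thesis by simp
qed

text \<open>Cauchy-Schwarz against the indicator function of [0, x], whose \<open>L2\<close> norm is
  sqrt x. This gain is what makes the product with the weight 1/x integrable.\<close>

lemma norm_prim_le_sqrt:
  assumes f: "f \<in> L2" and x: "0 \<le> x" "x \<le> 1"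
  shows "cmod (prim f x) \<le> sqrt x * L2_norm f"
proof -
  define e where "e t = (if t \<le> x then 1 else 0 :: complex)" for t
  have [measurable]: "(\<lambda>t::real. t) \<in> borel_measurable I01" 
    by (rule continuous_borel_measurable_I01) (intro continuous_intros)
  have "e \<in> borel_measurable I01" unfolding e_def[abs_def] by measurable
  then have eL: "e \<in> L2" by (rule L2_bounded[of _ 1]) (auto simp: e_def)
  have "of_real ((L2_norm e)\<^sup>2) = (LINT t|I01. complex_of_real ((cmod (e t))\<^sup>2))"
    unfolding L2_norm_square integral_complex_of_real ..
  also have "\<dots> = (LINT t|I01. (if t \<le> x then 1 else 0))"
    by (rule Bochner_Integration.integral_cong) (auto simp: e_def)
  also have "\<dots> = prim (\<lambda>_. 1) x" by (rule prim_eq_LINT[symmetric]) (use x in auto)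
  also have "\<dots> = of_real x" using x by (simp add: prim_def scaleR_conv_of_real)
  finally have "(L2_norm e)\<^sup>2 = x" by (simp only: of_real_eq_iff)
  then have e: "L2_norm e = sqrt x" by (metis L2_norm_nonneg real_sqrt_unique)
  have "prim f x = (LINT t|I01. e t * f t)"
    unfolding prim_eq_LINT[OF L2_integrable[OF f] x] by (rule Bochner_Integration.integral_cong) (auto simp: e_def)
  then show ?thesis using L2_bounded_LINT_prod[OF eL f] e by simp
qed

lemma integrable_inverse_sqrt: "integrable I01 (\<lambda>x. x powr (-1/2) :: real)"
proof -
  have "(\<lambda>x::real. x powr (-1/2)) integrable_on {0..1}" by (rule integrable_on_powr_from_0) auto
  then have "(\<lambda>x::real. x powr (-1/2)) integrable_on {0<..<1}" by (simp add: integrable_on_Icc_iff_Ioo)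
  then have "(\<lambda>x::real. x powr (-1/2)) absolutely_integrable_on {0<..<1}"
    by (rule nonnegative_absolutely_integrable_1) auto
  then show ?thesis by (simp add: set_integrable_def integrable_restrict_space)
qed

text \<open>Eliminating v = f + z u from (G - z)(u, v) = (f, g) gives u'' = q u + g + (z + 2
  \<alpha> / x) f, with q the potential. The third argument here is the derivative of that f, which
  is recovered by \<open>prim\<close>.\<close>

definition source :: "real \<Rightarrow> complex \<Rightarrow> (real \<Rightarrow> complex) \<Rightarrow> (real \<Rightarrow> complex) \<Rightarrow> real \<Rightarrow> complex" where
  "source \<alpha> z f g x = g x + (z + of_real (2 * \<alpha> / x)) * prim f x"

lemma Hardy_weight_continuous: "continuous_on {0<..<1} (\<lambda>x. z + complex_of_real (2 * \<alpha> / x))"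
  by (intro continuous_intros) auto

text \<open>The weight leaves a singularity of size x^(-1/2), so this estimate controls the source
  in L1 only. That suffices: the Volterra equation contains the source only through its
  primitive.\<close>

lemma source_bound:
  obtains K where "K > 0" and "\<And>f g. f \<in> L2 \<Longrightarrow> g \<in> L2 \<Longrightarrow> integrable I01 (source \<alpha> z f g)"
    and "\<And>f g. f \<in> L2 \<Longrightarrow> g \<in> L2 \<Longrightarrow> (LINT x|I01. cmod (source \<alpha> z f g x)) \<le> K * (L2_norm f + L2_norm g)"
proof -
  define N where "N = cmod z + 2 * \<bar>\<alpha>\<bar>"
  have N: "N \<ge> 0" by (simp add: N_def)
  define \<kappa> where "\<kappa> = (LINT x|I01. x powr (-1/2) :: real)"
  have \<kappa>: "\<kappa> \<ge> 0" by (simp add: \<kappa>_def integral_nonneg_AE)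
  have bound: "cmod (source \<alpha> z f g x) \<le> cmod (g x) + N * L2_norm f * x powr (-1/2)" 
    if f: "f \<in> L2" and x: "0 < x" "x < 1" for f g x
  proof -
    have "cmod (z + of_real (2 * \<alpha> / x)) \<le> cmod z + 2 * \<bar>\<alpha>\<bar> / x"
      using x by (intro order_trans[OF norm_triangle_ineq]) (simp add: norm_divide norm_mult)
    also have "\<dots> \<le> N / x" unfolding N_def add_divide_distrib using x
      by (intro add_right_mono) (simp add: field_simps mult_left_le_one_le)
    finally have "cmod ((z + of_real (2 * \<alpha> / x)) * prim f x) \<le> (N / x) * (sqrt x * L2_norm f)"
      unfolding norm_mult using x N by (intro mult_mono norm_prim_le_sqrt f) auto
    also have "\<dots> = N * L2_norm f * x powr (-1/2)"
      using x by (simp add: powr_minus powr_half_sqrt field_simps real_sqrt_mult_self flip: real_sqrt_mult)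
    finally show ?thesis unfolding source_def by (intro order_trans[OF norm_triangle_ineq]) simp
  qed
  have dom: "integrable I01 (\<lambda>x. cmod (g x) + N * L2_norm f * x powr (-1/2))" if "g \<in> L2" for f g
    by (intro Bochner_Integration.integrable_add integrable_mult_right integrable_inverse_sqrt integrable_norm L2_integrable that)
  have meas: "source \<alpha> z f g \<in> borel_measurable I01" if "f \<in> L2" "g \<in> L2" for f g
  proof -
    have [measurable]: "(\<lambda>x. z + complex_of_real (2 * \<alpha> / x)) \<in> borel_measurable I01" "g \<in> borel_measurable I01" "prim f \<in> borel_measurable I01"
      by (intro continuous_borel_measurable_I01 Hardy_weight_continuous L2_measurable prim_L2 that)+
    show ?thesis unfolding source_def[abs_def] by measurable
  qed
  have int: "integrable I01 (source \<alpha> z f g)" if fg: "f \<in> L2" "g \<in> L2" for f g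
  proof (rule Bochner_Integration.integrable_bound[OF dom[of g f]])
    show "AE x in I01. norm (source \<alpha> z f g x) \<le> norm (cmod (g x) + N * L2_norm f * x powr (-1/2))"
      using bound[OF fg(1)] N by (intro AE_I01I) (simp add: abs_of_nonneg)
  qed (use meas fg in auto)
  show ?thesis
  proof (rule that[of "1 + N * \<kappa>", OF _ int])
    show "1 + N * \<kappa> > 0" using N \<kappa> by (simp add: add_pos_nonneg)
    fix f g assume fg: "f \<in> L2" "g \<in> L2"
    have "(LINT x|I01. cmod (source \<alpha> z f g x)) \<le> (LINT x|I01. cmod (g x) + N * L2_norm f * x powr (-1/2))"
      by (rule integral_mono_AE) (use int[OF fg] dom[OF fg(2)] bound[OF fg(1)] in \<open>auto intro!: AE_I01I\<close>)
    also have "\<dots> = (LINT x|I01. cmod (g x)) + N * L2_norm f * \<kappa>"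
      unfolding \<kappa>_def
      by (subst Bochner_Integration.integral_add[OF integrable_norm[OF L2_integrable[OF fg(2)]] 
            integrable_mult_right[OF integrable_inverse_sqrt]]) simp
    also have "\<dots> \<le> L2_norm g + N * L2_norm f * \<kappa>" using L1_le_L2_norm[OF fg(2)] by simp
    also have "\<dots> \<le> (1 + N * \<kappa>) * (L2_norm f + L2_norm g)"
      using N \<kappa> by (simp add: algebra_simps)
    finally show "(LINT x|I01. cmod (source \<alpha> z f g x)) \<le> (1 + N * \<kappa>) * (L2_norm f + L2_norm g)" .
  qed
qed

lemma Hardy_weight_prim_L2:
  assumes "continuous_on {0..1} p"
  shows "(\<lambda>x. (z + of_real (2 * \<alpha> / x)) * prim p x) \<in> L2"
proof -
  \<comment> \<open>At parameter 1 the potential is 1 + 2 \<alpha> / x, so subtracting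
    \<open>prim p\<close> isolates the weight.\<close>
  have "(\<lambda>x. z * prim p x + wave_potential \<alpha> 1 x * prim p x - prim p x) \<in> L2"
    by (intro L2_add L2_diff L2_mult_const prim_L2 L2_continuous assms potential_times_prim_L2)
  then show ?thesis by (simp add: wave_potential_def algebra_simps)
qed

lemma source_L2: "continuous_on {0..1} f \<Longrightarrow> g \<in> L2 \<Longrightarrow> source \<alpha> z f g \<in> L2"
  unfolding source_def[abs_def] by (intro L2_add Hardy_weight_prim_L2)

lemma W22_weak_second_derivative:
  assumes "u \<in> W22"
  shows "has_weak_derivative u (weak_deriv u)" "has_weak_derivative (weak_deriv u) (weak_deriv (weak_deriv u))"
proof -
  from assms obtain g h where gh: "has_weak_derivative u g" "has_weak_derivative g h" by (auto simp: W22_def)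
  show 1: "has_weak_derivative u (weak_deriv u)" by (rule weak_deriv_works[OF gh(1)])
  have "has_weak_derivative (weak_deriv u) h"
    by (rule has_weak_derivative_cong_AE[OF gh(2)])
      (use weak_deriv_AE_eq[OF gh(1)] has_weak_derivative_L2[OF 1] has_weak_derivative_L2[OF gh(2)] in \<open>auto elim: eventually_mono\<close>)
  then show "has_weak_derivative (weak_deriv u) (weak_deriv (weak_deriv u))" by (rule weak_deriv_works)
qed

text \<open>Passes from the almost everywhere class of u to a continuous representative of u', which
  is the unknown of the Volterra equation.\<close>

lemma W012_W22_regular:
  assumes "u \<in> W012 \<inter> W22"
  obtains c where "weak_deriv (weak_deriv u) \<in> L2" 
    "prim (\<lambda>x. c + prim (weak_deriv (weak_deriv u)) x) 1 = 0"
    "AE x in I01. u x = prim (\<lambda>x. c + prim (weak_deriv (weak_deriv u)) x) x"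
    "has_weak_derivative u (\<lambda>x. c + prim (weak_deriv (weak_deriv u)) x)"
    "continuous_on {0..1} (\<lambda>x. c + prim (weak_deriv (weak_deriv u)) x)"
proof -
  note w = W22_weak_second_derivative[of u]
  obtain p where p: "p \<in> L2" "prim p 1 = 0" "AE x in I01. u x = prim p x" "has_weak_derivative u p"
    using assms W012_imp_primitive[of u] by auto
  obtain c where c: "AE x in I01. weak_deriv u x = c + prim (weak_deriv (weak_deriv u)) x"
    using weak_derivative_primitive[OF w(2)] assms by auto
  define P where "P x = c + prim (weak_deriv (weak_deriv u)) x" for x
  have wL: "weak_deriv (weak_deriv u) \<in> L2" using has_weak_derivative_L2(2)[OF w(2)] assms by auto
  have Pc: "continuous_on {0..1} P" unfolding P_def by (intro continuous_intros prim_continuous L2_integrable wL)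
  have pP: "AE x in I01. p x = P x"
    using eventually_conj[OF c weak_deriv_AE_eq[OF p(4)]] by (rule eventually_mono) (auto simp: P_def)
  have eq: "prim p x = prim P x" if "0 \<le> x" "x \<le> 1" for x
    by (rule prim_cong_AE[OF pP _ _ that]) (intro L2_integrable p L2_continuous Pc)+
  show ?thesis
  proof (rule that[of c, folded P_def])
    show "prim P 1 = 0" using eq[of 1] p(2) by simp
    show "AE x in I01. u x = prim P x"
      using p(3) by (rule AE_mp, intro AE_I01I impI) (simp add: eq)
    show "has_weak_derivative u P"
      by (rule has_weak_derivative_cong_AE[OF p(4) _ pP]) (auto intro: has_weak_derivative_L2[OF p(4)] L2_continuous Pc)
  qed (fact wL Pc)+
qed

section \<open>A priori bound and surjectivity for the closure\<close>

lemma H_norm_diff_ge: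
  assumes "A \<in> Hspace" "B \<in> Hspace"
  shows "H_norm A \<le> H_norm (A - B) + H_norm B" "H_norm A \<le> H_norm (B - A) + H_norm B" "A - B \<in> Hspace"
proof -
  obtain u v u' v' where AB: "A = (u, v)" "B = (u', v')" by (metis prod.exhaust)
  with assms have uv: "u \<in> W012" "u' \<in> W012" "v \<in> L2" "v' \<in> L2" by (auto simp: Hspace_def)
  obtain p where p: "has_weak_derivative u p" using uv(1) by (auto simp: W012_def W12_def)
  obtain p' where p': "has_weak_derivative u' p'" using uv(2) by (auto simp: W012_def W12_def)
  note L = has_weak_derivative_L2(2)[OF p] has_weak_derivative_L2(2)[OF p']
  have eq: "A - B = (u - u', v - v')" "B - A = (u' - u, v' - v)" by (auto simp: AB)
  have tri: "L2_norm f \<le> L2_norm (f - g) + L2_norm g" "L2_norm f \<le> L2_norm (g - f) + L2_norm g" if "f \<in> L2" "g \<in> L2" for f g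
  proof -
    have "L2_norm f = L2_norm (\<lambda>x. (f x - g x) + g x)" by simp
    also have "\<dots> \<le> L2_norm (f - g) + L2_norm g"
      unfolding fun_diff_def by (rule L2_norm_triangle[OF L2_diff[OF that] that(2)])
    finally show 1: "L2_norm f \<le> L2_norm (f - g) + L2_norm g" .
    have "L2_norm (g - f) = L2_norm (f - g)" unfolding L2_norm_def fun_diff_def by (simp add: norm_minus_commute)
    with 1 show "L2_norm f \<le> L2_norm (g - f) + L2_norm g" by simp
  qed
  have comb: "sqrt (a\<^sup>2 + b\<^sup>2) \<le> sqrt (a1\<^sup>2 + b1\<^sup>2) + sqrt (a2\<^sup>2 + b2\<^sup>2)" 
    if "a \<le> a1 + a2" "b \<le> b1 + b2" "0 \<le> a" "0 \<le> b" for a b a1 b1 a2 b2 :: real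
  proof -
    have "sqrt (a\<^sup>2 + b\<^sup>2) \<le> sqrt ((a1 + a2)\<^sup>2 + (b1 + b2)\<^sup>2)"
      by (intro real_sqrt_le_mono add_mono power_mono that)
    then show ?thesis using real_sqrt_sum_squares_triangle_ineq[of a1 a2 b1 b2] by linarith
  qed
  show "H_norm A \<le> H_norm (A - B) + H_norm B"
    unfolding eq unfolding AB H_norm_eq[OF p uv(3)] H_norm_eq[OF p' uv(4)] H_norm_eq[OF has_weak_derivative_diff[OF p p'] L2_diff'[OF uv(3,4)]]
    by (intro comb tri L uv) auto
  show "H_norm A \<le> H_norm (B - A) + H_norm B"
    unfolding eq unfolding AB H_norm_eq[OF p uv(3)] H_norm_eq[OF p' uv(4)] H_norm_eq[OF has_weak_derivative_diff[OF p' p] L2_diff'[OF uv(4,3)]]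
    by (intro comb tri L uv) auto
  show "A - B \<in> Hspace" unfolding eq
    using W012_lincomb[OF uv(1,2), of "-1"] L2_diff'[OF uv(3,4)] by (simp add: Hspace_def fun_diff_def)
qed

lemma H_scale_norm:
  assumes "A \<in> Hspace"
  shows "H_scale c A \<in> Hspace" "H_norm (H_scale c A) = cmod c * H_norm A"
proof -
  obtain u v where A: "A = (u, v)" by (metis prod.exhaust)
  with assms have uv: "u \<in> W012" "v \<in> L2" by (auto simp: Hspace_def)
  obtain p where p: "has_weak_derivative u p" using uv(1) by (auto simp: W012_def W12_def)
  have p': "has_weak_derivative (\<lambda>x. c * u x) (\<lambda>x. c * p x)"
    using has_weak_derivative_lincomb[OF p p, of "c - 1"] by (simp add: algebra_simps)
  show "H_scale c A \<in> Hspace"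
    using W012_lincomb[OF uv(1,1), of "c - 1"] L2_mult_const[OF uv(2)] by (simp add: Hspace_def H_scale_def A algebra_simps)
  have "sqrt ((cmod c * a)\<^sup>2 + (cmod c * b)\<^sup>2) = cmod c * sqrt (a\<^sup>2 + b\<^sup>2)" for a b
    by (simp add: power_mult_distrib real_sqrt_mult flip: distrib_left)
  then show "H_norm (H_scale c A) = cmod c * H_norm A"
    by (simp add: H_scale_def A H_norm_eq[OF p uv(2)] H_norm_eq[OF p' L2_mult_const[OF uv(2)]] L2_norm_scale)
qed

lemma L2_norm_prim_le: "f \<in> L2 \<Longrightarrow> L2_norm (prim f) \<le> L2_norm f"
  by (intro L2_norm_le_const norm_prim_le_L2 prim_L2) auto

lemma of_real_weight_measurable: "(\<lambda>x. complex_of_real (2 * \<alpha> / x)) \<in> borel_measurable I01"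
  using continuous_borel_measurable_I01[OF Hardy_weight_continuous[of 0 \<alpha>]] by simp

text \<open>As the primitive of a continuous function, v vanishes at 0 to first order, so dividing
  by x keeps it square integrable.\<close>

lemma damping_term_L2:
  assumes "v \<in> L2" "continuous_on {0..1} p" "AE x in I01. v x = prim p x"
  shows "(\<lambda>x. of_real (2 * \<alpha> / x) * v x) \<in> L2"
proof (rule L2_cong_AE)
  show "(\<lambda>x. (0 + of_real (2 * \<alpha> / x)) * prim p x) \<in> L2" by (rule Hardy_weight_prim_L2[OF assms(2)])
  show "AE x in I01. (0 + of_real (2 * \<alpha> / x)) * prim p x = of_real (2 * \<alpha> / x) * v x"
    using assms(3) by (rule eventually_mono) simp
  show "(\<lambda>x. of_real (2 * \<alpha> / x) * v x) \<in> borel_measurable I01"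
    by (intro borel_measurable_times of_real_weight_measurable L2_measurable assms)
qed

lemma G0_app_Hspace:
  assumes "U \<in> G0_dom"
  shows "U \<in> Hspace" "G0_app \<alpha> U \<in> Hspace"
proof -
  obtain u v where U: "U = (u, v)" by (metis prod.exhaust)
  have uv: "u \<in> W012 \<inter> W22" "v \<in> W012 \<inter> W22" using assms by (auto simp: G0_dom_def U)
  obtain c where c: "weak_deriv (weak_deriv v) \<in> L2" 
    "AE x in I01. v x = prim (\<lambda>x. c + prim (weak_deriv (weak_deriv v)) x) x"
    "has_weak_derivative v (\<lambda>x. c + prim (weak_deriv (weak_deriv v)) x)"
    "continuous_on {0..1} (\<lambda>x. c + prim (weak_deriv (weak_deriv v)) x)"
    by (rule W012_W22_regular[OF uv(2)])
  have vL: "v \<in> L2" by (rule has_weak_derivative_L2[OF c(3)])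
  have wL: "weak_deriv (weak_deriv u) \<in> L2" by (rule W012_W22_regular[OF uv(1)])
  show "U \<in> Hspace" "G0_app \<alpha> U \<in> Hspace"
    using uv vL L2_diff[OF wL damping_term_L2[OF vL c(4,2), of \<alpha>]] by (auto simp: Hspace_def U G0_app_def)
qed

text \<open>On the domain of the unclosed operator everything is regular enough to turn (G0 - z) U =
  (f, g) into the Volterra equation for u' whose source is built from f' and g.
  \<open>dirichlet_solution_bound\<close> controls u', and v = f + z u gives the rest.\<close>

lemma G0_apriori_bound:
  assumes w: "fundamental_derivative \<alpha> z w" "prim w 1 \<noteq> 0"
  obtains K where "K \<ge> 0" "\<And>U. U \<in> G0_dom \<Longrightarrow> H_norm U \<le> K * H_norm (G0_app \<alpha> U - H_scale z U)"
proof -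
  obtain D where D: "D > 0" and Db: "\<And>p c h A x. continuous_on {0..1} p \<Longrightarrow> prim p 1 = 0 \<Longrightarrow>
    (\<And>x. 0 \<le> x \<Longrightarrow> x \<le> 1 \<Longrightarrow> p x = c + h x + volterra \<alpha> z p x) \<Longrightarrow>
    (\<And>x. 0 \<le> x \<Longrightarrow> x \<le> 1 \<Longrightarrow> cmod (h x) \<le> A) \<Longrightarrow> 0 \<le> x \<Longrightarrow> x \<le> 1 \<Longrightarrow> cmod (p x) \<le> D * A"
    by (rule dirichlet_solution_bound[OF w]) blast
  obtain K0 where K0: "K0 > 0" and si: "\<And>f g. f \<in> L2 \<Longrightarrow> g \<in> L2 \<Longrightarrow> integrable I01 (source \<alpha> z f g)"
    and sb: "\<And>f g. f \<in> L2 \<Longrightarrow> g \<in> L2 \<Longrightarrow> (LINT x|I01. cmod (source \<alpha> z f g x)) \<le> K0 * (L2_norm f + L2_norm g)"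
    by (rule source_bound) blast
  define K where "K = 2 * ((1 + cmod z) * D * K0 + 1)"
  show ?thesis
  proof (rule that[of K])
    show "K \<ge> 0" using D K0 by (simp add: K_def)
    fix U assume "U \<in> G0_dom"
    obtain u v where U: "U = (u, v)" by (metis prod.exhaust)
    have uv: "u \<in> W012 \<inter> W22" "v \<in> W012 \<inter> W22" using \<open>U \<in> G0_dom\<close> by (auto simp: G0_dom_def U)
    define s where "s = weak_deriv (weak_deriv u)"
    obtain c where sL: "s \<in> L2" and P0: "prim (\<lambda>x. c + prim s x) 1 = 0"
      and uP: "AE x in I01. u x = prim (\<lambda>x. c + prim s x) x" and uw: "has_weak_derivative u (\<lambda>x. c + prim s x)"
      and Pc: "continuous_on {0..1} (\<lambda>x. c + prim s x)"
      unfolding s_def by (rule W012_W22_regular[OF uv(1)])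
    define P where "P x = c + prim s x" for x
    note P = P0[folded P_def] uP[folded P_def] uw[folded P_def] Pc[folded P_def]
    obtain c' where R0: "prim (\<lambda>x. c' + prim (weak_deriv (weak_deriv v)) x) 1 = 0"
      and vR: "AE x in I01. v x = prim (\<lambda>x. c' + prim (weak_deriv (weak_deriv v)) x) x" 
      and vw: "has_weak_derivative v (\<lambda>x. c' + prim (weak_deriv (weak_deriv v)) x)"
      and Rc: "continuous_on {0..1} (\<lambda>x. c' + prim (weak_deriv (weak_deriv v)) x)"
      by (rule W012_W22_regular[OF uv(2)])
    define R where "R x = c' + prim (weak_deriv (weak_deriv v)) x" for x
    note R = R0[folded R_def] vR[folded R_def] vw[folded R_def] Rc[folded R_def]
    have L: "u \<in> L2" "v \<in> L2" "P \<in> L2" "R \<in> L2"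
      using has_weak_derivative_L2[OF P(3)] has_weak_derivative_L2[OF R(3)] by auto
    have dL: "(\<lambda>x. of_real (2 * \<alpha> / x) * v x) \<in> L2" by (rule damping_term_L2[OF L(2) R(4) R(2)])
    define f where "f x = v x + (- z) * u x" for x
    define f' where "f' x = R x + (- z) * P x" for x
    have fw: "has_weak_derivative f f'" unfolding f_def f'_def by (rule has_weak_derivative_lincomb[OF R(3) P(3)])
    have f'c: "continuous_on {0..1} f'" unfolding f'_def by (intro continuous_intros R P)
    have zPc: "continuous_on {0..1} (\<lambda>x. - z * P x)" by (intro continuous_intros P)
    have f'p: "prim f' x = prim R x - z * prim P x" if "0 \<le> x" "x \<le> 1" for x
      using prim_add[OF integrable_I01_continuous[OF R(4)] integrable_I01_continuous[OF zPc] that] prim_mult[of "- z" P x]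
      unfolding f'_def by simp
    define g where "g x = s x - of_real (2 * \<alpha> / x) * v x - z * v x" for x
    have gL: "g \<in> L2" unfolding g_def by (intro L2_diff sL dL L2_mult_const L)
    have F: "G0_app \<alpha> U - H_scale z U = (f, g)"
      by (auto simp: U G0_app_def H_scale_def f_def g_def s_def fun_eq_iff)
    note fL = has_weak_derivative_L2[OF fw]
    define A where "A = K0 * (L2_norm f' + L2_norm g)"
    have "cmod (P x) \<le> D * A" if x: "0 \<le> x" "x \<le> 1" for x
    proof (rule Db[OF P(4) P(1) _ _ x])
      show "cmod (prim (source \<alpha> z f' g) y) \<le> A" if "0 \<le> y" "y \<le> 1" for y
        using norm_prim_le_L1[OF si[OF fL(2) gL] that] sb[OF fL(2) gL] unfolding A_def by linarith
      show "P y = c + prim (source \<alpha> z f' g) y + volterra \<alpha> z P y" if y: "0 \<le> y" "y \<le> 1" for y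
      proof -
        have ae: "AE x in I01. source \<alpha> z f' g x = s x - wave_potential \<alpha> z x * prim P x"
          using eventually_conj[OF P(2) R(2)]
          by (rule AE_mp, intro AE_I01I impI) 
            (simp add: source_def f'p g_def wave_potential_def field_simps power2_eq_square)
        have "prim (source \<alpha> z f' g) y = prim s y - volterra \<alpha> z P y"
          unfolding volterra_def using prim_cong_AE[OF ae si[OF fL(2) gL] _ y]
          by (simp add: prim_diff L2_integrable sL potential_times_prim_L2 P y L2_diff)
        then show ?thesis by (simp add: P_def)
      qed
    qed
    then have Pn: "L2_norm P \<le> D * A" by (intro L2_norm_le_const L) auto
    have un: "L2_norm u \<le> L2_norm P"
      using L2_norm_cong_AE[OF P(2) L(1) prim_L2[OF L(3)]] L2_norm_prim_le[OF L(3)] by simp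
    have fe: "AE x in I01. f x = prim f' x"
      using eventually_conj[OF P(2) R(2)] by (rule AE_mp, intro AE_I01I impI) (simp add: f'p f_def)
    have fn: "L2_norm f \<le> L2_norm f'"
      using L2_norm_cong_AE[OF fe fL(1) prim_L2[OF fL(2)]] L2_norm_prim_le[OF fL(2)] by simp
    have "L2_norm v = L2_norm (\<lambda>x. f x + z * u x)" by (simp add: f_def)
    also have "\<dots> \<le> L2_norm f + cmod z * L2_norm u"
      using L2_norm_triangle[OF fL(1) L2_mult_const[OF L(1), of z]] by (simp add: L2_norm_scale)
    also have "\<dots> \<le> L2_norm f' + cmod z * (D * A)"
      using fn un Pn by (intro add_mono mult_left_mono) auto
    finally have vn: "L2_norm v \<le> L2_norm f' + cmod z * (D * A)" .
    have "H_norm U \<le> L2_norm P + L2_norm v" unfolding U by (rule H_norm_le[OF P(3) L(2)])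
    also have "\<dots> \<le> L2_norm f' + L2_norm g + (1 + cmod z) * (D * A)" 
    proof -
      have "(1 + cmod z) * (D * A) = D * A + cmod z * (D * A)" by (simp add: algebra_simps)
      then show ?thesis using Pn vn L2_norm_nonneg[of g] by linarith
    qed
    also have "\<dots> = K / 2 * (L2_norm f' + L2_norm g)" by (simp add: K_def A_def algebra_simps)
    also have "\<dots> \<le> K / 2 * (2 * H_norm (f, g))"
      using H_norm_ge[OF fw gL] \<open>K \<ge> 0\<close> by (intro mult_left_mono) auto
    finally show "H_norm U \<le> K * H_norm (G0_app \<alpha> U - H_scale z U)" by (simp add: F)
  qed
qed

text \<open>The bound survives the graph closure. \<open>B\<close> collects the errors of replacing
  U and its image by an element of the graph of G0: one for U itself, and K times those of the image
  and of z U.\<close>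

lemma G_apriori_bound:
  assumes w: "fundamental_derivative \<alpha> z w" "prim w 1 \<noteq> 0"
  obtains K where "K \<ge> 0" "\<And>U F. (U, F) \<in> op_shift (G \<alpha>) z \<Longrightarrow> U \<in> Hspace \<and> F \<in> Hspace \<and> H_norm U \<le> K * H_norm F"
proof -
  obtain K where K: "K \<ge> 0" "\<And>U. U \<in> G0_dom \<Longrightarrow> H_norm U \<le> K * H_norm (G0_app \<alpha> U - H_scale z U)"
    by (rule G0_apriori_bound[OF w]) blast
  show ?thesis
  proof (rule that[OF K(1)])
    fix U F assume "(U, F) \<in> op_shift (G \<alpha>) z"
    then obtain F1 where F: "F = F1 - H_scale z U" and cl: "(U, F1) \<in> op_closure (G0 \<alpha>)"
      by (auto simp: op_shift_def G_def)
    then have H: "U \<in> Hspace" "F1 \<in> Hspace" by (auto simp: op_closure_def)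
    have FH: "F \<in> Hspace" unfolding F by (intro H_norm_diff_ge H_scale_norm H)
    have "H_norm U \<le> K * H_norm F + e" if "e > 0" for e
    proof -
      define B where "B = 1 + K * (1 + cmod z)"
      have B: "B > 0" using K(1) by (simp add: B_def add_pos_nonneg)
      obtain U' F' where UF: "(U', F') \<in> G0 \<alpha>" "H_norm (U - U') < e / B" "H_norm (F1 - F') < e / B"
      proof -
        have "e / B > 0" using \<open>e > 0\<close> B by simp
        then show ?thesis using cl that unfolding op_closure_def by blast
      qed
      have U': "U' \<in> G0_dom" and F': "F' = G0_app \<alpha> U'" using UF(1) by (auto simp: G0_def)
      have H': "U' \<in> Hspace" "F' \<in> Hspace" unfolding F' using G0_app_Hspace[OF U'] by auto
      note mem = H_norm_diff_ge(3) H_scale_norm(1) H H'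
      define E where "E = F' - H_scale z U'"
      have EH: "E \<in> Hspace" unfolding E_def by (intro mem)
      have "F - E = (F1 - F') - H_scale z (U - U')"
        by (auto simp: F E_def H_scale_def fun_eq_iff prod_eq_iff algebra_simps)
      then have "H_norm (F - E) = H_norm ((F1 - F') - H_scale z (U - U'))" by simp
      moreover have "H_norm ((F1 - F') - H_scale z (U - U')) \<le> H_norm (F1 - F') + H_norm (H_scale z (U - U'))"
      proof -
        define X where "X = F1 - F'"
        define Y where "Y = H_scale z (U - U')"
        have XY: "X \<in> Hspace" "Y \<in> Hspace" unfolding X_def Y_def by (intro mem)+
        have "X - Y - X = H_scale (-1) Y" by (auto simp: H_scale_def fun_eq_iff prod_eq_iff)
        then have "H_norm (X - Y - X) = H_norm Y" using H_scale_norm(2)[OF XY(2), of "-1"] by simp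
        then show ?thesis using H_norm_diff_ge(1)[OF H_norm_diff_ge(3)[OF XY] XY(1)] by (simp add: X_def Y_def)
      qed
      ultimately have FE: "H_norm (F - E) \<le> H_norm (F1 - F') + cmod z * H_norm (U - U')"
        by (simp add: H_scale_norm(2)[OF H_norm_diff_ge(3)[OF H(1) H'(1)]])
      have "H_norm E \<le> H_norm (F - E) + H_norm F" by (rule H_norm_diff_ge(2)[OF EH FH])
      then have E1: "H_norm E \<le> e / B + cmod z * (e / B) + H_norm F"
        using FE UF(2,3) mult_left_mono[OF less_imp_le[OF UF(2)], of "cmod z"] by simp
      have "H_norm U \<le> H_norm (U - U') + H_norm U'" by (rule H_norm_diff_ge(1)[OF H(1) H'(1)])
      also have "\<dots> \<le> e / B + K * (e / B + cmod z * (e / B) + H_norm F)"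
        using UF(2) K(2)[OF U'] mult_left_mono[OF E1 K(1)] by (simp add: E_def F')
      also have "\<dots> = K * H_norm F + e / B * B" 
      proof -
        have "q + K * (q + c * q + h) = K * h + q * (1 + K * (1 + c))" for q h c by (simp add: algebra_simps)
        from this[of "e / B" "cmod z" "H_norm F"] show ?thesis by (simp only: B_def)
      qed
      finally show ?thesis using B by simp
    qed
    then show "U \<in> Hspace \<and> F \<in> Hspace \<and> H_norm U \<le> K * H_norm F"
      using H FH by (auto intro: field_le_epsilon)
  qed
qed

lemma wave_potential_eq: "wave_potential \<alpha> z x = z * (z + of_real (2 * \<alpha> / x))"
  by (simp add: wave_potential_def power2_eq_square algebra_simps)

text \<open>With a source h in \<open>L2\<close>, and not merely integrable, p has the square
  integrable weak derivative h + q \<open>prim p\<close>, where q is the potential; hence its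
  primitive lies in \<open>W22\<close>.\<close>

lemma dirichlet_solution_regular:
  assumes p: "continuous_on {0..1} p" "prim p 1 = 0"
    and eq: "\<And>x. 0 \<le> x \<Longrightarrow> x \<le> 1 \<Longrightarrow> p x = c + prim h x + volterra \<alpha> z p x" and h: "h \<in> L2"
  shows "prim p \<in> W012 \<inter> W22" 
    "AE x in I01. weak_deriv (weak_deriv (prim p)) x = h x + wave_potential \<alpha> z x * prim p x"
    "has_weak_derivative (prim p) p"
proof -
  have pL: "p \<in> L2" by (rule L2_continuous[OF p(1)])
  note W = primitive_in_W012[OF pL p(2) prim_L2[OF pL], simplified]
  have kL: "(\<lambda>x. h x + wave_potential \<alpha> z x * prim p x) \<in> L2"
    by (intro L2_add h potential_times_prim_L2 p)
  have "has_weak_derivative (\<lambda>x. c + prim (\<lambda>x. h x + wave_potential \<alpha> z x * prim p x) x) (\<lambda>x. h x + wave_potential \<alpha> z x * prim p x)"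
    by (rule prim_weak_derivative[OF kL])
  then have pw: "has_weak_derivative p (\<lambda>x. h x + wave_potential \<alpha> z x * prim p x)"
  proof (rule has_weak_derivative_cong_AE)
    show "AE x in I01. c + prim (\<lambda>x. h x + wave_potential \<alpha> z x * prim p x) x = p x"
      by (intro AE_I01I) (simp add: eq volterra_def prim_add L2_integrable h potential_times_prim_L2 p)
  qed (use pL kL in auto)
  show 1: "has_weak_derivative (prim p) p" by (rule W(2))
  show W22: "prim p \<in> W012 \<inter> W22" using W(1) 1 pw by (auto simp: W22_def)
  have w2: "has_weak_derivative (weak_deriv (prim p)) (weak_deriv (weak_deriv (prim p)))"
    using W22_weak_second_derivative(2)[of "prim p"] W22 by auto
  have "has_weak_derivative p (weak_deriv (weak_deriv (prim p)))"
    by (rule has_weak_derivative_cong_AE[OF w2 weak_deriv_AE_eq[OF 1] AE_I2[OF refl] pL has_weak_derivative_L2(2)[OF w2]])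
  from weak_derivative_unique[OF this pw]
  show "AE x in I01. weak_deriv (weak_deriv (prim p)) x = h x + wave_potential \<alpha> z x * prim p x" .
qed

lemma W22_lincomb:
  assumes "f \<in> W22" "g \<in> W22" shows "(\<lambda>x. f x + c * g x) \<in> W22"
proof -
  from assms obtain f1 f2 g1 g2 where 
    "has_weak_derivative f f1" "has_weak_derivative f1 f2" "has_weak_derivative g g1" "has_weak_derivative g1 g2"
    by (auto simp: W22_def)
  then have "has_weak_derivative (\<lambda>x. f x + c * g x) (\<lambda>x. f1 x + c * g1 x)"
    "has_weak_derivative (\<lambda>x. f1 x + c * g1 x) (\<lambda>x. f2 x + c * g2 x)"
    by (simp_all add: has_weak_derivative_lincomb)
  then show ?thesis unfolding W22_def by blast
qed

lemma test_function_W22: "\<phi> \<in> test_functions \<Longrightarrow> \<phi> \<in> W22"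
proof -
  assume \<phi>: "\<phi> \<in> test_functions"
  obtain \<phi>' where \<phi>': "\<phi>' \<in> test_functions" "\<And>x. (\<phi> has_vector_derivative \<phi>' x) (at x)"
    by (rule test_function_deriv[OF \<phi>]) blast
  obtain \<phi>'' where \<phi>'': "\<phi>'' \<in> test_functions" "\<And>x. (\<phi>' has_vector_derivative \<phi>'' x) (at x)"
    by (rule test_function_deriv[OF \<phi>'(1)]) blast
  show ?thesis unfolding W22_def
    using test_function_weak_derivative(1)[OF \<phi> \<phi>'] test_function_weak_derivative(1)[OF \<phi>'(1) \<phi>''] by blast
qed

lemma source_diff:
  assumes "f \<in> L2" "f2 \<in> L2" "0 \<le> x" "x \<le> 1"
  shows "source \<alpha> z f g x - source \<alpha> z f2 g x = source \<alpha> z (\<lambda>t. f t - f2 t) (\<lambda>_. 0) x"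
  using assms by (simp add: source_def prim_diff L2_integrable algebra_simps diff_divide_distrib)

text \<open>For F = (f, g) with f only in \<open>W012\<close>, the component v = f + z u need not be
  in \<open>W22\<close>. Replacing f by a test function \<phi> gives an exact solution in the domain
  of G0 with right-hand side (\<phi>, g). Its graph distance to the candidate is at most a multiple
  of the \<open>L2\<close> distance between f' and \<phi>'.\<close>

lemma op_shift_G_surjective:
  assumes w: "fundamental_derivative \<alpha> z w" "prim w 1 \<noteq> 0" and F: "F \<in> Hspace"
  shows "\<exists>U. (U, F) \<in> op_shift (G \<alpha>) z"
proof -
  obtain D where D: "D > 0" and Db: "\<And>p c h A x. continuous_on {0..1} p \<Longrightarrow> prim p 1 = 0 \<Longrightarrow>
    (\<And>x. 0 \<le> x \<Longrightarrow> x \<le> 1 \<Longrightarrow> p x = c + h x + volterra \<alpha> z p x) \<Longrightarrow>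
    (\<And>x. 0 \<le> x \<Longrightarrow> x \<le> 1 \<Longrightarrow> cmod (h x) \<le> A) \<Longrightarrow> 0 \<le> x \<Longrightarrow> x \<le> 1 \<Longrightarrow> cmod (p x) \<le> D * A"
    by (rule dirichlet_solution_bound[OF w]) blast
  obtain K0 where K0: "K0 > 0" and si: "\<And>f g. f \<in> L2 \<Longrightarrow> g \<in> L2 \<Longrightarrow> integrable I01 (source \<alpha> z f g)"
    and sb: "\<And>f g. f \<in> L2 \<Longrightarrow> g \<in> L2 \<Longrightarrow> (LINT x|I01. cmod (source \<alpha> z f g x)) \<le> K0 * (L2_norm f + L2_norm g)"
    by (rule source_bound) blast
  have solve: "\<exists>p c. continuous_on {0..1} p \<and> prim p 1 = 0 \<and> 
      (\<forall>x\<in>{0..1}. p x = c + prim (source \<alpha> z f g) x + volterra \<alpha> z p x)" if "f \<in> L2" "g \<in> L2" for f g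
  proof -
    have "continuous_on {0..1} (prim (source \<alpha> z f g))" by (intro prim_continuous si that)
    from dirichlet_solution_exists[OF w this] show ?thesis by (metis atLeastAtMost_iff)
  qed
  obtain f g where Ff: "F = (f, g)" by (metis prod.exhaust)
  have fW: "f \<in> W012" and g: "g \<in> L2" using F by (auto simp: Hspace_def Ff)
  obtain f' where f': "f' \<in> L2" "prim f' 1 = 0" "AE x in I01. f x = prim f' x" "has_weak_derivative f f'"
    by (rule W012_imp_primitive[OF fW])
  have fL: "f \<in> L2" by (rule has_weak_derivative_L2[OF f'(4)])
  obtain p c where p: "continuous_on {0..1} p" "prim p 1 = 0" 
    and pe: "\<And>x. x \<in> {0..1} \<Longrightarrow> p x = c + prim (source \<alpha> z f' g) x + volterra \<alpha> z p x"
    using solve[OF f'(1) g] by blast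
  have pL: "p \<in> L2" by (rule L2_continuous[OF p(1)])
  note Wp = primitive_in_W012[OF pL p(2) prim_L2[OF pL], simplified]
  define v where "v x = f x + z * prim p x" for x
  define U where "U = (prim p, v)"
  define F1 where "F1 = ((\<lambda>x. f x + z * prim p x), (\<lambda>x. g x + z * v x))"
  have vW: "v \<in> W012" unfolding v_def by (rule W012_lincomb[OF fW Wp(1)])
  have vw: "has_weak_derivative v (\<lambda>x. f' x + z * p x)" unfolding v_def by (rule has_weak_derivative_lincomb[OF f'(4) Wp(2)])
  have vL: "v \<in> L2" by (rule has_weak_derivative_L2[OF vw])
  have gvL: "(\<lambda>x. g x + z * v x) \<in> L2" by (intro L2_add L2_mult_const g vL)
  have UF: "F = F1 - H_scale z U" by (auto simp: Ff F1_def U_def H_scale_def fun_eq_iff)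
  have UH: "U \<in> Hspace" unfolding U_def Hspace_def using Wp(1) vL by auto
  have F1H: "F1 \<in> Hspace" unfolding F1_def Hspace_def using vW[unfolded v_def] gvL by auto
  \<comment> \<open>Chosen so that K d dominates both graph distances below, d being the
    \<open>L2\<close> error in f': the derivative of u is off by at most D K0 d, v and its
    derivative by d + |z| D K0 d, and passing to the image costs a further factor 1 + |z|.\<close>
  define K where "K = (1 + cmod z) * (1 + (1 + cmod z) * (D * K0))"
  have K: "K > 0" unfolding K_def using D K0 by (intro mult_pos_pos add_pos_nonneg) auto
  have "\<exists>(U', F')\<in>G0 \<alpha>. H_norm (U - U') < e \<and> H_norm (F1 - F') < e" if "e > 0" for e
  proof -
    obtain \<phi> \<phi>' where \<phi>: "\<phi> \<in> test_functions" "\<phi>' \<in> test_functions" "\<And>x. (\<phi> has_vector_derivative \<phi>' x) (at x)"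
      and app: "L2_norm (\<lambda>x. f' x - \<phi>' x) < e / (2 * K)"
      by (rule mean_zero_test_functions_dense[OF f'(1,2), of "e / (2 * K)"]) (use K \<open>e > 0\<close> in auto)
    define d where "d = L2_norm (\<lambda>x. f' x - \<phi>' x)"
    note \<phi>w = test_function_weak_derivative[OF \<phi>]
    have \<phi>L: "\<phi> \<in> L2" "\<phi>' \<in> L2" using \<phi> by (auto intro: test_function_L2)
    have hL: "source \<alpha> z \<phi>' g \<in> L2" by (intro source_L2 test_function_continuous \<phi> g)
    obtain r c2 where r: "continuous_on {0..1} r" "prim r 1 = 0" 
      and re: "\<And>x. x \<in> {0..1} \<Longrightarrow> r x = c2 + prim (source \<alpha> z \<phi>' g) x + volterra \<alpha> z r x"
      using solve[OF \<phi>L(2) g] by blast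
    have rL: "r \<in> L2" by (rule L2_continuous[OF r(1)])
    have reg: "prim r \<in> W012 \<inter> W22" "AE x in I01. weak_deriv (weak_deriv (prim r)) x = source \<alpha> z \<phi>' g x + wave_potential \<alpha> z x * prim r x"
      "has_weak_derivative (prim r) r"
      using dirichlet_solution_regular[OF r re hL] by auto
    define v' where "v' x = \<phi> x + z * prim r x" for x
    have v'W: "v' \<in> W012 \<inter> W22" unfolding v'_def
      using W012_lincomb[OF test_function_W012[OF \<phi>(1)], of "prim r" z] W22_lincomb[OF test_function_W22[OF \<phi>(1)], of "prim r" z] reg(1)
      by auto
    have v'w: "has_weak_derivative v' (\<lambda>x. \<phi>' x + z * r x)" unfolding v'_def by (rule has_weak_derivative_lincomb[OF \<phi>w(1) reg(3)])
    have v'L: "v' \<in> L2" by (rule has_weak_derivative_L2[OF v'w])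
    define U' where "U' = (prim r, v')"
    have U'd: "U' \<in> G0_dom" unfolding U'_def G0_dom_def using reg(1) v'W by auto
    define F' where "F' = G0_app \<alpha> U'"
    have F'0: "(U', F') \<in> G0 \<alpha>" unfolding G0_def F'_def using U'd by blast
    define y where "y x = weak_deriv (weak_deriv (prim r)) x - of_real (2 * \<alpha> / x) * v' x" for x
    have F'eq: "F' = (v', y)" unfolding F'_def U'_def G0_app_def y_def by simp
    have yL: "y \<in> L2" using G0_app_Hspace(2)[OF U'd, of \<alpha>] by (simp add: F'_def[symmetric] F'eq Hspace_def)
    \<comment> \<open>By the choice of the source the singular terms cancel: up to null sets, G0 - z
      maps the approximant exactly to (\<phi>, g).\<close>
    have yae: "AE x in I01. y x = g x + z * v' x"
      using reg(2) by (rule AE_mp, intro AE_I01I impI) 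
        (simp add: y_def v'_def source_def wave_potential_eq \<phi>w(2) algebra_simps del: of_real_mult of_real_divide)
    have pr: "cmod (p x - r x) \<le> D * (K0 * d)" if x: "0 \<le> x" "x \<le> 1" for x
    proof (rule Db[where h = "prim (source \<alpha> z (\<lambda>t. f' t - \<phi>' t) (\<lambda>_. 0))" and c = "c - c2", OF _ _ _ _ x])
      show "continuous_on {0..1} (\<lambda>x. p x - r x)" by (intro continuous_intros p r)
      show "prim (\<lambda>x. p x - r x) 1 = 0"
        by (simp add: prim_diff integrable_I01_continuous p r)
      fix s :: real assume s: "0 \<le> s" "s \<le> 1"
      have "prim (source \<alpha> z f' g) s - prim (source \<alpha> z \<phi>' g) s = prim (\<lambda>t. source \<alpha> z f' g t - source \<alpha> z \<phi>' g t) s"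
        by (simp add: prim_diff si f'(1) \<phi>L g s)
      also have "\<dots> = prim (source \<alpha> z (\<lambda>t. f' t - \<phi>' t) (\<lambda>_. 0)) s"
        by (rule prim_cong) (use s in \<open>simp add: source_diff f'(1) \<phi>L\<close>)
      finally have h: "prim (source \<alpha> z f' g) s - prim (source \<alpha> z \<phi>' g) s = prim (source \<alpha> z (\<lambda>t. f' t - \<phi>' t) (\<lambda>_. 0)) s" .
      have "volterra \<alpha> z (\<lambda>x. p x - r x) s = volterra \<alpha> z p s - volterra \<alpha> z r s"
        using volterra_lincomb[OF p(1) r(1) s, of \<alpha> z "-1"] by simp
      then show "p s - r s = c - c2 + prim (source \<alpha> z (\<lambda>t. f' t - \<phi>' t) (\<lambda>_. 0)) s + volterra \<alpha> z (\<lambda>x. p x - r x) s"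
        using pe[of s] re[of s] s h[symmetric] by simp
      have dL: "(\<lambda>t. f' t - \<phi>' t) \<in> L2" by (intro L2_diff f'(1) \<phi>L)
      show "cmod (prim (source \<alpha> z (\<lambda>t. f' t - \<phi>' t) (\<lambda>_. 0)) s) \<le> K0 * d"
        using norm_prim_le_L1[OF si[OF dL L2_const] s, of 0] sb[OF dL L2_const, of 0] by (simp add: d_def)
    qed
    have dpL: "(\<lambda>x. p x - r x) \<in> L2" by (intro L2_diff pL rL)
    have prn: "L2_norm (p - r) \<le> D * (K0 * d)" unfolding fun_diff_def
      by (rule L2_norm_le_const[OF dpL]) (use pr in auto)
    have vv': "L2_norm (\<lambda>x. (f' x + z * p x) - (\<phi>' x + z * r x)) \<le> d + cmod z * (D * (K0 * d))"
    proof -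
      have "L2_norm (\<lambda>x. (f' x + z * p x) - (\<phi>' x + z * r x)) = L2_norm (\<lambda>x. (f' x - \<phi>' x) + z * (p x - r x))"
        by (rule arg_cong[where f = L2_norm]) (auto simp: algebra_simps)
      also have "\<dots> \<le> d + cmod z * L2_norm (\<lambda>x. p x - r x)"
        using L2_norm_triangle[OF L2_diff[OF f'(1) \<phi>L(2)] L2_mult_const[OF dpL, of z]] 
        by (simp add: d_def L2_norm_scale)
      also have "\<dots> \<le> d + cmod z * (D * (K0 * d))" using prn by (intro add_left_mono mult_left_mono) (auto simp: fun_diff_def)
      finally show ?thesis .
    qed
    have vae: "AE x in I01. v x - v' x = prim (\<lambda>x. (f' x + z * p x) - (\<phi>' x + z * r x)) x"
      using f'(3)
    proof (rule AE_mp, intro AE_I01I impI)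
      fix x :: real assume x: "0 < x" "x < 1" "f x = prim f' x"
      then show "v x - v' x = prim (\<lambda>x. (f' x + z * p x) - (\<phi>' x + z * r x)) x"
        by (simp add: v_def v'_def prim_diff prim_add prim_mult L2_integrable f'(1) pL rL \<phi>L \<phi>w(2) L2_add L2_mult_const)
    qed
    have vL2: "(\<lambda>x. (f' x + z * p x) - (\<phi>' x + z * r x)) \<in> L2" by (intro L2_diff L2_add L2_mult_const f'(1) pL rL \<phi>L)
    have vn: "L2_norm (v - v') \<le> d + cmod z * (D * (K0 * d))"
      using L2_norm_cong_AE[OF vae L2_diff[OF vL v'L] prim_L2[OF vL2]] L2_norm_prim_le[OF vL2] vv' by (simp add: fun_diff_def)
    have dd: "d \<ge> 0" by (simp add: d_def)
    have H1: "H_norm (U - U') \<le> D * (K0 * d) + (d + cmod z * (D * (K0 * d)))"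
    proof -
      have "U - U' = (prim p - prim r, v - v')" by (simp add: U_def U'_def)
      then show ?thesis using H_norm_le[OF has_weak_derivative_diff[OF Wp(2) reg(3)] L2_diff'[OF vL v'L]] prn vn by simp
    qed
    have H2: "H_norm (F1 - F') \<le> (d + cmod z * (D * (K0 * d))) + cmod z * (d + cmod z * (D * (K0 * d)))"
    proof -
      define G where "G = (\<lambda>x. g x + z * v x) - y"
      have GL: "G \<in> L2" unfolding G_def by (rule L2_diff'[OF gvL yL])
      have "AE x in I01. G x = z * (v x - v' x)"
        using yae by (rule eventually_mono) (simp add: G_def algebra_simps)
      then have "L2_norm G = cmod z * L2_norm (v - v')"
        using L2_norm_cong_AE[OF _ GL L2_mult_const[OF L2_diff[OF vL v'L]], of z] by (simp add: L2_norm_scale fun_diff_def)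
      then have Gn: "L2_norm G \<le> cmod z * (d + cmod z * (D * (K0 * d)))"
        using vn by (simp add: mult_left_mono)
      have "F1 - F' = (v - v', G)" by (simp add: F1_def F'eq G_def v_def[abs_def])
      then show ?thesis using H_norm_le[OF has_weak_derivative_diff[OF vw v'w] GL] Gn vv' by (simp add: fun_diff_def)
    qed
    have Kd: "K * d < e"
    proof -
      have "K * d \<le> K * (e / (2 * K))" using app K by (intro mult_left_mono) (auto simp: d_def)
      then show ?thesis using K \<open>e > 0\<close> by simp
    qed
    define q where "q = D * (K0 * d)"
    have q: "q \<ge> 0" unfolding q_def using D K0 dd by simp
    have Kq: "K * d = (1 + cmod z) * (d + (1 + cmod z) * q)" 
      unfolding K_def q_def by (simp only: ring_distribs mult_1 mult_1_right mult_ac)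
    have "0 \<le> cmod z * (d + (1 + cmod z) * q)" using dd q by simp
    then have "q + (d + cmod z * q) \<le> K * d"
      unfolding Kq by (simp only: ring_distribs mult_1 mult_1_right)
    moreover have "(1 + cmod z) * (d + cmod z * q) \<le> K * d"
      unfolding Kq using q by (intro mult_left_mono) (auto simp: ring_distribs)
    then have "(d + cmod z * q) + cmod z * (d + cmod z * q) \<le> K * d"
      by (simp only: ring_distribs mult_1)
    moreover note H1[folded q_def] H2[folded q_def]
    ultimately have "H_norm (U - U') < e" "H_norm (F1 - F') < e" using Kd by linarith+
    with F'0 show ?thesis by blast
  qed
  then have "(U, F1) \<in> G \<alpha>" unfolding G_def op_closure_def using UH F1H by simp
  then show ?thesis unfolding op_shift_def using UF by blast
qed

section \<open>Resolvent set and eigenvectors\<close>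

lemma H_norm_nonneg:
  assumes "U \<in> Hspace" shows "0 \<le> H_norm U"
proof -
  obtain u v where U: "U = (u, v)" by (metis prod.exhaust)
  with assms have uv: "u \<in> W012" "v \<in> L2" by (auto simp: Hspace_def)
  obtain p where p: "has_weak_derivative u p" using uv(1) by (auto simp: W012_def W12_def)
  show ?thesis unfolding U by (rule order_trans[OF L2_norm_nonneg H_norm_ge(1)[OF p uv(2)]])
qed

text \<open>Definiteness rests on the boundary value at 0: a vanishing derivative alone would leave
  a constant.\<close>

lemma H_null_iff_norm:
  assumes "U \<in> Hspace" shows "H_null U \<longleftrightarrow> H_norm U = 0"
proof -
  obtain u v where U: "U = (u, v)" by (metis prod.exhaust)
  with assms have uv: "u \<in> W012" "v \<in> L2" by (auto simp: Hspace_def)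
  obtain p where p: "p \<in> L2" "prim p 1 = 0" "AE x in I01. u x = prim p x" "has_weak_derivative u p"
    by (rule W012_imp_primitive[OF uv(1)])
  have z: "L2_norm (\<lambda>_. 0) = 0" by simp
  show ?thesis
  proof
    assume n: "H_null U"
    then have uv0: "AE x in I01. u x = 0 \<and> v x = 0" by (simp add: H_null_def U)
    have u0: "AE x in I01. 0 + prim (\<lambda>_. 0) x = u x" and v0: "AE x in I01. v x = 0"
      by (rule eventually_mono[OF uv0], simp add: prim_def)+
    have "has_weak_derivative (\<lambda>x. 0 + prim (\<lambda>_. 0) x) (\<lambda>_. 0)" by (rule prim_weak_derivative[OF L2_const])
    then have uw0: "has_weak_derivative u (\<lambda>_. 0)"
      by (rule has_weak_derivative_cong_AE[OF _ u0 AE_I2[OF refl] has_weak_derivative_L2(1)[OF p(4)] L2_const])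
    show "H_norm U = 0" unfolding U H_norm_eq[OF uw0 uv(2)] using L2_norm_cong_AE[OF v0 uv(2) L2_const] by simp
  next
    assume "H_norm U = 0"
    then have "L2_norm p = 0" "L2_norm v = 0"
      using H_norm_ge[OF p(4) uv(2)] L2_norm_nonneg[of p] L2_norm_nonneg[of v] unfolding U by linarith+
    then have ae: "AE x in I01. p x = 0" "AE x in I01. v x = 0"
      using L2_norm_eq_0_imp_AE[OF p(1)] L2_norm_eq_0_imp_AE[OF uv(2)] by auto
    have "prim p x = 0" if "0 \<le> x" "x \<le> 1" for x
      using prim_cong_AE[OF ae(1) L2_integrable[OF p(1)] integrable_const_I01 that] by (simp add: prim_def)
    then have "AE x in I01. u x = 0" by (intro p(3)[THEN AE_mp, OF AE_I01I] impI) simp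
    then show "H_null U" unfolding H_null_def U using ae(2) by (simp add: eventually_conj)
  qed
qed

lemma resolvent_set_G:
  assumes w: "fundamental_derivative \<alpha> z w" "prim w 1 \<noteq> 0"
  shows "z \<notin> op_spectrum (G \<alpha>)"
proof -
  obtain K where K: "K \<ge> 0" "\<And>U F. (U, F) \<in> op_shift (G \<alpha>) z \<Longrightarrow> U \<in> Hspace \<and> F \<in> Hspace \<and> H_norm U \<le> K * H_norm F"
    by (rule G_apriori_bound[OF w]) blast
  have "H_null U" if UF: "(U, F) \<in> op_shift (G \<alpha>) z" "H_null F" for U F
  proof -
    have "H_norm F = 0" using K(2)[OF UF(1)] UF(2) H_null_iff_norm by blast
    moreover have "H_norm U \<ge> 0" using K(2)[OF UF(1)] H_norm_nonneg by blast
    ultimately have "H_norm U = 0" using K(2)[OF UF(1)] by simp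
    then show ?thesis using H_null_iff_norm K(2)[OF UF(1)] by blast
  qed
  then show ?thesis unfolding op_spectrum_def op_resolvent_set_def
    using op_shift_G_surjective[OF w] K(2) by blast
qed

text \<open>The eigenvector already lies in the domain of G0. The closure enters because
  \<open>G0_app\<close> agrees with z U only almost everywhere, not as a function: their difference
  has norm 0. The scaling \<kappa> serves the Laguerre normalisation.\<close>

lemma eigenvector_G:
  assumes w: "fundamental_derivative \<alpha> z w" "prim w 1 = 0" and "\<kappa> \<noteq> 0"
    and f: "continuous_on {0..1} f" "\<And>x. 0 \<le> x \<Longrightarrow> x \<le> 1 \<Longrightarrow> f x = \<kappa> * prim w x"
  shows "is_eigenvector (G \<alpha>) z (f, \<lambda>x. z * f x)"
proof -
  have wc: "continuous_on {0..1} w" and wv: "\<And>x. 0 \<le> x \<Longrightarrow> x \<le> 1 \<Longrightarrow> w x = 1 + volterra \<alpha> z w x"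
    using w by (auto simp: fundamental_derivative_def)
  define p where "p x = \<kappa> * w x" for x
  have pc: "continuous_on {0..1} p" unfolding p_def by (intro continuous_intros wc)
  have pp: "prim p x = \<kappa> * prim w x" for x unfolding p_def by (rule prim_mult)
  have fp: "f x = prim p x" if "0 \<le> x" "x \<le> 1" for x using f(2)[OF that] pp by simp
  have pe: "p x = \<kappa> + prim (\<lambda>_. 0) x + volterra \<alpha> z p x" if "0 \<le> x" "x \<le> 1" for x
  proof -
    have "volterra \<alpha> z p x = \<kappa> * volterra \<alpha> z w x"
      unfolding volterra_def pp prim_mult[symmetric] by (simp add: mult_ac)
    then show ?thesis using wv[OF that] by (simp add: p_def prim_def algebra_simps)
  qed
  have p1: "prim p 1 = 0" using pp w(2) by simp
  note reg = dirichlet_solution_regular[OF pc p1 pe L2_const, simplified]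
  have fL: "f \<in> L2" by (rule L2_continuous[OF f(1)])
  have pfae: "AE x in I01. prim p x = f x" by (intro AE_I01I) (simp add: fp)
  have fw: "has_weak_derivative f p"
    by (rule has_weak_derivative_cong_AE[OF reg(3) pfae AE_I2[OF refl] fL L2_continuous[OF pc]])
  have pL: "p \<in> L2" by (rule L2_continuous[OF pc])
  have w2: "has_weak_derivative (weak_deriv (prim p)) (weak_deriv (weak_deriv (prim p)))"
    using W22_weak_second_derivative(2)[of "prim p"] reg(1) by auto
  have pw: "has_weak_derivative p (weak_deriv (weak_deriv (prim p)))"
    by (rule has_weak_derivative_cong_AE[OF w2 weak_deriv_AE_eq[OF reg(3)] AE_I2[OF refl] pL has_weak_derivative_L2(2)[OF w2]])
  have fW: "f \<in> W012 \<inter> W22"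
    using primitive_in_W012(1)[OF L2_continuous[OF pc] p1 fL] pfae fw pw by (auto simp: W22_def eq_commute)
  have zf: "(\<lambda>x. z * f x) \<in> W012 \<inter> W22"
    using W012_lincomb[of f f "z - 1"] W22_lincomb[of f f "z - 1"] fW by (auto simp: algebra_simps)
  have d2: "AE x in I01. weak_deriv (weak_deriv f) x = wave_potential \<alpha> z x * f x"
  proof -
    have f2: "has_weak_derivative (weak_deriv f) (weak_deriv (weak_deriv f))" 
      using W22_weak_second_derivative(2)[of f] fW by auto
    have "has_weak_derivative p (weak_deriv (weak_deriv f))"
      by (rule has_weak_derivative_cong_AE[OF f2 weak_deriv_AE_eq[OF fw] AE_I2[OF refl] pL has_weak_derivative_L2(2)[OF f2]])
    from weak_derivative_unique[OF this pw] reg(2) pfae show ?thesis by eventually_elim simp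
  qed
  define U where "U = (f, \<lambda>x. z * f x)"
  have Ud: "U \<in> G0_dom" using fW zf by (auto simp: U_def G0_dom_def)
  have UG: "(U, G0_app \<alpha> U) \<in> G0 \<alpha>" using Ud unfolding G0_def by blast
  note UH = G0_app_Hspace[OF Ud]
  have sH: "H_scale z U \<in> Hspace" by (rule H_scale_norm(1)[OF UH(1)])
  have "H_norm (U - U) = 0"
    by (subst H_null_iff_norm[symmetric]) (auto intro: H_norm_diff_ge UH simp: H_null_def)
  moreover have "H_norm (H_scale z U - G0_app \<alpha> U) = 0"
  proof (subst H_null_iff_norm[symmetric])
    show "H_scale z U - G0_app \<alpha> U \<in> Hspace" by (intro H_norm_diff_ge UH sH)
    show "H_null (H_scale z U - G0_app \<alpha> U)"
      unfolding H_null_def using d2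
      by (rule AE_mp, intro AE_I01I impI) (simp add: U_def H_scale_def G0_app_def wave_potential_eq algebra_simps del: of_real_mult of_real_divide)
  qed
  ultimately have "(U, H_scale z U) \<in> G \<alpha>"
    unfolding G_def op_closure_def using UH sH UG by (auto intro!: bexI[of _ "(U, G0_app \<alpha> U)"])
  \<comment> \<open>If f vanished almost everywhere, then by continuity so would
    \<open>prim w\<close> everywhere and w on (0, 1), against w = 1 +
    \<open>volterra \<alpha> z w\<close> at 1/2.\<close>
  moreover have "\<not> H_null U"
  proof
    assume "H_null U"
    then have "AE x in I01. f x = 0 \<and> z * f x = 0" by (simp add: H_null_def U_def)
    then have f0: "AE x in I01. f x = 0" by (rule eventually_mono) simp
    have "(LINT x|I01. (cmod (f x))\<^sup>2) = (LINT x|I01. 0)"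
      by (rule integral_cong_AE) (use f0 fL in \<open>auto\<close>)
    then have "integral {0..1} (\<lambda>x. (cmod (f x))\<^sup>2) = 0"
      using LINT_I01_eq_integral[OF L2_square_integrable[OF fL]] by simp
    moreover have "continuous_on {0..1} (\<lambda>x. (cmod (f x))\<^sup>2)" by (intro continuous_intros f)
    ultimately have "\<forall>x\<in>{0..1}. f x = 0" by (subst (asm) integral_eq_0_iff) auto
    then have p0: "prim w x = 0" if "0 \<le> x" "x \<le> 1" for x using f(2)[OF that] that \<open>\<kappa> \<noteq> 0\<close> by simp
    have w0: "w x = 0" if "0 < x" "x < 1" for x
    proof -
      have "((\<lambda>_. 0) has_vector_derivative 0) (at x)" by simp
      then have "(prim w has_vector_derivative 0) (at x)"
        by (rule has_vector_derivative_transform_within_open[of _ _ _ "{0<..<1}"]) (use that p0 in auto)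
      then show ?thesis using prim_has_derivative[OF wc that] vector_derivative_unique_at by blast
    qed
    have "volterra \<alpha> z w (1/2) = prim (\<lambda>_. 0) (1/2)" 
      unfolding volterra_def by (rule prim_cong) (simp add: p0)
    then have "volterra \<alpha> z w (1/2) = 0" by (simp add: prim_def)
    then show False using wv[of "1/2"] w0[of "1/2"] by simp
  qed
  ultimately show ?thesis by (simp add: is_eigenvector_def U_def)
qed

lemma eigenvector_in_spectrum:
  assumes "is_eigenvector (G \<alpha>) z U" shows "z \<in> op_spectrum (G \<alpha>)"
proof -
  have "(U, H_scale z U - H_scale z U) \<in> op_shift (G \<alpha>) z" "\<not> H_null U"
    using assms unfolding is_eigenvector_def op_shift_def by blast+
  moreover have "H_null (H_scale z U - H_scale z U)" by (simp add: H_null_def)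
  ultimately show ?thesis unfolding op_spectrum_def op_resolvent_set_def by blast
qed

section \<open>The Kummer function with second parameter 2\<close>

text \<open>Kept polymorphic because the positive zeros are counted over the reals, while the
  spectrum needs the complex function.\<close>

definition kum_coeff :: "'a::{real_normed_field,banach} \<Rightarrow> nat \<Rightarrow> 'a" where
  "kum_coeff a j = pochhammer a j / (pochhammer 2 j * fact j)"

definition kum :: "'a::{real_normed_field,banach} \<Rightarrow> 'a \<Rightarrow> 'a" where
  "kum a z = (\<Sum>j. kum_coeff a j * z ^ j)"

definition kum_deriv :: "'a::{real_normed_field,banach} \<Rightarrow> 'a \<Rightarrow> 'a" where
  "kum_deriv a z = (\<Sum>j. diffs (kum_coeff a) j * z ^ j)"

lemma kummer_M_eq_kum: "kummer_M a 2 z = kum a z"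
  by (simp add: kummer_M_def kum_def kum_coeff_def)

lemma pochhammer_2: "pochhammer 2 j = (fact (Suc j) :: 'a::{real_normed_field,banach})"
  using pochhammer_rec[of "1::'a" j] by (simp add: pochhammer_fact[symmetric])

lemma kum_coeff_0 [simp]: "kum_coeff a 0 = 1"
  by (simp add: kum_coeff_def)

lemma kum_coeff_Suc: "kum_coeff a (Suc j) = kum_coeff a j * (a + of_nat j) / (of_nat (Suc j) * of_nat (Suc (Suc j)))"
  by (simp add: kum_coeff_def pochhammer_2 pochhammer_Suc field_simps)

lemma summable_kum: 
  fixes a z :: "'a::{real_normed_field,banach}"
  shows "summable (\<lambda>j. kum_coeff a j * z ^ j)"
proof (rule summable_ratio_test)
  show "(1/2::real) < 1" by simp
  fix n assume n: "nat \<lceil>2 * (norm a + 1) * norm z\<rceil> \<le> n"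
  define A where "A = norm a + 1"
  have A: "A \<ge> 1" by (simp add: A_def)
  have nb: "2 * A * norm z \<le> real n" using n unfolding A_def by linarith
  have "norm (a + of_nat n) \<le> norm a + real n" using norm_triangle_ineq[of a "of_nat n"] by simp
  also have "\<dots> \<le> A * real (Suc n)" by (simp add: A_def algebra_simps)
  finally have 1: "norm (a + of_nat n) \<le> A * real (Suc n)" .
  have "norm (kum_coeff a (Suc n) * z ^ Suc n) = norm (kum_coeff a n * z ^ n) * (norm (a + of_nat n) * norm z / (real (Suc n) * real (Suc (Suc n))))"
    by (simp add: kum_coeff_Suc norm_mult norm_divide norm_power del: of_nat_Suc)
  also have "\<dots> \<le> norm (kum_coeff a n * z ^ n) * (A * real (Suc n) * norm z / (real (Suc n) * real (Suc (Suc n))))"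
    using 1 by (intro mult_left_mono divide_right_mono mult_right_mono) auto
  also have "A * real (Suc n) * norm z / (real (Suc n) * real (Suc (Suc n))) = A * norm z / real (Suc (Suc n))"
    by (simp add: field_simps del: of_nat_Suc)
  also have "\<dots> \<le> 1/2" using nb by (simp add: field_simps)
  finally show "norm (kum_coeff a (Suc n) * z ^ Suc n) \<le> 1/2 * norm (kum_coeff a n * z ^ n)"
    by (simp add: mult_left_mono)
qed

lemma kum_has_derivative: "(kum a has_field_derivative kum_deriv a z) (at z)"
  unfolding kum_def[abs_def] kum_deriv_def
  by (rule termdiffs_strong_converges_everywhere[OF summable_kum])

lemma kum_has_derivative_chain [derivative_intros]:
  "(f has_field_derivative D) (at x) \<Longrightarrow> ((\<lambda>x. kum a (f x)) has_field_derivative kum_deriv a (f x) * D) (at x)"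
  by (rule DERIV_chain2[OF kum_has_derivative])

lemma kum_continuous [continuous_intros]: "continuous_on A f \<Longrightarrow> continuous_on A (\<lambda>x. kum a (f x))"
  by (rule continuous_on_compose2[of UNIV "kum a"])
    (auto intro!: continuous_at_imp_continuous_on DERIV_isCont[OF kum_has_derivative])

lemma kum_0 [simp]: "kum a 0 = 1"
  unfolding kum_def by (subst powser_zero) simp

lemma summable_kum_deriv_series:
  fixes a z :: "'a::{real_normed_field,banach}"
  shows "summable (\<lambda>j. of_nat j * kum_coeff a j * z ^ j)" "z * kum_deriv a z = (\<Sum>j. of_nat j * kum_coeff a j * z ^ j)"
proof -
  have "(\<lambda>j. diffs (kum_coeff a) j * z ^ j) sums kum_deriv a z"
    unfolding kum_deriv_def by (intro summable_sums termdiff_converges_all summable_kum)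
  then have "(\<lambda>j. z * (diffs (kum_coeff a) j * z ^ j)) sums (z * kum_deriv a z)" by (rule sums_mult)
  then have "(\<lambda>j. of_nat (Suc j) * kum_coeff a (Suc j) * z ^ Suc j) sums (z * kum_deriv a z)"
    by (simp add: diffs_def mult_ac)
  then have "(\<lambda>j. of_nat j * kum_coeff a j * z ^ j) sums (z * kum_deriv a z + of_nat 0 * kum_coeff a 0 * z ^ 0)"
    using sums_Suc_iff[THEN iffD1, of "\<lambda>j. of_nat j * kum_coeff a j * z ^ j"] by simp
  then show "summable (\<lambda>j. of_nat j * kum_coeff a j * z ^ j)" "z * kum_deriv a z = (\<Sum>j. of_nat j * kum_coeff a j * z ^ j)"
    by (auto simp: sums_iff)
qed

text \<open>Contiguous relation, obtained coefficientwise from a ((a+1)_j - (a)_j) = j (a)_j for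
  rising factorials.\<close>

lemma kum_deriv_raise:
  fixes a z :: "'a::{real_normed_field,banach}"
  shows "z * kum_deriv a z = a * (kum (a + 1) z - kum a z)"
proof -
  have c: "of_nat j * kum_coeff a j = a * (kum_coeff (a + 1) j - kum_coeff a j)" for j
  proof -
    have "a * pochhammer (a + 1) j = pochhammer a j * (a + of_nat j)"
      using pochhammer_rec[of a j] pochhammer_Suc[of a j] by simp
    then have "a * (pochhammer (a + 1) j - pochhammer a j) = of_nat j * pochhammer a j"
      by (simp add: algebra_simps)
    then show ?thesis by (simp add: kum_coeff_def flip: diff_divide_distrib)
  qed
  have "a * (kum (a + 1) z - kum a z) = (\<Sum>j. a * (kum_coeff (a + 1) j * z ^ j - kum_coeff a j * z ^ j))"
    unfolding kum_def by (simp add: suminf_diff[OF summable_kum summable_kum] suminf_mult summable_diff[OF summable_kum summable_kum])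
  also have "\<dots> = (\<Sum>j. of_nat j * kum_coeff a j * z ^ j)"
    unfolding c by (simp add: algebra_simps)
  finally show ?thesis by (simp add: summable_kum_deriv_series)
qed

text \<open>Contiguous relation towards a - 1. The factor z shifts the coefficients, so they are
  compared at \<open>Suc i\<close>, where the rising factorials of a - 1 and of a are both multiples
  of that of a at i. The terms of index 0 cancel.\<close>

lemma kum_deriv_lower:
  fixes a z :: "'a::{real_normed_field,banach}"
  shows "z * kum_deriv a z = (2 - a) * kum (a - 1) z - (2 - a - z) * kum a z"
proof -
  have c: "of_nat (Suc i) * kum_coeff a (Suc i) = (2 - a) * kum_coeff (a - 1) (Suc i) - (2 - a) * kum_coeff a (Suc i) + kum_coeff a i" for i
  proof -
    have 1: "pochhammer (a - 1) (Suc i) = (a - 1) * pochhammer a i" using pochhammer_rec[of "a - 1" i] by simp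
    have 2: "pochhammer a (Suc i) = pochhammer a i * (a + of_nat i)" by (rule pochhammer_Suc)
    define P where "P = pochhammer a i"
    define q where "q = (pochhammer 2 (Suc i) * fact (Suc i) :: 'a)"
    have q: "q \<noteq> 0" by (simp add: q_def pochhammer_2 del: fact_Suc)
    define X where "X = (fact (Suc i) * fact i :: 'a)"
    have "q = of_nat (Suc i) * of_nat (Suc (Suc i)) * X"
      unfolding q_def pochhammer_2 X_def fact_Suc[of "Suc i"] fact_Suc[of i] by (simp only: mult_ac)
    moreover have "of_nat (Suc i) * of_nat (Suc (Suc i)) \<noteq> (0::'a)" by (simp del: of_nat_Suc)
    ultimately have "kum_coeff a i = P * (of_nat (Suc i) * of_nat (Suc (Suc i))) / q"
      unfolding kum_coeff_def P_def pochhammer_2 X_def[symmetric] 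
      by (simp del: of_nat_Suc)
    moreover have "kum_coeff a (Suc i) = P * (a + of_nat i) / q" "kum_coeff (a - 1) (Suc i) = (a - 1) * P / q"
      by (simp_all only: kum_coeff_def 1 2 P_def q_def)
    moreover have "of_nat (Suc i) * (P * (a + of_nat i)) = (2 - a) * ((a - 1) * P) - (2 - a) * (P * (a + of_nat i)) + P * (of_nat (Suc i) * of_nat (Suc (Suc i)))"
      by (simp add: algebra_simps)
    ultimately show ?thesis
      by (simp only: times_divide_eq_right add_divide_distrib diff_divide_distrib)
  qed
  have s: "(\<lambda>j. of_nat j * kum_coeff a j * z ^ j - (2 - a) * (kum_coeff (a - 1) j * z ^ j) + (2 - a) * (kum_coeff a j * z ^ j)) sums 
     (z * kum_deriv a z - (2 - a) * kum (a - 1) z + (2 - a) * kum a z)"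
    unfolding kum_def summable_kum_deriv_series
    by (intro sums_add sums_diff sums_mult summable_sums summable_kum summable_kum_deriv_series)
  have "(\<lambda>i. z * (kum_coeff a i * z ^ i)) sums (z * kum a z)"
    unfolding kum_def by (intro sums_mult summable_sums summable_kum)
  moreover have "z * (kum_coeff a i * z ^ i) = of_nat (Suc i) * kum_coeff a (Suc i) * z ^ Suc i - (2 - a) * (kum_coeff (a - 1) (Suc i) * z ^ Suc i) + (2 - a) * (kum_coeff a (Suc i) * z ^ Suc i)" for i
    unfolding c by (simp add: algebra_simps)
  ultimately have "(\<lambda>j. of_nat j * kum_coeff a j * z ^ j - (2 - a) * (kum_coeff (a - 1) j * z ^ j) + (2 - a) * (kum_coeff a j * z ^ j)) sums (z * kum a z)"
    using sums_Suc_iff[THEN iffD1, of "\<lambda>j. of_nat j * kum_coeff a j * z ^ j - (2 - a) * (kum_coeff (a - 1) j * z ^ j) + (2 - a) * (kum_coeff a j * z ^ j)" "z * kum a z"] 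
    by (simp del: power_Suc of_nat_Suc)
  from sums_unique2[OF s this] show ?thesis by (simp add: algebra_simps)
qed

lemma kum_three_term:
  fixes a z :: "'a::{real_normed_field,banach}"
  shows "(2 - a) * kum (a - 1) z + (2 * a - 2 + z) * kum a z - a * kum (a + 1) z = 0"
  using kum_deriv_raise[of z a] kum_deriv_lower[of z a] by (simp add: algebra_simps)

lemma kum_of_real: "kum (of_real a) (of_real x) = (of_real (kum a x) :: complex)"
proof -
  have c: "kum_coeff (of_real a) j = (of_real (kum_coeff a j) :: complex)" for j
    by (simp add: kum_coeff_def pochhammer_of_real pochhammer_2 del: fact_Suc)
  have "(\<lambda>j. of_real (kum_coeff a j * x ^ j) :: complex) sums of_real (kum a x)"
    unfolding kum_def sums_of_real_iff by (intro summable_sums summable_kum)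
  then show ?thesis unfolding kum_def c by (simp add: sums_iff)
qed

lemma kum_cnj: "kum (of_real a) (cnj z) = cnj (kum (of_real a) z)"
proof -
  have c: "cnj (kum_coeff (of_real a) j) = kum_coeff (of_real a) j" for j
    by (simp add: kum_coeff_def pochhammer_of_real pochhammer_2 del: fact_Suc)
  have "(\<lambda>j. cnj (kum_coeff (of_real a) j * z ^ j)) sums cnj (kum (of_real a) z)"
    unfolding kum_def sums_cnj by (intro summable_sums summable_kum)
  then show ?thesis unfolding kum_def by (simp add: c sums_iff)
qed

text \<open>In w the derivative of the Kummer function has been eliminated by
  \<open>kum_deriv_raise\<close>, which uses up the factor x. The formula is therefore regular at 0,
  where it gives \<alpha> + (1 - \<alpha>) = 1, as the Volterra equation demands.\<close>

lemma fundamental_derivative_kum: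
  fixes \<alpha> :: real and z :: complex
  defines "a \<equiv> of_real (1 - \<alpha>)"
  defines "w \<equiv> \<lambda>x::real. exp (z * of_real x) * ((of_real \<alpha> + z * of_real x) * kum a (- 2 * z * of_real x) + a * kum (a + 1) (- 2 * z * of_real x))"
  shows "fundamental_derivative \<alpha> z w"
    and "\<And>x. 0 \<le> x \<Longrightarrow> x \<le> 1 \<Longrightarrow> prim w x = of_real x * exp (z * of_real x) * kum a (- 2 * z * of_real x)"
proof -
  define \<phi> where "\<phi> x = x * exp (z * x) * kum a (- 2 * z * x)" for x :: complex
  define W where "W x = exp (z * x) * ((of_real \<alpha> + z * x) * kum a (- 2 * z * x) + a * kum (a + 1) (- 2 * z * x))" for x :: complex
  have wW: "w = (\<lambda>x. W (of_real x))" by (simp add: w_def W_def)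
  have y1: "x * (z * kum_deriv b (- (2 * z * x))) = - (b * (kum (b + 1) (- (2 * z * x)) - kum b (- (2 * z * x)))) / 2" for x b
    using kum_deriv_raise[of "- (2 * z * x)" b] by (simp add: field_simps)
  have y2: "x * (z * kum_deriv (a + 1) (- (2 * z * x))) = - ((1 - a) * kum a (- (2 * z * x)) - (1 - a + 2 * z * x) * kum (a + 1) (- (2 * z * x))) / 2" for x
    using kum_deriv_lower[of "- (2 * z * x)" "a + 1"] by (simp add: field_simps)
  have \<phi>': "(\<phi> has_field_derivative W x) (at x)" for x
  proof -
    have "(\<phi> has_field_derivative exp (z * x) * ((1 + z * x) * kum a (- (2 * z * x)) - 2 * (x * (z * kum_deriv a (- (2 * z * x)))))) (at x)"
      unfolding \<phi>_def[abs_def] by (rule derivative_eq_intros refl | simp)+ (simp add: algebra_simps)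
    also have "exp (z * x) * ((1 + z * x) * kum a (- (2 * z * x)) - 2 * (x * (z * kum_deriv a (- (2 * z * x))))) = W x"
    proof -
      have E: "2 * (x * (z * kum_deriv a (- (2 * z * x)))) = - (a * (kum (a + 1) (- (2 * z * x)) - kum a (- (2 * z * x))))"
        unfolding y1 by simp
      have "(1 + z * x) * kum a (- (2 * z * x)) - 2 * (x * (z * kum_deriv a (- (2 * z * x)))) =
        (of_real \<alpha> + z * x) * kum a (- 2 * z * x) + a * kum (a + 1) (- 2 * z * x)"
        unfolding E by (simp add: a_def algebra_simps)
      then show ?thesis unfolding W_def by simp
    qed
    finally show ?thesis .
  qed
  have W': "(W has_field_derivative (z\<^sup>2 + 2 * of_real \<alpha> * z / x) * \<phi> x) (at x)" if "x \<noteq> 0" for x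
  proof -
    define K1 where "K1 = kum_deriv a (- (2 * z * x))"
    define K2 where "K2 = kum_deriv (a + 1) (- (2 * z * x))"
    define k1 where "k1 = kum a (- (2 * z * x))"
    define k2 where "k2 = kum (a + 1) (- (2 * z * x))"
    have e1: "x * (z * K1) = - (a * (k2 - k1)) / 2" unfolding K1_def k1_def k2_def by (rule y1)
    have e2: "x * (z * K2) = - ((1 - a) * k1 - (1 - a + 2 * z * x) * k2) / 2" unfolding K2_def k1_def k2_def by (rule y2)
    have "(W has_field_derivative exp (z * x) * (z * ((of_real \<alpha> + z * x) * k1 + a * k2) + z * k1 
        + (of_real \<alpha> + z * x) * (- 2 * (z * K1)) + a * (- 2 * (z * K2)))) (at x)"
      unfolding W_def[abs_def] K1_def K2_def k1_def k2_def
      by (rule derivative_eq_intros refl | simp)+ (simp add: algebra_simps)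
    also have "z * ((of_real \<alpha> + z * x) * k1 + a * k2) + z * k1 
        + (of_real \<alpha> + z * x) * (- 2 * (z * K1)) + a * (- 2 * (z * K2)) = (z\<^sup>2 + 2 * of_real \<alpha> * z / x) * (x * k1)" (is "?L = ?R")
    proof -
      \<comment> \<open>The contiguous relations give only x times the derivatives, so the identity
        is proved after multiplication by x.\<close>
      have "x * ?L = z * x * ((of_real \<alpha> + z * x) * k1 + a * k2) + z * x * k1 
        + (of_real \<alpha> + z * x) * (- 2 * (x * (z * K1))) + a * (- 2 * (x * (z * K2)))"
        by (simp add: algebra_simps)
      also have "\<dots> = x * ?R"
        unfolding e1 e2 a_def using that by (simp add: field_simps power2_eq_square)
      finally show ?thesis using that by simp
    qed
    finally show ?thesis by (simp add: \<phi>_def k1_def mult_ac)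
  qed
  have Wc: "continuous_on A W" for A
    unfolding W_def by (intro continuous_intros)
  have wc: "continuous_on A w" for A
    unfolding wW by (intro continuous_on_compose2[OF Wc[of UNIV]] continuous_intros) auto
  have chain: "((\<lambda>x. f (of_real x)) has_vector_derivative D) (at x)" if "(f has_field_derivative D) (at (of_real x))" for f D and x :: real
    using has_vector_derivative_real_field[OF that] by simp
  have pw: "prim w x = \<phi> (of_real x)" if "0 \<le> x" "x \<le> 1" for x
  proof -
    have "prim w x = \<phi> (of_real x) - \<phi> (of_real 0)"
    proof (rule prim_FTC[OF _ _ that])
      show "((\<lambda>x. \<phi> (of_real x)) has_vector_derivative w y) (at y)" for y
        unfolding wW by (rule chain[OF \<phi>'])
      show "continuous_on {0..1} (\<lambda>x. \<phi> (complex_of_real x))"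
        unfolding \<phi>_def by (intro continuous_intros)
    qed
    then show ?thesis by (simp add: \<phi>_def)
  qed
  then show "prim w x = of_real x * exp (z * of_real x) * kum a (- 2 * z * of_real x)" if "0 \<le> x" "x \<le> 1" for x
    using that by (simp add: \<phi>_def)
  have "volterra \<alpha> z w x = w x - 1" if x: "0 \<le> x" "x \<le> 1" for x
  proof -
    have "volterra \<alpha> z w x = prim (\<lambda>t. wave_potential \<alpha> z t * \<phi> (of_real t)) x"
      unfolding volterra_def by (rule prim_cong) (use x in \<open>simp add: pw\<close>)
    also have "\<dots> = w x - w 0"
    proof (rule prim_FTC[OF wc _ x])
      fix t :: real assume "0 < t" "t < 1"
      then show "(w has_vector_derivative wave_potential \<alpha> z t * \<phi> (complex_of_real t)) (at t)"
        unfolding wW wave_potential_def by (intro chain W') auto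
    qed
    finally show ?thesis by (simp add: wW W_def a_def)
  qed
  then show "fundamental_derivative \<alpha> z w"
    using wc by (auto simp: fundamental_derivative_def)
qed

lemma spectrum_G_iff: "z \<in> op_spectrum (G \<alpha>) \<longleftrightarrow> kum (of_real (1 - \<alpha>)) (- 2 * z) = 0" (is ?th1)
  and eigenvector_kum: "z \<in> op_spectrum (G \<alpha>) \<Longrightarrow> \<kappa> \<noteq> 0 \<Longrightarrow> 
    is_eigenvector (G \<alpha>) z (\<lambda>x. \<kappa> * (of_real x * exp (z * of_real x) * kum (of_real (1 - \<alpha>)) (- 2 * z * of_real x)),
      \<lambda>x. z * (\<kappa> * (of_real x * exp (z * of_real x) * kum (of_real (1 - \<alpha>)) (- 2 * z * of_real x))))"
proof -
  obtain w where F: "fundamental_derivative \<alpha> z w" 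
    "\<And>x. 0 \<le> x \<Longrightarrow> x \<le> 1 \<Longrightarrow> prim w x = of_real x * exp (z * of_real x) * kum (of_real (1 - \<alpha>)) (- 2 * z * of_real x)"
    using fundamental_derivative_kum[where \<alpha> = \<alpha> and z = z] by blast
  have ev: "is_eigenvector (G \<alpha>) z (\<lambda>x. \<kappa> * (of_real x * exp (z * of_real x) * kum (of_real (1 - \<alpha>)) (- 2 * z * of_real x)),
      \<lambda>x. z * (\<kappa> * (of_real x * exp (z * of_real x) * kum (of_real (1 - \<alpha>)) (- 2 * z * of_real x))))" 
    if "kum (of_real (1 - \<alpha>)) (- 2 * z) = 0" "\<kappa> \<noteq> 0" for \<kappa>
    by (rule eigenvector_G[OF F(1) _ that(2)]) (use that F(2)[of 1] F(2) in \<open>auto intro!: continuous_intros\<close>)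
  show th1: ?th1
  proof
    assume "z \<in> op_spectrum (G \<alpha>)"
    then show "kum (of_real (1 - \<alpha>)) (- 2 * z) = 0" using resolvent_set_G[OF F(1)] F(2)[of 1] by force
  next
    assume "kum (of_real (1 - \<alpha>)) (- 2 * z) = 0"
    from eigenvector_in_spectrum[OF ev[OF this, of 1]] show "z \<in> op_spectrum (G \<alpha>)" by simp
  qed
  show "z \<in> op_spectrum (G \<alpha>) \<Longrightarrow> \<kappa> \<noteq> 0 \<Longrightarrow> 
    is_eigenvector (G \<alpha>) z (\<lambda>x. \<kappa> * (of_real x * exp (z * of_real x) * kum (of_real (1 - \<alpha>)) (- 2 * z * of_real x)),
      \<lambda>x. z * (\<kappa> * (of_real x * exp (z * of_real x) * kum (of_real (1 - \<alpha>)) (- 2 * z * of_real x))))"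
    using ev th1 by blast
qed

section \<open>Positive zeros of the real Kummer function\<close>

lemma kum_eventually_sign:
  fixes a :: real
  assumes "- real m \<le> a" "a < - real m + 1"
  obtains R where "\<And>x. x \<ge> R \<Longrightarrow> 0 < (-1) ^ m * kum a x"
proof -
  have sgn: "(-1) ^ m * pochhammer a m > 0"
  proof -
    have "(-1) ^ m * pochhammer a m = (\<Prod>i<m. - (a + real i))"
      by (simp only: pochhammer_prod atLeast0LessThan prod_uminus card_lessThan of_nat_id)
    also have "\<dots> > 0" by (rule prod_pos) (use assms in auto)
    finally show ?thesis .
  qed
  \<comment> \<open>The first m factors a + i are negative and the later ones nonnegative, so all
    coefficients from index m on share the sign (-1)^m. The infinite tail then cannot spoil the sign
    of the polynomial of degree m.\<close>
  have c: "(-1) ^ m * kum_coeff a (m + i) \<ge> 0" for i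
  proof -
    have "pochhammer a (m + i) = pochhammer a m * pochhammer (a + real m) i"
      by (rule pochhammer_product')
    moreover have "pochhammer (a + real m) i \<ge> 0"
      unfolding pochhammer_prod by (rule prod_nonneg) (use assms in auto)
    moreover have "pochhammer (2::real) (m + i) > 0" by (simp add: pochhammer_2 del: fact_Suc)
    ultimately show ?thesis using sgn by (simp add: kum_coeff_def mult.assoc[symmetric])
  qed
  have cm: "(-1) ^ m * kum_coeff a m > 0"
    using sgn by (simp add: kum_coeff_def pochhammer_2 del: fact_Suc)
  define p where "p = (\<Sum>j\<le>m. monom ((-1) ^ m * kum_coeff a j) j)"
  have cp: "coeff p j = (if j \<le> m then (-1) ^ m * kum_coeff a j else 0)" for j
    unfolding p_def by (simp add: coeff_sum)
  have "degree p = m"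
    by (rule antisym) (use cm in \<open>auto intro!: degree_le le_degree simp: cp\<close>)
  then have "lead_coeff p > 0" using cm by (simp add: cp)
  then obtain R where R: "\<And>x. x \<ge> R \<Longrightarrow> poly p x \<ge> lead_coeff p" using poly_pinfty_gt_lc by blast
  show ?thesis
  proof (rule that[of "max R 0"])
    fix x :: real assume x: "max R 0 \<le> x"
    have "kum a x = (\<Sum>i. kum_coeff a (i + Suc m) * x ^ (i + Suc m)) + (\<Sum>j<Suc m. kum_coeff a j * x ^ j)"
      unfolding kum_def by (rule suminf_split_initial_segment[OF summable_kum])
    moreover have "(-1) ^ m * (\<Sum>i. kum_coeff a (i + Suc m) * x ^ (i + Suc m)) \<ge> 0"
    proof -
      have s: "summable (\<lambda>i. kum_coeff a (i + Suc m) * x ^ (i + Suc m))" 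
        using summable_kum[of a x] by (rule summable_ignore_initial_segment)
      have "0 \<le> (-1) ^ m * (kum_coeff a (i + Suc m) * x ^ (i + Suc m))" for i
        using mult_nonneg_nonneg[OF c[of "Suc i"], of "x ^ (i + Suc m)"] x by (simp add: mult.assoc add_ac)
      then have "0 \<le> (\<Sum>i. (-1) ^ m * (kum_coeff a (i + Suc m) * x ^ (i + Suc m)))"
        by (intro suminf_nonneg summable_mult s) auto
      then show ?thesis using s by (simp add: suminf_mult)
    qed
    moreover have "(-1) ^ m * (\<Sum>j<Suc m. kum_coeff a j * x ^ j) = poly p x"
      by (simp add: p_def poly_sum poly_monom sum_distrib_left lessThan_Suc_atMost mult_ac)
    ultimately show "0 < (-1) ^ m * kum a x" 
      using R[of x] x \<open>lead_coeff p > 0\<close> by (simp add: distrib_left)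
  qed
qed

lemma kum_pos:
  fixes a x :: real
  assumes "0 \<le> a" "0 \<le> x"
  shows "kum a x > 0"
proof -
  have c: "kum_coeff a j \<ge> 0" for j
  proof -
    have "pochhammer a j \<ge> 0" unfolding pochhammer_prod by (rule prod_nonneg) (use assms in auto)
    then show ?thesis by (simp add: kum_coeff_def pochhammer_2 del: fact_Suc)
  qed
  have "kum_coeff a 0 * x ^ 0 \<le> kum a x"
    unfolding kum_def using sum_le_suminf[OF summable_kum[of a x], of "{0}"] c assms by simp
  then show ?thesis by simp
qed

text \<open>Induction from b = a + 1 to a. By \<open>kum_deriv_lower\<close>, e^(-x) x^(2-b)
  M(b,2,x) has the derivative (2-b) e^(-x) x^(1-b) M(a,2,x), so the mean value theorem yields a
  point with the required sign of M(a,2,x) in each of the m gaps for b. Adding 0, where M = 1, and a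
  far point from \<open>kum_eventually_sign\<close> makes m + 2 points.\<close>

lemma kum_sign_alternation:
  fixes a :: real
  assumes "- real m \<le> a" "a < - real m + 1"
  shows "\<exists>y :: nat \<Rightarrow> real. y 0 = 0 \<and> (\<forall>i<m. y i < y (Suc i)) \<and> (\<forall>i\<le>m. 0 < (-1) ^ i * kum a (y i))"
  using assms
proof (induct m arbitrary: a)
  case 0
  show ?case by (rule exI[of _ "\<lambda>_. 0"]) simp
next
  case (Suc m)
  define b where "b = a + 1"
  have b: "- real m \<le> b" "b < - real m + 1" "b < 1" using Suc(2,3) by (auto simp: b_def)
  obtain y where y: "y 0 = 0" "\<And>i. i < m \<Longrightarrow> y i < y (Suc i)" "\<And>i. i \<le> m \<Longrightarrow> 0 < (-1) ^ i * kum b (y i)"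
    using Suc(1)[OF b(1,2)] by blast
  have y_mono: "y i \<le> y j" if "i \<le> j" "j \<le> m" for i j
    using that
  proof (induct rule: dec_induct)
    case (step k)
    then show ?case using y(2)[of k] by simp
  qed simp
  define F where "F x = exp (- x) * x powr (2 - b) * kum b x" for x
  have F': "(F has_real_derivative (2 - b) * exp (- x) * x powr (1 - b) * kum a x) (at x)" if "x > 0" for x
  proof -
    have "(F has_real_derivative - exp (- x) * x powr (2 - b) * kum b x + exp (- x) * ((2 - b) * x powr (1 - b)) * kum b x
        + exp (- x) * x powr (2 - b) * kum_deriv b x) (at x)"
      unfolding F_def[abs_def] using that by (auto intro!: derivative_eq_intros simp: algebra_simps)
    also have "x powr (2 - b) = x powr (1 - b) * x" using that powr_add[of x "1 - b" 1] by simp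
    also have "- exp (- x) * (x powr (1 - b) * x) * kum b x + exp (- x) * ((2 - b) * x powr (1 - b)) * kum b x
        + exp (- x) * (x powr (1 - b) * x) * kum_deriv b x = exp (- x) * x powr (1 - b) * (x * kum_deriv b x + (2 - b - x) * kum b x)"
      by (simp add: algebra_simps)
    also have "x * kum_deriv b x + (2 - b - x) * kum b x = (2 - b) * kum a x"
      using kum_deriv_lower[of x b] by (simp add: b_def)
    finally show ?thesis by (simp add: mult_ac)
  qed
  have Fc: "continuous_on {0..} F" unfolding F_def
    by (intro continuous_intros continuous_on_powr') (use b in auto)
  have "\<exists>t. y i < t \<and> t < y (Suc i) \<and> 0 < (-1) ^ Suc i * kum a t" if i: "i < m" for i
  proof -
    have lt: "y i < y (Suc i)" by (rule y(2)[OF i])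
    have nn: "0 \<le> y i" using y_mono[of 0 i] i y(1) by simp
    \<comment> \<open>Only a weak inequality, since F vanishes at y 0 = 0; strictness at the right
      end of the gap is enough.\<close>
    have Fs: "(-1) ^ j * F (y j) \<ge> 0" if "j \<le> m" for j
    proof -
      have "(-1) ^ j * F (y j) = exp (- y j) * y j powr (2 - b) * ((-1) ^ j * kum b (y j))" by (simp add: F_def)
      moreover have "0 \<le> exp (- y j) * y j powr (2 - b) * ((-1) ^ j * kum b (y j))"
        by (rule mult_nonneg_nonneg) (use y(3)[OF that] in auto)
      ultimately show ?thesis by (simp only:)
    qed
    have Fs2: "(-1) ^ Suc i * F (y (Suc i)) > 0"
    proof -
      have "(-1) ^ Suc i * F (y (Suc i)) = exp (- y (Suc i)) * y (Suc i) powr (2 - b) * ((-1) ^ Suc i * kum b (y (Suc i)))" by (simp add: F_def)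
      moreover have "0 < (-1) ^ Suc i * kum b (y (Suc i))" using y(3)[of "Suc i"] i by simp
      moreover have "0 < exp (- y (Suc i)) * y (Suc i) powr (2 - b)" using lt nn by simp
      ultimately show ?thesis by (metis mult_pos_pos)
    qed
    obtain t where t: "y i < t" "t < y (Suc i)" 
      and eq: "F (y (Suc i)) - F (y i) = ((2 - b) * exp (- t) * t powr (1 - b) * kum a t) * (y (Suc i) - y i)"
    proof (rule mvt[OF lt, of F "\<lambda>x. (*) ((2 - b) * exp (- x) * x powr (1 - b) * kum a x)"])
      show "continuous_on {y i..y (Suc i)} F" by (rule continuous_on_subset[OF Fc]) (use nn in auto)
      show "(F has_derivative (*) ((2 - b) * exp (- x) * x powr (1 - b) * kum a x)) (at x)" if "y i < x" for x
        using F'[of x] that nn by (simp add: has_field_derivative_def)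
    qed blast
    have "0 < (-1) ^ Suc i * (F (y (Suc i)) - F (y i))"
      using Fs[of i] Fs2 i by (simp add: algebra_simps)
    also have "\<dots> = ((2 - b) * exp (- t) * t powr (1 - b) * (y (Suc i) - y i)) * ((-1) ^ Suc i * kum a t)"
      unfolding eq by (simp add: mult_ac)
    finally have "0 < ((2 - b) * exp (- t) * t powr (1 - b) * (y (Suc i) - y i)) * ((-1) ^ Suc i * kum a t)" .
    moreover have "0 < (2 - b) * exp (- t) * t powr (1 - b) * (y (Suc i) - y i)"
      using b lt t nn by (intro mult_pos_pos) auto
    ultimately have "0 < (-1) ^ Suc i * kum a t" using zero_less_mult_pos by blast
    with t show ?thesis by blast
  qed
  then obtain t where t: "\<And>i. i < m \<Longrightarrow> y i < t i" "\<And>i. i < m \<Longrightarrow> t i < y (Suc i)" "\<And>i. i < m \<Longrightarrow> 0 < (-1) ^ Suc i * kum a (t i)"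
    by metis
  obtain R where R: "\<And>x. x \<ge> R \<Longrightarrow> 0 < (-1) ^ Suc m * kum a x"
    using kum_eventually_sign[OF Suc(2,3)] by blast
  define Y where "Y i = (if i = 0 then 0 else if i = Suc m then max R (y m + 1) else t (i - 1))" for i
  have ym: "0 \<le> y m" using y_mono[of 0 m] y(1) by simp
  show ?case
  proof (intro exI[of _ Y] conjI allI impI)
    show "Y 0 = 0" by (simp add: Y_def)
    fix i
    show "Y i < Y (Suc i)" if im: "i < Suc m"
    proof (cases "i = 0")
      case True
      then show ?thesis using t(1)[of 0] ym y(1) by (auto simp: Y_def)
    next
      case False
      then obtain k where k: "i = Suc k" "k < m" using im by (cases i) auto
      have "t k < y (Suc k)" by (rule t(2)[OF k(2)])
      moreover have "y (Suc k) \<le> y m" by (rule y_mono) (use k in auto)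
      moreover have "y (Suc k) < t (Suc k)" if "Suc k \<noteq> m" using t(1)[of "Suc k"] k that by simp
      ultimately show ?thesis using k by (auto simp: Y_def)
    qed
    show "0 < (-1) ^ i * kum a (Y i)" if iS: "i \<le> Suc m"
    proof -
      have "i = 0 \<or> i = Suc m \<or> (\<exists>k. i = Suc k \<and> k < m)" using iS by (cases i) auto
      then consider "i = 0" | "i = Suc m" | k where "i = Suc k" "k < m" by blast
      then show ?thesis
      proof cases
        case 2
        then show ?thesis using R[of "max R (y m + 1)"] by (simp add: Y_def)
      next
        case 3
        then show ?thesis using t(3)[of k] by (simp add: Y_def)
      qed (simp add: Y_def)
    qed
  qed
qed

text \<open>To every zero except the largest belongs a critical point before the next zero, and
  these critical points are distinct.\<close>

lemma Rolle_zero_count: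
  fixes f f' :: "real \<Rightarrow> real"
  assumes "finite Z" "Z \<subseteq> {0<..}" "\<And>x. x \<in> Z \<Longrightarrow> f x = 0"
    and der: "\<And>x. x > 0 \<Longrightarrow> (f has_real_derivative f' x) (at x)"
  obtains Z' where "finite Z'" "Z' \<subseteq> {0<..}" "\<forall>x\<in>Z'. f' x = 0" "card Z \<le> Suc (card Z')"
proof (cases "Z = {}")
  case True
  then show ?thesis by (intro that[of "{}"]) auto
next
  case False
  define M where "M = Max Z"
  have M: "M \<in> Z" "\<And>z. z \<in> Z \<Longrightarrow> z \<le> M" using assms(1) False by (auto simp: M_def)
  have "\<exists>t. z < t \<and> f' t = 0 \<and> (\<forall>w\<in>Z. z < w \<longrightarrow> t < w)" if z: "z \<in> Z - {M}" for z
  proof -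
    define n where "n = Min {w \<in> Z. z < w}"
    have ne: "{w \<in> Z. z < w} \<noteq> {}" using M z by force
    have n: "n \<in> Z" "z < n" "\<And>w. w \<in> Z \<Longrightarrow> z < w \<Longrightarrow> n \<le> w"
      using Min_in[OF _ ne] assms(1) by (auto simp: n_def)
    have z0: "z > 0" using z assms(2) by auto
    have "continuous_on {z..n} f"
      by (rule continuous_at_imp_continuous_on, intro ballI, rule DERIV_isCont[OF der]) (use z0 in auto)
    moreover have "f z = f n" using assms(3) n(1) z by simp
    ultimately obtain t where t: "z < t" "t < n" "DERIV f t :> 0"
    proof -
      have "f differentiable at x" if "z < x" for x
        using der[of x] that z0 by (auto simp: real_differentiable_def)
      then show ?thesis using that Rolle[OF n(2), of f] \<open>f z = f n\<close> \<open>continuous_on {z..n} f\<close> by blast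
    qed
    have "f' t = 0" using DERIV_unique[OF der[of t] t(3)] t(1) z0 by simp
    then show ?thesis using t n(3) by force
  qed
  then obtain t where t: "\<And>z. z \<in> Z - {M} \<Longrightarrow> z < t z \<and> f' (t z) = 0 \<and> (\<forall>w\<in>Z. z < w \<longrightarrow> t z < w)" by metis
  have inj: "inj_on t (Z - {M})"
  proof (rule linorder_inj_onI')
    fix z1 z2 assume *: "z1 \<in> Z - {M}" "z2 \<in> Z - {M}" "z1 < z2"
    then have "t z1 < z2" "z2 < t z2" using t[OF *(1)] t[OF *(2)] by auto
    then show "t z1 \<noteq> t z2" by simp
  qed
  show ?thesis
  proof (rule that[of "t ` (Z - {M})"])
    show "t ` (Z - {M}) \<subseteq> {0<..}" using t assms(2) by force
    show "card Z \<le> Suc (card (t ` (Z - {M})))" using card_image[OF inj] assms(1) M(1) by (simp add: card_Diff_singleton)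
  qed (use t assms(1) in auto)
qed

text \<open>Each application of Rolle raises a by 1: x^a M(a,2,x) has the same positive zeros as
  M(a,2,x) and the derivative a x^(a-1) M(a+1,2,x). After m steps the parameter is in [0, 1), where
  M is positive.\<close>

lemma kum_zero_count_le:
  fixes a :: real
  assumes "- real m \<le> a" "a < - real m + 1" "finite Z" "Z \<subseteq> {x. 0 < x \<and> kum a x = 0}"
  shows "card Z \<le> m"
  using assms
proof (induct m arbitrary: a Z)
  case 0
  then have "0 < kum a x" "0 < x" "kum a x = 0" if "x \<in> Z" for x
    using kum_pos[of a x] that by auto
  then have "Z = {}" by force
  then show ?case by simp
next
  case (Suc m)
  have a: "a < 0" using Suc by simp
  define g where "g x = x powr a * kum a x" for x
  have der: "(g has_real_derivative a * x powr (a - 1) * kum (a + 1) x) (at x)" if "x > 0" for x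
  proof -
    have "(g has_real_derivative (a * x powr (a - 1)) * kum a x + x powr a * kum_deriv a x) (at x)"
      unfolding g_def[abs_def] using that by (auto intro!: derivative_eq_intros simp: algebra_simps)
    also have "x powr a = x powr (a - 1) * x" using that powr_add[of x "a - 1" 1] by simp
    also have "(a * x powr (a - 1)) * kum a x + x powr (a - 1) * x * kum_deriv a x = x powr (a - 1) * (a * kum a x + x * kum_deriv a x)"
      by (simp add: algebra_simps)
    also have "\<dots> = a * x powr (a - 1) * kum (a + 1) x" unfolding kum_deriv_raise by (simp add: algebra_simps)
    finally show ?thesis .
  qed
  have gz: "g x = 0" if "x \<in> Z" for x
    using Suc(5) that by (auto simp: g_def)
  have sub: "Z \<subseteq> {0<..}" using Suc(5) by auto
  obtain Z' where Z': "finite Z'" "Z' \<subseteq> {0<..}" "\<forall>x\<in>Z'. a * x powr (a - 1) * kum (a + 1) x = 0" "card Z \<le> Suc (card Z')"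
    by (rule Rolle_zero_count[OF Suc(4) sub gz der]) blast
  have "Z' \<subseteq> {x. 0 < x \<and> kum (a + 1) x = 0}" using Z'(2,3) a by force
  then have "card Z' \<le> m" using Suc(1)[of "a + 1" Z'] Suc(2,3) Z'(1) by simp
  then show ?case using Z'(4) by simp
qed

lemma kum_positive_zeros:
  fixes a :: real
  assumes m: "- real m \<le> a" "a < - real m + 1"
  shows "finite {x. 0 < x \<and> kum a x = 0}" "card {x. 0 < x \<and> kum a x = 0} = m"
proof -
  define S where "S = {x. 0 < x \<and> kum a x = 0}"
  show fin: "finite S"
  proof (rule ccontr)
    assume "infinite S"
    then obtain Z where "Z \<subseteq> S" "finite Z" "card Z = Suc m" using infinite_arbitrarily_large by blast
    then show False using kum_zero_count_le[OF m, of Z] by (simp add: S_def)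
  qed
  obtain y where y: "y 0 = 0" "\<And>i. i < m \<Longrightarrow> y i < y (Suc i)" "\<And>i. i \<le> m \<Longrightarrow> 0 < (-1) ^ i * kum a (y i)"
    using kum_sign_alternation[OF m] by blast
  have y_mono: "y i \<le> y j" if "i \<le> j" "j \<le> m" for i j
    using that
  proof (induct rule: dec_induct)
    case (step k)
    then show ?case using y(2)[of k] by simp
  qed simp
  have "\<exists>r. y i < r \<and> r < y (Suc i) \<and> kum a r = 0" if i: "i < m" for i
  proof -
    define h where "h x = (-1) ^ i * kum a x" for x
    have h: "h (y i) > 0" "h (y (Suc i)) < 0" using y(3)[of i] y(3)[of "Suc i"] i by (auto simp: h_def)
    have "continuous_on {y i..y (Suc i)} h" unfolding h_def by (intro continuous_intros)
    then obtain r where r: "y i \<le> r" "r \<le> y (Suc i)" "h r = 0"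
    proof -
      assume *: "continuous_on {y i..y (Suc i)} h" and that: "\<And>r. y i \<le> r \<Longrightarrow> r \<le> y (Suc i) \<Longrightarrow> h r = 0 \<Longrightarrow> thesis"
      show thesis using IVT2'[OF _ _ _ *, of 0] h y(2)[OF i] that by auto
    qed
    then have "r \<noteq> y i" "r \<noteq> y (Suc i)" using h by auto
    then have "y i < r" "r < y (Suc i)" "kum a r = 0" using r by (auto simp: h_def)
    then show ?thesis by blast
  qed
  then obtain r where r: "\<And>i. i < m \<Longrightarrow> y i < r i" "\<And>i. i < m \<Longrightarrow> r i < y (Suc i)" "\<And>i. i < m \<Longrightarrow> kum a (r i) = 0"
    by metis
  have "r i < r j" if "i < j" "j < m" for i j
    using r(2)[of i] r(1)[of j] y_mono[of "Suc i" j] that by simp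
  then have inj: "inj_on r {..<m}" by (intro linorder_inj_onI') force
  have "0 < r i" if "i < m" for i using y_mono[of 0 i] y(1) r(1)[OF that] that by simp
  then have "r ` {..<m} \<subseteq> S" using r(3) by (auto simp: S_def)
  from card_mono[OF fin this] have "m \<le> card S" using card_image[OF inj] by simp
  moreover have "card S \<le> m" by (rule kum_zero_count_le[OF m fin]) (simp add: S_def)
  ultimately show "card S = m" by simp
qed

text \<open>The factor n + 1 is the value of the Laguerre polynomial at 0, where the Kummer function
  is normalised to 1.\<close>

lemma laguerre1_eq_kum: "laguerre1 n z = of_nat (n + 1) * kum (- of_nat n) z"
proof -
  have c: "kum_coeff (- of_nat n :: complex) j = (- 1) ^ j * of_nat (n choose j) / fact (Suc j)" for j :: nat and n
  proof -
    have "of_nat (n choose j) = (- 1) ^ j * pochhammer (- of_nat n :: complex) j / fact j"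
      by (simp add: binomial_gbinomial gbinomial_pochhammer)
    then have "pochhammer (- of_nat n :: complex) j = (- 1) ^ j * (fact j * of_nat (n choose j))"
      by (simp add: field_simps)
    then show ?thesis by (simp add: kum_coeff_def pochhammer_2 del: fact_Suc)
  qed
  have "kum (- of_nat n) z = (\<Sum>j\<le>n. kum_coeff (- of_nat n) j * z ^ j)"
    unfolding kum_def by (rule suminf_finite) (auto simp: c)
  then have "of_nat (n + 1) * kum (- of_nat n) z = (\<Sum>j\<le>n. of_nat (n + 1) * (kum_coeff (- of_nat n) j * z ^ j))"
    by (simp add: sum_distrib_left)
  also have "\<dots> = laguerre1 n z"
    unfolding laguerre1_def
  proof (rule sum.cong[OF refl])
    fix j assume j: "j \<in> {..n}"
    have "(n + 1) * (n choose j) = ((n + 1) choose (n - j)) * Suc j"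
      using Suc_times_binomial_eq[of n j] binomial_symmetric[of "Suc j" "Suc n"] j by simp
    then have "of_nat (n + 1) * of_nat (n choose j) = (of_nat ((n + 1) choose (n - j)) * of_nat (Suc j) :: complex)"
      by (simp only: of_nat_mult[symmetric])
    then have "of_nat (n + 1) * (kum_coeff (- of_nat n) j * z ^ j) = (- 1) ^ j * (of_nat ((n + 1) choose (n - j)) * of_nat (Suc j)) * z ^ j / fact (Suc j)"
      unfolding c by (simp add: mult_ac del: of_nat_Suc fact_Suc of_nat_add)
    also have "\<dots> = of_nat ((n + 1) choose (n - j)) * ((- z) ^ j / fact j)"
      unfolding fact_Suc power_minus[of z] by (simp add: mult_ac del: of_nat_Suc binomial_Suc_Suc)
    finally show "of_nat (n + 1) * (kum_coeff (- of_nat n) j * z ^ j) = of_nat ((n + 1) choose (n - j)) * ((- z) ^ j / fact j)" .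
  qed
  finally show ?thesis ..
qed

text \<open>For the parameter -n the series is a polynomial of degree at most n, and the n positive
  zeros already found exhaust its roots.\<close>

lemma kum_neg_int_zeros:
  "{z. kum (- of_nat n :: complex) z = 0} = complex_of_real ` {x. 0 < x \<and> kum (- of_nat n) x = 0}"
proof -
  have m: "- real n \<le> - of_nat n" "- of_nat n < - real n + 1" by auto
  note Z = kum_positive_zeros[OF m]
  define p where "p = (\<Sum>j\<le>n. monom (kum_coeff (- of_nat n :: complex) j) j)"
  have c0: "kum_coeff (- of_nat n :: complex) j = 0" if "j > n" for j
    using that by (simp add: kum_coeff_def pochhammer_of_nat_eq_0_lemma)
  have "kum (- of_nat n) z = poly p z" for z
  proof -
    have "kum (- of_nat n) z = (\<Sum>j\<le>n. kum_coeff (- of_nat n) j * z ^ j)"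
      unfolding kum_def by (rule suminf_finite) (auto simp: c0)
    then show ?thesis by (simp add: p_def poly_sum poly_monom)
  qed
  note pk = this
  have "poly p 0 = 1" using pk[of 0] by simp
  then have p0: "p \<noteq> 0" by auto
  have deg: "degree p \<le> n" unfolding p_def by (intro degree_sum_le) (auto intro: order_trans[OF degree_monom_le])
  have fin: "finite {z. poly p z = 0}" by (rule poly_roots_finite[OF p0])
  have sub: "complex_of_real ` {x. 0 < x \<and> kum (- of_nat n) x = 0} \<subseteq> {z. poly p z = 0}"
    using kum_of_real[of "- of_nat n"] by (auto simp flip: pk)
  have "card {z. poly p z = 0} \<le> card (complex_of_real ` {x. 0 < x \<and> kum (- of_nat n) x = 0})"
    using card_poly_roots_bound[OF p0] deg Z(2) by (simp add: card_image inj_on_def)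
  from card_seteq[OF fin sub this] show ?thesis by (simp add: pk)
qed

section \<open>Laplace integrals along rays\<close>

abbreviation halfline :: "real measure" where "halfline \<equiv> lebesgue_on {0<..}"

lemma AE_halflineI: "(\<And>x. 0 < x \<Longrightarrow> P x) \<Longrightarrow> AE x in halfline. P x"
  by (rule AE_I2) auto

lemma continuous_borel_measurable_halfline:
  fixes f :: "real \<Rightarrow> 'a::euclidean_space"
  shows "continuous_on {0<..} f \<Longrightarrow> f \<in> borel_measurable halfline"
  by (rule continuous_imp_measurable_on_sets_lebesgue) auto

lemma integrable_exp_powr:
  assumes "\<beta> > -1" "a > 0"
  shows "integrable halfline (\<lambda>\<sigma>. exp (- (a * \<sigma>)) * \<sigma> powr \<beta> :: real)"
proof -
  have "(\<lambda>t. complex_of_real t powr (of_real (\<beta> + 1) - 1) / of_real (exp (a * t))) absolutely_integrable_on {0<..}"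
    by (rule absolutely_integrable_Gamma_integral) (use assms in auto)
  then have "integrable halfline (\<lambda>t. complex_of_real t powr (of_real (\<beta> + 1) - 1) / of_real (exp (a * t)))"
    by (simp add: set_integrable_def integrable_restrict_space)
  then have "integrable halfline (\<lambda>t. norm (complex_of_real t powr (of_real (\<beta> + 1) - 1) / of_real (exp (a * t))))"
    by (rule integrable_norm)
  also have "?this \<longleftrightarrow> ?thesis"
    by (rule Bochner_Integration.integrable_cong) (auto simp: norm_divide norm_powr_real_powr exp_minus field_simps)
  finally show ?thesis .
qed

lemma Gamma_halfline_integral:
  assumes "\<beta> > -1"
  shows "(LINT \<sigma>|halfline. exp (- complex_of_real \<sigma>) * of_real (\<sigma> powr \<beta>)) = Gamma (of_real (1 + \<beta>))"
proof -
  let ?f = "\<lambda>t. complex_of_real t powr (of_real (\<beta> + 1) - 1) / of_real (exp t)"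
  have "?f absolutely_integrable_on {0<..}"
    by (rule absolutely_integrable_Gamma_integral') (use assms in auto)
  then have i: "integrable halfline ?f"
    by (simp add: set_integrable_def integrable_restrict_space)
  have "(LINT \<sigma>|halfline. ?f \<sigma>) = Gamma (of_real (\<beta> + 1))"
    by (rule has_integral_unique[OF has_integral_integral_lebesgue_on[OF i] Gamma_integral_complex']) (use assms in auto)
  moreover have "(LINT \<sigma>|halfline. ?f \<sigma>) = (LINT \<sigma>|halfline. exp (- complex_of_real \<sigma>) * of_real (\<sigma> powr \<beta>))"
    by (rule Bochner_Integration.integral_cong) (auto simp: powr_of_real exp_minus exp_of_real field_simps)
  ultimately show ?thesis by (simp add: add.commute)
qed

text \<open>Dominated convergence for difference quotients: the mean value inequality on the ball
  bounds them by the same g that bounds the derivative.\<close>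

lemma has_field_derivative_integral:
  fixes f :: "complex \<Rightarrow> 'a \<Rightarrow> complex"
  assumes "r > 0" and der: "\<And>z s. z \<in> ball z0 r \<Longrightarrow> s \<in> space M \<Longrightarrow> ((\<lambda>z. f z s) has_field_derivative f' z s) (at z)"
    and bound: "\<And>z s. z \<in> ball z0 r \<Longrightarrow> s \<in> space M \<Longrightarrow> cmod (f' z s) \<le> g s"
    and g: "integrable M g" and f: "\<And>z. z \<in> ball z0 r \<Longrightarrow> integrable M (f z)"
    and meas: "f' z0 \<in> borel_measurable M"
  shows "((\<lambda>z. LINT s|M. f z s) has_field_derivative (LINT s|M. f' z0 s)) (at z0)"
proof -
  have diff: "cmod (f z s - f z0 s) \<le> g s * cmod (z - z0)" if "z \<in> ball z0 r" "s \<in> space M" for z s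
  proof (rule field_differentiable_bound[of "ball z0 r" "\<lambda>z. f z s" "\<lambda>z. f' z s"])
    show "((\<lambda>z. f z s) has_field_derivative f' w s) (at w within ball z0 r)" if "w \<in> ball z0 r" for w
      by (rule has_field_derivative_at_within[OF der[OF that \<open>s \<in> space M\<close>]])
  qed (use that bound \<open>r > 0\<close> in auto)
  have "((\<lambda>h. ((LINT s|M. f (z0 + h) s) - (LINT s|M. f z0 s)) / h) \<longlongrightarrow> (LINT s|M. f' z0 s)) (at 0)"
    unfolding tendsto_at_iff_sequentially
  proof (intro allI impI)
    fix X :: "nat \<Rightarrow> complex" assume X0: "\<forall>i. X i \<in> UNIV - {0}" and X: "X \<longlonglongrightarrow> 0"
    obtain N where N: "\<And>i. i \<ge> N \<Longrightarrow> cmod (X i) < r"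
      using LIMSEQ_D[OF X \<open>r > 0\<close>] by auto
    define Y where "Y i = X (i + N)" for i
    have Y: "Y i \<noteq> 0" "z0 + Y i \<in> ball z0 r" for i using X0 N[of "i + N"] by (auto simp: Y_def dist_norm)
    have Ylim: "Y \<longlonglongrightarrow> 0" unfolding Y_def using X by (rule LIMSEQ_ignore_initial_segment)
    have z0: "z0 \<in> ball z0 r" using \<open>r > 0\<close> by simp
    have lim: "(\<lambda>i. LINT s|M. (f (z0 + Y i) s - f z0 s) / Y i) \<longlonglongrightarrow> (LINT s|M. f' z0 s)"
    proof (rule integral_dominated_convergence[OF meas _ g])
      show "(\<lambda>s. (f (z0 + Y i) s - f z0 s) / Y i) \<in> borel_measurable M" for i
        using f[OF Y(2)[of i]] f[OF z0] by (intro borel_measurable_integrable) auto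
      show "AE s in M. (\<lambda>i. (f (z0 + Y i) s - f z0 s) / Y i) \<longlonglongrightarrow> f' z0 s"
      proof (rule AE_I2)
        fix s assume "s \<in> space M"
        have "((\<lambda>h. (f (z0 + h) s - f z0 s) / h) \<longlongrightarrow> f' z0 s) (at 0)"
          using der[OF z0 \<open>s \<in> space M\<close>] by (simp add: DERIV_def)
        then show "(\<lambda>i. (f (z0 + Y i) s - f z0 s) / Y i) \<longlonglongrightarrow> f' z0 s"
          unfolding tendsto_at_iff_sequentially using Y(1) Ylim by (auto simp: o_def)
      qed
      show "AE s in M. norm ((f (z0 + Y i) s - f z0 s) / Y i) \<le> g s" for i
        using diff[OF Y(2)[of i]] Y(1)[of i] by (intro AE_I2) (simp add: norm_divide field_simps)
    qed
    have eq: "(LINT s|M. (f (z0 + Y i) s - f z0 s) / Y i) = ((LINT s|M. f (z0 + Y i) s) - (LINT s|M. f z0 s)) / Y i" for i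
      using f[OF Y(2)[of i]] f[OF z0] by (simp add: Bochner_Integration.integral_diff)
    have "(\<lambda>i. ((LINT s|M. f (z0 + X (i + N)) s) - (LINT s|M. f z0 s)) / X (i + N)) \<longlonglongrightarrow> (LINT s|M. f' z0 s)"
      using lim unfolding eq unfolding Y_def .
    from LIMSEQ_offset[OF this]
    show "((\<lambda>h. ((LINT s|M. f (z0 + h) s) - (LINT s|M. f z0 s)) / h) \<circ> X) \<longlonglongrightarrow> (LINT s|M. f' z0 s)"
      by (simp add: o_def)
  qed
  then show ?thesis by (simp add: DERIV_def)
qed

text \<open>Phrased as a limit along the integers, so that nothing about F at infinity has to be
  assumed. In the applications F n tends to 0, or the values at the far ends of two rays are
  compared.\<close>

lemma halfline_FTC:
  fixes F f :: "real \<Rightarrow> complex"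
  assumes cont: "continuous_on {0..} F" and der: "\<And>s. s > 0 \<Longrightarrow> (F has_vector_derivative f s) (at s)"
    and f: "integrable halfline f"
  shows "(\<lambda>n. F (real n)) \<longlonglongrightarrow> F 0 + (LINT s|halfline. f s)"
proof -
  have [measurable]: "f \<in> borel_measurable halfline" using f by auto
  have [measurable]: "(\<lambda>x. x) \<in> borel_measurable halfline" 
    by (rule continuous_borel_measurable_halfline) (intro continuous_intros)
  define s where "s n x = (if x \<le> real n then f x else 0)" for n x
  have s: "s n \<in> borel_measurable halfline" for n unfolding s_def by measurable
  have "(\<lambda>n. LINT x|halfline. s n x) \<longlonglongrightarrow> (LINT x|halfline. f x)"
  proof (rule integral_dominated_convergence[where w = "\<lambda>x. cmod (f x)"])
    show "AE x in halfline. (\<lambda>n. s n x) \<longlonglongrightarrow> f x"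
    proof (rule AE_halflineI)
      fix x :: real
      have "\<forall>\<^sub>F n in sequentially. x \<le> real n"
        using filterlim_real_sequentially by (simp add: filterlim_at_top)
      then have "\<forall>\<^sub>F n in sequentially. s n x = f x"
        by eventually_elim (auto simp: s_def)
      then show "(\<lambda>n. s n x) \<longlonglongrightarrow> f x" by (simp add: tendsto_eventually)
    qed
  qed (use s f in \<open>auto simp: s_def\<close>)
  moreover have "(LINT x|halfline. s n x) = F (real n) - F 0" for n
  proof -
    have si: "integrable halfline (s n)"
      by (rule Bochner_Integration.integrable_bound[OF f s]) (auto simp: s_def)
    have "(s n has_integral (LINT x|halfline. s n x)) {0<..}"
      by (rule has_integral_integral_lebesgue_on[OF si]) auto
    moreover have "s n = (\<lambda>x. if x \<in> {..real n} then f x else 0)" by (auto simp: s_def fun_eq_iff)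
    ultimately have "(f has_integral (LINT x|halfline. s n x)) ({..real n} \<inter> {0<..})"
      by (simp only: has_integral_restrict_Int)
    then have 1: "(f has_integral (LINT x|halfline. s n x)) {0..real n}"
      by (rule has_integral_spike_set_eq[THEN iffD1, rotated 2]) (auto intro: negligible_subset[of "{0}"])
    have "(f has_integral (F (real n) - F 0)) {0..real n}"
      by (rule fundamental_theorem_of_calculus_interior) (auto intro: der continuous_on_subset[OF cont])
    with 1 show ?thesis by (rule has_integral_unique)
  qed
  ultimately have "(\<lambda>n. F (real n) - F 0 + F 0) \<longlonglongrightarrow> (LINT s|halfline. f s) + F 0"
    by (intro tendsto_add) auto
  then show ?thesis by (simp add: add.commute)
qed

definition laplace_powr :: "real \<Rightarrow> complex \<Rightarrow> complex" where
  "laplace_powr \<beta> c = (LINT \<sigma>|halfline. exp (- (c * of_real \<sigma>)) * of_real (\<sigma> powr \<beta>))"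

lemma laplace_powr_integrable:
  assumes "\<beta> > -1" "Re c > 0"
  shows "integrable halfline (\<lambda>\<sigma>. exp (- (c * of_real \<sigma>)) * of_real (\<sigma> powr \<beta>) :: complex)"
proof (rule Bochner_Integration.integrable_bound[OF integrable_exp_powr[OF assms]])
  show "(\<lambda>\<sigma>. exp (- (c * of_real \<sigma>)) * of_real (\<sigma> powr \<beta>)) \<in> borel_measurable halfline"
    by (rule continuous_borel_measurable_halfline) (intro continuous_intros, auto)
qed (simp add: norm_mult)

lemma laplace_powr_derivative:
  assumes b: "\<beta> > -1" and c: "Re c > 0"
  shows "(laplace_powr \<beta> has_field_derivative - laplace_powr (\<beta> + 1) c) (at c)"
proof -
  define e where "e = Re c / 2"
  have e: "e > 0" using c by (simp add: e_def)
  have ball: "Re w > e" if "w \<in> ball c e" for w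
    using that abs_Re_le_cmod[of "c - w"] by (simp add: e_def dist_norm) 
  have "((\<lambda>c. LINT \<sigma>|halfline. exp (- (c * of_real \<sigma>)) * of_real (\<sigma> powr \<beta>)) has_field_derivative
    (LINT \<sigma>|halfline. - (exp (- (c * of_real \<sigma>)) * of_real (\<sigma> powr (\<beta> + 1))))) (at c)"
  proof (rule has_field_derivative_integral[OF e])
    fix w :: complex and \<sigma> :: real assume w: "w \<in> ball c e" and "\<sigma> \<in> space halfline"
    then have s: "\<sigma> > 0" by simp
    have p: "\<sigma> powr (\<beta> + 1) = \<sigma> powr \<beta> * \<sigma>" using s powr_add[of \<sigma> \<beta> 1] by simp
    show "((\<lambda>w. exp (- (w * of_real \<sigma>)) * of_real (\<sigma> powr \<beta>)) has_field_derivative - (exp (- (w * of_real \<sigma>)) * of_real (\<sigma> powr (\<beta> + 1)))) (at w)"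
      unfolding p by (auto intro!: derivative_eq_intros)
    show "cmod (- (exp (- (w * of_real \<sigma>)) * of_real (\<sigma> powr (\<beta> + 1)))) \<le> exp (- (e * \<sigma>)) * \<sigma> powr (\<beta> + 1)"
      using ball[OF w] s by (simp add: norm_mult mult_right_mono)
  next
    show "integrable halfline (\<lambda>\<sigma>. exp (- (e * \<sigma>)) * \<sigma> powr (\<beta> + 1))"
      by (rule integrable_exp_powr) (use b e in auto)
    show "integrable halfline (\<lambda>\<sigma>. exp (- (w * complex_of_real \<sigma>)) * complex_of_real (\<sigma> powr \<beta>))" if "w \<in> ball c e" for w
      by (rule laplace_powr_integrable[OF b]) (use ball[OF that] e in auto)
    show "(\<lambda>\<sigma>. - (exp (- (c * of_real \<sigma>)) * of_real (\<sigma> powr (\<beta> + 1)))) \<in> borel_measurable halfline"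
      by (rule continuous_borel_measurable_halfline) (intro continuous_intros, auto)
  qed
  then show ?thesis by (simp add: laplace_powr_def[abs_def])
qed

lemma exp_powr_tendsto_0:
  fixes a p :: real
  assumes "a > 0"
  shows "(\<lambda>n. exp (- (a * real n)) * real n powr p) \<longlonglongrightarrow> 0"
proof -
  have "((\<lambda>x::real. exp (- (a * x)) * x powr p) \<longlongrightarrow> 0) at_top"
    using assms by real_asymp
  then show ?thesis using filterlim_real_sequentially by (rule filterlim_compose)
qed

text \<open>Integration by parts with exp(-c \<sigma>) \<sigma>^(\<beta>+1), which vanishes at 0 and
  at infinity.\<close>

lemma laplace_powr_rec:
  assumes b: "\<beta> > -1" and c: "Re c > 0"
  shows "c * laplace_powr (\<beta> + 1) c = of_real (\<beta> + 1) * laplace_powr \<beta> c"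
proof -
  let ?F = "\<lambda>\<sigma>::real. exp (- (c * of_real \<sigma>)) * of_real (\<sigma> powr (\<beta> + 1))"
  let ?f = "\<lambda>\<sigma>::real. of_real (\<beta> + 1) * (exp (- (c * of_real \<sigma>)) * of_real (\<sigma> powr \<beta>)) - c * (exp (- (c * of_real \<sigma>)) * of_real (\<sigma> powr (\<beta> + 1)))"
  have i: "integrable halfline (\<lambda>\<sigma>. exp (- (c * of_real \<sigma>)) * of_real (\<sigma> powr \<beta>) :: complex)"
     "integrable halfline (\<lambda>\<sigma>. exp (- (c * of_real \<sigma>)) * of_real (\<sigma> powr (\<beta> + 1)) :: complex)"
    by (rule laplace_powr_integrable; use assms in simp)+
  have "(\<lambda>n. ?F (real n)) \<longlonglongrightarrow> ?F 0 + (LINT s|halfline. ?f s)"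
  proof (rule halfline_FTC)
    show "continuous_on {0..} ?F" by (intro continuous_intros continuous_on_powr') (use b in auto)
    show "(?F has_vector_derivative ?f s) (at s)" if "s > 0" for s
    proof -
      have "((\<lambda>s. s powr (\<beta> + 1)) has_real_derivative (\<beta> + 1) * s powr \<beta>) (at s)"
        using that by (auto intro!: derivative_eq_intros)
      then have 1: "((\<lambda>s. complex_of_real (s powr (\<beta> + 1))) has_vector_derivative of_real ((\<beta> + 1) * s powr \<beta>)) (at s)"
        by (intro has_vector_derivative_of_real) (simp add: has_real_derivative_iff_has_vector_derivative)
      have "((\<lambda>w. exp (- (c * w))) has_field_derivative (- c * exp (- (c * of_real s)))) (at (of_real s))"
        by (auto intro!: derivative_eq_intros)
      from has_vector_derivative_real_field[OF this]
      have 2: "((\<lambda>s. exp (- (c * of_real s))) has_vector_derivative (- c * exp (- (c * of_real s)))) (at s)" by simp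
      show ?thesis
        by (rule has_vector_derivative_eq_rhs[OF has_vector_derivative_mult[OF 2 1]]) (simp add: algebra_simps)
    qed
    show "integrable halfline ?f" using i by auto
  qed
  moreover have "(\<lambda>n. ?F (real n)) \<longlonglongrightarrow> 0"
  proof (rule Lim_null_comparison)
    show "\<forall>\<^sub>F n in sequentially. norm (?F (real n)) \<le> exp (- (Re c * real n)) * real n powr (\<beta> + 1)"
      by (simp add: norm_mult)
  qed (rule exp_powr_tendsto_0[OF c])
  ultimately have "?F 0 + (LINT s|halfline. ?f s) = 0" using LIMSEQ_unique by blast
  moreover have "?F 0 = 0" using b by simp
  moreover have "(LINT s|halfline. ?f s) = of_real (\<beta> + 1) * laplace_powr \<beta> c - c * laplace_powr (\<beta> + 1) c"
    unfolding laplace_powr_def using i by simp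
  ultimately show ?thesis by simp
qed

text \<open>Rotates the ray of the Gamma integral without a contour argument: by
  \<open>laplace_powr_rec\<close> the left-hand side has derivative 0 in c, so it is constant on the
  right half-plane, and c = 1 gives the value.\<close>

lemma laplace_powr_eq:
  assumes b: "\<beta> > -1" and c: "Re c > 0"
  shows "c powr of_real (1 + \<beta>) * laplace_powr \<beta> c = Gamma (of_real (1 + \<beta>))"
proof -
  define S where "S = {c::complex. Re c > 0}"
  have S: "convex S" unfolding S_def by (rule convex_halfspace_Re_gt)
  obtain k where k: "\<And>c. c \<in> S \<Longrightarrow> c powr of_real (1 + \<beta>) * laplace_powr \<beta> c = k"
  proof (rule has_field_derivative_zero_constant[OF S, THEN exE])
    fix c assume "c \<in> S"
    then have c: "Re c > 0" by (simp add: S_def)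
    then have nz: "c \<notin> \<real>\<^sub>\<le>\<^sub>0" "c \<noteq> 0" by (auto simp: complex_nonpos_Reals_iff)
    have "((\<lambda>c. c powr of_real (1 + \<beta>) * laplace_powr \<beta> c) has_field_derivative 
       of_real (1 + \<beta>) * c powr (of_real (1 + \<beta>) - 1) * laplace_powr \<beta> c + c powr of_real (1 + \<beta>) * - laplace_powr (\<beta> + 1) c) (at c)"
      by (auto intro!: derivative_eq_intros laplace_powr_derivative b c nz)
    also have "c powr of_real (1 + \<beta>) = c powr (of_real (1 + \<beta>) - 1) * c"
      using nz powr_add[of c "of_real \<beta>" 1] by (simp add: add.commute)
    also have "of_real (1 + \<beta>) * c powr (of_real (1 + \<beta>) - 1) * laplace_powr \<beta> c + c powr (of_real (1 + \<beta>) - 1) * c * - laplace_powr (\<beta> + 1) c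
      = c powr (of_real (1 + \<beta>) - 1) * (of_real (\<beta> + 1) * laplace_powr \<beta> c - c * laplace_powr (\<beta> + 1) c)"
      by (simp add: algebra_simps)
    also have "\<dots> = 0" by (simp add: laplace_powr_rec[OF b c])
    finally show "((\<lambda>c. c powr of_real (1 + \<beta>) * laplace_powr \<beta> c) has_field_derivative 0) (at c within S)"
      by (rule has_field_derivative_at_within)
  qed blast
  have "k = laplace_powr \<beta> 1" using k[of 1] by (simp add: S_def)
  also have "\<dots> = Gamma (of_real (1 + \<beta>))" using Gamma_halfline_integral[OF b] by (simp add: laplace_powr_def)
  finally show ?thesis using k[of c] c by (simp add: S_def)
qed

text \<open>
  The confluent hypergeometric integrals are taken along rotated rays, with \<open>c = 1 - \<i>\<close>:
  this keeps the factor \<open>1 - c \<sigma> / z\<close> in a half-plane bounded away from the origin, uniformly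
  for \<open>z\<close> in the upper half-plane.
\<close>

definition ray_factor :: "complex \<Rightarrow> real \<Rightarrow> complex" where
  "ray_factor z \<sigma> = 1 - (1 - \<i>) * of_real \<sigma> / z"

definition ray_integrand :: "real \<Rightarrow> real \<Rightarrow> complex \<Rightarrow> real \<Rightarrow> complex" where
  "ray_integrand \<beta> b z \<sigma> = exp (- ((1 - \<i>) * of_real \<sigma>)) * of_real (\<sigma> powr \<beta>) * ray_factor z \<sigma> powr of_real b"

definition ray_integral :: "real \<Rightarrow> real \<Rightarrow> complex \<Rightarrow> complex" where
  "ray_integral \<beta> b z = (LINT \<sigma>|halfline. ray_integrand \<beta> b z \<sigma>)"

text \<open>The real and imaginary parts of -(1 - i) \<sigma> / z add up to 2 \<sigma> Im z / |z|^2,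
  which is nonnegative.\<close>

lemma ray_factor_halfplane:
  assumes "Im z > 0" "\<sigma> \<ge> 0"
  shows "Re (ray_factor z \<sigma>) + Im (ray_factor z \<sigma>) \<ge> 1"
proof -
  define m where "m = (Re z)\<^sup>2 + (Im z)\<^sup>2"
  have m: "m > 0" using assms by (simp add: m_def sum_power2_gt_zero_iff)
  have "Re (ray_factor z \<sigma>) + Im (ray_factor z \<sigma>) = 1 + 2 * \<sigma> * Im z / m"
    unfolding ray_factor_def Re_divide Im_divide minus_complex.sel m_def[symmetric]
    using m by (simp add: field_simps)
  then show ?thesis using assms m by simp
qed

lemma cmod_ray_factor_le: "\<sigma> \<ge> 0 \<Longrightarrow> cmod (ray_factor z \<sigma>) \<le> 1 + 2 * \<sigma> / cmod z"
proof -
  assume s: "\<sigma> \<ge> 0"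
  have "cmod (1 - \<i>) \<le> 2" using norm_triangle_ineq4[of 1 \<i>] by simp
  then have "cmod ((1 - \<i>) * of_real \<sigma> / z) \<le> 2 * \<sigma> / cmod z"
    using s by (simp add: norm_mult norm_divide mult_right_mono divide_right_mono)
  then show ?thesis unfolding ray_factor_def
    using norm_triangle_ineq4[of 1 "(1 - \<i>) * of_real \<sigma> / z"] by simp
qed

lemma halfplane_facts:
  assumes "Re w + Im w \<ge> 1"
  shows "w \<notin> \<real>\<^sub>\<le>\<^sub>0" "w \<noteq> 0" "cmod w \<ge> 1/2"
proof -
  show "w \<notin> \<real>\<^sub>\<le>\<^sub>0" "w \<noteq> 0" using assms by (auto simp: complex_nonpos_Reals_iff)
  show "cmod w \<ge> 1/2" using assms complex_Re_le_cmod[of w] abs_Im_le_cmod[of w] by linarith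
qed

text \<open>A positive exponent needs the upper bound X on |w|, a negative one the lower bound 1/2;
  the factor 2 covers both cases.\<close>

lemma halfplane_powr_bound:
  assumes w: "Re w + Im w \<ge> 1" and X: "cmod w \<le> X" "1 \<le> X"
  shows "cmod (w powr of_real b) \<le> (2 * X) powr \<bar>b\<bar>"
proof -
  note h = halfplane_facts[OF w]
  have eq: "cmod (w powr of_real b) = cmod w powr b" by (simp add: norm_powr_real_powr')
  show ?thesis
  proof (cases "b \<ge> 0")
    case True
    then show ?thesis unfolding eq using h X by (auto intro!: powr_mono2)
  next
    case False
    have "cmod w powr b = (1 / cmod w) powr (- b)" using h(2) by (simp add: powr_minus powr_divide field_simps)
    also have "1 / cmod w \<le> 2" using h(2,3) by (simp add: field_simps)
    then have "(1 / cmod w) powr (- b) \<le> (2 * X) powr (- b)" using X False by (intro powr_mono2) auto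
    finally show ?thesis unfolding eq using False by simp
  qed
qed

lemma one_plus_powr_le:
  fixes \<sigma> N :: real
  assumes "\<sigma> > 0" "N \<ge> 0"
  shows "(1 + \<sigma>) powr N \<le> 2 powr N * (1 + \<sigma> powr N)"
proof (cases "\<sigma> \<le> 1")
  case True
  have "(1 + \<sigma>) powr N \<le> 2 powr N" using True assms by (intro powr_mono2) auto
  also have "\<dots> \<le> 2 powr N * (1 + \<sigma> powr N)" by simp
  finally show ?thesis .
next
  case False
  have "(1 + \<sigma>) powr N \<le> (2 * \<sigma>) powr N" using False assms by (intro powr_mono2) auto
  also have "\<dots> = 2 powr N * \<sigma> powr N" using assms by (simp add: powr_mult)
  also have "\<dots> \<le> 2 powr N * (1 + \<sigma> powr N)" by (simp add: distrib_left)
  finally show ?thesis .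
qed

text \<open>Up to a constant this dominates exp(-\<sigma>) \<sigma>^\<beta> (1 + \<sigma>)^N.
  Writing it as a sum of two Gamma integrands makes integrability immediate.\<close>

definition ray_dominator :: "real \<Rightarrow> real \<Rightarrow> real \<Rightarrow> real" where
  "ray_dominator \<beta> N \<sigma> = exp (- \<sigma>) * \<sigma> powr \<beta> + exp (- \<sigma>) * \<sigma> powr (\<beta> + N)"

lemma ray_dominator_integrable: "\<beta> > -1 \<Longrightarrow> N \<ge> 0 \<Longrightarrow> integrable halfline (ray_dominator \<beta> N)"
  unfolding ray_dominator_def[abs_def]
  using integrable_exp_powr[of \<beta> 1] integrable_exp_powr[of "\<beta> + N" 1]
  by (intro Bochner_Integration.integrable_add) simp_all

lemma ray_dominator_eq: "\<sigma> > 0 \<Longrightarrow> ray_dominator \<beta> N \<sigma> = exp (- \<sigma>) * \<sigma> powr \<beta> * (1 + \<sigma> powr N)"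
  by (simp add: ray_dominator_def powr_add algebra_simps)

definition ray_const :: "real \<Rightarrow> real \<Rightarrow> real" where
  "ray_const \<rho> N = (2 + 4 / \<rho>) powr N * 2 powr N"

lemma ray_linear_powr_le:
  assumes "\<rho> > 0" "\<sigma> > 0" "N \<ge> 0"
  shows "(2 * (1 + 2 * \<sigma> / \<rho>)) powr N \<le> ray_const \<rho> N * (1 + \<sigma> powr N)"
proof -
  have "(2 * (1 + 2 * \<sigma> / \<rho>)) powr N \<le> ((2 + 4 / \<rho>) * (1 + \<sigma>)) powr N"
    using assms by (intro powr_mono2) (auto simp: field_simps)
  also have "\<dots> = (2 + 4 / \<rho>) powr N * (1 + \<sigma>) powr N" using assms by (simp add: powr_mult)
  also have "\<dots> \<le> (2 + 4 / \<rho>) powr N * (2 powr N * (1 + \<sigma> powr N))"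
    using assms by (intro mult_left_mono one_plus_powr_le) auto
  finally show ?thesis by (simp add: ray_const_def mult_ac)
qed

lemma ray_integrand_bound:
  assumes "Im z > 0" "\<sigma> > 0" "\<rho> > 0" "cmod z \<ge> \<rho>"
  shows "cmod (ray_integrand \<beta> b z \<sigma>) \<le> ray_const \<rho> \<bar>b\<bar> * ray_dominator \<beta> \<bar>b\<bar> \<sigma>"
proof -
  have z: "cmod z > 0" using assms by linarith
  have "cmod (ray_factor z \<sigma>) \<le> 1 + 2 * \<sigma> / cmod z" using assms by (intro cmod_ray_factor_le) auto
  also have "\<dots> \<le> 1 + 2 * \<sigma> / \<rho>" using assms z by (intro add_left_mono divide_left_mono mult_pos_pos) auto
  finally have "cmod (ray_factor z \<sigma> powr of_real b) \<le> (2 * (1 + 2 * \<sigma> / \<rho>)) powr \<bar>b\<bar>"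
    using assms by (intro halfplane_powr_bound ray_factor_halfplane) auto
  also have "\<dots> \<le> ray_const \<rho> \<bar>b\<bar> * (1 + \<sigma> powr \<bar>b\<bar>)" by (rule ray_linear_powr_le) (use assms in auto)
  finally have "exp (- \<sigma>) * \<sigma> powr \<beta> * cmod (ray_factor z \<sigma> powr of_real b) \<le> exp (- \<sigma>) * \<sigma> powr \<beta> * (ray_const \<rho> \<bar>b\<bar> * (1 + \<sigma> powr \<bar>b\<bar>))"
    by (intro mult_left_mono) auto
  then show ?thesis using assms by (simp add: ray_integrand_def norm_mult ray_dominator_eq mult_ac)
qed

lemma ray_factor_continuous: "z \<noteq> 0 \<Longrightarrow> continuous_on A (ray_factor z)"
  unfolding ray_factor_def[abs_def] by (intro continuous_intros) auto

lemma ray_integrand_continuous: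
  assumes "Im z > 0"
  shows "continuous_on {0<..} (ray_integrand \<beta> b z)"
proof -
  have "z \<noteq> 0" using assms by auto
  then show ?thesis unfolding ray_integrand_def[abs_def]
    using halfplane_facts(1,2)[OF ray_factor_halfplane[OF assms]]
    by (intro continuous_intros continuous_on_powr_complex ray_factor_continuous) (auto simp: complex_nonpos_Reals_iff less_imp_le)
qed

lemma ray_integrand_integrable:
  assumes "\<beta> > -1" "Im z > 0"
  shows "integrable halfline (ray_integrand \<beta> b z)"
proof (rule Bochner_Integration.integrable_bound)
  have "z \<noteq> 0" using assms by auto
  show "integrable halfline (\<lambda>\<sigma>. ray_const (cmod z) \<bar>b\<bar> * ray_dominator \<beta> \<bar>b\<bar> \<sigma>)"
    by (intro integrable_mult_right ray_dominator_integrable) (use assms in auto)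
  show "AE \<sigma> in halfline. norm (ray_integrand \<beta> b z \<sigma>) \<le> norm (ray_const (cmod z) \<bar>b\<bar> * ray_dominator \<beta> \<bar>b\<bar> \<sigma>)"
  proof (rule AE_halflineI)
    fix \<sigma> :: real assume "\<sigma> > 0"
    have "norm (ray_integrand \<beta> b z \<sigma>) \<le> ray_const (cmod z) \<bar>b\<bar> * ray_dominator \<beta> \<bar>b\<bar> \<sigma>"
      by (rule ray_integrand_bound) (use assms \<open>z \<noteq> 0\<close> \<open>\<sigma> > 0\<close> in auto)
    also have "\<dots> \<le> norm (ray_const (cmod z) \<bar>b\<bar> * ray_dominator \<beta> \<bar>b\<bar> \<sigma>)" by simp
    finally show "norm (ray_integrand \<beta> b z \<sigma>) \<le> norm (ray_const (cmod z) \<bar>b\<bar> * ray_dominator \<beta> \<bar>b\<bar> \<sigma>)" .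
  qed
qed (rule continuous_borel_measurable_halfline[OF ray_integrand_continuous[OF assms(2)]])

lemma ray_integral_derivative:
  assumes b: "\<beta> > -1" and z: "Im z > 0"
  shows "(ray_integral \<beta> b has_field_derivative of_real b * (1 - \<i>) / z\<^sup>2 * ray_integral (\<beta> + 1) (b - 1) z) (at z)"
proof -
  \<comment> \<open>With this radius the ball stays in the upper half-plane and outside the disc of
    radius r, so one dominating function serves for all its points.\<close>
  define r where "r = Im z / 2"
  have r: "r > 0" using z by (simp add: r_def)
  have ball: "Im w > 0" "cmod w \<ge> r" if "w \<in> ball z r" for w
  proof -
    show *: "Im w > 0" using that abs_Im_le_cmod[of "z - w"] z by (simp add: r_def dist_norm)
    show "cmod w \<ge> r" using that abs_Im_le_cmod[of "z - w"] abs_Im_le_cmod[of w] * by (simp add: r_def dist_norm)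
  qed
  define g where "g w \<sigma> = of_real b * (1 - \<i>) / w\<^sup>2 * ray_integrand (\<beta> + 1) (b - 1) w \<sigma>" for w \<sigma>
  define N where "N = \<bar>b - 1\<bar>"
  have "((\<lambda>z. LINT \<sigma>|halfline. ray_integrand \<beta> b z \<sigma>) has_field_derivative (LINT \<sigma>|halfline. g z \<sigma>)) (at z)"
  proof (rule has_field_derivative_integral[OF r])
    fix w :: complex and \<sigma> :: real assume w: "w \<in> ball z r" and "\<sigma> \<in> space halfline"
    then have s: "\<sigma> > 0" by simp
    have w0: "w \<noteq> 0" using ball(1)[OF w] by auto
    have nr: "ray_factor w \<sigma> \<notin> \<real>\<^sub>\<le>\<^sub>0" by (rule halfplane_facts(1)[OF ray_factor_halfplane]) (use ball(1)[OF w] s in auto)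
    have p: "\<sigma> powr (\<beta> + 1) = \<sigma> powr \<beta> * \<sigma>" using s powr_add[of \<sigma> \<beta> 1] by simp
    have "((\<lambda>w. ray_factor w \<sigma>) has_field_derivative (1 - \<i>) * of_real \<sigma> / w\<^sup>2) (at w)"
      unfolding ray_factor_def using w0 by (auto intro!: derivative_eq_intros simp: power2_eq_square)
    from DERIV_chain2[where f = "\<lambda>w. w powr of_real b", OF has_field_derivative_powr[OF nr] this]
    have "((\<lambda>w. ray_factor w \<sigma> powr of_real b) has_field_derivative of_real b * ray_factor w \<sigma> powr of_real (b - 1) * ((1 - \<i>) * of_real \<sigma> / w\<^sup>2)) (at w)"
      by simp
    from DERIV_cmult[OF this, of "exp (- ((1 - \<i>) * of_real \<sigma>)) * of_real (\<sigma> powr \<beta>)"]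
    show "((\<lambda>w. ray_integrand \<beta> b w \<sigma>) has_field_derivative g w \<sigma>) (at w)"
      unfolding ray_integrand_def g_def p by (simp add: mult_ac)
    have "cmod (ray_integrand (\<beta> + 1) (b - 1) w \<sigma>) \<le> ray_const r N * ray_dominator (\<beta> + 1) N \<sigma>"
      unfolding N_def by (rule ray_integrand_bound) (use ball[OF w] s r in auto)
    moreover have "cmod (of_real b * (1 - \<i>) / w\<^sup>2) \<le> \<bar>b\<bar> * cmod (1 - \<i>) / r\<^sup>2"
    proof -
      have "r\<^sup>2 \<le> (cmod w)\<^sup>2" using ball(2)[OF w] r by (intro power_mono) auto
      moreover have "0 < (cmod w)\<^sup>2 * r\<^sup>2" using w0 r by simp
      ultimately have "\<bar>b\<bar> * cmod (1 - \<i>) / (cmod w)\<^sup>2 \<le> \<bar>b\<bar> * cmod (1 - \<i>) / r\<^sup>2"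
        by (intro divide_left_mono) auto
      then show ?thesis by (simp only: norm_divide norm_mult norm_power norm_of_real)
    qed
    ultimately show "cmod (g w \<sigma>) \<le> \<bar>b\<bar> * cmod (1 - \<i>) / r\<^sup>2 * (ray_const r N * ray_dominator (\<beta> + 1) N \<sigma>)"
      unfolding g_def norm_mult[of "_ / _"] by (intro mult_mono) auto
  next
    show "integrable halfline (\<lambda>\<sigma>. \<bar>b\<bar> * cmod (1 - \<i>) / r\<^sup>2 * (ray_const r N * ray_dominator (\<beta> + 1) N \<sigma>))"
      by (intro integrable_mult_right ray_dominator_integrable) (use b in \<open>auto simp: N_def\<close>)
    show "integrable halfline (ray_integrand \<beta> b w)" if "w \<in> ball z r" for w
      by (rule ray_integrand_integrable[OF b ball(1)[OF that]])
    show "g z \<in> borel_measurable halfline"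
      unfolding g_def[abs_def] by (intro continuous_borel_measurable_halfline continuous_intros ray_integrand_continuous z)
  qed
  then show ?thesis by (simp add: ray_integral_def[abs_def] g_def)
qed

lemma ray_integral_holomorphic: "\<beta> > -1 \<Longrightarrow> ray_integral \<beta> b holomorphic_on {z. Im z > 0}"
  by (rule holomorphic_onI)
    (metis (no_types, lifting) field_differentiable_at_within field_differentiable_def mem_Collect_eq ray_integral_derivative)

text \<open>For large z the factor \<open>ray_factor z \<sigma>\<close> tends to 1. The mean value
  inequality for w^b is applied on the half-plane intersected with a disc, a convex set that
  contains 1 and the factor and avoids the branch cut. The gained factor 2 \<sigma> / |z| raises
  \<beta> by one in the dominating function.\<close>

lemma ray_integral_asymptotic:
  assumes b: "\<beta> > -1"
  obtains K where "K \<ge> 0" "\<And>z. Im z > 0 \<Longrightarrow> cmod z \<ge> 1 \<Longrightarrow> cmod (ray_integral \<beta> b z - laplace_powr \<beta> (1 - \<i>)) \<le> K / cmod z"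
proof -
  define N where "N = \<bar>b - 1\<bar>"
  define J where "J = (LINT \<sigma>|halfline. ray_dominator (\<beta> + 1) N \<sigma>)"
  have di: "integrable halfline (ray_dominator (\<beta> + 1) N)" by (rule ray_dominator_integrable) (use b in \<open>auto simp: N_def\<close>)
  have J: "J \<ge> 0" unfolding J_def by (rule integral_nonneg_AE) (auto simp: ray_dominator_def intro!: AE_I2)
  show ?thesis
  proof (rule that[of "\<bar>b\<bar> * ray_const 1 N * 2 * J"])
    show "0 \<le> \<bar>b\<bar> * ray_const 1 N * 2 * J" using J by (simp add: ray_const_def)
    fix z assume z: "Im z > 0" "cmod z \<ge> 1"
    have pw: "cmod (ray_integrand \<beta> b z \<sigma> - exp (- ((1 - \<i>) * of_real \<sigma>)) * of_real (\<sigma> powr \<beta>)) \<le> \<bar>b\<bar> * ray_const 1 N * 2 / cmod z * ray_dominator (\<beta> + 1) N \<sigma>"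
      if s: "\<sigma> > 0" for \<sigma>
    proof -
      define S where "S = {w. Re w + Im w \<ge> 1} \<inter> cball 0 (1 + 2 * \<sigma>)"
      have "{w. Re w + Im w \<ge> 1} = {w. (1 + \<i>) \<bullet> w \<ge> 1}" by (auto simp: inner_complex_def)
      then have conv: "convex S" unfolding S_def by (intro convex_Int convex_cball) (simp add: convex_halfspace_ge)
      have B: "cmod (of_real b * w powr of_real (b - 1)) \<le> \<bar>b\<bar> * (ray_const 1 N * (1 + \<sigma> powr N))" if "w \<in> S" for w
      proof -
        have "cmod (w powr of_real (b - 1)) \<le> (2 * (1 + 2 * \<sigma>)) powr N"
          unfolding N_def by (rule halfplane_powr_bound) (use that s in \<open>auto simp: S_def\<close>)
        also have "\<dots> \<le> ray_const 1 N * (1 + \<sigma> powr N)" using ray_linear_powr_le[of 1 \<sigma> N] s by (simp add: N_def)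
        finally show ?thesis unfolding norm_mult by (simp add: mult_left_mono)
      qed
      have "cmod (ray_factor z \<sigma> powr of_real b - 1 powr of_real b) \<le> \<bar>b\<bar> * (ray_const 1 N * (1 + \<sigma> powr N)) * cmod (ray_factor z \<sigma> - 1)"
      proof (rule field_differentiable_bound[OF conv _ B])
        show "((\<lambda>w. w powr of_real b) has_field_derivative of_real b * w powr of_real (b - 1)) (at w within S)" if "w \<in> S" for w
          using has_field_derivative_powr[OF halfplane_facts(1), of w "of_real b"] that
          by (auto simp: S_def intro: has_field_derivative_at_within)
        have "cmod (ray_factor z \<sigma>) \<le> 1 + 2 * \<sigma> / cmod z" by (rule cmod_ray_factor_le) (use s in auto)
        also have "2 * \<sigma> / cmod z \<le> 2 * \<sigma> / 1" using s z by (intro divide_left_mono) auto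
        finally show "ray_factor z \<sigma> \<in> S" using ray_factor_halfplane[OF z(1), of \<sigma>] s by (auto simp: S_def)
        show "1 \<in> S" using s by (auto simp: S_def)
      qed auto
      also have "cmod (ray_factor z \<sigma> - 1) \<le> 2 * \<sigma> / cmod z"
      proof -
        have "cmod (1 - \<i>) \<le> 2" using norm_triangle_ineq4[of 1 \<i>] by simp
        then show ?thesis using s by (simp add: ray_factor_def norm_mult norm_divide mult_right_mono divide_right_mono)
      qed
      finally have 1: "cmod (ray_factor z \<sigma> powr of_real b - 1) \<le> \<bar>b\<bar> * (ray_const 1 N * (1 + \<sigma> powr N)) * (2 * \<sigma> / cmod z)"
        by (simp add: mult_left_mono ray_const_def)
      have "ray_integrand \<beta> b z \<sigma> - exp (- ((1 - \<i>) * of_real \<sigma>)) * of_real (\<sigma> powr \<beta>) = 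
        exp (- ((1 - \<i>) * of_real \<sigma>)) * of_real (\<sigma> powr \<beta>) * (ray_factor z \<sigma> powr of_real b - 1)"
        by (simp add: ray_integrand_def algebra_simps)
      then have "cmod (ray_integrand \<beta> b z \<sigma> - exp (- ((1 - \<i>) * of_real \<sigma>)) * of_real (\<sigma> powr \<beta>)) = 
        exp (- \<sigma>) * \<sigma> powr \<beta> * cmod (ray_factor z \<sigma> powr of_real b - 1)"
        by (simp add: norm_mult)
      also have "\<dots> \<le> exp (- \<sigma>) * \<sigma> powr \<beta> * (\<bar>b\<bar> * (ray_const 1 N * (1 + \<sigma> powr N)) * (2 * \<sigma> / cmod z))"
        using 1 by (intro mult_left_mono) auto
      also have "\<dots> = \<bar>b\<bar> * ray_const 1 N * 2 / cmod z * ray_dominator (\<beta> + 1) N \<sigma>"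
        using s by (simp add: ray_dominator_eq powr_add)
      finally show ?thesis .
    qed
    have i: "integrable halfline (ray_integrand \<beta> b z)" "integrable halfline (\<lambda>\<sigma>. exp (- ((1 - \<i>) * of_real \<sigma>)) * of_real (\<sigma> powr \<beta>) :: complex)"
      by (rule ray_integrand_integrable[OF b z(1)], rule laplace_powr_integrable) (use b in auto)
    have "cmod (ray_integral \<beta> b z - laplace_powr \<beta> (1 - \<i>)) = cmod (LINT \<sigma>|halfline. ray_integrand \<beta> b z \<sigma> - exp (- ((1 - \<i>) * of_real \<sigma>)) * of_real (\<sigma> powr \<beta>))"
      unfolding ray_integral_def laplace_powr_def using i by simp
    also have "\<dots> \<le> (LINT \<sigma>|halfline. cmod (ray_integrand \<beta> b z \<sigma> - exp (- ((1 - \<i>) * of_real \<sigma>)) * of_real (\<sigma> powr \<beta>)))"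
      by (rule integral_norm_bound)
    also have "\<dots> \<le> (LINT \<sigma>|halfline. \<bar>b\<bar> * ray_const 1 N * 2 / cmod z * ray_dominator (\<beta> + 1) N \<sigma>)"
      by (rule integral_mono_AE) (use i di pw in \<open>auto intro!: AE_halflineI\<close>)
    also have "\<dots> = \<bar>b\<bar> * ray_const 1 N * 2 * J / cmod z" by (simp add: J_def)
    finally show "cmod (ray_integral \<beta> b z - laplace_powr \<beta> (1 - \<i>)) \<le> \<bar>b\<bar> * ray_const 1 N * 2 * J / cmod z" .
  qed
qed

text \<open>Integration by parts with exp(-c \<sigma>) \<sigma>^\<alpha> W^(-\<alpha>), where c = 1
  - i and W = \<open>ray_factor z \<sigma>\<close>. Through this relation the growing parts obey a
  three-term recursion in \<alpha> matching that of the Kummer functions.\<close>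

lemma ray_integral_rec:
  assumes a: "\<alpha> > 0" and z: "Im z > 0"
  shows "(1 - \<i>) * ray_integral \<alpha> (- \<alpha>) z = of_real \<alpha> * (ray_integral (\<alpha> - 1) (1 - \<alpha>) z + 
     2 * (1 - \<i>) / z * ray_integral \<alpha> (- \<alpha>) z + ((1 - \<i>) / z)\<^sup>2 * ray_integral (\<alpha> + 1) (- \<alpha> - 1) z)"
proof -
  define c where "c = 1 - \<i>"
  have z0: "z \<noteq> 0" using z by auto
  define F where "F \<sigma> = exp (- (c * of_real \<sigma>)) * of_real (\<sigma> powr \<alpha>) * ray_factor z \<sigma> powr of_real (- \<alpha>)" for \<sigma> :: real
  define T where "T \<beta> = ray_integrand \<beta> (- \<beta>) z" for \<beta>
  define f where "f \<sigma> = of_real \<alpha> * (T (\<alpha> - 1) \<sigma> + 2 * c / z * T \<alpha> \<sigma> + (c / z)\<^sup>2 * T (\<alpha> + 1) \<sigma>) - c * T \<alpha> \<sigma>" for \<sigma>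
  have Ti: "integrable halfline (T \<beta>)" if "\<beta> > -1" for \<beta> unfolding T_def by (rule ray_integrand_integrable[OF that z])
  have nr: "ray_factor z \<sigma> \<notin> \<real>\<^sub>\<le>\<^sub>0" "ray_factor z \<sigma> \<noteq> 0" if "\<sigma> \<ge> 0" for \<sigma>
    using halfplane_facts[OF ray_factor_halfplane[OF z that]] by auto
  have "(\<lambda>n. F (real n)) \<longlonglongrightarrow> F 0 + (LINT s|halfline. f s)"
  proof (rule halfline_FTC)
    show "continuous_on {0..} F" unfolding F_def
      by (intro continuous_intros continuous_on_powr' continuous_on_powr_complex ray_factor_continuous z0) 
        (use a nr in \<open>auto simp: complex_nonpos_Reals_iff\<close>)
    show "integrable halfline f" unfolding f_def[abs_def] using a
      by (intro Bochner_Integration.integrable_add Bochner_Integration.integrable_diff integrable_mult_right Ti) auto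
    fix s :: real assume s: "s > 0"
    define W where "W = ray_factor z s"
    note W = nr[of s, folded W_def]
    have 1: "((\<lambda>s. complex_of_real (s powr \<alpha>)) has_vector_derivative of_real (\<alpha> * s powr (\<alpha> - 1))) (at s)"
      by (rule has_vector_derivative_of_real)
       (use s in \<open>auto intro!: derivative_eq_intros simp flip: has_real_derivative_iff_has_vector_derivative\<close>)
    have "((\<lambda>w. exp (- (c * w)) * (1 - c * w / z) powr of_real (- \<alpha>)) has_field_derivative
        exp (- (c * of_real s)) * (- c * W powr of_real (- \<alpha>) + of_real \<alpha> * c / z * W powr (of_real (- \<alpha>) - 1))) (at (of_real s))"
    proof -
      have Wc: "1 - c * of_real s / z = W" by (simp add: W_def ray_factor_def c_def)
      have g: "((\<lambda>w. 1 - c * w / z) has_field_derivative - (c / z)) (at (of_real s))"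
        using z0 by (auto intro!: derivative_eq_intros)
      have "1 - c * of_real s / z \<notin> \<real>\<^sub>\<le>\<^sub>0" unfolding Wc using W(1) s by simp
      from DERIV_chain2[where f = "\<lambda>w. w powr of_real (- \<alpha>)", OF has_field_derivative_powr[OF this] g]
      have p: "((\<lambda>w. (1 - c * w / z) powr of_real (- \<alpha>)) has_field_derivative 
        of_real (- \<alpha>) * W powr (of_real (- \<alpha>) - 1) * - (c / z)) (at (of_real s))"
        unfolding Wc .
      have e: "((\<lambda>w. exp (- (c * w))) has_field_derivative exp (- (c * of_real s)) * - c) (at (of_real s))"
        by (auto intro!: derivative_eq_intros)
      from DERIV_mult[OF e p] show ?thesis unfolding Wc
        by (simp add: algebra_simps)
    qed
    from has_vector_derivative_real_field[OF this]
    have 2: "((\<lambda>s. exp (- (c * of_real s)) * ray_factor z s powr of_real (- \<alpha>)) has_vector_derivative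
        exp (- (c * of_real s)) * (- c * W powr of_real (- \<alpha>) + of_real \<alpha> * c / z * W powr (of_real (- \<alpha>) - 1))) (at s)"
      by (simp add: ray_factor_def c_def)
    have "(F has_vector_derivative exp (- (c * of_real s)) * ray_factor z s powr of_real (- \<alpha>) * of_real (\<alpha> * s powr (\<alpha> - 1)) +
       exp (- (c * of_real s)) * (- c * W powr of_real (- \<alpha>) + of_real \<alpha> * c / z * W powr (of_real (- \<alpha>) - 1)) * of_real (s powr \<alpha>)) (at s)"
      using has_vector_derivative_mult[OF 2 1] by (simp add: F_def[abs_def] mult_ac)
    also have "exp (- (c * of_real s)) * ray_factor z s powr of_real (- \<alpha>) * of_real (\<alpha> * s powr (\<alpha> - 1)) +
       exp (- (c * of_real s)) * (- c * W powr of_real (- \<alpha>) + of_real \<alpha> * c / z * W powr (of_real (- \<alpha>) - 1)) * of_real (s powr \<alpha>) = f s"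
    proof -
      define q where "q = W powr of_real (- \<alpha> - 1)"
      define x where "x = complex_of_real (s powr (\<alpha> - 1))"
      define E where "E = exp (- (c * of_real s))"
      define S where "S = complex_of_real s"
      have Weq: "W = 1 - c * S / z" by (simp add: W_def ray_factor_def c_def S_def)
      have Wp: "W powr of_real (- \<alpha>) = q * W" "W powr of_real (1 - \<alpha>) = q * W\<^sup>2"
        using W s powr_add[of W "of_real (- \<alpha> - 1)" 1] powr_add[of W "of_real (- \<alpha> - 1)" 2] by (simp_all add: q_def algebra_simps)
      have sp: "complex_of_real (s powr \<alpha>) = x * S" "complex_of_real (s powr (\<alpha> + 1)) = x * S\<^sup>2"
      proof -
        have "s powr \<alpha> = s powr (\<alpha> - 1) * s" "s powr (\<alpha> + 1) = s powr (\<alpha> - 1) * s\<^sup>2"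
          using s powr_add[of s "\<alpha> - 1" 1] powr_add[of s "\<alpha> - 1" 2] by (simp_all add: powr_numeral add.commute)
        then show "complex_of_real (s powr \<alpha>) = x * S" "complex_of_real (s powr (\<alpha> + 1)) = x * S\<^sup>2"
          by (simp_all add: x_def S_def)
      qed
      have T: "T (\<alpha> - 1) s = E * x * (q * W\<^sup>2)" "T \<alpha> s = E * (x * S) * (q * W)" "T (\<alpha> + 1) s = E * (x * S\<^sup>2) * q"
        unfolding T_def ray_integrand_def W_def[symmetric] c_def[symmetric] E_def[symmetric] 
        using Wp sp by (simp_all add: x_def[symmetric] q_def)
      have A: "W powr (of_real (- \<alpha>) - 1) = q" "complex_of_real (\<alpha> * s powr (\<alpha> - 1)) = of_real \<alpha> * x"
        by (simp_all add: q_def x_def)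
      \<comment> \<open>The derivative contains W + c \<sigma> / z to the first power. This equals
        1, so it may be squared, which splits the term into the integrands with parameters \<alpha>
        - 1, \<alpha> and \<alpha> + 1.\<close>
      have "W + c / z * S = 1" by (simp add: Weq)
      then have "(W + c / z * S) = (W + c / z * S)\<^sup>2" by simp
      then have "E * (q * W) * (of_real \<alpha> * x) + E * (- c * (q * W) + of_real \<alpha> * c / z * q) * (x * S)
         = of_real \<alpha> * E * x * q * (W + c / z * S)\<^sup>2 - c * (E * (x * S) * (q * W))"
        by (simp add: algebra_simps)
      then show ?thesis unfolding f_def T W_def[symmetric] E_def[symmetric] Wp(1) sp(1) A
        by (simp add: power2_eq_square algebra_simps)
    qed
    finally show "(F has_vector_derivative f s) (at s)" .
  qed
  moreover have "(\<lambda>n. F (real n)) \<longlonglongrightarrow> 0"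
  proof (rule Lim_null_comparison)
    define K where "K = ray_const (cmod z) \<bar>-\<alpha>\<bar>"
    show "\<forall>\<^sub>F n in sequentially. norm (F (real n)) \<le> K * (exp (- (1 * real n)) * real n powr \<alpha> + exp (- (1 * real n)) * real n powr (\<alpha> + \<bar>-\<alpha>\<bar>))"
      using eventually_gt_at_top[of 0]
    proof eventually_elim
      case (elim n)
      have "F (real n) = ray_integrand \<alpha> (- \<alpha>) z (real n)" by (simp add: F_def ray_integrand_def c_def)
      then show ?case using ray_integrand_bound[OF z, of "real n" "cmod z" \<alpha> "-\<alpha>"] elim z0
        by (simp add: K_def ray_dominator_def)
    qed
    have "(\<lambda>n. K * (exp (- (1 * real n)) * real n powr \<alpha> + exp (- (1 * real n)) * real n powr (\<alpha> + \<bar>-\<alpha>\<bar>))) \<longlonglongrightarrow> K * (0 + 0)"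
      by (intro tendsto_intros exp_powr_tendsto_0) auto
    then show "(\<lambda>n. K * (exp (- (1 * real n)) * real n powr \<alpha> + exp (- (1 * real n)) * real n powr (\<alpha> + \<bar>-\<alpha>\<bar>))) \<longlonglongrightarrow> 0" by simp
  qed
  ultimately have "F 0 + (LINT s|halfline. f s) = 0" using LIMSEQ_unique by blast
  moreover have "F 0 = 0" using a by (simp add: F_def)
  moreover have "(LINT s|halfline. f s) = of_real \<alpha> * (ray_integral (\<alpha> - 1) (1 - \<alpha>) z + 2 * c / z * ray_integral \<alpha> (- \<alpha>) z + (c / z)\<^sup>2 * ray_integral (\<alpha> + 1) (- \<alpha> - 1) z) - c * ray_integral \<alpha> (- \<alpha>) z"
    using Ti[of "\<alpha> - 1"] Ti[of \<alpha>] Ti[of "\<alpha> + 1"] a by (simp add: f_def T_def ray_integral_def)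
  ultimately show ?thesis by (simp add: c_def)
qed

section \<open>Connection formula in the upper half-plane\<close>

lemma integrable_I01_powr_powr:
  assumes "a > -1" "b > -1"
  shows "integrable I01 (\<lambda>t. t powr a * (1 - t) powr b :: real)"
    and "(LINT t|I01. t powr a * (1 - t) powr b) = Beta (a + 1) (b + 1)"
proof -
  have B: "((\<lambda>t. t powr a * (1 - t) powr b) has_integral Beta (a + 1) (b + 1)) {0..1}"
    using has_integral_Beta_real[of "a + 1" "b + 1"] assms by simp
  then have "((\<lambda>t. t powr a * (1 - t) powr b) has_integral Beta (a + 1) (b + 1)) {0<..<1}"
    by (simp add: has_integral_Icc_iff_Ioo)
  then have "(\<lambda>t. t powr a * (1 - t) powr b) integrable_on {0<..<1}" by blast
  then have "(\<lambda>t. t powr a * (1 - t) powr b) absolutely_integrable_on {0<..<1}"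
    by (rule nonnegative_absolutely_integrable_1) auto
  then show i: "integrable I01 (\<lambda>t. t powr a * (1 - t) powr b :: real)"
    by (simp add: set_integrable_def integrable_restrict_space)
  show "(LINT t|I01. t powr a * (1 - t) powr b) = Beta (a + 1) (b + 1)"
    unfolding LINT_I01_eq_integral[OF i] using B by (rule integral_unique)
qed

text \<open>Expand exp(z t) and integrate term by term; the j-th term is the Beta integral B(j + 1 -
  \<alpha>, 1 + \<alpha>). The exponents -\<alpha> and \<alpha> at the two ends must both exceed -1,
  hence the restriction on \<alpha>.\<close>

lemma kum_Euler_integral:
  fixes \<alpha> :: real and z :: complex
  assumes "\<bar>\<alpha>\<bar> < 1"
  shows "(LINT t|I01. exp (z * of_real t) * of_real (t powr (- \<alpha>) * (1 - t) powr \<alpha>)) = 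
    of_real (Gamma (1 - \<alpha>) * Gamma (1 + \<alpha>)) * kum (of_real (1 - \<alpha>)) z"
proof -
  define w where "w t = t powr (- \<alpha>) * (1 - t) powr \<alpha>" for t :: real
  define f where "f j t = z ^ j / fact j * of_real (t powr (real j - \<alpha>) * (1 - t) powr \<alpha>)" for j and t :: real
  have tj: "t powr (real j - \<alpha>) = t ^ j * t powr (- \<alpha>)" if "0 < t" for t j
    using that powr_add[of t "real j" "- \<alpha>"] by (simp add: powr_realpow)
  have fw: "f j t = (z * of_real t) ^ j / fact j * of_real (w t)" if "0 < t" for j t
    using that by (simp add: f_def w_def tj power_mult_distrib)
  have ri: "integrable I01 (\<lambda>t. t powr (real j - \<alpha>) * (1 - t) powr \<alpha>)" for j
    by (rule integrable_I01_powr_powr) (use assms in auto)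
  have fi: "integrable I01 (f j)" for j
    unfolding f_def[abs_def] by (intro integrable_mult_right integrable_of_real ri)
  have wi: "integrable I01 w" using ri[of 0] by (simp add: w_def[abs_def])
  have w0: "w t \<ge> 0" for t by (simp add: w_def)
  have sums: "(\<lambda>j. LINT t|I01. f j t) sums (LINT t|I01. (\<Sum>j. f j t))"
  proof (rule sums_integral[OF fi])
    show "AE t in I01. summable (\<lambda>j. norm (f j t))"
    proof (rule AE_I01I)
      fix t :: real assume t: "0 < t" "t < 1"
      have "summable (\<lambda>j. norm (z * of_real t) ^ j / fact j * w t)"
        using summable_mult2[OF summable_exp[of "norm (z * complex_of_real t)"], of "w t"] by (simp add: field_simps)
      then show "summable (\<lambda>j. norm (f j t))" using t w0[of t] 
        by (simp add: fw norm_mult norm_divide norm_power)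
    qed
    show "summable (\<lambda>j. LINT t|I01. norm (f j t))"
    proof (rule summable_comparison_test')
      show "summable (\<lambda>j. norm z ^ j / fact j * (LINT t|I01. w t))"
        using summable_mult2[OF summable_exp[of "norm z"], of "LINT t|I01. w t"] by (simp add: field_simps)
      fix j :: nat
      have "(LINT t|I01. norm (f j t)) \<le> (LINT t|I01. norm z ^ j / fact j * w t)"
      proof (rule integral_mono_AE)
        show "AE t in I01. norm (f j t) \<le> norm z ^ j / fact j * w t"
        proof (rule AE_I01I)
          fix t :: real assume t: "0 < t" "t < 1"
          have "norm (f j t) = norm z ^ j / fact j * w t * t ^ j" using t w0[of t]
            by (simp add: fw norm_mult norm_divide norm_power power_mult_distrib)
          also have "\<dots> \<le> norm z ^ j / fact j * w t"
            using t w0[of t] by (intro mult_left_le power_le_one) auto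
          finally show "norm (f j t) \<le> norm z ^ j / fact j * w t" .
        qed
      qed (use fi wi in auto)
      moreover have "(LINT t|I01. norm (f j t)) \<ge> 0" by (intro integral_nonneg_AE) auto
      ultimately show "norm (LINT t|I01. norm (f j t)) \<le> norm z ^ j / fact j * (LINT t|I01. w t)" using wi by simp
    qed
  qed
  have "(LINT t|I01. (\<Sum>j. f j t)) = (LINT t|I01. exp (z * of_real t) * of_real (w t))"
  proof (rule Bochner_Integration.integral_cong[OF refl])
    fix t :: real assume "t \<in> space I01"
    then have t: "0 < t" by simp
    have "(\<lambda>j. (z * of_real t) ^ j / fact j * of_real (w t)) sums (exp (z * of_real t) * of_real (w t))"
      using sums_mult2[OF exp_converges[of "z * of_real t"], of "of_real (w t)"] by (simp add: scaleR_conv_of_real field_simps)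
    then show "(\<Sum>j. f j t) = exp (z * of_real t) * of_real (w t)" unfolding fw[OF t] by (simp add: sums_iff)
  qed
  moreover have "(LINT t|I01. f j t) = of_real (Gamma (1 - \<alpha>) * Gamma (1 + \<alpha>)) * (kum_coeff (of_real (1 - \<alpha>)) j * z ^ j)" for j
  proof -
    have "(LINT t|I01. t powr (real j - \<alpha>) * (1 - t) powr \<alpha>) = Beta (real j - \<alpha> + 1) (\<alpha> + 1)"
      by (rule integrable_I01_powr_powr) (use assms in auto)
    also have "\<dots> = Gamma (1 - \<alpha> + real j) * Gamma (1 + \<alpha>) / Gamma (real (Suc (Suc j)))"
      by (simp add: Beta_def algebra_simps)
    also have "Gamma (real (Suc (Suc j))) = fact (Suc j)" by (rule Gamma_fact[of "Suc j", unfolded of_nat_Suc[symmetric], simplified add.commute])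
    also have "Gamma (1 - \<alpha> + real j) = pochhammer (1 - \<alpha>) j * Gamma (1 - \<alpha>)"
    proof -
      have "1 - \<alpha> \<notin> \<int>\<^sub>\<le>\<^sub>0" using assms by (auto elim!: nonpos_Ints_cases)
      then show ?thesis using pochhammer_Gamma[of "1 - \<alpha>" j] Gamma_eq_zero_iff[of "1 - \<alpha>"] by simp
    qed
    finally have e: "(LINT t|I01. t powr (real j - \<alpha>) * (1 - t) powr \<alpha>) = pochhammer (1 - \<alpha>) j * Gamma (1 - \<alpha>) * Gamma (1 + \<alpha>) / fact (Suc j)" .
    have "(LINT t|I01. f j t) = z ^ j / fact j * of_real (LINT t|I01. t powr (real j - \<alpha>) * (1 - t) powr \<alpha>)"
      unfolding f_def integral_complex_of_real[symmetric] by (rule integral_mult_right_zero)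
    then show ?thesis unfolding e
      by (simp add: kum_coeff_def pochhammer_2 pochhammer_of_real[of "1 - \<alpha>", simplified] mult_ac del: fact_Suc)
  qed
  ultimately have "(\<lambda>j. of_real (Gamma (1 - \<alpha>) * Gamma (1 + \<alpha>)) * (kum_coeff (of_real (1 - \<alpha>)) j * z ^ j)) sums 
    (LINT t|I01. exp (z * of_real t) * of_real (w t))" using sums by simp
  moreover have "(\<lambda>j. of_real (Gamma (1 - \<alpha>) * Gamma (1 + \<alpha>)) * (kum_coeff (of_real (1 - \<alpha>)) j * z ^ j)) sums 
    (of_real (Gamma (1 - \<alpha>) * Gamma (1 + \<alpha>)) * kum (of_real (1 - \<alpha>)) z)"
    unfolding kum_def by (intro sums_mult summable_sums summable_kum)
  ultimately show ?thesis unfolding w_def using sums_unique2 by blast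
qed

text \<open>A logarithm found by adding up arguments may a priori leave the principal strip. For
  arguments in [-5 pi/4, -pi] the sine is nonnegative, so Im W < 0 rules them out.\<close>

lemma Ln_eq_third_quadrant:
  assumes "exp X = W" "Im W < 0" "- (5 * pi / 4) \<le> Im X" "Im X \<le> - (3 * pi / 4)"
  shows "Ln W = X"
proof -
  have "sin (Im X) < 0" using assms(1,2) by (auto simp: Im_exp mult_less_0_iff)
  moreover have "sin (Im X + pi) \<le> 0" if "Im X \<le> - pi"
    using sin_ge_zero[of "- (Im X + pi)"] that assms(3) pi_gt_zero by simp
  then have "sin (Im X) \<ge> 0" if "Im X \<le> - pi" using that by simp
  ultimately have "Im X > - pi" by force
  then show ?thesis using assms pi_gt_zero by (intro Ln_unique) auto
qed

section \<open>Deformation of Euler's integral for z on the imaginary axis\<close>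

definition euler_integrand :: "real \<Rightarrow> real \<Rightarrow> complex \<Rightarrow> complex" where
  "euler_integrand \<alpha> y t = exp (\<i> * of_real y * t) * ((1 - t) / t) powr of_real \<alpha>"

text \<open>As (1 - t)/t = 1/t - 1 sends the upper half-plane into the lower one, the principal
  power of the quotient is holomorphic there.\<close>

lemma euler_quotient:
  assumes "Im t > 0"
  shows "Im ((1 - t) / t) < 0" "(1 - t) / t \<notin> \<real>\<^sub>\<le>\<^sub>0" "t \<noteq> 0" "t \<noteq> 1"
proof -
  show "t \<noteq> 0" "t \<noteq> 1" using assms by auto
  have "(1 - t) / t = 1 / t - 1" using \<open>t \<noteq> 0\<close> by (simp add: field_simps)
  then show *: "Im ((1 - t) / t) < 0" using assms by (simp add: Im_divide sum_power2_gt_zero_iff divide_less_0_iff)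
  then show "(1 - t) / t \<notin> \<real>\<^sub>\<le>\<^sub>0" by (auto simp: complex_nonpos_Reals_iff)
qed

lemma euler_integrand_holomorphic: "euler_integrand \<alpha> y holomorphic_on {t. Im t > 0}"
  unfolding euler_integrand_def[abs_def]
  by (intro holomorphic_intros) (use euler_quotient in auto)

lemma euler_integrand_norm_le:
  assumes "Im t > 0"
  shows "cmod (euler_integrand \<alpha> y t) \<le> exp (- (y * Im t)) * ((1 + 1 / cmod t) powr \<bar>\<alpha>\<bar> + (1 + 1 / cmod (1 - t)) powr \<bar>\<alpha>\<bar>)"
proof -
  note q = euler_quotient[OF assms]
  have "cmod (1 - t) > 0" "cmod t > 0" using q by auto
  note t = this
  have "(cmod (1 - t) / cmod t) powr \<alpha> \<le> (1 + 1 / cmod t) powr \<bar>\<alpha>\<bar> + (1 + 1 / cmod (1 - t)) powr \<bar>\<alpha>\<bar>"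
  proof (cases "\<alpha> \<ge> 0")
    case True
    have "cmod (1 - t) \<le> 1 + cmod t" using norm_triangle_ineq4[of 1 t] by simp
    then have "cmod (1 - t) / cmod t \<le> 1 + 1 / cmod t" using t by (simp add: field_simps)
    then have "(cmod (1 - t) / cmod t) powr \<alpha> \<le> (1 + 1 / cmod t) powr \<bar>\<alpha>\<bar>" using True by (simp add: powr_mono2)
    then show ?thesis by (simp add: add_increasing2)
  next
    case False
    have "cmod t \<le> 1 + cmod (1 - t)" using norm_triangle_ineq4[of 1 "1 - t"] by simp
    then have "cmod t / cmod (1 - t) \<le> 1 + 1 / cmod (1 - t)" using t by (simp add: field_simps)
    then have "(cmod t / cmod (1 - t)) powr (- \<alpha>) \<le> (1 + 1 / cmod (1 - t)) powr \<bar>\<alpha>\<bar>" using False by (simp add: powr_mono2)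
    moreover have "(cmod (1 - t) / cmod t) powr \<alpha> = (cmod t / cmod (1 - t)) powr (- \<alpha>)"
      using t by (simp add: powr_divide powr_minus field_simps)
    ultimately show ?thesis by (simp add: add_increasing)
  qed
  then have "exp (- (y * Im t)) * (cmod (1 - t) / cmod t) powr \<alpha> \<le> exp (- (y * Im t)) * ((1 + 1 / cmod t) powr \<bar>\<alpha>\<bar> + (1 + 1 / cmod (1 - t)) powr \<bar>\<alpha>\<bar>)"
    by (intro mult_left_mono) auto
  moreover have "cmod (euler_integrand \<alpha> y t) = exp (- (y * Im t)) * (cmod (1 - t) / cmod t) powr \<alpha>"
    by (simp add: euler_integrand_def norm_mult norm_powr_real_powr' norm_divide)
  ultimately show ?thesis by simp
qed

text \<open>A point of the ray is at distance at least 1 from one of 0 and 1 and at least \<sigma>/y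
  from the other. So only one factor is singular, of size \<sigma>^(-|\<alpha>|), which is
  integrable at 0 when |\<alpha>| < 1.\<close>

lemma euler_ray_bound:
  assumes y: "y > 0" and s: "\<sigma> > 0" and t: "Im t \<ge> \<sigma> / y" 
    and far: "cmod t \<ge> \<sigma> / y \<and> cmod (1 - t) \<ge> 1 \<or> cmod (1 - t) \<ge> \<sigma> / y \<and> cmod t \<ge> 1"
  shows "cmod (euler_integrand \<alpha> y t) \<le> (2 * (1 + y)) powr \<bar>\<alpha>\<bar> * 2 * ray_dominator (- \<bar>\<alpha>\<bar>) \<bar>\<alpha>\<bar> \<sigma>"
proof -
  define a where "a = \<bar>\<alpha>\<bar>"
  have a: "a \<ge> 0" by (simp add: a_def)
  have "0 < \<sigma> / y" using s y by simp
  then have t0: "Im t > 0" using t by linarith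
  have near: "(1 + 1 / r) powr a \<le> (2 * (1 + y)) powr a * \<sigma> powr (- a) * (1 + \<sigma> powr a)" if "r \<ge> \<sigma> / y" for r
  proof -
    have "1 / r \<le> 1 / (\<sigma> / y)" using that \<open>0 < \<sigma> / y\<close> by (intro divide_left_mono mult_pos_pos) auto
    moreover have "(1 + y) * (1 + \<sigma>) / \<sigma> = 1 + y / \<sigma> + y + 1 / \<sigma>" using s by (simp add: field_simps)
    moreover have "1 / (\<sigma> / y) = y / \<sigma>" "1 / \<sigma> > 0" using s by simp_all
    ultimately have "1 + 1 / r \<le> (1 + y) * (1 + \<sigma>) / \<sigma>" using y by linarith
    moreover have "0 \<le> 1 + 1 / r" using that \<open>0 < \<sigma> / y\<close> by simp
    ultimately have "(1 + 1 / r) powr a \<le> ((1 + y) * (1 + \<sigma>) / \<sigma>) powr a" using a by (intro powr_mono2) auto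
    also have "\<dots> = (1 + y) powr a * \<sigma> powr (- a) * (1 + \<sigma>) powr a"
    proof -
      have "((1 + y) * (1 + \<sigma>) / \<sigma>) powr a = ((1 + y) * (1 + \<sigma>)) powr a / \<sigma> powr a"
        using s y by (simp only: powr_divide)
      also have "((1 + y) * (1 + \<sigma>)) powr a = (1 + y) powr a * (1 + \<sigma>) powr a"
        using s y by (simp only: powr_mult)
      finally show ?thesis by (simp add: powr_minus divide_inverse mult_ac)
    qed
    also have "\<dots> \<le> (1 + y) powr a * \<sigma> powr (- a) * (2 powr a * (1 + \<sigma> powr a))"
      using s a by (intro mult_left_mono one_plus_powr_le) auto
    also have "\<dots> = (2 * (1 + y)) powr a * \<sigma> powr (- a) * (1 + \<sigma> powr a)" by (simp only: powr_mult mult_ac)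
    finally show ?thesis .
  qed
  have far1: "(1 + 1 / r) powr a \<le> (2 * (1 + y)) powr a * \<sigma> powr (- a) * (1 + \<sigma> powr a)" if "r \<ge> 1" for r
  proof -
    have "1 / r \<le> 1" using that by simp
    then have "1 + 1 / r \<le> 1 + 1" by (rule add_left_mono)
    moreover have "1 + 1 \<le> 2 * (1 + y)" using y by simp
    ultimately have "1 + 1 / r \<le> 2 * (1 + y)" by (rule order_trans)
    then have "(1 + 1 / r) powr a \<le> (2 * (1 + y)) powr a * 1" using that a by (simp add: powr_mono2)
    also have "1 \<le> \<sigma> powr (- a) * (1 + \<sigma> powr a)" using s by (simp add: distrib_left flip: powr_add)
    then have "(2 * (1 + y)) powr a * 1 \<le> (2 * (1 + y)) powr a * (\<sigma> powr (- a) * (1 + \<sigma> powr a))" by (intro mult_left_mono) auto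
    finally show ?thesis by (simp add: mult_ac)
  qed
  have "\<sigma> \<le> y * Im t" using t y by (simp add: field_simps)
  then have e: "exp (- (y * Im t)) \<le> exp (- \<sigma>)" by simp
  have "cmod (euler_integrand \<alpha> y t) \<le> exp (- (y * Im t)) * ((1 + 1 / cmod t) powr a + (1 + 1 / cmod (1 - t)) powr a)"
    unfolding a_def by (rule euler_integrand_norm_le[OF t0])
  also have "\<dots> \<le> exp (- \<sigma>) * (2 * ((2 * (1 + y)) powr a * \<sigma> powr (- a) * (1 + \<sigma> powr a)))"
  proof (rule mult_mono[OF e])
    show "(1 + 1 / cmod t) powr a + (1 + 1 / cmod (1 - t)) powr a \<le> 2 * ((2 * (1 + y)) powr a * \<sigma> powr (- a) * (1 + \<sigma> powr a))"
      using far near far1 by (smt (verit))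
  qed auto
  also have "\<dots> = (2 * (1 + y)) powr a * 2 * ray_dominator (- a) a \<sigma>"
    using s by (simp add: ray_dominator_eq)
  finally show ?thesis by (simp add: a_def)
qed

lemma euler_integrand_isCont:
  assumes "t \<noteq> 0" "(1 - t) / t \<notin> \<real>\<^sub>\<le>\<^sub>0"
  shows "isCont (euler_integrand \<alpha> y) t"
proof -
  have "isCont (\<lambda>t. (1 - t) / t) t" using assms(1) by (intro continuous_intros) auto
  then show ?thesis unfolding euler_integrand_def[abs_def]
    by (intro isCont_mult isCont_powr_complex assms continuous_intros)
qed

text \<open>Lifting the segment by \<delta> puts the whole contour into the open upper half-plane,
  where convexity gives a primitive P; the fundamental theorem on the segment and the two rays then
  replaces a closed contour. Since i y d0 = -(1 + i) and i y d1 = -(1 - i), exp(i y t) decays like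
  exp(-\<sigma>) along both rays.\<close>

lemma euler_contour_shifted:
  fixes y \<delta> \<alpha> :: real
  assumes y: "y > 0" and d: "\<delta> > 0" and a: "\<bar>\<alpha>\<bar> < 1"
  defines "d0 \<equiv> (\<i> - 1) / of_real y" and "d1 \<equiv> (\<i> + 1) / of_real y"
  shows "(LINT s|I01. euler_integrand \<alpha> y (of_real s + \<i> * of_real \<delta>)) = 
     (LINT \<sigma>|halfline. euler_integrand \<alpha> y (\<i> * of_real \<delta> + d0 * of_real \<sigma>) * d0) - 
     (LINT \<sigma>|halfline. euler_integrand \<alpha> y (1 + \<i> * of_real \<delta> + d1 * of_real \<sigma>) * d1)"
proof -
  define H where "H = {t. Im t > 0}"
  have H: "convex H" "open H" unfolding H_def by (rule convex_halfspace_Im_gt, rule open_halfspace_Im_gt)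
  obtain P where P0: "\<And>x. x \<in> H \<Longrightarrow> (P has_field_derivative euler_integrand \<alpha> y x) (at x within H)"
    using holomorphic_convex_primitive'[OF H(1,2) euler_integrand_holomorphic[folded H_def]] by blast
  have P: "(P has_field_derivative euler_integrand \<alpha> y t) (at t)" if "Im t > 0" for t
    using P0[of t] at_within_open[of t H] that H(2) by (simp add: H_def)
  have Fc: "isCont (euler_integrand \<alpha> y) t" if "Im t > 0" for t
    by (rule euler_integrand_isCont) (use euler_quotient[OF that] in auto)
  have path: "((\<lambda>s. P (p + q * of_real s)) has_vector_derivative euler_integrand \<alpha> y (p + q * of_real s) * q) (at s)"
    if "Im (p + q * of_real s) > 0" for p q s
  proof -
    have "((\<lambda>w. P (p + q * w)) has_field_derivative euler_integrand \<alpha> y (p + q * of_real s) * q) (at (of_real s))"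
    proof (rule DERIV_chain2[where f = P])
      show "(P has_field_derivative euler_integrand \<alpha> y (p + q * of_real s)) (at (p + q * of_real s))" by (rule P[OF that])
    qed (auto intro!: derivative_eq_intros)
    from has_vector_derivative_real_field[OF this] show ?thesis by simp
  qed
  have Imd: "Im (d0 * of_real s) = s / y" "Im (d1 * of_real s) = s / y" "Re (d0 * of_real s) = - s / y" "Re (d1 * of_real s) = s / y" for s
    unfolding d0_def d1_def by simp_all
  define C where "C = (2 * (1 + y)) powr \<bar>\<alpha>\<bar> * 2"
  have di: "integrable halfline (\<lambda>\<sigma>. C * ray_dominator (- \<bar>\<alpha>\<bar>) \<bar>\<alpha>\<bar> \<sigma> * cmod q)" for q :: complex
    by (intro integrable_mult_left integrable_mult_right ray_dominator_integrable) (use a in auto)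
  have ray: "(\<lambda>n. P (p + q * of_real (real n))) \<longlonglongrightarrow> P p + (LINT \<sigma>|halfline. euler_integrand \<alpha> y (p + q * of_real \<sigma>) * q)"
    if pq: "\<And>\<sigma>. \<sigma> \<ge> 0 \<Longrightarrow> Im (p + q * of_real \<sigma>) \<ge> \<delta> + \<sigma> / y" 
      and far: "\<And>\<sigma>. \<sigma> > 0 \<Longrightarrow> cmod (p + q * of_real \<sigma>) \<ge> \<sigma> / y \<and> cmod (1 - (p + q * of_real \<sigma>)) \<ge> 1 \<or> cmod (1 - (p + q * of_real \<sigma>)) \<ge> \<sigma> / y \<and> cmod (p + q * of_real \<sigma>) \<ge> 1"
    for p q
  proof -
    have pos: "Im (p + q * of_real \<sigma>) > 0" if "\<sigma> \<ge> 0" for \<sigma>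
    proof -
      have "0 \<le> \<sigma> / y" using that y by simp
      then show ?thesis using pq[OF that] d by linarith
    qed
    have "(\<lambda>n. P (p + q * of_real (real n))) \<longlonglongrightarrow> P (p + q * of_real 0) + (LINT \<sigma>|halfline. euler_integrand \<alpha> y (p + q * of_real \<sigma>) * q)"
    proof (rule halfline_FTC)
      show "continuous_on {0..} (\<lambda>\<sigma>. P (p + q * of_real \<sigma>))"
        by (rule continuous_at_imp_continuous_on) (auto intro!: has_vector_derivative_continuous[OF path] pos)
      show "((\<lambda>\<sigma>. P (p + q * of_real \<sigma>)) has_vector_derivative euler_integrand \<alpha> y (p + q * of_real s) * q) (at s)" if "s > 0" for s
        by (rule path) (use pos that in auto)
      show "integrable halfline (\<lambda>\<sigma>. euler_integrand \<alpha> y (p + q * of_real \<sigma>) * q)"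
      proof (rule Bochner_Integration.integrable_bound[OF di[of q]])
        have "continuous_on {0<..} (\<lambda>\<sigma>. euler_integrand \<alpha> y (p + q * of_real \<sigma>))"
          by (rule continuous_at_imp_continuous_on) (auto intro!: isCont_o2[OF _ Fc] continuous_intros pos)
        then show "(\<lambda>\<sigma>. euler_integrand \<alpha> y (p + q * of_real \<sigma>) * q) \<in> borel_measurable halfline"
          by (intro continuous_borel_measurable_halfline continuous_intros)
        show "AE \<sigma> in halfline. norm (euler_integrand \<alpha> y (p + q * of_real \<sigma>) * q) \<le> norm (C * ray_dominator (- \<bar>\<alpha>\<bar>) \<bar>\<alpha>\<bar> \<sigma> * cmod q)"
        proof (rule AE_halflineI)
          fix \<sigma> :: real assume s: "\<sigma> > 0"
          have "cmod (euler_integrand \<alpha> y (p + q * of_real \<sigma>)) \<le> C * ray_dominator (- \<bar>\<alpha>\<bar>) \<bar>\<alpha>\<bar> \<sigma>"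
            unfolding C_def by (rule euler_ray_bound[OF y s]) (use pq[of \<sigma>] far[OF s] s d in auto)
          then have "norm (euler_integrand \<alpha> y (p + q * of_real \<sigma>) * q) \<le> C * ray_dominator (- \<bar>\<alpha>\<bar>) \<bar>\<alpha>\<bar> \<sigma> * cmod q"
            unfolding norm_mult by (rule mult_right_mono) simp
          also have "\<dots> \<le> norm (C * ray_dominator (- \<bar>\<alpha>\<bar>) \<bar>\<alpha>\<bar> \<sigma> * cmod q)"
            unfolding real_norm_def by (rule abs_ge_self)
          finally show "norm (euler_integrand \<alpha> y (p + q * of_real \<sigma>) * q) \<le> norm (C * ray_dominator (- \<bar>\<alpha>\<bar>) \<bar>\<alpha>\<bar> \<sigma> * cmod q)" .
        qed
      qed
    qed
    then show ?thesis by simp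
  qed
  have R0: "(\<lambda>n. P (\<i> * of_real \<delta> + d0 * of_real (real n))) \<longlonglongrightarrow> P (\<i> * of_real \<delta>) + (LINT \<sigma>|halfline. euler_integrand \<alpha> y (\<i> * of_real \<delta> + d0 * of_real \<sigma>) * d0)"
  proof (rule ray)
    fix \<sigma> :: real assume s: "\<sigma> > 0"
    define t where "t = \<i> * of_real \<delta> + d0 * of_real \<sigma>"
    have Rt: "Re t = - (\<sigma> / y)" "Re (1 - t) = 1 + \<sigma> / y" using Imd(3)[of \<sigma>] by (simp_all add: t_def)
    have sy: "\<sigma> / y > 0" using s y by simp
    have "cmod t \<ge> \<sigma> / y" "cmod (1 - t) \<ge> 1"
      using sy Rt abs_Re_le_cmod[of t] complex_Re_le_cmod[of "1 - t"] by linarith+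
    then show "\<sigma> / y \<le> cmod (\<i> * of_real \<delta> + d0 * of_real \<sigma>) \<and> 1 \<le> cmod (1 - (\<i> * of_real \<delta> + d0 * of_real \<sigma>)) \<or> 
      \<sigma> / y \<le> cmod (1 - (\<i> * of_real \<delta> + d0 * of_real \<sigma>)) \<and> 1 \<le> cmod (\<i> * of_real \<delta> + d0 * of_real \<sigma>)"
      by (simp add: t_def)
  qed (use Imd in simp)
  have R1: "(\<lambda>n. P (1 + \<i> * of_real \<delta> + d1 * of_real (real n))) \<longlonglongrightarrow> P (1 + \<i> * of_real \<delta>) + (LINT \<sigma>|halfline. euler_integrand \<alpha> y (1 + \<i> * of_real \<delta> + d1 * of_real \<sigma>) * d1)"
  proof (rule ray)
    fix \<sigma> :: real assume s: "\<sigma> > 0"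
    define t where "t = 1 + \<i> * of_real \<delta> + d1 * of_real \<sigma>"
    have Rt: "Re t = 1 + \<sigma> / y" "Re (1 - t) = - (\<sigma> / y)" using Imd(4)[of \<sigma>] by (simp_all add: t_def)
    have sy: "\<sigma> / y > 0" using s y by simp
    have "cmod (1 - t) \<ge> \<sigma> / y" "cmod t \<ge> 1"
      using sy Rt abs_Re_le_cmod[of "1 - t"] complex_Re_le_cmod[of t] by linarith+
    then show "\<sigma> / y \<le> cmod (1 + \<i> * of_real \<delta> + d1 * of_real \<sigma>) \<and> 1 \<le> cmod (1 - (1 + \<i> * of_real \<delta> + d1 * of_real \<sigma>)) \<or> 
      \<sigma> / y \<le> cmod (1 - (1 + \<i> * of_real \<delta> + d1 * of_real \<sigma>)) \<and> 1 \<le> cmod (1 + \<i> * of_real \<delta> + d1 * of_real \<sigma>)"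
      by (simp add: t_def)
  qed (use Imd in simp)
  \<comment> \<open>The far ends of the rays are 1 + 2 n / y apart, at height above n / y, where the
    integrand is O(exp(-n)). Hence the values of P there have the same limit.\<close>
  have top: "(\<lambda>n. P (1 + \<i> * of_real \<delta> + d1 * of_real (real n)) - P (\<i> * of_real \<delta> + d0 * of_real (real n))) \<longlonglongrightarrow> 0"
  proof (rule Lim_null_comparison)
    show "\<forall>\<^sub>F n in sequentially. norm (P (1 + \<i> * of_real \<delta> + d1 * of_real (real n)) - P (\<i> * of_real \<delta> + d0 * of_real (real n))) \<le> exp (- real n) * 4 * (1 + 2 * real n / y)"
      using eventually_gt_at_top[of "nat \<lceil>y\<rceil>"]
    proof eventually_elim
      case (elim n)
      then have n: "real n \<ge> y" "real n > 0" using y by linarith+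
      define S where "S = {t. Im t \<ge> real n / y}"
      have ny: "real n / y \<ge> 1" using n y by simp
      have SB: "cmod (euler_integrand \<alpha> y t) \<le> exp (- real n) * 4" if "t \<in> S" for t
      proof -
        have t: "Im t \<ge> real n / y" "Im t \<ge> 1" using that ny by (auto simp: S_def)
        have "cmod t \<ge> 1" "cmod (1 - t) \<ge> 1" using t abs_Im_le_cmod[of t] abs_Im_le_cmod[of "1 - t"] by auto
        moreover have "(1 + 1 / r) powr \<bar>\<alpha>\<bar> \<le> 2 powr \<bar>\<alpha>\<bar>" if "r \<ge> 1" for r :: real
        proof -
          have "1 / r \<le> 1" "0 \<le> 1 / r" using that by simp_all
          then show ?thesis by (intro powr_mono2) auto
        qed
        ultimately have "(1 + 1 / cmod t) powr \<bar>\<alpha>\<bar> \<le> 2 powr \<bar>\<alpha>\<bar>" "(1 + 1 / cmod (1 - t)) powr \<bar>\<alpha>\<bar> \<le> 2 powr \<bar>\<alpha>\<bar>"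
          by blast+
        moreover have "2 powr \<bar>\<alpha>\<bar> \<le> (2::real) powr 1" using a by (intro powr_mono) auto
        ultimately have 1: "(1 + 1 / cmod t) powr \<bar>\<alpha>\<bar> + (1 + 1 / cmod (1 - t)) powr \<bar>\<alpha>\<bar> \<le> 4" by simp
        have "real n \<le> y * Im t" using t(1) y by (simp add: field_simps)
        then have 2: "exp (- (y * Im t)) \<le> exp (- real n)" by simp
        have "cmod (euler_integrand \<alpha> y t) \<le> exp (- (y * Im t)) * ((1 + 1 / cmod t) powr \<bar>\<alpha>\<bar> + (1 + 1 / cmod (1 - t)) powr \<bar>\<alpha>\<bar>)"
          by (rule euler_integrand_norm_le) (use t in auto)
        also have "\<dots> \<le> exp (- real n) * 4" using 1 2 by (intro mult_mono) auto
        finally show ?thesis .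
      qed
      have "norm (P (1 + \<i> * of_real \<delta> + d1 * of_real (real n)) - P (\<i> * of_real \<delta> + d0 * of_real (real n))) \<le> exp (- real n) * 4 * norm ((1 + \<i> * of_real \<delta> + d1 * of_real (real n)) - (\<i> * of_real \<delta> + d0 * of_real (real n)))"
      proof (rule field_differentiable_bound[of S P "euler_integrand \<alpha> y"])
        show "convex S" unfolding S_def by (rule convex_halfspace_Im_ge)
        show "(P has_field_derivative euler_integrand \<alpha> y t) (at t within S)" if "t \<in> S" for t
          by (rule has_field_derivative_at_within[OF P]) (use that ny in \<open>auto simp: S_def\<close>)
      qed (use SB Imd[of "real n"] d in \<open>auto simp: S_def\<close>)
      also have "(1 + \<i> * of_real \<delta> + d1 * of_real (real n)) - (\<i> * of_real \<delta> + d0 * of_real (real n)) = of_real (1 + 2 * real n / y)"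
        unfolding d0_def d1_def using y by (simp add: field_simps)
      also have "norm (of_real (1 + 2 * real n / y) :: complex) = 1 + 2 * real n / y"
        unfolding norm_of_real using y n by (intro abs_of_nonneg) simp
      finally show ?case .
    qed
    have "((\<lambda>x::real. exp (- x) * 4 * (1 + 2 * x / y)) \<longlongrightarrow> 0) at_top" using y by real_asymp
    then show "(\<lambda>n. exp (- real n) * 4 * (1 + 2 * real n / y)) \<longlonglongrightarrow> 0"
      using filterlim_real_sequentially by (rule filterlim_compose)
  qed
  have lim: "P (1 + \<i> * of_real \<delta>) + (LINT \<sigma>|halfline. euler_integrand \<alpha> y (1 + \<i> * of_real \<delta> + d1 * of_real \<sigma>) * d1) - 
    (P (\<i> * of_real \<delta>) + (LINT \<sigma>|halfline. euler_integrand \<alpha> y (\<i> * of_real \<delta> + d0 * of_real \<sigma>) * d0)) = 0"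
    using LIMSEQ_unique[OF tendsto_diff[OF R1 R0] top] .
  have top_edge: "(LINT s|I01. euler_integrand \<alpha> y (of_real s + \<i> * of_real \<delta>)) = P (1 + \<i> * of_real \<delta>) - P (\<i> * of_real \<delta>)"
  proof -
    have pos: "Im (\<i> * of_real \<delta> + 1 * of_real s) > 0" for s using d by simp
    have cont: "continuous_on {0..1} (\<lambda>s. euler_integrand \<alpha> y (\<i> * of_real \<delta> + 1 * of_real s))"
      by (rule continuous_at_imp_continuous_on) (intro ballI isCont_o2[OF _ Fc] continuous_intros pos)
    have contP: "continuous_on {0..1} (\<lambda>s. P (\<i> * of_real \<delta> + 1 * of_real s))"
      by (rule continuous_at_imp_continuous_on) (intro ballI has_vector_derivative_continuous[OF path] pos)
    have "prim (\<lambda>s. euler_integrand \<alpha> y (\<i> * of_real \<delta> + 1 * of_real s) * 1) 1 = P (\<i> * of_real \<delta> + 1 * of_real 1) - P (\<i> * of_real \<delta> + 1 * of_real 0)"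
      by (rule prim_FTC[OF contP path[OF pos]]) simp_all
    then show ?thesis using prim_1[OF integrable_I01_continuous[OF cont]] by (simp add: add.commute)
  qed
  have "I = R0 - R1" if "A + R1 - (B + R0) = 0" "I = A - B" for A B R0 R1 I :: complex
    using that by algebra
  from this[OF lim top_edge] show ?thesis .
qed

text \<open>The lift \<delta> = 1/(n+1) is removed by dominated convergence. One dominating function
  serves for all n, because lifting only increases heights and leaves horizontal distances
  unchanged.\<close>

lemma euler_contour:
  fixes y \<alpha> :: real
  assumes y: "y > 0" and a: "\<bar>\<alpha>\<bar> < 1"
  defines "d0 \<equiv> (\<i> - 1) / of_real y" and "d1 \<equiv> (\<i> + 1) / of_real y"
  shows "(LINT s|I01. euler_integrand \<alpha> y (of_real s)) = 
     (LINT \<sigma>|halfline. euler_integrand \<alpha> y (d0 * of_real \<sigma>) * d0) - 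
     (LINT \<sigma>|halfline. euler_integrand \<alpha> y (1 + d1 * of_real \<sigma>) * d1)"
proof -
  define \<delta> where "\<delta> n = 1 / real (Suc n)" for n
  have d: "\<delta> n > 0" for n by (simp add: \<delta>_def)
  have "\<delta> \<longlonglongrightarrow> 0" unfolding \<delta>_def using LIMSEQ_inverse_real_of_nat by (simp add: inverse_eq_divide)
  then have d0lim: "(\<lambda>n. p + \<i> * of_real (\<delta> n) + r) \<longlonglongrightarrow> p + \<i> * of_real 0 + r" for p r :: complex
    by (intro tendsto_intros)
  have lim: "(\<lambda>n. euler_integrand \<alpha> y (p + \<i> * of_real (\<delta> n) + r)) \<longlonglongrightarrow> euler_integrand \<alpha> y (p + r)"
    if "p + r \<noteq> 0" "(1 - (p + r)) / (p + r) \<notin> \<real>\<^sub>\<le>\<^sub>0" for p r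
    using isCont_tendsto_compose[OF euler_integrand_isCont[OF that, of \<alpha> y], of "\<lambda>n. p + \<i> * of_real (\<delta> n) + r" sequentially] d0lim[of p r] by simp
  have Imd: "Im (d0 * of_real s) = s / y" "Im (d1 * of_real s) = s / y" "Re (d0 * of_real s) = - s / y" "Re (d1 * of_real s) = s / y" for s
    unfolding d0_def d1_def by simp_all
  have Fc: "isCont (euler_integrand \<alpha> y) t" if "Im t > 0" for t
    by (rule euler_integrand_isCont) (use euler_quotient[OF that] in auto)
  define C where "C = (2 * (1 + y)) powr \<bar>\<alpha>\<bar> * 2"
  have di: "integrable halfline (\<lambda>\<sigma>. C * ray_dominator (- \<bar>\<alpha>\<bar>) \<bar>\<alpha>\<bar> \<sigma> * cmod q)" for q :: complex
    by (intro integrable_mult_left integrable_mult_right ray_dominator_integrable) (use a in auto)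
  have ray: "(\<lambda>n. LINT \<sigma>|halfline. euler_integrand \<alpha> y (p + \<i> * of_real (\<delta> n) + q * of_real \<sigma>) * q) \<longlonglongrightarrow> (LINT \<sigma>|halfline. euler_integrand \<alpha> y (p + q * of_real \<sigma>) * q)"
    if pq: "\<And>\<sigma>. \<sigma> > 0 \<Longrightarrow> Im (p + q * of_real \<sigma>) \<ge> \<sigma> / y" 
      and far: "\<And>\<sigma> \<delta>. \<sigma> > 0 \<Longrightarrow> cmod (p + \<i> * of_real \<delta> + q * of_real \<sigma>) \<ge> \<sigma> / y \<and> cmod (1 - (p + \<i> * of_real \<delta> + q * of_real \<sigma>)) \<ge> 1 \<or> cmod (1 - (p + \<i> * of_real \<delta> + q * of_real \<sigma>)) \<ge> \<sigma> / y \<and> cmod (p + \<i> * of_real \<delta> + q * of_real \<sigma>) \<ge> 1"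
    for p q
  proof (rule integral_dominated_convergence[OF _ _ di[of q]])
    have pos: "Im (p + q * of_real \<sigma>) > 0" if "\<sigma> > 0" for \<sigma>
      using pq[OF that] divide_pos_pos[OF that y] by linarith
    have pos2: "Im (p + \<i> * of_real (\<delta> n) + q * of_real \<sigma>) > 0" if "\<sigma> > 0" for \<sigma> n
      using pos[OF that] d[of n] by simp
    have "continuous_on {0<..} (\<lambda>\<sigma>. euler_integrand \<alpha> y (p + q * of_real \<sigma>))"
      by (rule continuous_at_imp_continuous_on) (intro ballI isCont_o2[OF _ Fc] continuous_intros pos, auto)
    then show "(\<lambda>\<sigma>. euler_integrand \<alpha> y (p + q * of_real \<sigma>) * q) \<in> borel_measurable halfline"
      by (intro continuous_borel_measurable_halfline continuous_intros)
    have "continuous_on {0<..} (\<lambda>\<sigma>. euler_integrand \<alpha> y (p + \<i> * of_real (\<delta> n) + q * of_real \<sigma>))" for n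
      by (rule continuous_at_imp_continuous_on) (intro ballI isCont_o2[OF _ Fc] continuous_intros pos2, auto)
    then show "(\<lambda>\<sigma>. euler_integrand \<alpha> y (p + \<i> * of_real (\<delta> n) + q * of_real \<sigma>) * q) \<in> borel_measurable halfline" for n
      by (intro continuous_borel_measurable_halfline continuous_intros)
    show "AE \<sigma> in halfline. (\<lambda>n. euler_integrand \<alpha> y (p + \<i> * of_real (\<delta> n) + q * of_real \<sigma>) * q) \<longlonglongrightarrow> euler_integrand \<alpha> y (p + q * of_real \<sigma>) * q"
      by (rule AE_halflineI) (intro tendsto_mult lim tendsto_const, use euler_quotient[OF pos] in auto)
    show "AE \<sigma> in halfline. norm (euler_integrand \<alpha> y (p + \<i> * of_real (\<delta> n) + q * of_real \<sigma>) * q) \<le> C * ray_dominator (- \<bar>\<alpha>\<bar>) \<bar>\<alpha>\<bar> \<sigma> * cmod q" for n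
    proof (rule AE_halflineI)
      fix \<sigma> :: real assume s: "\<sigma> > 0"
      have "cmod (euler_integrand \<alpha> y (p + \<i> * of_real (\<delta> n) + q * of_real \<sigma>)) \<le> C * ray_dominator (- \<bar>\<alpha>\<bar>) \<bar>\<alpha>\<bar> \<sigma>"
        unfolding C_def by (rule euler_ray_bound[OF y s _ far[OF s]]) (use pq[OF s] d[of n] in auto)
      then show "norm (euler_integrand \<alpha> y (p + \<i> * of_real (\<delta> n) + q * of_real \<sigma>) * q) \<le> C * ray_dominator (- \<bar>\<alpha>\<bar>) \<bar>\<alpha>\<bar> \<sigma> * cmod q"
        unfolding norm_mult by (rule mult_right_mono) simp
    qed
  qed
  have R0: "(\<lambda>n. LINT \<sigma>|halfline. euler_integrand \<alpha> y (0 + \<i> * of_real (\<delta> n) + d0 * of_real \<sigma>) * d0) \<longlonglongrightarrow> (LINT \<sigma>|halfline. euler_integrand \<alpha> y (0 + d0 * of_real \<sigma>) * d0)"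
  proof (rule ray)
    fix \<sigma> \<delta> :: real assume s: "\<sigma> > 0"
    define t where "t = 0 + \<i> * of_real \<delta> + d0 * of_real \<sigma>"
    have Rt: "Re t = - (\<sigma> / y)" "Re (1 - t) = 1 + \<sigma> / y" using Imd(3)[of \<sigma>] by (simp_all add: t_def)
    have sy: "\<sigma> / y > 0" using s y by simp
    have "cmod t \<ge> \<sigma> / y" "cmod (1 - t) \<ge> 1"
      using sy Rt abs_Re_le_cmod[of t] complex_Re_le_cmod[of "1 - t"] by linarith+
    then show "\<sigma> / y \<le> cmod (0 + \<i> * of_real \<delta> + d0 * of_real \<sigma>) \<and> 1 \<le> cmod (1 - (0 + \<i> * of_real \<delta> + d0 * of_real \<sigma>)) \<or> 
      \<sigma> / y \<le> cmod (1 - (0 + \<i> * of_real \<delta> + d0 * of_real \<sigma>)) \<and> 1 \<le> cmod (0 + \<i> * of_real \<delta> + d0 * of_real \<sigma>)"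
      unfolding t_def by blast
  qed (use Imd in simp)
  have R1: "(\<lambda>n. LINT \<sigma>|halfline. euler_integrand \<alpha> y (1 + \<i> * of_real (\<delta> n) + d1 * of_real \<sigma>) * d1) \<longlonglongrightarrow> (LINT \<sigma>|halfline. euler_integrand \<alpha> y (1 + d1 * of_real \<sigma>) * d1)"
  proof (rule ray)
    fix \<sigma> \<delta> :: real assume s: "\<sigma> > 0"
    define t where "t = 1 + \<i> * of_real \<delta> + d1 * of_real \<sigma>"
    have Rt: "Re t = 1 + \<sigma> / y" "Re (1 - t) = - (\<sigma> / y)" using Imd(4)[of \<sigma>] by (simp_all add: t_def)
    have sy: "\<sigma> / y > 0" using s y by simp
    have "cmod (1 - t) \<ge> \<sigma> / y" "cmod t \<ge> 1"
      using sy Rt abs_Re_le_cmod[of "1 - t"] complex_Re_le_cmod[of t] by linarith+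
    then show "\<sigma> / y \<le> cmod (1 + \<i> * of_real \<delta> + d1 * of_real \<sigma>) \<and> 1 \<le> cmod (1 - (1 + \<i> * of_real \<delta> + d1 * of_real \<sigma>)) \<or> 
      \<sigma> / y \<le> cmod (1 - (1 + \<i> * of_real \<delta> + d1 * of_real \<sigma>)) \<and> 1 \<le> cmod (1 + \<i> * of_real \<delta> + d1 * of_real \<sigma>)"
      unfolding t_def by blast
  qed (use Imd in simp)
  define aa where "aa = \<bar>\<alpha>\<bar>"
  \<comment> \<open>The exponents 0 are written out so that both summands are Beta
    integrands.\<close>
  define w where "w s = 2 powr aa * (s powr (- aa) * (1 - s) powr 0 + s powr 0 * (1 - s) powr (- aa))" for s :: real
  have "(\<lambda>n. LINT s|I01. euler_integrand \<alpha> y (of_real s + \<i> * of_real (\<delta> n) + 0)) \<longlonglongrightarrow> (LINT s|I01. euler_integrand \<alpha> y (of_real s + 0))"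
  proof (rule integral_dominated_convergence[where w = w])
    show "integrable I01 w" unfolding w_def
      by (intro integrable_mult_right Bochner_Integration.integrable_add integrable_I01_powr_powr) (use a in \<open>auto simp: aa_def\<close>)
    have c0: "isCont (euler_integrand \<alpha> y) (of_real s)" if "0 < s" "s < 1" for s
    proof (rule euler_integrand_isCont)
      have "(1 - complex_of_real s) / of_real s = of_real ((1 - s) / s)" by simp
      then show "(1 - complex_of_real s) / of_real s \<notin> \<real>\<^sub>\<le>\<^sub>0" using that by (simp only: complex_nonpos_Reals_iff) (simp add: not_le)
    qed (use that in simp)
    have "continuous_on {0<..<1} (\<lambda>s. euler_integrand \<alpha> y (of_real s))"
      by (rule continuous_at_imp_continuous_on) (intro ballI isCont_o2[where f = complex_of_real and g = "euler_integrand \<alpha> y"] c0 continuous_intros, auto)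
    then show "(\<lambda>s. euler_integrand \<alpha> y (of_real s + 0)) \<in> borel_measurable I01"
      by (simp add: continuous_borel_measurable_I01)
    have pos: "Im (of_real s + \<i> * of_real (\<delta> n) + 0) > 0" for s n using d[of n] by simp
    show "(\<lambda>s. euler_integrand \<alpha> y (of_real s + \<i> * of_real (\<delta> n) + 0)) \<in> borel_measurable I01" for n
      by (intro continuous_borel_measurable_I01 continuous_at_imp_continuous_on ballI isCont_o2[OF _ Fc] continuous_intros pos)
    show "AE s in I01. (\<lambda>n. euler_integrand \<alpha> y (of_real s + \<i> * of_real (\<delta> n) + 0)) \<longlonglongrightarrow> euler_integrand \<alpha> y (of_real s + 0)"
    proof (rule AE_I01I)
      fix s :: real assume "0 < s" "s < 1"
      then have "isCont (euler_integrand \<alpha> y) (of_real s + \<i> * of_real 0 + 0)" using c0[of s] by simp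
      from isCont_tendsto_compose[OF this d0lim[of "of_real s" 0]]
      show "(\<lambda>n. euler_integrand \<alpha> y (of_real s + \<i> * of_real (\<delta> n) + 0)) \<longlonglongrightarrow> euler_integrand \<alpha> y (of_real s + 0)" by simp
    qed
    show "AE s in I01. norm (euler_integrand \<alpha> y (of_real s + \<i> * of_real (\<delta> n) + 0)) \<le> w s" for n
    proof (rule AE_I01I)
      fix s :: real assume s: "0 < s" "s < 1"
      define t where "t = of_real s + \<i> * of_real (\<delta> n) + 0"
      have t: "Im t > 0" "Re t = s" using d[of n] by (auto simp: t_def)
      have near: "(1 + 1 / r) powr aa \<le> 2 powr aa * x powr (- aa)" if "x \<le> r" "0 < x" "x < 1" for r x :: real
      proof -
        have "1 / r \<le> 1 / x" using that by (intro divide_left_mono) auto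
        moreover have "1 \<le> 1 / x" using that by simp
        ultimately have "1 + 1 / r \<le> 2 * (1 / x)" by simp
        then have "(1 + 1 / r) powr aa \<le> (2 * (1 / x)) powr aa" using that by (intro powr_mono2) (auto simp: aa_def)
        also have "\<dots> = 2 powr aa * x powr (- aa)" by (simp only: powr_mult powr_divide powr_minus) (simp add: field_simps)
        finally show ?thesis .
      qed
      have "cmod (euler_integrand \<alpha> y t) \<le> exp (- (y * Im t)) * ((1 + 1 / cmod t) powr aa + (1 + 1 / cmod (1 - t)) powr aa)"
        unfolding aa_def by (rule euler_integrand_norm_le[OF t(1)])
      also have "\<dots> \<le> 1 * ((1 + 1 / cmod t) powr aa + (1 + 1 / cmod (1 - t)) powr aa)"
        using y t by (intro mult_right_mono) auto
      also have "\<dots> \<le> 2 powr aa * s powr (- aa) + 2 powr aa * (1 - s) powr (- aa)"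
        using near[of s "cmod t"] near[of "1 - s" "cmod (1 - t)"] s t complex_Re_le_cmod[of t] complex_Re_le_cmod[of "1 - t"] by simp
      also have "\<dots> = w s" using s by (simp add: w_def distrib_left)
      finally show "norm (euler_integrand \<alpha> y (of_real s + \<i> * of_real (\<delta> n) + 0)) \<le> w s" by (simp add: t_def)
    qed
  qed
  moreover have "(\<lambda>n. LINT s|I01. euler_integrand \<alpha> y (of_real s + \<i> * of_real (\<delta> n) + 0)) = 
     (\<lambda>n. (LINT \<sigma>|halfline. euler_integrand \<alpha> y (0 + \<i> * of_real (\<delta> n) + d0 * of_real \<sigma>) * d0) - 
     (LINT \<sigma>|halfline. euler_integrand \<alpha> y (1 + \<i> * of_real (\<delta> n) + d1 * of_real \<sigma>) * d1))"
    using euler_contour_shifted[OF y d a] by (simp add: d0_def d1_def)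
  ultimately show ?thesis using tendsto_diff[OF R0 R1] LIMSEQ_unique by fastforce
qed

text \<open>Contribution of the ray that starts at t = 1, where exp(z t) is exp z.\<close>

definition growing_part :: "real \<Rightarrow> complex \<Rightarrow> complex" where
  "growing_part \<alpha> z = exp z * z powr of_real (- 1 - \<alpha>) * ((1 - \<i>) powr of_real (1 + \<alpha>) * ray_integral \<alpha> (- \<alpha>) z)"

text \<open>Contribution of the ray that starts at t = 0. It calls for 1 + i, the conjugate of the
  constant in \<open>ray_integral\<close>; conjugating and reflecting z to -cnj z, which stays in
  the upper half-plane, lets one family of integrals serve for both rays. The phase comes from -1 =
  exp(-i pi).\<close>

definition algebraic_part :: "real \<Rightarrow> complex \<Rightarrow> complex" where
  "algebraic_part \<alpha> z = - exp (- (\<i> * of_real (pi * \<alpha>))) * z powr of_real (\<alpha> - 1) * 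
     cnj ((1 - \<i>) powr of_real (1 - \<alpha>) * ray_integral (- \<alpha>) \<alpha> (- cnj z))"

lemma Ln_1_minus_i: "Im (Ln (1 - \<i>)) = - (pi / 4)" "Im (Ln (1 + \<i>)) = pi / 4"
proof -
  have "exp (Complex (ln (sqrt 2)) (- (pi / 4))) = 1 - \<i>" "exp (Complex (ln (sqrt 2)) (pi / 4)) = 1 + \<i>"
    by (simp_all add: complex_eq_iff Re_exp Im_exp cos_45 sin_45)
  moreover have "- (pi / 4) \<le> pi" using pi_gt_zero by linarith
  ultimately have "Ln (1 - \<i>) = Complex (ln (sqrt 2)) (- (pi / 4))" "Ln (1 + \<i>) = Complex (ln (sqrt 2)) (pi / 4)"
    using pi_gt_zero \<open>- (pi / 4) \<le> pi\<close> by (auto intro!: Ln_unique)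
  then show "Im (Ln (1 - \<i>)) = - (pi / 4)" "Im (Ln (1 + \<i>)) = pi / 4" by simp_all
qed

lemma euler_integrand_right_ray:
  assumes y: "y > 0" and s: "\<sigma> > 0"
  defines "z \<equiv> \<i> * of_real y" and "d1 \<equiv> (\<i> + 1) / of_real y"
  shows "euler_integrand \<alpha> y (1 + d1 * of_real \<sigma>) * d1 = 
    - (exp z * z powr of_real (- 1 - \<alpha>) * ((1 - \<i>) powr of_real (1 + \<alpha>) * ray_integrand \<alpha> (- \<alpha>) z \<sigma>))"
proof -
  define c where "c = 1 - \<i>"
  define t where "t = 1 + d1 * of_real \<sigma>"
  define w where "w = ray_factor z \<sigma>"
  have z0: "z \<noteq> 0" using y by (simp add: z_def)
  have d1: "d1 = - (c / z)" using y by (simp add: d1_def c_def z_def field_simps)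
  have tw: "t = w" by (simp add: t_def w_def ray_factor_def d1 c_def)
  have sy: "\<sigma> / y > 0" using s y by simp
  have Rew: "Re w = 1 + \<sigma> / y" "Im w = \<sigma> / y" unfolding tw[symmetric] t_def d1_def using y by simp_all
  then have w0: "w \<noteq> 0" using sy by (auto simp: complex_eq_iff)
  have LnW: "0 \<le> Im (Ln w)" "Im (Ln w) \<le> pi / 2"
    using Im_Ln_pos_le[OF w0] Re_Ln_pos_le[OF w0] Rew sy by auto
  have Lnz: "Ln z = of_real (ln y) + \<i> * of_real (pi / 2)"
    unfolding z_def using y by (subst Ln_times_ii) (auto simp: Ln_of_real)
  have ps: "complex_of_real (\<sigma> powr q) = exp (of_real q * of_real (ln \<sigma>))" for q
    using s by (simp add: powr_def flip: exp_of_real of_real_mult)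
  have es: "exp (complex_of_real (ln \<sigma>)) = of_real \<sigma>" using s by (simp add: exp_of_real)
  \<comment> \<open>Here t = w and (1 - t)/t = c \<sigma> / (z w), so X adds up the principal
    logarithms of the factors. The bounds on Im (Ln w) alone would allow Im X down to -5 pi/4; the
    sign of the imaginary part of the quotient excludes values up to -pi.\<close>
  define X where "X = Ln c + of_real (ln \<sigma>) - Ln z - Ln w"
  have "exp X = c * of_real \<sigma> / z / w"
    unfolding X_def using s z0 w0 by (simp add: exp_diff exp_add c_def es complex_eq_iff[of "1 - \<i>" 0])
  also have "\<dots> = (1 - t) / t" unfolding tw by (simp add: w_def ray_factor_def c_def)
  finally have eX: "exp X = (1 - t) / t" .
  have "Im t > 0" using Rew sy tw by simp
  then have "Im ((1 - t) / t) < 0" by (rule euler_quotient)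
  moreover have "Im X = - (pi / 4) - pi / 2 - Im (Ln w)" unfolding X_def Lnz c_def by (simp add: Ln_1_minus_i)
  ultimately have "Ln ((1 - t) / t) = X" using eX LnW by (intro Ln_eq_third_quadrant) auto
  moreover have "(1 - t) / t \<noteq> 0" using \<open>Im ((1 - t) / t) < 0\<close> by auto
  ultimately have "((1 - t) / t) powr of_real \<alpha> = exp (of_real \<alpha> * X)" by (simp add: powr_def)
  also have "\<dots> = c powr of_real \<alpha> * of_real (\<sigma> powr \<alpha>) * z powr of_real (- \<alpha>) * w powr of_real (- \<alpha>)"
  proof -
    have "c \<noteq> 0" by (simp add: c_def complex_eq_iff)
    moreover have "of_real \<alpha> * X = of_real \<alpha> * Ln c + of_real \<alpha> * of_real (ln \<sigma>) + of_real (- \<alpha>) * Ln z + of_real (- \<alpha>) * Ln w"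
      unfolding X_def by (simp add: algebra_simps)
    ultimately show ?thesis using z0 w0 unfolding ps by (simp only: powr_def exp_add if_False)
  qed
  finally have p: "((1 - t) / t) powr of_real \<alpha> = c powr of_real \<alpha> * of_real (\<sigma> powr \<alpha>) * z powr of_real (- \<alpha>) * w powr of_real (- \<alpha>)" .
  have e: "exp (\<i> * of_real y * t) = exp z * exp (- (c * of_real \<sigma>))"
  proof -
    have "\<i> * of_real y * t = z + - (c * of_real \<sigma>)" unfolding t_def d1 using z0 by (simp add: z_def algebra_simps)
    then show ?thesis by (simp only: exp_add)
  qed
  have c1: "c powr of_real (1 + \<alpha>) = c * c powr of_real \<alpha>" "z powr of_real (- 1 - \<alpha>) = z powr of_real (- \<alpha>) / z"
    using z0 powr_add[of c 1 "of_real \<alpha>"] powr_diff[of z "of_real (- \<alpha>)" 1] by (simp_all add: diff_diff_eq add.commute minus_diff_commute c_def complex_eq_iff[of "1 - \<i>" 0])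
  show ?thesis
    unfolding t_def[symmetric] unfolding euler_integrand_def p e ray_integrand_def w_def[symmetric] c_def[symmetric] c1 unfolding d1
    by (simp add: field_simps)
qed

lemma euler_integrand_left_ray:
  assumes y: "y > 0" and s: "\<sigma> > 0"
  defines "z \<equiv> \<i> * of_real y" and "d0 \<equiv> (\<i> - 1) / of_real y"
  shows "euler_integrand \<alpha> y (d0 * of_real \<sigma>) * d0 = 
    - exp (- (\<i> * of_real (pi * \<alpha>))) * z powr of_real (\<alpha> - 1) * 
     cnj ((1 - \<i>) powr of_real (1 - \<alpha>) * ray_integrand (- \<alpha>) \<alpha> (- cnj z) \<sigma>)"
proof -
  define c where "c = 1 + \<i>"
  define t where "t = d0 * of_real \<sigma>"
  define u where "u = 1 + c * of_real \<sigma> / z"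
  have z0: "z \<noteq> 0" using y by (simp add: z_def)
  have c0: "c \<noteq> 0" by (simp add: c_def complex_eq_iff)
  have d0: "d0 = - (c / z)" using y by (simp add: d0_def c_def z_def field_simps)
  have t0: "t \<noteq> 0" using s z0 c0 by (simp add: t_def d0)
  have ut: "1 - t = u" by (simp add: t_def u_def d0)
  have sy: "\<sigma> / y > 0" using s y by simp
  have Ret: "Re t = - \<sigma> / y" "Im t = \<sigma> / y" unfolding t_def d0_def using y by simp_all
  have Reu: "Re u = 1 + \<sigma> / y" "Im u = - \<sigma> / y" unfolding ut[symmetric] using Ret by simp_all
  then have u0: "u \<noteq> 0" using sy by (auto simp: complex_eq_iff)
  have u_np: "u \<notin> \<real>\<^sub>\<le>\<^sub>0" using Reu sy by (auto simp: complex_nonpos_Reals_iff)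
  have LnU: "Im (Ln u) \<le> 0" "Im (Ln u) \<ge> - (pi / 2)"
    using Im_Ln_pos_lt[OF u0] Re_Ln_pos_le[OF u0] Reu sy Im_Ln_less_pi[OF u_np] by auto
  have Lnz: "Ln z = of_real (ln y) + \<i> * of_real (pi / 2)"
    unfolding z_def using y by (subst Ln_times_ii) (auto simp: Ln_of_real)
  have ps: "complex_of_real (\<sigma> powr q) = exp (of_real q * of_real (ln \<sigma>))" for q
    using s by (simp add: powr_def flip: exp_of_real of_real_mult)
  have es: "exp (complex_of_real (ln \<sigma>)) = of_real \<sigma>" using s by (simp add: exp_of_real)
  \<comment> \<open>Here (1 - t)/t = - u z / (c \<sigma>). The sign is taken as exp(-i pi) and not
    exp(i pi) because the quotient lies in the lower half-plane; this choice produces the phase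
    exp(-i pi \<alpha>).\<close>
  define X where "X = Ln u + Ln z - \<i> * of_real pi - Ln c - of_real (ln \<sigma>)"
  have "exp X = u * z * (- 1) / c / of_real \<sigma>"
    unfolding X_def using s z0 u0 c0 by (simp add: exp_diff exp_add es)
  also have "\<dots> = (1 - t) / t" unfolding ut using s z0 c0 by (simp add: t_def d0 field_simps)
  finally have eX: "exp X = (1 - t) / t" .
  have "Im t > 0" using Ret sy by simp
  then have Q: "Im ((1 - t) / t) < 0" by (rule euler_quotient)
  moreover have "Im X = Im (Ln u) + pi / 2 - pi - pi / 4" unfolding X_def Lnz c_def by (simp add: Ln_1_minus_i)
  ultimately have "Ln ((1 - t) / t) = X" using eX LnU by (intro Ln_eq_third_quadrant) auto
  moreover have "(1 - t) / t \<noteq> 0" using Q by auto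
  ultimately have "((1 - t) / t) powr of_real \<alpha> = exp (of_real \<alpha> * X)" by (simp add: powr_def)
  also have "of_real \<alpha> * X = of_real \<alpha> * Ln u + of_real \<alpha> * Ln z + - (\<i> * of_real (pi * \<alpha>)) + of_real (- \<alpha>) * Ln c + of_real (- \<alpha>) * of_real (ln \<sigma>)"
    unfolding X_def by (simp add: algebra_simps)
  also have "exp \<dots> = u powr of_real \<alpha> * z powr of_real \<alpha> * exp (- (\<i> * of_real (pi * \<alpha>))) * c powr of_real (- \<alpha>) * of_real (\<sigma> powr (- \<alpha>))"
    using u0 z0 c0 unfolding ps by (simp only: powr_def exp_add if_False)
  finally have p: "((1 - t) / t) powr of_real \<alpha> = u powr of_real \<alpha> * z powr of_real \<alpha> * exp (- (\<i> * of_real (pi * \<alpha>))) * c powr of_real (- \<alpha>) * of_real (\<sigma> powr (- \<alpha>))" .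
  have e: "exp (\<i> * of_real y * t) = exp (- (c * of_real \<sigma>))"
  proof -
    have "\<i> * of_real y * t = - (c * of_real \<sigma>)" unfolding t_def d0 using z0 by (simp add: z_def algebra_simps)
    then show ?thesis by (simp only:)
  qed
  have c1: "c powr of_real (1 - \<alpha>) = c * c powr of_real (- \<alpha>)" "z powr of_real (\<alpha> - 1) = z powr of_real \<alpha> / z"
    using z0 c0 powr_add[of c 1 "of_real (- \<alpha>)"] powr_diff[of z "of_real \<alpha>" 1] by simp_all
  have cc: "cnj ((1 - \<i>) powr of_real (1 - \<alpha>)) = c powr of_real (1 - \<alpha>)"
    by (subst cnj_powr) (auto simp: c_def)
  have rf: "ray_factor (- cnj z) \<sigma> = cnj u"
    by (simp add: ray_factor_def u_def c_def)
  have rc: "cnj (cnj u powr of_real \<alpha>) = u powr of_real \<alpha>"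
    by (subst cnj_powr) (use Reu sy in auto)
  have ri: "cnj (ray_integrand (- \<alpha>) \<alpha> (- cnj z) \<sigma>) = exp (- (c * of_real \<sigma>)) * of_real (\<sigma> powr (- \<alpha>)) * u powr of_real \<alpha>"
    unfolding ray_integrand_def rf complex_cnj_mult rc by (simp add: exp_cnj c_def)
  show ?thesis
    unfolding t_def[symmetric] unfolding euler_integrand_def p e complex_cnj_mult cc c1 ri unfolding d0
    by (simp add: field_simps)
qed

lemma connection_formula_imaginary_axis:
  assumes y: "y > 0" and a: "\<bar>\<alpha>\<bar> < 1"
  defines "z \<equiv> \<i> * of_real y"
  shows "of_real (Gamma (1 - \<alpha>) * Gamma (1 + \<alpha>)) * kum (of_real (1 - \<alpha>)) z = growing_part \<alpha> z + algebraic_part \<alpha> z"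
proof -
  have "of_real (Gamma (1 - \<alpha>) * Gamma (1 + \<alpha>)) * kum (of_real (1 - \<alpha>)) z = 
     (LINT t|I01. exp (z * of_real t) * of_real (t powr (- \<alpha>) * (1 - t) powr \<alpha>))"
    by (rule kum_Euler_integral[OF a, symmetric])
  also have "\<dots> = (LINT s|I01. euler_integrand \<alpha> y (of_real s))"
  proof (rule Bochner_Integration.integral_cong[OF refl])
    fix s :: real assume "s \<in> space I01"
    then have s: "0 < s" "s < 1" by auto
    have "(1 - complex_of_real s) / of_real s = of_real ((1 - s) / s)" by simp
    moreover have "of_real ((1 - s) / s) powr of_real \<alpha> = complex_of_real (((1 - s) / s) powr \<alpha>)"
      using s by (intro powr_of_real) auto
    moreover have "((1 - s) / s) powr \<alpha> = s powr (- \<alpha>) * (1 - s) powr \<alpha>"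
      using s powr_divide[of "1 - s" s \<alpha>] by (simp add: powr_minus field_simps)
    ultimately show "exp (z * of_real s) * of_real (s powr (- \<alpha>) * (1 - s) powr \<alpha>) = euler_integrand \<alpha> y (of_real s)"
      by (simp only: euler_integrand_def z_def)
  qed
  also have "\<dots> = (LINT \<sigma>|halfline. euler_integrand \<alpha> y ((\<i> - 1) / of_real y * of_real \<sigma>) * ((\<i> - 1) / of_real y)) - 
     (LINT \<sigma>|halfline. euler_integrand \<alpha> y (1 + (\<i> + 1) / of_real y * of_real \<sigma>) * ((\<i> + 1) / of_real y))"
    by (rule euler_contour[OF y a])
  also have "(LINT \<sigma>|halfline. euler_integrand \<alpha> y (1 + (\<i> + 1) / of_real y * of_real \<sigma>) * ((\<i> + 1) / of_real y)) = 
     (LINT \<sigma>|halfline. - (exp z * z powr of_real (- 1 - \<alpha>) * ((1 - \<i>) powr of_real (1 + \<alpha>) * ray_integrand \<alpha> (- \<alpha>) z \<sigma>)))"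
    by (rule Bochner_Integration.integral_cong[OF refl]) (unfold z_def, rule euler_integrand_right_ray[OF y], simp)
  also have "\<dots> = - growing_part \<alpha> z" by (simp add: growing_part_def ray_integral_def)
  also have "(LINT \<sigma>|halfline. euler_integrand \<alpha> y ((\<i> - 1) / of_real y * of_real \<sigma>) * ((\<i> - 1) / of_real y)) = 
     (LINT \<sigma>|halfline. - exp (- (\<i> * of_real (pi * \<alpha>))) * z powr of_real (\<alpha> - 1) * 
     cnj ((1 - \<i>) powr of_real (1 - \<alpha>) * ray_integrand (- \<alpha>) \<alpha> (- cnj z) \<sigma>))"
    by (rule Bochner_Integration.integral_cong[OF refl]) (unfold z_def, rule euler_integrand_left_ray[OF y], simp)
  also have "\<dots> = algebraic_part \<alpha> z"
    unfolding algebraic_part_def ray_integral_def complex_cnj_mult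
    by (simp only: integral_mult_right_zero mult.assoc Bochner_Integration.integral_cnj)
  finally show ?thesis by simp
qed

definition growing_coeff :: "real \<Rightarrow> complex \<Rightarrow> complex" where
  "growing_coeff \<alpha> z = (1 - \<i>) powr of_real (1 + \<alpha>) * ray_integral \<alpha> (- \<alpha>) z"

lemma growing_part_eq: "growing_part \<alpha> z = exp z * z powr of_real (- 1 - \<alpha>) * growing_coeff \<alpha> z"
  by (simp add: growing_part_def growing_coeff_def)

lemma upper_half_nonpos: "Im z > 0 \<Longrightarrow> z \<notin> \<real>\<^sub>\<le>\<^sub>0" "Im z > 0 \<Longrightarrow> z \<noteq> 0"
  by (auto simp: complex_nonpos_Reals_iff)

lemma growing_coeff_holomorphic: "\<alpha> > -1 \<Longrightarrow> growing_coeff \<alpha> holomorphic_on {z. Im z > 0}"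
  unfolding growing_coeff_def[abs_def] by (intro holomorphic_intros ray_integral_holomorphic)

lemma growing_part_holomorphic: "\<alpha> > -1 \<Longrightarrow> growing_part \<alpha> holomorphic_on {z. Im z > 0}"
  unfolding growing_part_eq[abs_def]
  by (intro holomorphic_intros growing_coeff_holomorphic) (auto simp: upper_half_nonpos)

lemma algebraic_part_holomorphic:
  assumes "\<alpha> < 1"
  shows "algebraic_part \<alpha> holomorphic_on {z. Im z > 0}"
proof -
  define f where "f w = (1 - \<i>) powr of_real (1 - \<alpha>) * ray_integral (- \<alpha>) \<alpha> w" for w
  have f: "f holomorphic_on {z. Im z > 0}"
    unfolding f_def[abs_def] using assms by (intro holomorphic_intros ray_integral_holomorphic) auto
  have "(\<lambda>w. f (- w)) holomorphic_on cnj ` {z. Im z > 0}"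
    by (rule holomorphic_on_compose_gen[OF _ f, of uminus, unfolded o_def]) (auto intro!: holomorphic_intros)
  then have "cnj \<circ> (\<lambda>w. f (- w)) \<circ> cnj holomorphic_on {z. Im z > 0}"
    by (rule holomorphic_on_compose_cnj_cnj) (rule open_halfspace_Im_gt)
  then have "(\<lambda>z. cnj (f (- cnj z))) holomorphic_on {z. Im z > 0}" by (simp add: o_def)
  then show ?thesis unfolding algebraic_part_def[abs_def] f_def[symmetric]
    by (intro holomorphic_intros) (auto simp: upper_half_nonpos)
qed

lemma kum_holomorphic: "kum a holomorphic_on A"
  unfolding holomorphic_on_def field_differentiable_def
  using kum_has_derivative has_field_derivative_at_within by blast

text \<open>Identity theorem: all terms are holomorphic in the upper half-plane and agree on the
  positive imaginary axis, which accumulates at i.\<close>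

lemma connection_formula:
  assumes a: "\<bar>\<alpha>\<bar> < 1" and z: "Im z > 0"
  shows "of_real (Gamma (1 - \<alpha>) * Gamma (1 + \<alpha>)) * kum (of_real (1 - \<alpha>)) z = growing_part \<alpha> z + algebraic_part \<alpha> z"
proof -
  define f where "f z = of_real (Gamma (1 - \<alpha>) * Gamma (1 + \<alpha>)) * kum (of_real (1 - \<alpha>)) z - (growing_part \<alpha> z + algebraic_part \<alpha> z)" for z
  have "f z = 0"
  proof (rule analytic_continuation[of f "{z. Im z > 0}" "(\<lambda>y. \<i> * of_real y) ` {0<..}" \<i>])
    show "f holomorphic_on {z. Im z > 0}"
      unfolding f_def[abs_def] using a
      by (intro holomorphic_intros kum_holomorphic growing_part_holomorphic algebraic_part_holomorphic) auto
    show "connected {z. Im z > 0}" by (intro convex_connected convex_halfspace_Im_gt)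
    show "\<i> islimpt (\<lambda>y. \<i> * complex_of_real y) ` {0<..}"
      unfolding islimpt_approachable
    proof (intro allI impI)
      fix e :: real assume "e > 0"
      then show "\<exists>x'\<in>(\<lambda>y. \<i> * complex_of_real y) ` {0<..}. x' \<noteq> \<i> \<and> dist x' \<i> < e"
        by (intro bexI[of _ "\<i> * of_real (1 + e / 2)"])
          (auto simp: dist_norm algebra_simps norm_mult intro!: image_eqI[of _ _ "1 + e / 2"])
    qed
    show "f w = 0" if "w \<in> (\<lambda>y. \<i> * complex_of_real y) ` {0<..}" for w
      using that connection_formula_imaginary_axis[OF _ a] by (auto simp: f_def)
  qed (use z open_halfspace_Im_gt in auto)
  then show ?thesis by (simp add: f_def)
qed

section \<open>Extension to all positive non-integer parameters by recursion\<close>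

definition connection_const :: "real \<Rightarrow> real" where
  "connection_const \<alpha> = \<alpha> / (Gamma (1 - \<alpha>) * Gamma (1 + \<alpha>))"

text \<open>For \<alpha> >= 1 the integral in \<open>algebraic_part\<close> diverges at 0, so that
  part is replaced by what remains after subtraction. The factor \<alpha> turns the three-term
  relation into X(\<alpha>+1) = ((2 \<alpha> - z)/\<alpha>) X(\<alpha>) - X(\<alpha>-1). For
  non-integer \<alpha> the constant \<open>connection_const\<close> is sin(pi \<alpha>)/pi, which
  changes sign when \<alpha> grows by 1.\<close>

definition kum_rest :: "real \<Rightarrow> complex \<Rightarrow> complex" where
  "kum_rest \<alpha> z = of_real \<alpha> * kum (of_real (1 - \<alpha>)) z - of_real (connection_const \<alpha>) * growing_part \<alpha> z"

text \<open>The coefficient of the leading term z^(\<alpha>-1) of \<open>kum_rest\<close>. For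
  nonzero \<alpha> with |\<alpha>| < 1 it is \<open>connection_const\<close> times the phase of
  \<open>algebraic_part\<close> times Gamma(1 - \<alpha>).\<close>

definition rest_coeff :: "real \<Rightarrow> complex" where
  "rest_coeff \<alpha> = - exp (- (\<i> * of_real (pi * \<alpha>))) * of_real (\<alpha> / Gamma (1 + \<alpha>))"

lemma connection_const_plus1:
  assumes "\<alpha> \<notin> \<int>"
  shows "connection_const (\<alpha> + 1) = - connection_const \<alpha>"
proof -
  have nz: "\<alpha> + 1 \<notin> \<int>" "- \<alpha> \<notin> \<int>" "1 - \<alpha> \<notin> \<int>"
    using assms Ints_diff[of "\<alpha> + 1" 1] Ints_diff[of 1 "1 - \<alpha>"] by auto
  then have "\<alpha> + 1 \<notin> \<int>\<^sub>\<le>\<^sub>0" "- \<alpha> \<notin> \<int>\<^sub>\<le>\<^sub>0" "1 - \<alpha> \<notin> \<int>\<^sub>\<le>\<^sub>0" using nonpos_Ints_Int by blast+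
  moreover have "\<alpha> \<noteq> 0" using assms by auto
  moreover have "1 + \<alpha> \<noteq> 0" using nz(1) Ints_0 by (metis add.commute)
  moreover have "Gamma (- \<alpha> + 1) = - \<alpha> * Gamma (- \<alpha>)" "Gamma ((\<alpha> + 1) + 1) = (\<alpha> + 1) * Gamma (\<alpha> + 1)"
    by (rule Gamma_plus1, fact)+
  ultimately show ?thesis
    unfolding connection_const_def by (simp add: add_ac Gamma_eq_zero_iff divide_simps)
qed

lemma rest_coeff_plus1:
  assumes "\<alpha> > 0"
  shows "rest_coeff (\<alpha> + 1) = - rest_coeff \<alpha> / of_real \<alpha>"
proof -
  have e: "exp (- (\<i> * of_real (pi * (\<alpha> + 1)))) = - exp (- (\<i> * of_real (pi * \<alpha>)))"
  proof -
    have "- (\<i> * complex_of_real (pi * (\<alpha> + 1))) = - (\<i> * of_real (pi * \<alpha>)) + - (\<i> * of_real pi)" by (simp add: algebra_simps)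
    then show ?thesis by (simp only: exp_add exp_minus[of "\<i> * of_real pi"]) simp
  qed
  have "Gamma ((\<alpha> + 1) + 1) = (\<alpha> + 1) * Gamma (\<alpha> + 1)"
    using assms by (intro Gamma_plus1) (auto dest!: nonpos_Ints_nonpos)
  moreover have "Gamma (\<alpha> + 1) \<noteq> 0" using assms by (auto simp: Gamma_eq_zero_iff dest!: nonpos_Ints_nonpos)
  ultimately have "(\<alpha> + 1) / Gamma (1 + (\<alpha> + 1)) = \<alpha> / Gamma (1 + \<alpha>) / \<alpha>"
    using assms by (simp add: add_ac)
  then show ?thesis unfolding rest_coeff_def e by simp
qed

text \<open>This is \<open>ray_integral_rec\<close> multiplied by z (1 - i)^\<alpha> /
  \<alpha>.\<close>

lemma growing_coeff_rec:
  assumes a: "\<alpha> > 0" and z: "Im z > 0"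
  shows "z * growing_coeff \<alpha> z / of_real \<alpha> = z * growing_coeff (\<alpha> - 1) z + 2 * growing_coeff \<alpha> z + growing_coeff (\<alpha> + 1) z / z"
proof -
  define p where "p = (1 - \<i>) powr of_real \<alpha>"
  define R0 R R1 where "R0 = ray_integral (\<alpha> - 1) (1 - \<alpha>) z" and "R = ray_integral \<alpha> (- \<alpha>) z" and "R1 = ray_integral (\<alpha> + 1) (- (\<alpha> + 1)) z"
  have c0: "1 - \<i> \<noteq> 0" by (simp add: complex_eq_iff)
  have z0: "z \<noteq> 0" using z by auto
  have "growing_coeff (\<alpha> - 1) z = p * R0" "growing_coeff \<alpha> z = (1 - \<i>) * p * R" "growing_coeff (\<alpha> + 1) z = (1 - \<i>)\<^sup>2 * p * R1"
    unfolding growing_coeff_def p_def R0_def R_def R1_def using c0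
      powr_add[of "1 - \<i>" 1 "of_real \<alpha>"] powr_add[of "1 - \<i>" 1 "1 + of_real \<alpha>"]
    by (simp_all add: power2_eq_square add_ac)
  moreover have "(1 - \<i>) * R = of_real \<alpha> * (R0 + 2 * (1 - \<i>) / z * R + ((1 - \<i>) / z)\<^sup>2 * R1)"
  proof -
    have "- \<alpha> - 1 = - (\<alpha> + 1)" by simp
    from ray_integral_rec[OF a z, unfolded this] show ?thesis unfolding R0_def R_def R1_def .
  qed
  moreover have "z * (c * p * R) / x = z * (p * R0) + 2 * (c * p * R) + c\<^sup>2 * p * R1 / z"
    if "c * R = x * (R0 + 2 * c / z * R + (c / z)\<^sup>2 * R1)" "x \<noteq> 0" for c x
  proof -
    have "z * (c * p * R) / x = z * p * (c * R) / x" by (simp add: ac_simps)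
    also have "\<dots> = z * p * (R0 + 2 * c / z * R + (c / z)\<^sup>2 * R1)" unfolding that(1) using that(2) by simp
    also have "\<dots> = z * (p * R0) + 2 * (c * p * R) + c\<^sup>2 * p * R1 / z"
      using z0 by (simp add: power2_eq_square distrib_left)
    finally show ?thesis .
  qed
  ultimately show ?thesis using a by simp
qed

text \<open>Kummer functions and growing parts are treated separately. The growing parts satisfy the
  relation with the signs of both outer terms reversed, and the alternating sign of
  \<open>connection_const\<close> compensates this, so the difference satisfies it as well.\<close>

lemma kum_rest_rec:
  assumes a: "\<alpha> > 0" "\<alpha> \<notin> \<int>" and z: "Im z > 0"
  shows "kum_rest (\<alpha> + 1) z = ((2 * of_real \<alpha> - z) / of_real \<alpha>) * kum_rest \<alpha> z - kum_rest (\<alpha> - 1) z"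
proof -
  define x where "x = complex_of_real \<alpha>"
  define k0 k k1 where "k0 = kum (of_real (1 - (\<alpha> - 1))) z" and "k = kum (of_real (1 - \<alpha>)) z" and "k1 = kum (of_real (1 - (\<alpha> + 1))) z"
  define L0 L L1 where "L0 = growing_coeff (\<alpha> - 1) z" and "L = growing_coeff \<alpha> z" and "L1 = growing_coeff (\<alpha> + 1) z"
  define q where "q = exp z * z powr of_real (- 1 - \<alpha>)"
  define g where "g = complex_of_real (connection_const \<alpha>)"
  have z0: "z \<noteq> 0" using z by auto
  have x0: "x \<noteq> 0" using a by (simp add: x_def)
  have K: "(x + 1) * k1 = (2 * x - z) / x * (x * k) - (x - 1) * k0"
  proof -
    have "(2 - (1 - x)) * kum ((1 - x) - 1) z + (2 * (1 - x) - 2 + z) * kum (1 - x) z - (1 - x) * kum ((1 - x) + 1) z = 0"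
      by (rule kum_three_term)
    moreover have "kum ((1 - x) - 1) z = k1" "kum (1 - x) z = k" "kum ((1 - x) + 1) z = k0"
      by (simp_all add: k_def k0_def k1_def x_def algebra_simps)
    ultimately have "(1 + x) * k1 + (z - 2 * x) * k - (1 - x) * k0 = 0" by (simp add: algebra_simps)
    moreover have "(2 * x - z) / x * (x * k) = (2 * x - z) * k" using x0 by simp
    ultimately show ?thesis by algebra
  qed
  have G: "z * L / x = z * L0 + 2 * L + L1 / z"
    unfolding L0_def L_def L1_def x_def by (rule growing_coeff_rec[OF a(1) z])
  have "\<alpha> - 1 \<notin> \<int>" using a(2) Ints_add[of "\<alpha> - 1" 1] by auto
  then have g: "connection_const (\<alpha> + 1) = - connection_const \<alpha>" "connection_const (\<alpha> - 1) = - connection_const \<alpha>"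
    using connection_const_plus1[of "\<alpha> - 1"] connection_const_plus1[OF a(2)] by simp_all
  have pw: "growing_part (\<alpha> + 1) z = q / z * L1" "growing_part \<alpha> z = q * L" "growing_part (\<alpha> - 1) z = q * z * L0"
    unfolding growing_part_eq q_def L_def L0_def L1_def
    using z0 powr_diff[of z "of_real (- 1 - \<alpha>)" 1] powr_add[of z "of_real (- 1 - \<alpha>)" 1]
    by (simp_all add: algebra_simps)
  have V: "(2 * x - z) / x * (q * L) + q * z * L0 = - (q / z * L1)"
  proof -
    have "(2 * x - z) / x * (q * L) = q * (2 * L - z * L / x)" using x0 by (simp add: diff_divide_distrib algebra_simps)
    also have "\<dots> = - (q * z * L0) - q / z * L1" unfolding G by (simp add: algebra_simps)
    finally have "(2 * x - z) / x * (q * L) = - (q * z * L0) - q / z * L1" .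
    then show ?thesis by simp
  qed
  have "N1 - (- g) * V1 = A * (N - g * V) - (N0 - (- g) * V0)" if "N1 = A * N - N0" "A * V + V0 = - V1" for N N0 N1 V V0 V1 A
    using that by algebra
  from this[OF K V]
  have "(x + 1) * k1 - (- g) * (q / z * L1) = (2 * x - z) / x * (x * k - g * (q * L)) - ((x - 1) * k0 - (- g) * (q * z * L0))" .
  then show ?thesis unfolding kum_rest_def pw g k_def k0_def k1_def g_def x_def by simp
qed

lemma laplace_limit: 
  assumes "\<beta> > -1"
  shows "(1 - \<i>) powr of_real (1 + \<beta>) * laplace_powr \<beta> (1 - \<i>) = of_real (Gamma (1 + \<beta>))"
  using laplace_powr_eq[OF assms, of "1 - \<i>"] Gamma_complex_of_real[of "1 + \<beta>"] by simp

lemma growing_coeff_asymptotic: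
  assumes a: "\<alpha> > -1"
  obtains K where "K \<ge> 0" "\<And>z. Im z > 0 \<Longrightarrow> cmod z \<ge> 1 \<Longrightarrow> cmod (growing_coeff \<alpha> z - of_real (Gamma (1 + \<alpha>))) \<le> K / cmod z"
proof -
  obtain K where K: "K \<ge> 0" "\<And>z. Im z > 0 \<Longrightarrow> cmod z \<ge> 1 \<Longrightarrow> cmod (ray_integral \<alpha> (- \<alpha>) z - laplace_powr \<alpha> (1 - \<i>)) \<le> K / cmod z"
    by (rule ray_integral_asymptotic[OF a, of "- \<alpha>"]) blast
  define p where "p = (1 - \<i>) powr of_real (1 + \<alpha>)"
  show ?thesis
  proof (rule that[of "cmod p * K"])
    fix z :: complex assume z: "Im z > 0" "cmod z \<ge> 1"
    have "growing_coeff \<alpha> z - of_real (Gamma (1 + \<alpha>)) = p * (ray_integral \<alpha> (- \<alpha>) z - laplace_powr \<alpha> (1 - \<i>))"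
      unfolding growing_coeff_def laplace_limit[OF a, symmetric] p_def by (simp add: algebra_simps)
    then show "cmod (growing_coeff \<alpha> z - of_real (Gamma (1 + \<alpha>))) \<le> cmod p * K / cmod z"
      using mult_left_mono[OF K(2)[OF z], of "cmod p"] by (simp add: norm_mult)
  qed (use K in simp)
qed

definition rest_asymptotic :: "real \<Rightarrow> bool" where
  "rest_asymptotic \<alpha> \<longleftrightarrow> (\<exists>K\<ge>0. \<forall>z. Im z > 0 \<longrightarrow> cmod z \<ge> 1 \<longrightarrow>
     cmod (kum_rest \<alpha> z - rest_coeff \<alpha> * z powr of_real (\<alpha> - 1)) \<le> K * cmod z powr (\<alpha> - 2))"

lemma cmod_powr_of_real: "cmod (z powr of_real x) = cmod z powr x"
  by (subst norm_powr_real_powr') simp_all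

text \<open>In this range the connection formula makes \<open>kum_rest\<close> a multiple of
  \<open>algebraic_part\<close>, whose ray integral has a known limit with error O(1/|z|).\<close>

lemma rest_asymptotic_base:
  assumes a: "\<bar>\<alpha>\<bar> < 1" "\<alpha> \<noteq> 0"
  shows "rest_asymptotic \<alpha>"
proof -
  define d where "d = (1 - \<i>) powr of_real (1 + - \<alpha>)"
  have a': "- \<alpha> > -1" using a by simp
  obtain K where K: "K \<ge> 0" "\<And>z. Im z > 0 \<Longrightarrow> cmod z \<ge> 1 \<Longrightarrow> cmod (ray_integral (- \<alpha>) \<alpha> z - laplace_powr (- \<alpha>) (1 - \<i>)) \<le> K / cmod z"
    by (rule ray_integral_asymptotic[OF a', of \<alpha>]) blast
  have Gn: "Gamma (1 - \<alpha>) \<noteq> 0" "Gamma (1 + \<alpha>) \<noteq> 0"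
    using a by (auto simp: Gamma_eq_zero_iff dest!: nonpos_Ints_nonpos)
  define e where "e = - exp (- (\<i> * complex_of_real (pi * \<alpha>)))"
  define g where "g = complex_of_real (connection_const \<alpha>)"
  have Cc: "rest_coeff \<alpha> = g * e * cnj (of_real (Gamma (1 + - \<alpha>)))"
    using Gn by (simp add: rest_coeff_def g_def e_def connection_const_def field_simps)
  show ?thesis unfolding rest_asymptotic_def
  proof (intro exI[of _ "cmod (g * e) * (cmod d * K)"] conjI allI impI)
    show "0 \<le> cmod (g * e) * (cmod d * K)" using K by simp
    fix z :: complex assume z: "Im z > 0" "1 \<le> cmod z"
    define J where "J = ray_integral (- \<alpha>) \<alpha> (- cnj z)"
    have P: "kum_rest \<alpha> z = g * algebraic_part \<alpha> z"
    proof -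
      have "of_real \<alpha> * kum (of_real (1 - \<alpha>)) z = g * (of_real (Gamma (1 - \<alpha>) * Gamma (1 + \<alpha>)) * kum (of_real (1 - \<alpha>)) z)"
        using Gn by (simp add: g_def connection_const_def)
      then show ?thesis unfolding kum_rest_def connection_formula[OF a(1) z(1)] g_def by (simp add: algebra_simps)
    qed
    have "kum_rest \<alpha> z - rest_coeff \<alpha> * z powr of_real (\<alpha> - 1) = 
       g * e * z powr of_real (\<alpha> - 1) * cnj (d * (J - laplace_powr (- \<alpha>) (1 - \<i>)))"
      unfolding P Cc laplace_limit[OF a', symmetric] algebraic_part_def d_def J_def e_def
      by (simp add: algebra_simps)
    also have "cmod \<dots> = cmod (g * e) * cmod z powr (\<alpha> - 1) * (cmod d * cmod (J - laplace_powr (- \<alpha>) (1 - \<i>)))"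
      unfolding norm_mult complex_mod_cnj cmod_powr_of_real by simp
    also have "\<dots> \<le> cmod (g * e) * cmod z powr (\<alpha> - 1) * (cmod d * (K / cmod z))"
      using K(2)[of "- cnj z"] z by (intro mult_left_mono) (auto simp: J_def)
    also have "\<dots> = cmod (g * e) * (cmod d * K) * (cmod z powr (\<alpha> - 1) / cmod z)" by simp
    also have "cmod z powr (\<alpha> - 1) / cmod z = cmod z powr (\<alpha> - 2)"
      using z powr_diff[of "cmod z" "\<alpha> - 1" 1] by auto
    finally show "cmod (kum_rest \<alpha> z - rest_coeff \<alpha> * z powr of_real (\<alpha> - 1)) \<le> cmod (g * e) * (cmod d * K) * cmod z powr (\<alpha> - 2)" .
  qed
qed

text \<open>The new leading term is -z/\<alpha> times the one at \<alpha>. Everything else is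
  O(|z|^(\<alpha>-1)), exactly the error allowed at \<alpha> + 1: multiplication by z raises the old
  error to that order, and the other terms of the recursion are no larger.\<close>

lemma rest_asymptotic_step:
  assumes a: "\<alpha> > 0" "\<alpha> \<notin> \<int>" and r: "rest_asymptotic \<alpha>" "rest_asymptotic (\<alpha> - 1)"
  shows "rest_asymptotic (\<alpha> + 1)"
proof -
  obtain K where K: "K \<ge> 0" "\<And>z. Im z > 0 \<Longrightarrow> cmod z \<ge> 1 \<Longrightarrow> cmod (kum_rest \<alpha> z - rest_coeff \<alpha> * z powr of_real (\<alpha> - 1)) \<le> K * cmod z powr (\<alpha> - 2)"
    using r(1) unfolding rest_asymptotic_def by auto
  obtain M where M: "M \<ge> 0" "\<And>z. Im z > 0 \<Longrightarrow> cmod z \<ge> 1 \<Longrightarrow> cmod (kum_rest (\<alpha> - 1) z - rest_coeff (\<alpha> - 1) * z powr of_real (\<alpha> - 1 - 1)) \<le> M * cmod z powr (\<alpha> - 1 - 2)"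
    using r(2) unfolding rest_asymptotic_def by auto
  define C D where "C = rest_coeff \<alpha>" and "D = rest_coeff (\<alpha> - 1)"
  define T where "T = 2 * (cmod C + K) + K / \<alpha> + (cmod D + M)"
  show ?thesis unfolding rest_asymptotic_def
  proof (intro exI[of _ T] conjI allI impI)
    show "0 \<le> T" using K M a by (simp add: T_def)
    fix z :: complex assume z: "Im z > 0" "1 \<le> cmod z"
    define P Q where "P = kum_rest \<alpha> z" and "Q = kum_rest (\<alpha> - 1) z"
    define E where "E = P - C * z powr of_real (\<alpha> - 1)"
    define F where "F = Q - D * z powr of_real (\<alpha> - 1 - 1)"
    define r where "r = cmod z"
    have r: "r \<ge> 1" using z by (simp add: r_def)
    have z0: "z \<noteq> 0" using z by auto
    have pz: "z powr of_real (\<alpha> + 1 - 1) = z * z powr of_real (\<alpha> - 1)"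
      using z0 powr_add[of z 1 "of_real \<alpha> - 1"] by simp
    have mono: "r powr (\<alpha> - 2) \<le> r powr (\<alpha> - 1)" "r powr (\<alpha> - 1 - 1) \<le> r powr (\<alpha> - 1)" "r powr (\<alpha> - 1 - 2) \<le> r powr (\<alpha> - 1)"
      using r by (auto intro!: powr_mono)
    have E: "cmod E \<le> K * r powr (\<alpha> - 2)" unfolding E_def P_def C_def r_def by (rule K(2)[OF z])
    have F: "cmod F \<le> M * r powr (\<alpha> - 1 - 2)" unfolding F_def Q_def D_def r_def by (rule M(2)[OF z])
    have "kum_rest (\<alpha> + 1) z - rest_coeff (\<alpha> + 1) * z powr of_real (\<alpha> + 1 - 1) = 
        2 * P - z * E / of_real \<alpha> - Q"
    proof -
      have "(2 * x - z) / x * P - Q - - C / x * (z * w) = 2 * P - z * (P - C * w) / x - Q" if "x \<noteq> 0" for x w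
        using that by (simp add: diff_divide_distrib algebra_simps)
      from this[of "of_real \<alpha>" "z powr of_real (\<alpha> - 1)"] show ?thesis
        unfolding kum_rest_rec[OF a z(1)] rest_coeff_plus1[OF a(1)] pz E_def P_def Q_def C_def using a by simp
    qed
    also have "cmod (2 * P - z * E / of_real \<alpha> - Q) \<le> 2 * cmod P + r * cmod E / \<alpha> + cmod Q"
    proof -
      have "cmod (2 * P - z * E / of_real \<alpha> - Q) \<le> cmod (2 * P) + cmod (z * E / of_real \<alpha>) + cmod Q"
        using norm_triangle_ineq4[of "2 * P - z * E / of_real \<alpha>" Q] norm_triangle_ineq4[of "2 * P" "z * E / of_real \<alpha>"] by linarith
      then show ?thesis using a by (simp add: norm_mult norm_divide r_def)
    qed
    also have "\<dots> \<le> T * r powr (\<alpha> - 1)"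
    proof -
    have "cmod P \<le> cmod C * r powr (\<alpha> - 1) + K * r powr (\<alpha> - 1)"
    proof -
      have "cmod P \<le> cmod E + cmod (C * z powr of_real (\<alpha> - 1))"
        using norm_triangle_ineq[of E "C * z powr of_real (\<alpha> - 1)"] by (simp add: E_def)
      also have "cmod (C * z powr of_real (\<alpha> - 1)) = cmod C * r powr (\<alpha> - 1)" unfolding norm_mult cmod_powr_of_real r_def ..
      finally show ?thesis using E mult_left_mono[OF mono(1) K(1)] by linarith
    qed
    moreover have "cmod Q \<le> cmod D * r powr (\<alpha> - 1) + M * r powr (\<alpha> - 1)"
    proof -
      have "cmod Q \<le> cmod F + cmod (D * z powr of_real (\<alpha> - 1 - 1))"
        using norm_triangle_ineq[of F "D * z powr of_real (\<alpha> - 1 - 1)"] by (simp add: F_def)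
      also have "cmod (D * z powr of_real (\<alpha> - 1 - 1)) = cmod D * r powr (\<alpha> - 1 - 1)" 
        unfolding norm_mult cmod_powr_of_real r_def ..
      finally show ?thesis using F mult_left_mono[OF mono(3) M(1)] mult_left_mono[OF mono(2), of "cmod D"] by simp
    qed
    moreover have "r * cmod E / \<alpha> \<le> K / \<alpha> * r powr (\<alpha> - 1)"
    proof -
      have "r * cmod E \<le> r * (K * r powr (\<alpha> - 2))" using E r by (intro mult_left_mono) auto
      also have "\<dots> = K * (r powr 1 * r powr (\<alpha> - 2))" using r by simp
      also have "r powr 1 * r powr (\<alpha> - 2) = r powr (\<alpha> - 1)" unfolding powr_add[symmetric] by simp
      finally show ?thesis using a by (simp add: divide_right_mono)
    qed
    moreover have "2 * (cmod C * r powr (\<alpha> - 1) + K * r powr (\<alpha> - 1)) + K / \<alpha> * r powr (\<alpha> - 1) + (cmod D * r powr (\<alpha> - 1) + M * r powr (\<alpha> - 1)) = T * r powr (\<alpha> - 1)"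
      unfolding T_def by (simp add: distrib_right distrib_left)
    moreover have "2 * a + e + q \<le> t" if "a \<le> a'" "q \<le> q'" "e \<le> e'" "2 * a' + e' + q' = t" for a e q a' e' q' t :: real
      using that by linarith
    ultimately show ?thesis by blast
    qed
    finally show "cmod (kum_rest (\<alpha> + 1) z - rest_coeff (\<alpha> + 1) * z powr of_real (\<alpha> + 1 - 1)) \<le> T * cmod z powr (\<alpha> + 1 - 2)"
      by (simp add: r_def)
  qed
qed

lemma rest_asymptotic:
  assumes a: "\<alpha> > 0" "\<alpha> \<notin> \<int>"
  shows "rest_asymptotic \<alpha>"
proof -
  \<comment> \<open>The induction carries two neighbouring parameters. It starts from the fractional
    part x in (0, 1) and from x - 1 in (-1, 0), both in the range of the connection formula.\<close>
  define n where "n = nat \<lfloor>\<alpha>\<rfloor>"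
  define x where "x = \<alpha> - real n"
  have n: "real n = of_int \<lfloor>\<alpha>\<rfloor>" using a by (simp add: n_def)
  have "of_int \<lfloor>\<alpha>\<rfloor> \<noteq> \<alpha>" using a(2) by (metis Ints_of_int)
  then have x: "x > 0" "x < 1" using floor_correct[of \<alpha>] unfolding x_def n by linarith+
  have xn: "x + real m \<notin> \<int>" for m
  proof
    assume "x + real m \<in> \<int>"
    from Ints_add[OF this Ints_diff[OF Ints_of_nat[of n] Ints_of_nat[of m]]]
    have "x + real m + (real n - real m) \<in> \<int>" .
    moreover have "x + real m + (real n - real m) = \<alpha>" by (simp add: x_def)
    ultimately show False using a(2) by (simp only:)
  qed
  have "rest_asymptotic (x + real m) \<and> rest_asymptotic (x + real m - 1)" for m
  proof (induction m)
    case 0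
    then show ?case using x by (auto intro!: rest_asymptotic_base)
  next
    case (Suc m)
    then have "rest_asymptotic (x + real m + 1)" using x by (intro rest_asymptotic_step[OF _ xn]) auto
    with Suc show ?case by (simp add: add_ac)
  qed
  from this[of n] show ?thesis by (simp add: x_def)
qed

section \<open>Location of the large zeros\<close>

text \<open>After removal of nonvanishing factors \<alpha> M becomes exp z - D z^(2 \<alpha>) q(z),
  where q is the quotient of the normalised algebraic and growing amplitudes and is 1 + O(1/|z|).
  Putting h = Ln q makes the equation purely exponential.\<close>

lemma kum_zero_equation:
  assumes a: "\<alpha> > 0" "\<alpha> \<notin> \<int>"
  obtains h K R where "R \<ge> 1" "K \<ge> 0" "h holomorphic_on {z. Im z > 0 \<and> cmod z > R}"
    "\<And>z. Im z > 0 \<Longrightarrow> cmod z > R \<Longrightarrow> cmod (h z) \<le> K / cmod z"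
    "\<And>z. Im z > 0 \<Longrightarrow> cmod z > R \<Longrightarrow> kum (of_real (1 - \<alpha>)) z = 0 \<longleftrightarrow>
      exp z = exp (- (\<i> * of_real (pi * \<alpha>))) * of_real (Gamma (1 - \<alpha>) / Gamma (1 + \<alpha>)) * exp (of_real (2 * \<alpha>) * Ln z) * exp (h z)"
proof -
  define g0 g1 where "g0 = Gamma (1 - \<alpha>)" and "g1 = Gamma (1 + \<alpha>)"
  have "1 - \<alpha> \<notin> \<int>" using a(2) Ints_diff[of 1 "1 - \<alpha>"] by auto
  then have g0: "g0 \<noteq> 0" unfolding g0_def by (auto simp: Gamma_eq_zero_iff dest: nonpos_Ints_Int)
  have g1: "g1 \<noteq> 0" using a unfolding g1_def by (auto simp: Gamma_eq_zero_iff dest!: nonpos_Ints_nonpos)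
  define e where "e = exp (- (\<i> * of_real (pi * \<alpha>)))"
  define C where "C = rest_coeff \<alpha>"
  have C: "C = - e * of_real (\<alpha> / g1)" by (simp add: C_def rest_coeff_def e_def g1_def)
  then have C0: "C \<noteq> 0" using a g1 by (simp add: e_def)
  define Q where "Q z = z powr of_real (1 - \<alpha>) * kum_rest \<alpha> z / C" for z
  define L where "L z = growing_coeff \<alpha> z / of_real g1" for z
  obtain K where K: "K \<ge> 0" "\<And>z. Im z > 0 \<Longrightarrow> cmod z \<ge> 1 \<Longrightarrow> cmod (kum_rest \<alpha> z - C * z powr of_real (\<alpha> - 1)) \<le> K * cmod z powr (\<alpha> - 2)"
    using rest_asymptotic[OF a] unfolding rest_asymptotic_def C_def by auto
  have am: "\<alpha> > -1" using a by simp
  obtain M where M: "M \<ge> 0" "\<And>z. Im z > 0 \<Longrightarrow> cmod z \<ge> 1 \<Longrightarrow> cmod (growing_coeff \<alpha> z - of_real (Gamma (1 + \<alpha>))) \<le> M / cmod z"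
    by (rule growing_coeff_asymptotic[OF am]) blast
  define K' M' where "K' = K / cmod C" and "M' = M / \<bar>g1\<bar>"
  have KM0: "K' \<ge> 0" "M' \<ge> 0" using K M by (simp_all add: K'_def M'_def)
  have pc: "z powr of_real (1 - \<alpha>) * z powr of_real (\<alpha> - 1) = 1" if "z \<noteq> 0" for z :: complex
    using that unfolding powr_add[symmetric] by simp
  have Q: "cmod (Q z - 1) \<le> K' / cmod z" if z: "Im z > 0" "cmod z \<ge> 1" for z
  proof -
    have z0: "z \<noteq> 0" using z by auto
    have "Q z - 1 = z powr of_real (1 - \<alpha>) * (kum_rest \<alpha> z - C * z powr of_real (\<alpha> - 1)) / C"
    proof -
      have "p * P / C - 1 = p * (P - C * r) / C" if "p * r = 1" for p r P
        using that C0 by (simp add: right_diff_distrib diff_divide_distrib mult.left_commute)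
      from this[OF pc[OF z0]] show ?thesis unfolding Q_def .
    qed
    then have "cmod (Q z - 1) = cmod z powr (1 - \<alpha>) * cmod (kum_rest \<alpha> z - C * z powr of_real (\<alpha> - 1)) / cmod C"
      by (simp only: norm_mult norm_divide cmod_powr_of_real)
    also have "\<dots> \<le> cmod z powr (1 - \<alpha>) * (K * cmod z powr (\<alpha> - 2)) / cmod C"
      by (intro divide_right_mono mult_left_mono K(2) z) auto
    also have "\<dots> = K' * (cmod z powr (1 - \<alpha>) * cmod z powr (\<alpha> - 2))" by (simp add: K'_def)
    also have "cmod z powr (1 - \<alpha>) * cmod z powr (\<alpha> - 2) = 1 / cmod z"
      unfolding powr_add[symmetric] using z0 by (simp add: powr_minus_divide)
    finally show ?thesis by simp
  qed
  have L: "cmod (L z - 1) \<le> M' / cmod z" if z: "Im z > 0" "cmod z \<ge> 1" for z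
  proof -
    have "L z - 1 = (growing_coeff \<alpha> z - of_real g1) / of_real g1" using g1 by (simp add: L_def diff_divide_distrib)
    then have "cmod (L z - 1) = cmod (growing_coeff \<alpha> z - of_real g1) / \<bar>g1\<bar>" by (simp add: norm_divide)
    also have "\<dots> \<le> M / cmod z / \<bar>g1\<bar>" using M(2)[OF z] by (intro divide_right_mono) (auto simp: g1_def)
    finally show ?thesis by (simp add: M'_def mult.commute)
  qed
  define N where "N = 2 * (K' + M')"
  \<comment> \<open>Beyond R one has |q - 1| < 1/2. So q stays in the right half-plane, Ln q is
    holomorphic, and |Ln q| is at most 2 |q - 1|.\<close>
  define R where "R = max 1 (2 * N)"
  define S where "S = {z. Im z > 0 \<and> cmod z > R}"
  have N0: "N \<ge> 0" using KM0 by (simp add: N_def)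
  define q where "q z = Q z / L z" for z
  have *: "cmod (q z - 1) \<le> N / cmod z" "cmod (q z - 1) < 1/2" "L z \<noteq> 0" if "z \<in> S" for z
  proof -
    have z: "Im z > 0" "cmod z \<ge> 1" "cmod z > 2 * N" "cmod z > 0" using that by (auto simp: S_def R_def)
    have "cmod (L z - 1) \<le> 1 / 2"
    proof -
      have "M' / cmod z \<le> 1 / 2" using z KM0 by (simp add: N_def field_simps)
      then show ?thesis using L[OF z(1,2)] by linarith
    qed
    then have l: "cmod (L z) \<ge> 1 / 2" using norm_triangle_ineq2[of 1 "1 - L z"] by (simp add: norm_minus_commute)
    then show l0: "L z \<noteq> 0" by auto
    have "q z - 1 = (Q z - L z) / L z" using l0 by (simp add: q_def diff_divide_distrib)
    then have "cmod (q z - 1) = cmod (Q z - L z) / cmod (L z)" by (simp add: norm_divide)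
    also have "\<dots> \<le> cmod (Q z - L z) / (1/2)" using l by (intro divide_left_mono) (auto intro: mult_pos_pos)
    also have "cmod (Q z - L z) \<le> K' / cmod z + M' / cmod z"
      using norm_triangle_ineq4[of "Q z - 1" "L z - 1"] Q[OF z(1,2)] L[OF z(1,2)] by simp
    finally show b: "cmod (q z - 1) \<le> N / cmod z" by (simp add: N_def add_divide_distrib mult.commute[of 2])
    also have "N / cmod z < 1 / 2" using z by (simp add: field_simps)
    finally show "cmod (q z - 1) < 1/2" .
  qed
  have q: "q z \<notin> \<real>\<^sub>\<le>\<^sub>0" "q z \<noteq> 0" if "z \<in> S" for z
  proof -
    have "Re (q z) > 0" using *(2)[OF that] abs_Re_le_cmod[of "q z - 1"] by simp
    then show "q z \<notin> \<real>\<^sub>\<le>\<^sub>0" "q z \<noteq> 0" by (auto simp: complex_nonpos_Reals_iff)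
  qed
  have SU: "S \<subseteq> {z. Im z > 0}" by (auto simp: S_def)
  have kr: "kum_rest \<alpha> holomorphic_on S"
    unfolding kum_rest_def[abs_def]
    by (intro holomorphic_intros kum_holomorphic holomorphic_on_subset[OF growing_part_holomorphic SU] am)
  have hq: "q holomorphic_on S"
    unfolding q_def[abs_def] Q_def[abs_def]
  proof (intro holomorphic_intros kr)
    show "L holomorphic_on S" unfolding L_def[abs_def]
      by (intro holomorphic_intros holomorphic_on_subset[OF growing_coeff_holomorphic SU] am) (use g1 in simp)
  qed (use SU upper_half_nonpos C0 *(3) in auto)
  show ?thesis
  proof (rule that[of R "2 * N" "\<lambda>z. Ln (q z)"])
    show "R \<ge> 1" "2 * N \<ge> 0" using N0 by (auto simp: R_def)
    show "(\<lambda>z. Ln (q z)) holomorphic_on {z. Im z > 0 \<and> cmod z > R}"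
      unfolding S_def[symmetric] by (intro holomorphic_intros hq q)
    fix z assume "Im z > 0" "cmod z > R"
    then have zS: "z \<in> S" and z0: "z \<noteq> 0" and z: "Im z > 0" by (auto simp: S_def)
    show "cmod (Ln (q z)) \<le> 2 * N / cmod z"
      using norm_Ln_le[OF *(2)[OF zS]] *(1)[OF zS] by simp
    define w where "w = z powr of_real (- 1 - \<alpha>)"
    define E where "E = exp (of_real (2 * \<alpha>) * Ln z)"
    define x where "x = complex_of_real \<alpha>"
    have w0: "w \<noteq> 0" using z0 by (simp add: w_def)
    have Ew: "z powr of_real (\<alpha> - 1) = E * w"
      using z0 unfolding E_def w_def powr_def by (simp add: algebra_simps flip: exp_add)
    have G: "growing_part \<alpha> z = exp z * w * (of_real g1 * L z)"
      unfolding growing_part_eq w_def L_def using g1 by simp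
    have P: "kum_rest \<alpha> z = C * (E * w) * Q z"
    proof -
      have "P = C * r * (p * P / C)" if "p * r = 1" for p r P
        using that C0 by (simp add: mult.commute mult.left_commute)
      from this[OF pc[OF z0]] show ?thesis unfolding Q_def Ew .
    qed
    define D where "D = e * of_real (g0 / g1)"
    define cc where "cc = complex_of_real (connection_const \<alpha>)"
    have cc: "cc * of_real g1 * D = - C" "cc * of_real g1 \<noteq> 0"
      unfolding cc_def connection_const_def C D_def g0_def[symmetric] g1_def[symmetric] using g0 g1 a by simp_all
    have "x * kum (of_real (1 - \<alpha>)) z = kum_rest \<alpha> z + cc * growing_part \<alpha> z"
      by (simp add: kum_rest_def x_def cc_def)
    also have "\<dots> = cc * of_real g1 * w * L z * (exp z - D * E * q z)"
    proof -
      have "Q z = q z * L z" using *(3)[OF zS] by (simp add: q_def)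
      moreover have "C * (E * w) * (qq * l) + k * (ez * w * (G * l)) = k * G * w * l * (ez - D * E * qq)" if "k * G * D = - C" for k G l qq ez
        using that by algebra
      ultimately show ?thesis using cc(1) unfolding P G by simp
    qed
    finally have "x * kum (of_real (1 - \<alpha>)) z = cc * of_real g1 * w * L z * (exp z - D * E * q z)" .
    moreover have "x \<noteq> 0" using a by (simp add: x_def)
    ultimately have "kum (of_real (1 - \<alpha>)) z = 0 \<longleftrightarrow> exp z - D * E * q z = 0"
      using cc(2) w0 *(3)[OF zS] by (metis mult_eq_0_iff)
    then show "kum (of_real (1 - \<alpha>)) z = 0 \<longleftrightarrow>
      exp z = exp (- (\<i> * of_real (pi * \<alpha>))) * of_real (Gamma (1 - \<alpha>) / Gamma (1 + \<alpha>)) * exp (of_real (2 * \<alpha>) * Ln z) * exp (Ln (q z))"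
      using q[OF zS] by (simp add: D_def E_def e_def g0_def g1_def)
  qed
qed

section \<open>Roots of the logarithmic equation\<close>

definition log_root :: "complex \<Rightarrow> real \<Rightarrow> (complex \<Rightarrow> complex) \<Rightarrow> real \<Rightarrow> int \<Rightarrow> complex \<Rightarrow> bool" where
  "log_root c a h R k z \<longleftrightarrow> Im z > 0 \<and> cmod z > R \<and> z = c + of_real a * Ln z + h z + \<i> * of_real (2 * pi * of_int k)"

text \<open>The slope 1/20 is small enough for the self-map below: on the disc of radius k about 2
  pi i k one has |z| <= 9 k, and 9/20 + 1/2 < 1.\<close>

lemma real_log_linear_bound:
  assumes "a \<ge> (0::real)"
  obtains E where "E \<ge> 0" "\<And>x. x > 0 \<Longrightarrow> a * ln x \<le> x / 20 + E"
proof (rule that[of "a * ln (20 * a + 1)"])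
  show "0 \<le> a * ln (20 * a + 1)" using assms by simp
  fix x :: real assume x: "x > 0"
  define b where "b = 20 * a + 1"
  have b: "b \<ge> 1" using assms by (simp add: b_def)
  have "ln x = ln (x / b) + ln b" using x b by (simp add: ln_div)
  also have "\<dots> \<le> x / b + ln b" using ln_le_minus_one[of "x / b"] x b by simp
  finally have "a * ln x \<le> a * (x / b) + a * ln b" using mult_left_mono[OF _ assms] unfolding distrib_left[symmetric] by blast
  also have "a * (x / b) = x * (a / b)" by simp
  also have "\<dots> \<le> x * (1 / 20)" using x b assms by (intro mult_left_mono) (auto simp: b_def field_simps)
  finally show "a * ln x \<le> x / 20 + a * ln (20 * a + 1)" by (simp add: b_def)
qed

lemma cmod_Ln_le: 
  assumes "cmod z \<ge> 1"
  shows "cmod (Ln z) \<le> ln (cmod z) + pi"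
proof -
  have "z \<noteq> 0" using assms by auto
  then have "\<bar>Re (Ln z)\<bar> = ln (cmod z)" "\<bar>Im (Ln z)\<bar> \<le> pi"
    using assms mpi_less_Im_Ln[of z] Im_Ln_le_pi[of z] by auto
  then show ?thesis using cmod_le[of "Ln z"] by linarith
qed

text \<open>For large k the right-hand side maps the disc of radius k about 2 pi i k into itself and
  halves distances, so it has one root there. Size estimates force every root of such an index k
  into this disc, and confine the roots of all smaller indices, negative ones included, to a bounded
  set.\<close>

lemma log_equation_roots:
  fixes c :: complex and a K R :: real
  assumes a: "a \<ge> 0" and K: "K \<ge> 0" and R: "R \<ge> 1"
    and hol: "h holomorphic_on {z. Im z > 0 \<and> cmod z > R}"
    and bd: "\<And>z. Im z > 0 \<Longrightarrow> cmod z > R \<Longrightarrow> cmod (h z) \<le> K / cmod z"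
  obtains k1 :: int and \<zeta> M B where "k1 \<ge> 1" "\<And>k. k \<ge> k1 \<Longrightarrow> log_root c a h R k (\<zeta> k)"
    "\<And>k z. k \<ge> k1 \<Longrightarrow> log_root c a h R k z \<Longrightarrow> z = \<zeta> k"
    "\<And>k z. k < k1 \<Longrightarrow> log_root c a h R k z \<Longrightarrow> cmod z \<le> B"
    "\<And>k. k \<ge> k1 \<Longrightarrow> cmod (\<zeta> k - (\<i> * of_real (2 * pi * of_int k) + c + of_real a * Ln (\<i> * of_real (2 * pi * of_int k)))) \<le> M * (ln (of_int k) / of_int k)"
proof -
  obtain E where E: "E \<ge> 0" "\<And>x. x > 0 \<Longrightarrow> a * ln x \<le> x / 20 + E"
    by (rule real_log_linear_bound[OF a]) blast
  define A where "A = cmod c + a * pi + K"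
  define p where "p k = \<i> * complex_of_real (2 * pi * of_int k)" for k :: int
  define S where "S = {z. Im z > 0 \<and> cmod z > R}"
  define F where "F z = c + of_real a * Ln z + h z" for z
  have A0: "A \<ge> 0" using a K by (simp add: A_def)
  have F1: "cmod (F z) \<le> A + a * ln (cmod z)" if "z \<in> S" for z
  proof -
    have z: "cmod z \<ge> 1" "Im z > 0" "cmod z > R" using that R by (auto simp: S_def)
    have "K / cmod z \<le> K / 1" using z K by (intro divide_left_mono) auto
    then have "cmod (h z) \<le> K" using bd[OF z(2,3)] by simp
    moreover have "cmod (of_real a * Ln z) \<le> a * (ln (cmod z) + pi)"
      using a cmod_Ln_le[OF z(1)] by (simp add: norm_mult mult_left_mono)
    ultimately show ?thesis unfolding F_def A_def
      using norm_triangle_ineq[of "c + of_real a * Ln z" "h z"] norm_triangle_ineq[of c "of_real a * Ln z"]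
      by (simp add: distrib_left)
  qed
  have F2: "cmod (F z) \<le> A + E + r / 20" if "z \<in> S" "cmod z \<le> r" for z r
  proof -
    have "cmod z > 0" using that R by (auto simp: S_def)
    from F1[OF that(1)] E(2)[OF this] that(2) show ?thesis by simp
  qed
  have root: "log_root c a h R k z \<longleftrightarrow> z \<in> S \<and> z = F z + p k" for k z
    by (auto simp: log_root_def S_def F_def p_def)
  \<comment> \<open>The entry 3 makes ln k at least 1, the second lets the disc be mapped into
    itself, the third bounds a/k + K/k by 1/2, and the last keeps the disc and the Cauchy circles
    outside |z| <= R.\<close>
  define k1 where "k1 = max 3 (max \<lceil>2 * (A + E)\<rceil> (max \<lceil>2 * (a + K)\<rceil> \<lceil>R\<rceil>))"
  have k1: "real_of_int k \<ge> 3" "real_of_int k \<ge> 2 * (A + E)" "real_of_int k \<ge> 2 * (a + K)" "real_of_int k \<ge> R" if "k \<ge> k1" for k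
    using that by (auto simp: k1_def ceiling_le_iff)
  have pk: "4 * real_of_int k \<le> 2 * pi * of_int k" "2 * pi * of_int k \<le> 8 * real_of_int k" "cmod (p k) = 2 * pi * of_int k" if "k \<ge> 0" for k
    using that pi_ge_two pi_less_4 mult_right_mono[of 2 pi "real_of_int k"] mult_right_mono[of pi 4 "real_of_int k"]
    by (auto simp: p_def norm_mult)
  define B where "B k = cball (p k) (of_int k)" for k
  have near: "Im w \<ge> 4 * of_int k - r \<and> cmod w \<ge> 4 * of_int k - r \<and> cmod w \<le> 8 * of_int k + r" if "cmod (w - p k) \<le> r" "k \<ge> 0" for w k r
  proof -
    have "Im (p k) = 2 * pi * of_int k" by (simp add: p_def)
    then show ?thesis
      using pk[OF that(2)] that(1) abs_Im_le_cmod[of "w - p k"] norm_triangle_ineq2[of "p k" "p k - w"] norm_triangle_ineq[of "w - p k" "p k"]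
      by (simp add: norm_minus_commute) 
  qed
  have BS: "z \<in> S" "cmod z \<le> 9 * of_int k" "cmod z \<ge> 3 * of_int k" if "k \<ge> k1" "z \<in> B k" for z k
    using near[of z k "of_int k"] that k1[OF that(1)] by (auto simp: B_def S_def dist_norm norm_minus_commute)
  have dh: "(h has_field_derivative deriv h z) (at z)" if "z \<in> S" for z
    by (rule holomorphic_derivI[OF hol[folded S_def]])
      (use that in \<open>auto simp: S_def intro!: open_Collect_conj open_Collect_less continuous_intros\<close>)
  \<comment> \<open>Cauchy's inequality on circles of radius k about points of the disc; these
    circles stay in |w| >= 2 k, where h is at most K / (2 k).\<close>
  have dhb: "cmod (deriv h z) \<le> K / of_int k" if k: "k \<ge> k1" and z: "z \<in> B k" for z k
  proof -
    have w: "w \<in> S \<and> cmod w \<ge> 2 * of_int k" if "cmod (z - w) \<le> of_int k" for w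
    proof -
      have "cmod (w - p k) \<le> 2 * of_int k"
        using that z norm_triangle_ineq[of "w - z" "z - p k"] by (simp add: B_def dist_norm norm_minus_commute)
      from near[OF this] show ?thesis using k1[OF k] by (auto simp: S_def)
    qed
    have "cmod ((deriv ^^ 1) h z) \<le> fact 1 * (K / (2 * of_int k)) / of_int k ^ 1"
    proof (rule Cauchy_inequality)
      show "h holomorphic_on ball z (of_int k)"
        by (rule holomorphic_on_subset[OF hol[folded S_def]]) (use w in \<open>auto simp: dist_norm\<close>)
      show "continuous_on (cball z (of_int k)) h"
        by (rule continuous_on_subset[OF holomorphic_on_imp_continuous_on[OF hol[folded S_def]]]) (use w in \<open>auto simp: dist_norm\<close>)
      show "cmod (h x) \<le> K / (2 * of_int k)" if "cmod (z - x) = of_int k" for x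
      proof -
        have x: "x \<in> S" "cmod x \<ge> 2 * of_int k" using w[of x] that by auto
        have "cmod (h x) \<le> K / cmod x" using x bd by (auto simp: S_def)
        also have "\<dots> \<le> K / (2 * of_int k)" using x k1[OF k] K by (intro frac_le) auto
        finally show ?thesis .
      qed
    qed (use k1[OF k] in auto)
    also have "fact 1 * (K / (2 * real_of_int k)) / of_int k ^ 1 = (K / of_int k) * (1 / (2 * real_of_int k))" by simp
    also have "\<dots> \<le> (K / of_int k) * 1" using k1[OF k] K by (intro mult_left_mono) (auto simp: field_simps)
    finally show ?thesis by simp
  qed
  have Lnb: "cmod (inverse z) \<le> 1 / of_int k" if k: "k \<ge> k1" and z: "z \<in> B k" for z k
    using BS(3)[OF that] k1[OF k] unfolding norm_inverse unfolding inverse_eq_divide by (intro frac_le) auto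
  have cvx: "convex (B k)" for k by (simp add: B_def)
  have uni: "\<exists>!z\<in>B k. F z + p k = z" if k: "k \<ge> k1" for k
  proof (rule Banach_fix[of _ "1/2"])
    show "complete (B k)" "B k \<noteq> {}" using k1[OF k] by (auto simp: B_def compact_imp_complete)
    show "(\<lambda>z. F z + p k) ` B k \<subseteq> B k"
    proof safe
      fix z assume z: "z \<in> B k"
      have "cmod (F z) \<le> A + E + 9 * of_int k / 20" using F2[OF BS(1,2)[OF k z]] .
      also have "\<dots> \<le> of_int k" using k1[OF k] by simp
      finally show "F z + p k \<in> B k" by (simp add: B_def dist_norm)
    qed
    fix x y assume xy: "x \<in> B k" "y \<in> B k"
    have "cmod (F x - F y) \<le> (1/2) * cmod (x - y)"
    proof (rule field_differentiable_bound[OF cvx _ _ xy])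
      fix z assume z: "z \<in> B k"
      have zS: "z \<in> S" by (rule BS[OF k z])
      then have zn: "z \<notin> \<real>\<^sub>\<le>\<^sub>0" using upper_half_nonpos by (auto simp: S_def)
      show "(F has_field_derivative of_real a * inverse z + deriv h z) (at z within B k)"
        unfolding F_def[abs_def] using zn
        by (auto intro!: derivative_eq_intros has_field_derivative_at_within[OF dh[OF zS]] simp: inverse_eq_divide)
      have "cmod (of_real a * inverse z + deriv h z) \<le> a * (1 / of_int k) + K / of_int k"
        using norm_triangle_ineq[of "of_real a * inverse z" "deriv h z"] dhb[OF k z] mult_left_mono[OF Lnb[OF k z] a] a
        by (simp add: norm_mult)
      also have "\<dots> \<le> 1 / 2" using k1[OF k] by (simp add: field_simps)
      finally show "cmod (of_real a * inverse z + deriv h z) \<le> 1 / 2" .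
    qed
    then show "dist (F x + p k) (F y + p k) \<le> 1 / 2 * dist x y" by (simp add: dist_norm)
  qed simp_all
  define \<zeta> where "\<zeta> k = (THE z. z \<in> B k \<and> F z + p k = z)" for k
  have \<zeta>: "\<zeta> k \<in> B k" "F (\<zeta> k) + p k = \<zeta> k" if "k \<ge> k1" for k
    using theI'[OF uni[OF that]] by (auto simp: \<zeta>_def)
  \<comment> \<open>From |z - p k| <= A + E + |z|/20 and |z| <= |z - p k| + 8 k it follows that |z -
    p k| <= k: the root is trapped in the disc of the contraction.\<close>
  have only: "z = \<zeta> k" if k: "k \<ge> k1" and z: "log_root c a h R k z" for k z
  proof -
    have zS: "z \<in> S" and zF: "z = F z + p k" using z root by blast+
    then have "cmod (z - p k) \<le> A + E + cmod z / 20" using F2[OF zS order_refl] by (metis add_diff_cancel_right')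
    moreover have "cmod z \<le> cmod (z - p k) + 8 * of_int k" using near[of z k "cmod (z - p k)"] k1[OF k] by simp
    moreover have "w \<le> x" if "w \<le> q + r / 20" "r \<le> w + 8 * x" "2 * q \<le> x" "3 \<le> x" for w x r q :: real
      using that by linarith
    ultimately have "cmod (z - p k) \<le> of_int k" using k1(1,2)[OF k] by blast
    then have "z \<in> B k" by (simp add: B_def dist_norm norm_minus_commute)
    then show ?thesis using uni[OF k] \<zeta>[OF k] zF by metis
  qed
  have bounded: "cmod z \<le> 4 * (A + E) + 16 * of_int k1" if k: "k < k1" and z: "log_root c a h R k z" for k z
  proof -
    have zS: "z \<in> S" and zF: "z = F z + p k" using z root by blast+
    then have F: "cmod (z - p k) \<le> A + E + cmod z / 20" using F2[OF zS order_refl] by (metis add_diff_cancel_right')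
    have tri: "cmod z \<le> cmod (z - p k) + cmod (p k)" using norm_triangle_ineq[of "z - p k" "p k"] by simp
    have k10: "k1 \<ge> 0" by (simp add: k1_def)
    show ?thesis
    proof (cases "k \<ge> 0")
      case True
      have "cmod (p k) \<le> 8 * of_int k1" using pk[OF True] k by simp
      then show ?thesis using tri F A0 E(1) k10 by simp
    next
      \<comment> \<open>For negative k the point p k lies below the real axis while Im z > 0, so |p
        k| <= |z - p k|, and the estimate of F bounds z independently of k.\<close>
      case False
      have "Im z > 0" using zS by (simp add: S_def)
      moreover have "Im (z - p k) = Im z + cmod (p k)" using False by (simp add: p_def norm_mult abs_mult)
      ultimately have "cmod (p k) \<le> cmod (z - p k)" using abs_Im_le_cmod[of "z - p k"] by simp
      moreover have "real_of_int k1 \<ge> 0" using k10 by simp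
      moreover have "r \<le> 4 * (u + v) + 16 * x" if "q \<le> w" "0 \<le> x" "r \<le> w + q" "w \<le> u + v + r / 20" "0 \<le> u" "0 \<le> v" for w q r u v x :: real
        using that by simp
      ultimately show ?thesis using tri F A0 E(1) by blast
    qed
  qed
  \<comment> \<open>Comes from |\<zeta> k - p k| <= A + a (ln k + ln 9), divided by k when passing
    to the difference of logarithms; the constants are absorbed by ln k >= 1.\<close>
  define M where "M = a * (A + a * (1 + ln 9)) + K"
  have asy: "cmod (\<zeta> k - (p k + c + of_real a * Ln (p k))) \<le> M * (ln (of_int k) / of_int k)" if k: "k \<ge> k1" for k
  proof -
    define x where "x = real_of_int k"
    have x: "x \<ge> 3" using k1[OF k] by (simp add: x_def)
    have "exp 1 \<le> x" using x exp_le by linarith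
    then have lx: "ln x \<ge> 1" using x by (simp add: ln_ge_iff)
    note zB = \<zeta>(1)[OF k] and zF = \<zeta>(2)[OF k]
    have pB: "p k \<in> B k" using x by (simp add: B_def x_def)
    have S: "\<zeta> k \<in> S" by (rule BS[OF k zB])
    have "cmod (Ln (\<zeta> k) - Ln (p k)) \<le> 1 / x * cmod (\<zeta> k - p k)"
    proof (rule field_differentiable_bound[OF cvx _ _ zB pB])
      fix z assume z: "z \<in> B k"
      then have "z \<notin> \<real>\<^sub>\<le>\<^sub>0" using BS[OF k z] upper_half_nonpos by (auto simp: S_def)
      then show "(Ln has_field_derivative inverse z) (at z within B k)"
        by (intro has_field_derivative_at_within[OF has_field_derivative_Ln])
      show "cmod (inverse z) \<le> 1 / x" unfolding x_def by (rule Lnb[OF k z])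
    qed
    also have "\<zeta> k - p k = F (\<zeta> k)" using zF by (metis add_diff_cancel_right')
    also have "cmod (F (\<zeta> k)) \<le> A + a * (ln x + ln 9)"
    proof -
      have "ln (cmod (\<zeta> k)) \<le> ln (9 * x)" 
      proof (subst ln_le_cancel_iff)
        show "0 < cmod (\<zeta> k)" using BS(3)[OF k zB] x unfolding x_def by linarith
      qed (use BS(2)[OF k zB] x in \<open>simp_all add: x_def\<close>)
      also have "\<dots> = ln x + ln 9" using x by (simp add: ln_mult)
      finally show ?thesis using F1[OF S] mult_left_mono[OF _ a] by fastforce
    qed
    finally have l: "cmod (Ln (\<zeta> k) - Ln (p k)) \<le> 1 / x * (A + a * (ln x + ln 9))" using x by (simp add: divide_right_mono)
    have hz: "cmod (h (\<zeta> k)) \<le> K / x"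
    proof -
      have "cmod (h (\<zeta> k)) \<le> K / cmod (\<zeta> k)" using S bd by (auto simp: S_def)
      also have "\<dots> \<le> K / x" using BS(3)[OF k zB] x K by (intro frac_le) (auto simp: x_def)
      finally show ?thesis .
    qed
    have "\<zeta> k - (p k + c + of_real a * Ln (p k)) = of_real a * (Ln (\<zeta> k) - Ln (p k)) + h (\<zeta> k)"
    proof -
      have "z - (p k + c + a * l') = a * (l - l') + h" if "c + a * l + h + p k = z" for z l l' h a
        unfolding that[symmetric] by (simp add: algebra_simps)
      from this[OF zF[unfolded F_def]] show ?thesis .
    qed
    also have "cmod \<dots> \<le> a * cmod (Ln (\<zeta> k) - Ln (p k)) + cmod (h (\<zeta> k))"
      using norm_triangle_ineq[of "of_real a * (Ln (\<zeta> k) - Ln (p k))" "h (\<zeta> k)"] a by (simp add: norm_mult)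
    also have "\<dots> \<le> a * (1 / x * (A + a * (ln x + ln 9))) + K / x" by (intro add_mono mult_left_mono l hz a)
    also have "\<dots> = (a * (A + a * (ln x + ln 9)) + K) / x"
    proof -
      have "a * (1 / x * t) + K / x = (a * t + K) / x" for t by (simp add: add_divide_distrib)
      then show ?thesis .
    qed
    also have "\<dots> \<le> M * ln x / x"
    proof (rule divide_right_mono)
      have "a * (A * 1 + a * (ln x + ln 9 * 1)) + K * 1 \<le> a * (A * ln x + a * (ln x + ln 9 * ln x)) + K * ln x"
        by (intro add_mono mult_left_mono a A0 K lx order_refl) auto
      also have "\<dots> = M * ln x" by (simp add: M_def algebra_simps)
      finally show "a * (A + a * (ln x + ln 9)) + K \<le> M * ln x" by simp
    qed (use x in simp)
    finally show ?thesis by (simp add: x_def)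
  qed
  show ?thesis
  proof (rule that[of k1 \<zeta> "4 * (A + E) + 16 * of_int k1" M])
    show "1 \<le> k1" by (simp add: k1_def)
    show "log_root c a h R k (\<zeta> k)" if "k \<ge> k1" for k
      unfolding root using BS(1)[OF that \<zeta>(1)[OF that]] \<zeta>(2)[OF that] by simp
  qed (use only bounded asy in \<open>simp_all add: p_def\<close>)
qed

section \<open>Eigenvalues of the damped wave operator\<close>

text \<open>An accumulation point of zeros would force the entire function to vanish identically,
  but it is 1 at 0.\<close>

lemma kum_zeros_bounded_finite: "finite {z \<in> cball 0 B. kum (a :: complex) z = 0}"
proof (rule ccontr)
  assume inf: "infinite {z \<in> cball 0 B. kum a z = 0}"
  have "compact (cball (0 :: complex) B)" by simp
  then obtain x where "x \<in> cball 0 B" and x: "x islimpt {z \<in> cball 0 B. kum a z = 0}"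
    using inf unfolding compact_eq_Bolzano_Weierstrass by blast
  have "kum a 0 = 0"
    by (rule analytic_continuation[OF kum_holomorphic open_UNIV connected_UNIV _ _ x]) auto
  then show False by simp
qed

text \<open>The zeros other than \<zeta> k with k >= k1 lie in a bounded set, so they are finitely
  many. They receive the indices just below k1, which leaves the index of every large root
  unshifted; k0 is the start that this requires and need not be positive.\<close>

lemma kum_upper_zeros:
  assumes a: "\<alpha> > 0" "\<alpha> \<notin> \<int>" and c: "exp c = exp (- (\<i> * of_real (pi * \<alpha>))) * of_real (Gamma (1 - \<alpha>) / Gamma (1 + \<alpha>))"
  obtains k0 k1 :: int and \<zeta> M where "bij_betw \<zeta> {k0..} {z. Im z > 0 \<and> kum (of_real (1 - \<alpha>)) z = 0}"
    "\<And>k. k \<ge> k1 \<Longrightarrow> cmod (\<zeta> k - (\<i> * of_real (2 * pi * of_int k) + c + of_real (2 * \<alpha>) * Ln (\<i> * of_real (2 * pi * of_int k)))) \<le> M * (ln (of_int k) / of_int k)"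
proof -
  define Z where "Z = {z. Im z > 0 \<and> kum (of_real (1 - \<alpha>)) z = 0}"
  obtain h K R where R: "R \<ge> 1" "K \<ge> 0" "h holomorphic_on {z. Im z > 0 \<and> cmod z > R}"
    and hK: "\<And>z. Im z > 0 \<Longrightarrow> cmod z > R \<Longrightarrow> cmod (h z) \<le> K / cmod z"
    and eq: "\<And>z. Im z > 0 \<Longrightarrow> cmod z > R \<Longrightarrow> kum (of_real (1 - \<alpha>)) z = 0 \<longleftrightarrow>
      exp z = exp (- (\<i> * of_real (pi * \<alpha>))) * of_real (Gamma (1 - \<alpha>) / Gamma (1 + \<alpha>)) * exp (of_real (2 * \<alpha>) * Ln z) * exp (h z)"
    by (rule kum_zero_equation[OF a]) blast
  have a2: "2 * \<alpha> \<ge> 0" using a by simp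
  let ?r = "log_root c (2 * \<alpha>) h R"
  obtain k1 :: int and \<zeta> M B where k1: "k1 \<ge> 1" and ex: "\<And>k. k \<ge> k1 \<Longrightarrow> ?r k (\<zeta> k)"
    and only: "\<And>k z. k \<ge> k1 \<Longrightarrow> ?r k z \<Longrightarrow> z = \<zeta> k"
    and bnd: "\<And>k z. k < k1 \<Longrightarrow> ?r k z \<Longrightarrow> cmod z \<le> B"
    and asy: "\<And>k. k \<ge> k1 \<Longrightarrow> cmod (\<zeta> k - (\<i> * of_real (2 * pi * of_int k) + c + of_real (2 * \<alpha>) * Ln (\<i> * of_real (2 * pi * of_int k)))) \<le> M * (ln (of_int k) / of_int k)"
  proof (rule log_equation_roots[OF a2 R(2,1,3) hK, of c], goal_cases)
    case (3 k1 \<zeta> M B)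
    from that[OF 3(2) 3(3) 3(4) 3(5) 3(6)] show ?case .
  qed assumption+
  have Zr: "z \<in> Z \<longleftrightarrow> (\<exists>k. ?r k z)" if "Im z > 0" "cmod z > R" for z
  proof -
    have "z \<in> Z \<longleftrightarrow> exp z = exp (c + of_real (2 * \<alpha>) * Ln z + h z)"
      using eq[OF that] that(1) unfolding Z_def exp_add c by simp
    also have "\<dots> \<longleftrightarrow> (\<exists>k::int. z = c + of_real (2 * \<alpha>) * Ln z + h z + of_real (of_int (2 * k) * pi) * \<i>)"
      unfolding exp_eq ..
    also have "\<dots> \<longleftrightarrow> (\<exists>k. ?r k z)"
      using that unfolding log_root_def by (simp add: mult_ac)
    finally show ?thesis .
  qed
  have rU: "Im z > 0" "cmod z > R" if "?r k z" for k z using that by (simp_all add: log_root_def)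
  have inj: "inj_on \<zeta> {k1..}"
  proof (rule inj_onI)
    fix k l assume kl: "k \<in> {k1..}" "l \<in> {k1..}" "\<zeta> k = \<zeta> l"
    have "z = f + p k \<Longrightarrow> z = f + p l \<Longrightarrow> p k = p l" for z f :: complex and p :: "int \<Rightarrow> complex" by simp
    from this[of "\<zeta> k" "c + of_real (2 * \<alpha>) * Ln (\<zeta> k) + h (\<zeta> k)" "\<lambda>k. \<i> * of_real (2 * pi * of_int k)"]
    have "\<i> * complex_of_real (2 * pi * of_int k) = \<i> * of_real (2 * pi * of_int l)"
      using ex[of k] ex[of l] kl unfolding log_root_def by simp
    then show "k = l" by simp
  qed
  define W where "W = Z - \<zeta> ` {k1..}"
  have sub: "\<zeta> ` {k1..} \<subseteq> Z" using ex rU Zr by blast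
  have "W \<subseteq> {z \<in> cball 0 (max R B). kum (of_real (1 - \<alpha>)) z = 0}"
  proof
    fix z assume z: "z \<in> W"
    have "cmod z \<le> max R B"
    proof (cases "cmod z > R")
      case True
      then obtain k where k: "?r k z" using z Zr[of z] by (auto simp: W_def Z_def)
      have "k < k1"
      proof (rule ccontr)
        assume "\<not> k < k1"
        then have "k \<ge> k1" by simp
        with only[OF this k] z show False by (auto simp: W_def)
      qed
      from bnd[OF this k] show ?thesis by simp
    qed auto
    then show "z \<in> {z \<in> cball 0 (max R B). kum (of_real (1 - \<alpha>)) z = 0}" using z by (auto simp: W_def Z_def)
  qed
  then have fin: "finite W" using kum_zeros_bounded_finite finite_subset by blast
  define k0 where "k0 = k1 - int (card W)"
  have "card {k0..<k1} = card W" by (simp add: k0_def)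
  then obtain f where f: "bij_betw f {k0..<k1} W"
    using finite_same_card_bij[of "{k0..<k1}" W] fin by auto
  define \<xi> where "\<xi> k = (if k < k1 then f k else \<zeta> k)" for k
  have "bij_betw \<xi> {k0..<k1} W" using f by (rule bij_betw_cong[THEN iffD1, rotated]) (simp add: \<xi>_def)
  moreover have "bij_betw \<xi> {k1..} (\<zeta> ` {k1..})"
    using inj_on_imp_bij_betw[OF inj] by (rule bij_betw_cong[THEN iffD1, rotated]) (simp add: \<xi>_def)
  ultimately have "bij_betw \<xi> ({k0..<k1} \<union> {k1..}) (W \<union> \<zeta> ` {k1..})"
    by (rule bij_betw_combine) (auto simp: W_def)
  moreover have "{k0..<k1} \<union> {k1..} = {k0..}" by (auto simp: k0_def)
  moreover have "W \<union> \<zeta> ` {k1..} = Z" using sub by (auto simp: W_def)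
  ultimately have "bij_betw \<xi> {k0..} Z" by (simp only:)
  then show ?thesis
    by (rule that[of \<xi> k0 k1 M, unfolded Z_def[symmetric]]) (use asy in \<open>simp add: \<xi>_def\<close>)
qed

text \<open>The branch constant is chosen so that the index \<open>k\<close> of a root agrees with the index of the main term.\<close>

definition branch_const :: "real \<Rightarrow> complex" where
  "branch_const \<alpha> = \<i> * of_real (pi * (1 - \<alpha>)) - \<i> * of_real (pi * \<alpha>) +
     Ln (- of_real (Gamma (1 - \<alpha>) / Gamma (1 + \<alpha>)) * exp (\<i> * of_real (pi * \<alpha>)))"

lemma Gamma_quotient_nonzero:
  assumes a: "\<alpha> > 0" "\<alpha> \<notin> \<int>"
  shows "Gamma (1 - \<alpha>) / Gamma (1 + \<alpha>) \<noteq> 0"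
proof -
  have "1 - \<alpha> \<notin> \<int>" using a(2) Ints_diff[of 1 "1 - \<alpha>"] by auto
  then show ?thesis using a by (auto simp: Gamma_eq_zero_iff dest: nonpos_Ints_Int dest!: nonpos_Ints_nonpos)
qed

text \<open>The first summand contributes -exp(-i pi \<alpha>), whose sign cancels the one inside
  the logarithm; the other two phases cancel each other.\<close>

lemma exp_branch_const:
  assumes a: "\<alpha> > 0" "\<alpha> \<notin> \<int>"
  shows "exp (branch_const \<alpha>) = exp (- (\<i> * of_real (pi * \<alpha>))) * of_real (Gamma (1 - \<alpha>) / Gamma (1 + \<alpha>))"
proof -
  define \<gamma> where "\<gamma> = complex_of_real (Gamma (1 - \<alpha>) / Gamma (1 + \<alpha>))"
  define E where "E = exp (\<i> * complex_of_real (pi * \<alpha>))"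
  have E: "E \<noteq> 0" by (simp add: E_def)
  have \<gamma>: "\<gamma> \<noteq> 0" unfolding \<gamma>_def using Gamma_quotient_nonzero[OF a] by (metis of_real_eq_0_iff)
  have "exp (\<i> * of_real (pi * (1 - \<alpha>))) = - inverse E"
  proof -
    have "\<i> * complex_of_real (pi * (1 - \<alpha>)) = \<i> * of_real pi + - (\<i> * of_real (pi * \<alpha>))" by (simp add: algebra_simps)
    then show ?thesis by (simp only: exp_add exp_minus E_def) simp
  qed
  note half = this
  have "exp (branch_const \<alpha>) = (- inverse E) / E * (- \<gamma> * E)"
    unfolding branch_const_def exp_add exp_diff \<gamma>_def[symmetric] E_def[symmetric] half using E \<gamma> by simp
  also have "\<dots> = inverse E * \<gamma>" using E by simp
  finally show ?thesis by (simp add: E_def \<gamma>_def exp_minus)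
qed

lemma asymp_eigenvalue_argument:
  assumes k: "k \<ge> (1::int)"
  shows "(of_real (1 * 2 * of_int k * pi) * \<i>) powr of_real (2 * \<alpha>) =
    of_real ((2 * of_int k * pi) powr (2 * \<alpha>)) * exp (\<i> * of_real (pi * \<alpha>))"
    and "Ln (\<i> * complex_of_real (2 * pi * of_int k)) = of_real (ln (2 * of_int k * pi)) + \<i> * of_real (pi / 2)"
proof -
  define x where "x = 2 * real_of_int k * pi"
  have x: "x > 0" using k by (simp add: x_def)
  then have "Ln (\<i> * complex_of_real x) = of_real (ln x) + \<i> * of_real (pi / 2)"
    by (subst Ln_times_ii) (auto simp: Ln_of_real)
  moreover from this have "(of_real x * \<i>) powr of_real (2 * \<alpha>) = exp (of_real (2 * \<alpha> * ln x) + \<i> * of_real (pi * \<alpha>))"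
    using x by (simp add: powr_def mult.commute[of _ \<i>] algebra_simps)
  then have "(of_real x * \<i>) powr of_real (2 * \<alpha>) = of_real (x powr (2 * \<alpha>)) * exp (\<i> * of_real (pi * \<alpha>))"
    unfolding exp_add exp_of_real using x by (simp add: powr_def)
  ultimately show "(of_real (1 * 2 * of_int k * pi) * \<i>) powr of_real (2 * \<alpha>) =
    of_real ((2 * of_int k * pi) powr (2 * \<alpha>)) * exp (\<i> * of_real (pi * \<alpha>))"
    "Ln (\<i> * complex_of_real (2 * pi * of_int k)) = of_real (ln (2 * of_int k * pi)) + \<i> * of_real (pi / 2)"
    by (simp_all only: x_def mult_1 mult_ac)
qed

text \<open>A positive factor can be pulled out of the principal logarithm, which separates (2 k
  pi)^(2 \<alpha>) from the constant phase. Conjugation passes through Ln only off the negative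
  axis: the argument has imaginary part proportional to sin(pi \<alpha>), which is nonzero as
  \<alpha> is not an integer.\<close>

lemma asymp_eigenvalue_eq:
  assumes a: "\<alpha> > 0" "\<alpha> \<notin> \<int>" and k: "k \<ge> 1"
  shows "asymp_eigenvalue \<alpha> 1 k = - (1 / 2) * (\<i> * of_real (2 * pi * of_int k) + branch_const \<alpha> + of_real (2 * \<alpha>) * Ln (\<i> * of_real (2 * pi * of_int k)))"
    and "cnj (asymp_eigenvalue \<alpha> 1 k) = asymp_eigenvalue \<alpha> (- 1) k"
proof -
  define \<gamma> where "\<gamma> = Gamma (1 - \<alpha>) / Gamma (1 + \<alpha>)"
  define E where "E = exp (\<i> * complex_of_real (pi * \<alpha>))"
  define x where "x = 2 * real_of_int k * pi"
  have x: "x > 0" using k by (simp add: x_def)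
  have g0: "\<gamma> \<noteq> 0" unfolding \<gamma>_def by (rule Gamma_quotient_nonzero[OF a])
  have w0: "- of_real \<gamma> * E \<noteq> 0" using g0 by (simp add: E_def)
  have "Ln (- of_real \<gamma> * (of_real (x powr (2 * \<alpha>)) * E)) = Ln (of_real (x powr (2 * \<alpha>)) * (- of_real \<gamma> * E))"
    by (simp only: mult_ac)
  also have "\<dots> = of_real (ln (x powr (2 * \<alpha>))) + Ln (- of_real \<gamma> * E)"
    using x w0 by (subst Ln_times_of_real) (auto simp: Ln_of_real)
  also have "ln (x powr (2 * \<alpha>)) = 2 * \<alpha> * ln x" using x by (simp add: ln_powr)
  finally have Ln: "Ln (- of_real \<gamma> * (of_real (x powr (2 * \<alpha>)) * E)) = of_real (2 * \<alpha> * ln x) + Ln (- of_real \<gamma> * E)" .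
  show "asymp_eigenvalue \<alpha> 1 k = - (1 / 2) * (\<i> * of_real (2 * pi * of_int k) + branch_const \<alpha> + of_real (2 * \<alpha>) * Ln (\<i> * of_real (2 * pi * of_int k)))"
    unfolding asymp_eigenvalue_def asymp_eigenvalue_argument[OF k] branch_const_def \<gamma>_def[symmetric] E_def[symmetric] x_def[symmetric] Ln
    by (simp add: x_def field_simps)
  have sin: "sin (pi * \<alpha>) \<noteq> 0"
  proof
    assume "sin (pi * \<alpha>) = 0"
    then obtain i :: int where "pi * \<alpha> = of_int i * pi" unfolding sin_zero_iff_int2 by blast
    then have "\<alpha> = of_int i" by simp
    then show False using a(2) by simp
  qed
  have "Im (- of_real \<gamma> * (of_real (x powr (2 * \<alpha>)) * E)) = - (\<gamma> * (x powr (2 * \<alpha>) * sin (pi * \<alpha>)))"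
    by (simp add: E_def Im_exp)
  also have "\<dots> \<noteq> 0" using g0 x sin by simp
  finally have np: "- of_real \<gamma> * (of_real (x powr (2 * \<alpha>)) * E) \<notin> \<real>\<^sub>\<le>\<^sub>0"
    by (auto simp: complex_nonpos_Reals_iff)
  have "of_real (x powr (2 * \<alpha>)) * E = (of_real (1 * 2 * of_int k * pi) * \<i>) powr of_real (2 * \<alpha>)"
    unfolding asymp_eigenvalue_argument[OF k] x_def E_def ..
  with np have np': "- of_real \<gamma> * (of_real (1 * 2 * of_int k * pi) * \<i>) powr of_real (2 * \<alpha>) \<notin> \<real>\<^sub>\<le>\<^sub>0" by simp
  have "cnj ((of_real (1 * 2 * of_int k * pi) * \<i>) powr of_real (2 * \<alpha>)) = (of_real (- 1 * 2 * of_int k * pi) * \<i>) powr of_real (2 * \<alpha>)"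
    using k by (subst cnj_powr) auto
  then show "cnj (asymp_eigenvalue \<alpha> 1 k) = asymp_eigenvalue \<alpha> (- 1) k"
    unfolding asymp_eigenvalue_def \<gamma>_def[symmetric] complex_cnj_diff complex_cnj_mult cnj_Ln[OF np'] by simp
qed

section \<open>Enumeration of the eigenvalues\<close>

lemma spectrum_is_eigenvalue: "z \<in> op_spectrum (G \<alpha>) \<Longrightarrow> is_eigenvalue (G \<alpha>) z"
  unfolding is_eigenvalue_def using eigenvector_kum[of z \<alpha> 1] by auto

text \<open>Eigenvalues are -1/2 times zeros of the Kummer function, so zeros in the upper
  half-plane give eigenvalues in the lower one, matching the upper signs of
  \<open>asymp_eigenvalue\<close>. The real parameter supplies the conjugate sequence with the same
  indices.\<close>

lemma eigenvalue_sequences: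
  assumes a: "\<alpha> > 0" "\<alpha> \<notin> \<int>"
  obtains k0 :: int and lamU :: "int \<Rightarrow> complex"
  where "bij_betw lamU {k0..} {z \<in> op_spectrum (G \<alpha>). is_eigenvalue (G \<alpha>) z \<and> Im z < 0}"
    "bij_betw (\<lambda>k. cnj (lamU k)) {k0..} {z \<in> op_spectrum (G \<alpha>). is_eigenvalue (G \<alpha>) z \<and> Im z > 0}"
    "(\<lambda>k. cmod (lamU k - asymp_eigenvalue \<alpha> 1 k)) \<in> O(\<lambda>k. ln (of_int k) / of_int k)"
    "(\<lambda>k. cmod (cnj (lamU k) - asymp_eigenvalue \<alpha> (-1) k)) \<in> O(\<lambda>k. ln (of_int k) / of_int k)"
proof -
  obtain k0 k1 :: int and \<zeta> M where \<zeta>: "bij_betw \<zeta> {k0..} {z. Im z > 0 \<and> kum (of_real (1 - \<alpha>)) z = 0}"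
    and asy: "\<And>k. k \<ge> k1 \<Longrightarrow> cmod (\<zeta> k - (\<i> * of_real (2 * pi * of_int k) + branch_const \<alpha> + of_real (2 * \<alpha>) * Ln (\<i> * of_real (2 * pi * of_int k)))) \<le> M * (ln (of_int k) / of_int k)"
    by (rule kum_upper_zeros[OF a exp_branch_const[OF a]]) blast
  define lamU where "lamU k = - (1 / 2) * \<zeta> k" for k
  let ?P = "\<lambda>z. z \<in> op_spectrum (G \<alpha>) \<and> is_eigenvalue (G \<alpha>) z"
  have P: "?P z \<longleftrightarrow> kum (of_real (1 - \<alpha>)) (- 2 * z) = 0" for z
    using spectrum_is_eigenvalue spectrum_G_iff by blast
  have "bij_betw ((\<lambda>z. - (1 / 2) * z) \<circ> \<zeta>) {k0..} {z. ?P z \<and> Im z < 0}"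
    by (rule bij_betw_trans[OF \<zeta>], rule bij_betw_byWitness[where f' = "\<lambda>z. - 2 * z"]) (auto simp: P)
  then have U: "bij_betw lamU {k0..} {z \<in> op_spectrum (G \<alpha>). is_eigenvalue (G \<alpha>) z \<and> Im z < 0}"
    by (simp add: lamU_def[abs_def] o_def conj_assoc)
  have Pc: "?P (cnj z) \<longleftrightarrow> ?P z" for z
    unfolding P using kum_cnj[of "1 - \<alpha>" "- 2 * z"] by simp
  have "bij_betw (cnj \<circ> lamU) {k0..} {z \<in> op_spectrum (G \<alpha>). is_eigenvalue (G \<alpha>) z \<and> Im z > 0}"
    by (rule bij_betw_trans[OF U], rule bij_betw_byWitness[where f' = cnj]) (use Pc in auto)
  then have L: "bij_betw (\<lambda>k. cnj (lamU k)) {k0..} {z \<in> op_spectrum (G \<alpha>). is_eigenvalue (G \<alpha>) z \<and> Im z > 0}"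
    by (simp add: o_def)
  have bound: "cmod (lamU k - asymp_eigenvalue \<alpha> 1 k) \<le> M / 2 * norm (ln (real_of_int k) / of_int k)" 
    if k: "k \<ge> max 1 k1" for k
  proof -
    have "lamU k - asymp_eigenvalue \<alpha> 1 k = - (1 / 2) * (\<zeta> k - (\<i> * of_real (2 * pi * of_int k) + branch_const \<alpha> + of_real (2 * \<alpha>) * Ln (\<i> * of_real (2 * pi * of_int k))))"
      using k by (subst asymp_eigenvalue_eq[OF a]) (auto simp: lamU_def right_diff_distrib)
    then have "cmod (lamU k - asymp_eigenvalue \<alpha> 1 k) \<le> 1 / 2 * (M * (ln (of_int k) / of_int k))"
      using asy[of k] k by (simp only: norm_mult) simp
    moreover have "norm (ln (real_of_int k) / of_int k) = ln (of_int k) / of_int k" using k by simp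
    ultimately show ?thesis by simp
  qed
  show ?thesis
  proof (rule that[OF U L])
    show "(\<lambda>k. cmod (lamU k - asymp_eigenvalue \<alpha> 1 k)) \<in> O(\<lambda>k. ln (of_int k) / of_int k)"
      by (rule bigoI[where c = "M / 2"], rule eventually_at_top_linorderI[of "max 1 k1"]) (use bound in simp)
    have "cmod (cnj (lamU k) - asymp_eigenvalue \<alpha> (- 1) k) \<le> M / 2 * norm (ln (real_of_int k) / of_int k)" if k: "k \<ge> max 1 k1" for k
    proof -
      have "cnj (lamU k) - asymp_eigenvalue \<alpha> (- 1) k = cnj (lamU k - asymp_eigenvalue \<alpha> 1 k)"
        using asymp_eigenvalue_eq(2)[OF a, of k] k by simp
      then show ?thesis using bound[OF k] by (simp only: complex_mod_cnj)
    qed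
    then show "(\<lambda>k. cmod (cnj (lamU k) - asymp_eigenvalue \<alpha> (- 1) k)) \<in> O(\<lambda>k. ln (of_int k) / of_int k)"
      by (intro bigoI[where c = "M / 2"] eventually_at_top_linorderI[of "max 1 k1"]) simp
  qed
qed

text \<open>For a = 1 - \<alpha> the ceiling m of \<alpha> - 1 is the integer with -m <= a < -m + 1,
  so \<open>kum_positive_zeros\<close> provides m positive zeros x; each corresponds to the
  eigenvalue -x/2.\<close>

lemma negative_eigenvalues:
  assumes a: "\<alpha> > 0"
  shows "finite {z \<in> op_spectrum (G \<alpha>). is_eigenvalue (G \<alpha>) z \<and> z \<in> \<real> \<and> Re z < 0}" (is "finite ?N")
    and "int (card {z \<in> op_spectrum (G \<alpha>). is_eigenvalue (G \<alpha>) z \<and> z \<in> \<real> \<and> Re z < 0}) = \<lceil>\<alpha> - 1\<rceil>"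
proof -
  define m where "m = nat \<lceil>\<alpha> - 1\<rceil>"
  have m: "int m = \<lceil>\<alpha> - 1\<rceil>" using a by (simp add: m_def)
  then have "real m = of_int \<lceil>\<alpha> - 1\<rceil>" by (metis of_int_of_nat_eq)
  then have "- real m \<le> 1 - \<alpha>" "1 - \<alpha> < - real m + 1" using ceiling_correct[of "\<alpha> - 1"] by linarith+
  note X = kum_positive_zeros[OF this]
  have "?N = (\<lambda>x. complex_of_real (- x / 2)) ` {x. 0 < x \<and> kum (1 - \<alpha>) x = 0}"
  proof (intro equalityI subsetI)
    fix z assume z: "z \<in> ?N"
    then obtain x where x: "z = of_real x" by (auto elim: Reals_cases)
    have "kum (of_real (1 - \<alpha>)) (of_real (- 2 * x)) = (0 :: complex)" using z x by (simp add: spectrum_G_iff)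
    then have "kum (1 - \<alpha>) (- 2 * x) = 0" unfolding kum_of_real by (simp only: of_real_eq_0_iff)
    then show "z \<in> (\<lambda>x. complex_of_real (- x / 2)) ` {x. 0 < x \<and> kum (1 - \<alpha>) x = 0}"
      using z x by (intro image_eqI[of _ _ "- 2 * x"]) auto
  next
    fix z assume "z \<in> (\<lambda>x. complex_of_real (- x / 2)) ` {x. 0 < x \<and> kum (1 - \<alpha>) x = 0}"
    then obtain x where x: "z = of_real (- x / 2)" "0 < x" "kum (1 - \<alpha>) x = 0" by auto
    have "- 2 * z = of_real x" by (simp add: x(1))
    then have "z \<in> op_spectrum (G \<alpha>)" unfolding spectrum_G_iff using x(3) by (simp only: kum_of_real of_real_0)
    then show "z \<in> ?N" using spectrum_is_eigenvalue x by auto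
  qed
  moreover have "inj_on (\<lambda>x. complex_of_real (- x / 2)) A" for A by (auto simp: inj_on_def)
  ultimately show "finite ?N" "int (card ?N) = \<lceil>\<alpha> - 1\<rceil>" using X m by (simp_all add: card_image)
qed

text \<open>The Kummer parameter is -n here, so the n positive zeros are the only complex ones and
  account for the whole spectrum.\<close>

lemma spectrum_integer_case:
  assumes n: "\<alpha> = real n + 1"
  obtains mu :: "nat \<Rightarrow> real" where "inj_on mu {1..n}" "\<And>k. k \<in> {1..n} \<Longrightarrow> mu k < 0"
    "op_spectrum (G \<alpha>) = (\<lambda>k. complex_of_real (mu k)) ` {1..n}"
proof -
  have b: "- real n \<le> - of_nat n" "- of_nat n < - real n + 1" by auto
  define X where "X = {x. 0 < x \<and> kum (- of_nat n) x = (0 :: real)}"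
  have X: "finite X" "card X = n" unfolding X_def by (rule kum_positive_zeros[OF b])+
  from ex_bij_betw_nat_finite_1[OF X(1)] obtain f where f: "bij_betw f {1..n} X" unfolding X(2) by blast
  define mu where "mu k = - f k / 2" for k
  have fX: "f ` {1..n} = X" "inj_on f {1..n}" using f by (auto simp: bij_betw_def)
  have ne: "of_real (1 - \<alpha>) = (- of_nat n :: complex)" by (simp add: n)
  have "op_spectrum (G \<alpha>) = (\<lambda>z. - z / 2) ` {z. kum (- of_nat n :: complex) z = 0}"
  proof (intro equalityI subsetI)
    fix z assume "z \<in> op_spectrum (G \<alpha>)"
    then show "z \<in> (\<lambda>z. - z / 2) ` {z. kum (- of_nat n :: complex) z = 0}"
      unfolding spectrum_G_iff ne by (intro image_eqI[of _ _ "- 2 * z"]) simp_all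
  next
    fix z assume "z \<in> (\<lambda>z. - z / 2) ` {z. kum (- of_nat n :: complex) z = 0}"
    then obtain w where w: "z = - w / 2" "w \<in> {z. kum (- of_nat n) z = 0}" by (rule imageE)
    have "- 2 * z = w" by (simp add: w(1))
    with w(2)[unfolded mem_Collect_eq] show "z \<in> op_spectrum (G \<alpha>)" unfolding spectrum_G_iff ne by (simp only:)
  qed
  also have "{z. kum (- of_nat n :: complex) z = 0} = complex_of_real ` f ` {1..n}"
    unfolding fX(1) X_def by (rule kum_neg_int_zeros)
  also have "(\<lambda>z. - z / 2) ` complex_of_real ` f ` {1..n} = (\<lambda>k. complex_of_real (mu k)) ` {1..n}"
    unfolding image_image by (rule image_cong) (simp_all add: mu_def)
  finally have sp: "op_spectrum (G \<alpha>) = (\<lambda>k. complex_of_real (mu k)) ` {1..n}" .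
  have inj: "inj_on mu {1..n}"
  proof (rule inj_onI)
    fix k l assume "k \<in> {1..n}" "l \<in> {1..n}" "mu k = mu l"
    moreover from this have "f k = f l" by (simp add: mu_def)
    ultimately show "k = l" using inj_onD[OF fX(2)] by blast
  qed
  have neg: "mu k < 0" if "k \<in> {1..n}" for k
  proof -
    have "f k \<in> X" using fX(1) that by blast
    then show ?thesis by (simp add: mu_def X_def)
  qed
  show ?thesis by (rule that[OF inj neg sp])
qed

theorem theorem2p2:
  fixes \<alpha> :: real
  assumes "\<alpha> > 0"
  shows
    "((\<forall>z. z \<in> op_spectrum (G \<alpha>) \<longleftrightarrow> kummer_M (of_real (1 - \<alpha>)) 2 (- 2 * z) = 0) \<and>
      (\<forall>z \<in> op_spectrum (G \<alpha>).
         let f = (\<lambda>x::real. of_real x * exp (z * of_real x) *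
                    kummer_M (of_real (1 - \<alpha>)) 2 (- 2 * z * of_real x))
         in is_eigenvector (G \<alpha>) z (f, \<lambda>x. z * f x)))
     \<and>
     (\<alpha> \<notin> \<nat> \<longrightarrow>
        finite {z \<in> op_spectrum (G \<alpha>). is_eigenvalue (G \<alpha>) z \<and> z \<in> \<real> \<and> Re z < 0} \<and>
        int (card {z \<in> op_spectrum (G \<alpha>). is_eigenvalue (G \<alpha>) z \<and> z \<in> \<real> \<and> Re z < 0})
          = \<lceil>\<alpha> - 1\<rceil> \<and>
        infinite {z \<in> op_spectrum (G \<alpha>). is_eigenvalue (G \<alpha>) z \<and> z \<notin> \<real>} \<and>
        (\<exists>(k0::int) (lamU :: int \<Rightarrow> complex) (lamL :: int \<Rightarrow> complex).
           bij_betw lamU {k0..} {z \<in> op_spectrum (G \<alpha>). is_eigenvalue (G \<alpha>) z \<and> Im z < 0} \<and>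
           bij_betw lamL {k0..} {z \<in> op_spectrum (G \<alpha>). is_eigenvalue (G \<alpha>) z \<and> Im z > 0} \<and>
           (\<forall>k\<ge>k0. lamL k = cnj (lamU k)) \<and>
           (\<lambda>k. cmod (lamU k - asymp_eigenvalue \<alpha> 1 k)) \<in> O(\<lambda>k. ln (of_int k) / of_int k) \<and>
           (\<lambda>k. cmod (lamL k - asymp_eigenvalue \<alpha> (-1) k)) \<in> O(\<lambda>k. ln (of_int k) / of_int k)))
     \<and>
     (\<forall>n::nat. \<alpha> = real n + 1 \<longrightarrow>
        (\<exists>mu :: nat \<Rightarrow> real.
           inj_on mu {1..n} \<and>
           (\<forall>k\<in>{1..n}. mu k < 0) \<and>
           op_spectrum (G \<alpha>) = (\<lambda>k. complex_of_real (mu k)) ` {1..n} \<and>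
           (\<forall>z. z \<in> op_spectrum (G \<alpha>) \<longleftrightarrow> laguerre1 n (- 2 * z) = 0) \<and>
           (\<forall>k\<in>{1..n}.
              let f = (\<lambda>x::real. of_real x * exp (of_real (mu k) * of_real x) *
                         laguerre1 n (- 2 * of_real (mu k) * of_real x))
              in is_eigenvector (G \<alpha>) (of_real (mu k)) (f, \<lambda>x. of_real (mu k) * f x))))"
proof (intro conjI impI allI ballI)
  fix z
  show "z \<in> op_spectrum (G \<alpha>) \<longleftrightarrow> kummer_M (of_real (1 - \<alpha>)) 2 (- 2 * z) = 0"
    unfolding kummer_M_eq_kum by (rule spectrum_G_iff)
  assume z: "z \<in> op_spectrum (G \<alpha>)"
  show "let f = (\<lambda>x::real. of_real x * exp (z * of_real x) * kummer_M (of_real (1 - \<alpha>)) 2 (- 2 * z * of_real x))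
     in is_eigenvector (G \<alpha>) z (f, \<lambda>x. z * f x)"
    unfolding kummer_M_eq_kum Let_def using eigenvector_kum[OF z, of 1] by simp
next
  assume "\<alpha> \<notin> \<nat>"
  \<comment> \<open>The hypothesis excludes natural numbers; positivity extends this to all
    integers, which is the form the recursion and the Gamma quotients need.\<close>
  have ai: "\<alpha> \<notin> \<int>"
  proof
    assume "\<alpha> \<in> \<int>"
    then obtain i :: int where "\<alpha> = of_int i" by (rule Ints_cases)
    then have "\<alpha> = of_nat (nat i)" using assms by simp
    then show False using \<open>\<alpha> \<notin> \<nat>\<close> by (metis of_nat_in_Nats)
  qed
  show "finite {z \<in> op_spectrum (G \<alpha>). is_eigenvalue (G \<alpha>) z \<and> z \<in> \<real> \<and> Re z < 0}"
    "int (card {z \<in> op_spectrum (G \<alpha>). is_eigenvalue (G \<alpha>) z \<and> z \<in> \<real> \<and> Re z < 0}) = \<lceil>\<alpha> - 1\<rceil>"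
    by (rule negative_eigenvalues[OF assms])+
  obtain k0 :: int and lamU where lam: 
    "bij_betw lamU {k0..} {z \<in> op_spectrum (G \<alpha>). is_eigenvalue (G \<alpha>) z \<and> Im z < 0}"
    "bij_betw (\<lambda>k. cnj (lamU k)) {k0..} {z \<in> op_spectrum (G \<alpha>). is_eigenvalue (G \<alpha>) z \<and> Im z > 0}"
    "(\<lambda>k. cmod (lamU k - asymp_eigenvalue \<alpha> 1 k)) \<in> O(\<lambda>k. ln (of_int k) / of_int k)"
    "(\<lambda>k. cmod (cnj (lamU k) - asymp_eigenvalue \<alpha> (-1) k)) \<in> O(\<lambda>k. ln (of_int k) / of_int k)"
    by (rule eigenvalue_sequences[OF assms ai]) blast
  show "\<exists>(k0::int) (lamU :: int \<Rightarrow> complex) (lamL :: int \<Rightarrow> complex).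
           bij_betw lamU {k0..} {z \<in> op_spectrum (G \<alpha>). is_eigenvalue (G \<alpha>) z \<and> Im z < 0} \<and>
           bij_betw lamL {k0..} {z \<in> op_spectrum (G \<alpha>). is_eigenvalue (G \<alpha>) z \<and> Im z > 0} \<and>
           (\<forall>k\<ge>k0. lamL k = cnj (lamU k)) \<and>
           (\<lambda>k. cmod (lamU k - asymp_eigenvalue \<alpha> 1 k)) \<in> O(\<lambda>k. ln (of_int k) / of_int k) \<and>
           (\<lambda>k. cmod (lamL k - asymp_eigenvalue \<alpha> (-1) k)) \<in> O(\<lambda>k. ln (of_int k) / of_int k)"
    by (rule exI[of _ k0], rule exI[of _ lamU], rule exI[of _ "\<lambda>k. cnj (lamU k)"]) (intro conjI lam allI impI refl)
  have "infinite {z \<in> op_spectrum (G \<alpha>). is_eigenvalue (G \<alpha>) z \<and> Im z < 0}"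
    using bij_betw_finite[OF lam(1)] infinite_Ici[of k0] by simp
  moreover have "{z \<in> op_spectrum (G \<alpha>). is_eigenvalue (G \<alpha>) z \<and> Im z < 0} \<subseteq> {z \<in> op_spectrum (G \<alpha>). is_eigenvalue (G \<alpha>) z \<and> z \<notin> \<real>}"
    by (auto simp: complex_is_Real_iff)
  ultimately show "infinite {z \<in> op_spectrum (G \<alpha>). is_eigenvalue (G \<alpha>) z \<and> z \<notin> \<real>}"
    using infinite_super by blast
next
  fix n :: nat assume n: "\<alpha> = real n + 1"
  have ne: "of_real (1 - \<alpha>) = (- of_nat n :: complex)" by (simp add: n)
  have lag: "laguerre1 n z = 0 \<longleftrightarrow> kum (- of_nat n) z = 0" for z
    unfolding laguerre1_eq_kum by (simp del: of_nat_Suc of_nat_add)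
  obtain mu where mu: "inj_on mu {1..n}" "\<And>k. k \<in> {1..n} \<Longrightarrow> mu k < 0"
    "op_spectrum (G \<alpha>) = (\<lambda>k. complex_of_real (mu k)) ` {1..n}"
    by (rule spectrum_integer_case[OF n]) blast
  show "\<exists>mu :: nat \<Rightarrow> real.
           inj_on mu {1..n} \<and>
           (\<forall>k\<in>{1..n}. mu k < 0) \<and>
           op_spectrum (G \<alpha>) = (\<lambda>k. complex_of_real (mu k)) ` {1..n} \<and>
           (\<forall>z. z \<in> op_spectrum (G \<alpha>) \<longleftrightarrow> laguerre1 n (- 2 * z) = 0) \<and>
           (\<forall>k\<in>{1..n}.
              let f = (\<lambda>x::real. of_real x * exp (of_real (mu k) * of_real x) *
                         laguerre1 n (- 2 * of_real (mu k) * of_real x))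
              in is_eigenvector (G \<alpha>) (of_real (mu k)) (f, \<lambda>x. of_real (mu k) * f x))"
  proof (intro exI[of _ mu] conjI ballI allI mu)
    show "z \<in> op_spectrum (G \<alpha>) \<longleftrightarrow> laguerre1 n (- 2 * z) = 0" for z
      unfolding lag spectrum_G_iff ne ..
    fix k assume "k \<in> {1..n}"
    then have "complex_of_real (mu k) \<in> op_spectrum (G \<alpha>)" using mu(3) by blast
    \<comment> \<open>The Laguerre eigenfunction is n + 1 times the Kummer one, so the eigenvector
      is taken with this scaling.\<close>
    moreover have "of_nat (n + 1) \<noteq> (0 :: complex)" by (simp del: of_nat_Suc of_nat_add)
    ultimately have ev: "is_eigenvector (G \<alpha>) (of_real (mu k))
        (\<lambda>x. of_nat (n + 1) * (of_real x * exp (of_real (mu k) * of_real x) * kum (of_real (1 - \<alpha>)) (- 2 * of_real (mu k) * of_real x)),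
         \<lambda>x. of_real (mu k) * (of_nat (n + 1) * (of_real x * exp (of_real (mu k) * of_real x) * kum (of_real (1 - \<alpha>)) (- 2 * of_real (mu k) * of_real x))))"
      by (rule eigenvector_kum)
    have f: "(\<lambda>x::real. of_real x * exp (of_real (mu k) * of_real x) * laguerre1 n (- 2 * of_real (mu k) * of_real x)) =
       (\<lambda>x. of_nat (n + 1) * (of_real x * exp (of_real (mu k) * of_real x) * kum (of_real (1 - \<alpha>)) (- 2 * of_real (mu k) * of_real x)))"
      unfolding laguerre1_eq_kum ne by (rule ext) (simp only: mult_ac)
    show "let f = (\<lambda>x::real. of_real x * exp (of_real (mu k) * of_real x) * laguerre1 n (- 2 * of_real (mu k) * of_real x))
       in is_eigenvector (G \<alpha>) (of_real (mu k)) (f, \<lambda>x. of_real (mu k) * f x)"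
      unfolding Let_def f by (rule ev)
  qed
qed

end
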